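(* Let $m>1$, $\Omega\subset\mathbb{R}^N$ an arbitrary bounded open set, $T>0$, $\Omega_T=\Omega\times(0,T)$. Let $u$ be a bounded viscosity subsolution and $v$ a bounded viscosity supersolution in $\Omega_T$ such that $$\limsup_{z\to z_0}u(z)\le\liminf_{z\to z_0}v(z)\quad\text{for all } z_0\in\partial_p\Omega_T.$$ Then $u\le v$ in $\Omega_T$.
   Context: Throughout, $m>1$ and all functions are nonnegative. For an open set $U\subset\mathbb{R}^N$ and $t_1<t_2$ write $U_{t_1,t_2}=U\times(t_1,t_2)$, with parabolic boundary $\partial_p U_{t_1,t_2}=(\overline U\times\{t_1\})\cup(\partial U\times[t_1,t_2])$. A (local) weak solution of $\partial_t u-\Delta u^m=0$ in an open cylinder $D$ is a nonnegative $u$ with $u^m\in L^2(t_1,t_2;H^1(U))$ for every $U_{t_1,t_2}\Subset D$ and $\iint(-u\,\partial_t\varphi+\nabla u^m\cdot\nabla\varphi)\,dx\,dt=0$ for all $\varphi\in C_c^\infty(D)$; weak solutions are taken to be continuous. A function $u:\Omega_T\to[0,\infty]$ is a viscosity supersolution if (i) $u$ is lower semicontinuous, (ii) $u$ is finite on a dense subset of $\Omega_T$, and (iii) whenever $U_{t_1,t_2}\Subset\Omega_T$ and $h$ is a weak solution in $U_{t_1,t_2}$ continuous on $\overline{U_{t_1,t_2}}$ with $h\le u$ on $\partial_pU_{t_1,t_2}$, then $h\le u$ in $U_{t_1,t_2}$. Viscosity subsolutions are defined analogously with upper semicontinuity and reversed inequalities in (iii). *)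

theory Defs
  imports "HOL-Analysis.Analysis"
begin

type_synonym 'n pt = "(real ^ 'n) \<times> real"

definition cyl :: "(real ^ 'n) set \<Rightarrow> real \<Rightarrow> real \<Rightarrow> 'n pt set" where
  "cyl U t1 t2 = U \<times> {t1<..<t2}"

definition pbdry :: "(real ^ 'n) set \<Rightarrow> real \<Rightarrow> real \<Rightarrow> 'n pt set" where
  "pbdry U t1 t2 = (closure U \<times> {t1}) \<union> (frontier U \<times> {t1..t2})"

definition cc :: "'a::metric_space set \<Rightarrow> 'a set \<Rightarrow> bool" where
  "cc A D \<longleftrightarrow> compact (closure A) \<and> closure A \<subseteq> D"

definition pd :: "('a::euclidean_space \<Rightarrow> real) \<Rightarrow> 'a \<Rightarrow> 'a \<Rightarrow> real" where
  "pd f v = (\<lambda>z. frechet_derivative f (at z) v)"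

fun iter_pd :: "('a::euclidean_space \<Rightarrow> real) \<Rightarrow> 'a list \<Rightarrow> 'a \<Rightarrow> real" where
  "iter_pd f [] = f"
| "iter_pd f (v # vs) = pd (iter_pd f vs) v"

definition smooth :: "('a::euclidean_space \<Rightarrow> real) \<Rightarrow> bool" where
  "smooth f \<longleftrightarrow> (\<forall>vs. set vs \<subseteq> Basis \<longrightarrow>
      (\<forall>z. iter_pd f vs differentiable (at z)) \<and> continuous_on UNIV (iter_pd f vs))"

definition test_fun :: "'a::euclidean_space set \<Rightarrow> ('a \<Rightarrow> real) \<Rightarrow> bool" where
  "test_fun D \<phi> \<longleftrightarrow> smooth \<phi> \<and> compact (closure {z. \<phi> z \<noteq> 0}) \<and> closure {z. \<phi> z \<noteq> 0} \<subseteq> D"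

definition dx :: "('n::finite pt \<Rightarrow> real) \<Rightarrow> 'n \<Rightarrow> 'n pt \<Rightarrow> real" where
  "dx \<phi> i = pd \<phi> (axis i 1, 0)"

definition dt :: "('n::finite pt \<Rightarrow> real) \<Rightarrow> 'n pt \<Rightarrow> real" where
  "dt \<phi> = pd \<phi> (0, 1)"

text \<open>Local weak solution of u_t - Delta u^m = 0 in an open set D (continuous by convention).
  g is the weak spatial gradient of u^m: it is square integrable on every cylinder
  compactly contained in D (together with u^m), which is u^m in L^2(t1,t2;H^1(U)).\<close>
definition weak_sol :: "real \<Rightarrow> 'n::finite pt set \<Rightarrow> ('n pt \<Rightarrow> real) \<Rightarrow> bool" where
  "weak_sol m D u \<longleftrightarrow>
     (\<forall>z\<in>D. 0 \<le> u z) \<and> continuous_on D u \<and>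
     (\<exists>g :: 'n pt \<Rightarrow> real ^ 'n.
        (\<forall>U t1 t2. open U \<and> t1 < t2 \<and> cc (cyl U t1 t2) D \<longrightarrow>
            set_borel_measurable lborel (cyl U t1 t2) (\<lambda>z. u z powr m) \<and>
            set_integrable lborel (cyl U t1 t2) (\<lambda>z. (u z powr m)\<^sup>2) \<and>
            (\<forall>i. set_borel_measurable lborel (cyl U t1 t2) (\<lambda>z. g z $ i) \<and>
                 set_integrable lborel (cyl U t1 t2) (\<lambda>z. (g z $ i)\<^sup>2))) \<and>
        (\<forall>\<phi>. test_fun D \<phi> \<longrightarrow>
            (\<forall>i. (LINT z:D|lborel. u z powr m * dx \<phi> i z) = - (LINT z:D|lborel. g z $ i * \<phi> z)) \<and>
            (LINT z:D|lborel. - u z * dt \<phi> z + (\<Sum>i\<in>UNIV. g z $ i * dx \<phi> i z)) = 0))"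

definition lsc_on :: "'a::topological_space set \<Rightarrow> ('a \<Rightarrow> ereal) \<Rightarrow> bool" where
  "lsc_on S f \<longleftrightarrow> (\<forall>z\<in>S. f z \<le> Liminf (at z within S) f)"

definition usc_on :: "'a::topological_space set \<Rightarrow> ('a \<Rightarrow> ereal) \<Rightarrow> bool" where
  "usc_on S f \<longleftrightarrow> (\<forall>z\<in>S. Limsup (at z within S) f \<le> f z)"

definition visc_super :: "real \<Rightarrow> 'n::finite pt set \<Rightarrow> ('n pt \<Rightarrow> ereal) \<Rightarrow> bool" where
  "visc_super m S u \<longleftrightarrow>
     (\<forall>z\<in>S. 0 \<le> u z) \<and> lsc_on S u \<and> S \<subseteq> closure {z\<in>S. u z \<noteq> \<infinity>} \<and>
     (\<forall>U t1 t2 h. open U \<and> t1 < t2 \<and> cc (cyl U t1 t2) S \<and>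
        weak_sol m (cyl U t1 t2) h \<and> continuous_on (closure (cyl U t1 t2)) h \<and>
        (\<forall>z\<in>pbdry U t1 t2. ereal (h z) \<le> u z) \<longrightarrow>
        (\<forall>z\<in>cyl U t1 t2. ereal (h z) \<le> u z))"

definition visc_sub :: "real \<Rightarrow> 'n::finite pt set \<Rightarrow> ('n pt \<Rightarrow> ereal) \<Rightarrow> bool" where
  "visc_sub m S u \<longleftrightarrow>
     (\<forall>z\<in>S. 0 \<le> u z) \<and> usc_on S u \<and> S \<subseteq> closure {z\<in>S. u z \<noteq> \<infinity>} \<and>
     (\<forall>U t1 t2 h. open U \<and> t1 < t2 \<and> cc (cyl U t1 t2) S \<and>
        weak_sol m (cyl U t1 t2) h \<and> continuous_on (closure (cyl U t1 t2)) h \<and>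
        (\<forall>z\<in>pbdry U t1 t2. u z \<le> ereal (h z)) \<longrightarrow>
        (\<forall>z\<in>cyl U t1 t2. u z \<le> ereal (h z)))"

end

theory Submission
  imports Defs "HOL-Complex_Analysis.Great_Picard"
begin

text \<open>Write \<open>w = u\<^sup>m\<close>. The explicit lattice scheme for \<open>\<partial>\<^sub>t w\<^sup>1\<^sup>/\<^sup>m = \<Delta>w\<close> is monotone under a
  CFL condition. An Aronson-Benilan type barrier gives the interior one-sided bound \<open>w\<^sub>k - w\<^sub>k\<^sub>+\<^sub>1 \<le> K\<tau>\<close>, whence time
  averages have bounded discrete Laplacian; this yields interior equicontinuity that depends only on the
  bound of the data. With semiconvex Lipschitz data on domains with exterior balls, boundary barriers and
  an energy bound show that the scheme converges to a continuous weak solution with prescribed data.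

  Sup-convolution of \<open>u\<^sup>m\<close> on the parabolic boundary of a slightly smaller cylinder gives data \<open>\<Psi>\<close> with
  \<open>u\<^sup>m \<le> \<Psi>\<close> and \<open>\<Psi> - \<epsilon> \<le> v\<^sup>m\<close> there, so that \<open>u\<close> lies below the solution with data \<open>\<Psi>\<close>, and \<open>v\<close> above the one
  with data \<open>(\<Psi> - \<epsilon>)\<^sub>+\<close>. The time sum of the difference of the two discrete solutions is almost
  subharmonic, hence small with \<open>\<epsilon>\<close> by the maximum principle; equicontinuity, uniform in \<open>\<epsilon>\<close>, turns
  this into a pointwise bound.\<close>

section \<open>Discrete maximum and comparison principles\<close>

text \<open>With \<open>w\<close> as unknown the diffusion is linear, so time sums of the scheme
  satisfy exact Poisson equations. All nonlinearity sits in the time difference of the root, whose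
  slope is unbounded at level zero. Concavity then bounds the decrease of \<open>w\<close> in time
  but not its increase; at the lateral boundary and around low points, lower and sideways estimates
  therefore go through time averages, and the one-sided bound converts averages into values.

  The obstacle is the order of choices. The shift \<open>\<epsilon>\<close> of the data is fixed
  from the tolerance. The boundary layer where \<open>u\<close> to the power \<open>m\<close> is
  below that of \<open>v\<close> plus \<open>\<epsilon>\<close>, hence the inner domain
  \<open>U\<close>, and the steepness \<open>k\<close> of the sup-convolution, hence
  \<open>\<Lambda>\<close>, come later and depend on \<open>\<epsilon>\<close>. Only interior bounds
  in terms of \<open>M\<close> and a distance \<open>\<rho>\<close> may enter the stability
  estimate; bounds with \<open>\<Lambda>\<close> serve existence. Both solutions are limits along
  one common sequence of mesh sizes, so that their comparison can take place on the lattice.\<close>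

definition nsum :: "real \<Rightarrow> (real^'n::finite \<Rightarrow> real) \<Rightarrow> real^'n \<Rightarrow> real" where
  "nsum h f x = (\<Sum>i\<in>UNIV. f (x + h *\<^sub>R axis i 1) + f (x - h *\<^sub>R axis i 1))"

text \<open>The factor \<open>1/h\<^sup>2\<close> is left out: for smooth \<open>f\<close> this is
  about \<open>h\<^sup>2\<close> times the Laplacian, which explains the powers of \<open>h\<close>
  in all later bounds.\<close>

definition lap :: "real \<Rightarrow> (real^'n::finite \<Rightarrow> real) \<Rightarrow> real^'n \<Rightarrow> real" where
  "lap h f x = (\<Sum>i\<in>UNIV. f (x + h *\<^sub>R axis i 1) + f (x - h *\<^sub>R axis i 1) - 2 * f x)"

definition nbrs :: "real \<Rightarrow> real^'n::finite \<Rightarrow> (real^'n) set" where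
  "nbrs h x = (\<Union>i. {x + h *\<^sub>R axis i 1, x - h *\<^sub>R axis i 1})"

lemma nbrsI [simp]: "x + h *\<^sub>R axis i 1 \<in> nbrs h x" "x - h *\<^sub>R axis i 1 \<in> nbrs h x"
  by (auto simp: nbrs_def)

lemma nbrsE:
  assumes "y \<in> nbrs h x"
  obtains i where "y = x + h *\<^sub>R axis i 1" | i where "y = x - h *\<^sub>R axis i 1"
  using assms by (auto simp: nbrs_def)

lemma dist_nbrs: "y \<in> nbrs h x \<Longrightarrow> dist y x = \<bar>h\<bar>"
  by (erule nbrsE) (auto simp: dist_norm)

lemma lap_nsum: "lap h f x = nsum h f x - 2 * real CARD('n) * f (x::real^'n::finite)"
  by (simp add: lap_def nsum_def sum_subtractf)

lemma nsum_mono: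
  assumes "\<And>y. y \<in> nbrs h x \<Longrightarrow> f y \<le> g y"
  shows "nsum h f x \<le> nsum h g x"
  unfolding nsum_def by (intro sum_mono add_mono assms) auto

lemma nsum_const: "nsum h (\<lambda>_. c) (x::real^'n::finite) = 2 * real CARD('n) * c"
  by (simp add: nsum_def)

lemma lap_cmult: "lap h (\<lambda>x. c * f x) x = c * lap h f x"
  by (simp add: lap_def sum_distrib_left algebra_simps)

lemma lap_add: "lap h (\<lambda>x. f x + g x) x = lap h f x + lap h g x"
  by (simp add: lap_def sum.distrib[symmetric] algebra_simps)

lemma lap_diff: "lap h (\<lambda>x. f x - g x) x = lap h f x - lap h g x"
  by (simp add: lap_def sum_subtractf[symmetric] algebra_simps)

lemma lap_const: "lap h (\<lambda>_. c) x = 0"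
  by (simp add: lap_def)

lemma lap_sum: "lap h (\<lambda>x. \<Sum>j\<in>J. f j x) x = (\<Sum>j\<in>J. lap h (f j) x)"
proof (induction J rule: infinite_finite_induct)
  case (insert j J) thus ?case by (simp add: lap_add)
qed (auto simp: lap_const)

lemma lap_mono:
  assumes "\<And>y. y \<in> nbrs h x \<Longrightarrow> f y \<le> g y" "g x \<le> f x"
  shows "lap h f x \<le> lap h g x"
  using nsum_mono[of h x f g] assms by (auto simp: lap_nsum intro!: diff_mono mult_left_mono)

lemma norm_axis_shift:
  fixes x c :: "real^'n::finite"
  shows "(norm (x + h *\<^sub>R axis i 1 - c))\<^sup>2 = (norm (x - c))\<^sup>2 + 2 * h * (x - c) $ i + h\<^sup>2"
    and "(norm (x - h *\<^sub>R axis i 1 - c))\<^sup>2 = (norm (x - c))\<^sup>2 - 2 * h * (x - c) $ i + h\<^sup>2"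
proof -
  have gen: "(norm (z + k *\<^sub>R axis i 1))\<^sup>2 = (norm z)\<^sup>2 + 2 * k * z $ i + k\<^sup>2" for z :: "real^'n" and k
    unfolding power2_norm_eq_inner
    by (simp add: inner_add_left inner_add_right inner_axis_axis inner_axis inner_axis' power2_eq_square algebra_simps)
  have "x + h *\<^sub>R axis i 1 - c = (x - c) + h *\<^sub>R axis i 1"
    "x - h *\<^sub>R axis i 1 - c = (x - c) + (-h) *\<^sub>R axis i 1" by auto
  then show "(norm (x + h *\<^sub>R axis i 1 - c))\<^sup>2 = (norm (x - c))\<^sup>2 + 2 * h * (x - c) $ i + h\<^sup>2"
    "(norm (x - h *\<^sub>R axis i 1 - c))\<^sup>2 = (norm (x - c))\<^sup>2 - 2 * h * (x - c) $ i + h\<^sup>2"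
    by (simp_all only: gen) simp_all
qed

lemma lap_norm_sq:
  fixes x c :: "real^'n::finite"
  shows "lap h (\<lambda>x. (norm (x - c))\<^sup>2) x = 2 * real CARD('n) * h\<^sup>2"
  by (simp add: lap_def norm_axis_shift)

text \<open>At a point where \<open>g\<close> is within \<open>\<kappa>/(4 n)\<close> of its
  supremum, \<open>n\<close> the dimension, the neighbours exceed it by too little for a Laplacian
  of size \<open>\<kappa>\<close>. The strict bound \<open>\<kappa>\<close> replaces attainment of
  the supremum, so \<open>D\<close> may be infinite.\<close>

lemma discrete_max_principle:
  fixes g :: "real^'n::finite \<Rightarrow> real"
  assumes bdd: "bdd_above (g ` D)" and "\<kappa> > 0"
    and D: "\<And>x. x \<in> D \<Longrightarrow> g x > 0 \<Longrightarrow> lap h g x \<ge> \<kappa>"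
    and nb: "\<And>x y. x \<in> D \<Longrightarrow> g x > 0 \<Longrightarrow> y \<in> nbrs h x \<Longrightarrow> y \<in> D \<or> g y \<le> 0"
    and x: "x \<in> D"
  shows "g x \<le> 0"
proof (rule ccontr)
  assume pos: "\<not> g x \<le> 0"
  define E where "E = Sup (g ` D)"
  have le: "g y \<le> E" if "y \<in> D" for y unfolding E_def using that bdd by (simp add: cSUP_upper)
  have E0: "E > 0" using le[OF x] pos by linarith
  let ?n = "2 * real CARD('n)"
  have n0: "?n > 0" by simp
  have "max 0 (E - \<kappa> / ?n / 2) < E" using E0 \<open>\<kappa>>0\<close> n0 by (auto simp: field_simps)
  then obtain y where y: "y \<in> D" "max 0 (E - \<kappa> / ?n / 2) < g y"
    unfolding E_def using x bdd by (subst (asm) less_cSUP_iff) auto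
  have "nsum h g y \<le> nsum h (\<lambda>_. E) y"
    using nb[OF y(1)] y(2) le E0 by (intro nsum_mono) force
  then have "lap h g y \<le> ?n * E - ?n * g y" by (simp add: lap_nsum nsum_const)
  also have "\<dots> = ?n * (E - g y)" by (simp add: algebra_simps)
  also have "\<dots> \<le> ?n * (\<kappa> / ?n / 2)" using y(2) n0 by (intro mult_left_mono) linarith+
  also have "\<dots> < \<kappa>" using n0 \<open>\<kappa>>0\<close> by simp
  finally show False using D[OF y(1)] y(2) by simp
qed

section \<open>Slopes and strict concavity of the root\<close>

lemma root_mvt:
  fixes m :: real
  assumes "m > 1" "0 \<le> a" "a < b"
  shows "\<exists>z. a < z \<and> z < b \<and> b powr (1/m) - a powr (1/m) = (b - a) * ((1/m) * z powr (1/m - 1))"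
proof -
  have "\<exists>\<xi>\<in>{a<..<b}. b powr (1/m) - a powr (1/m) = (\<lambda>h. (1/m) * \<xi> powr (1/m - 1) * h) (b - a)"
  \<comment> \<open>Differentiability is asked for in the open interval alone, which admits
    \<open>a = 0\<close>, where the root has infinite slope.\<close>
  proof (rule mvt[where f = "\<lambda>x. x powr (1/m)" and f' = "\<lambda>x h. (1/m) * x powr (1/m - 1) * h"])
    show "a < b" by fact
    show "continuous_on {a..b} (\<lambda>x. x powr (1/m))"
      using assms by (intro continuous_on_powr') (auto intro: continuous_intros)
    fix x assume "a < x" "x < b"
    then have "((\<lambda>x. x powr (1/m)) has_real_derivative (1/m) * x powr (1/m - 1)) (at x)"
      using assms by (auto intro!: derivative_eq_intros simp: powr_diff field_simps)
    then show "((\<lambda>x. x powr (1/m)) has_derivative (\<lambda>h. (1/m) * x powr (1/m - 1) * h)) (at x)"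
      unfolding has_field_derivative_def .
  qed (blast intro: greaterThanLessThan_iff[THEN iffD2])
  then show ?thesis by (auto simp: mult.commute mult.left_commute)
qed

lemma powr_neg_mono: "0 < x \<Longrightarrow> x \<le> y \<Longrightarrow> m > 1 \<Longrightarrow> y powr (1/m - 1) \<le> x powr (1/m - (1::real))"
  by (rule powr_mono2') (auto simp: field_simps)

lemma root_slope_ge:
  fixes m :: real
  assumes "m > 1" "0 \<le> a" "a \<le> b" "b \<le> B" "B > 0"
  shows "b powr (1/m) - a powr (1/m) \<ge> (b - a) * ((1/m) * B powr (1/m - 1))"
proof (cases "a = b")
  case False
  then obtain z where z: "a < z" "z < b" "b powr (1/m) - a powr (1/m) = (b - a) * ((1/m) * z powr (1/m - 1))"
    using root_mvt[of m a b] assms by auto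
  have "B powr (1/m - 1) \<le> z powr (1/m - 1)" using z assms by (intro powr_neg_mono) auto
  then show ?thesis unfolding z(3) using z assms by (intro mult_left_mono) auto
qed simp

lemma root_slope_le:
  fixes m :: real
  assumes "m > 1" "0 < a" "a \<le> b"
  shows "b powr (1/m) - a powr (1/m) \<le> (b - a) * ((1/m) * a powr (1/m - 1))"
proof (cases "a = b")
  case False
  then obtain z where z: "a < z" "z < b" "b powr (1/m) - a powr (1/m) = (b - a) * ((1/m) * z powr (1/m - 1))"
    using root_mvt[of m a b] assms by auto
  have "z powr (1/m - 1) \<le> a powr (1/m - 1)" using z assms by (intro powr_neg_mono) auto
  then show ?thesis unfolding z(3) using z assms by (intro mult_left_mono) auto
qed simp

lemma root_mono: "m > 1 \<Longrightarrow> 0 \<le> a \<Longrightarrow> a \<le> b \<Longrightarrow> a powr (1/m) \<le> b powr (1/(m::real))"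
  by (rule powr_mono2) auto

lemma root_le_imp: "m > 1 \<Longrightarrow> 0 \<le> a \<Longrightarrow> 0 \<le> b \<Longrightarrow> a powr (1/m) \<le> b powr (1/(m::real)) \<Longrightarrow> a \<le> b"
  using powr_less_mono2[of "1/m" b a] by force

text \<open>The slope is at least that at \<open>b\<close> on the upper half of the interval and
  strictly larger on the lower half; adding the halves gives the relative gain
  \<open>(1 - 1/m) * p / (4 * M)\<close>. This quadratic gain plays the part of the equation y' = -c
  y^2 in the Aronson-Benilan estimate.\<close>

lemma root_strict_concave:
  fixes m :: real
  assumes m: "m > 1" and p: "0 < p" "p < b" and M: "b \<le> M"
  shows "b powr (1/m) - (b - p) powr (1/m)
    \<ge> p * ((1/m) * b powr (1/m - 1)) * (1 + (1 - 1/m) * p / (4 * M))"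
proof -
  let ?d = "(1/m) * b powr (1/m - 1)"
  have d0: "?d \<ge> 0" using m by simp
  have n: "1 - 1/m > 0" using m by (simp add: field_simps)
  have A: "b powr (1/m) - (b - p/2) powr (1/m) \<ge> (p/2) * ?d"
    using root_slope_ge[of m "b-p/2" b b] m p by auto
  have B: "(b-p/2) powr (1/m) - (b - p) powr (1/m) \<ge> (p/2) * ((1/m) * (b-p/2) powr (1/m - 1))"
    using root_slope_ge[of m "b-p" "b-p/2" "b-p/2"] m p by auto
  define x where "x = p / (2*b)"
  have x: "0 < x" "x < 1" using p by (auto simp: x_def field_simps)
  have bp: "b - p/2 = b * (1 - x)" using p by (simp add: x_def field_simps)
  \<comment> \<open>Bernoulli's inequality for the negative exponent \<open>1/m - 1\<close>, from
    \<open>exp t \<ge> 1 + t\<close> and \<open>ln (1-x) \<le> -x\<close>.\<close>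
  have "(1-x) powr (1/m - 1) = exp (- ((1 - 1/m) * ln (1-x)))"
    using x by (simp add: powr_def algebra_simps)
  also have "\<dots> \<ge> 1 + - ((1 - 1/m) * ln (1-x))" by (rule exp_ge_add_one_self)
  finally have 1: "(1-x) powr (1/m - 1) \<ge> 1 - (1 - 1/m) * ln (1-x)" by simp
  have "ln (1-x) \<le> -x" using x by (metis ln_add_one_self_le_self2 add_uminus_conv_diff neg_less_iff_less)
  then have "(1 - 1/m) * ln (1-x) \<le> (1-1/m) * (-x)" using n by (intro mult_left_mono) auto
  then have 2: "(1-x) powr (1/m - 1) \<ge> 1 + (1 - 1/m) * x" using 1 by linarith
  have "(b-p/2) powr (1/m - 1) = b powr (1/m - 1) * (1-x) powr (1/m - 1)"
    unfolding bp using x p by (simp add: powr_mult)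
  also have "\<dots> \<ge> b powr (1/m - 1) * (1 + (1 - 1/m) * x)" using 2 by (intro mult_left_mono) auto
  finally have C: "(1/m) * (b-p/2) powr (1/m - 1) \<ge> ?d * (1 + (1 - 1/m) * x)"
    using m by (simp add: divide_right_mono)
  have "x \<ge> p / (2*M)" unfolding x_def using p M by (intro divide_left_mono) auto
  then have "(1-1/m) * (p / (2*M)) \<le> (1-1/m) * x" using n by (intro mult_left_mono) auto
  then have D: "?d * (1 + (1 - 1/m) * x) \<ge> ?d * (1 + (1-1/m) * (p / (2*M)))"
    using d0 by (intro mult_left_mono) auto
  have "(p/2) * (?d * (1 + (1-1/m) * (p / (2*M)))) \<le> (p/2) * ((1/m) * (b-p/2) powr (1/m - 1))"
    using C D p by (intro mult_left_mono) auto
  then have "b powr (1/m) - (b - p) powr (1/m) \<ge> (p/2) * ?d + (p/2) * (?d * (1 + (1-1/m) * (p / (2*M))))"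
    using A B by linarith
  also have "(p/2) * ?d + (p/2) * (?d * (1 + (1-1/m) * (p / (2*M)))) = p * ?d * (1 + (1 - 1/m) * p / (4 * M))"
  proof -
    have "(p/2) * d + (p/2) * (d * (1 + c * (p / (2*M)))) = p * d * (1 + c * p / (4 * M))" for d c
      by (simp add: field_simps)
    then show ?thesis by blast
  qed
  finally show ?thesis .
qed

text \<open>\<open>M\<close> bounds \<open>w\<close>, and \<open>l\<close> is the ratio of the time
  step to \<open>h\<^sup>2\<close>. The right-hand side of \<open>cfl\<close> is the smallest slope
  of the root on \<open>[0, M+1]\<close>; the interval ends above \<open>M\<close> so that barriers
  may exceed the bound by 1. Monotonicity of the scheme asks for \<open>2 * N * l\<close>; the
  surplus factor 2 is spent in the one-sided estimate. The parameter \<open>dm\<close> fixes the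
  dimension.\<close>

locale pme =
  fixes m M l N :: real and dm :: "'n::finite itself"
  assumes m1: "m > 1" and M0: "M > 0" and l0: "l > 0"
    and N_def: "N = real CARD('n)"
    and cfl: "4 * N * l \<le> (1/m) * (M+1) powr (1/m - 1)"
begin

abbreviation rt where "rt w \<equiv> w powr (1/m)"

lemma N1: "N \<ge> 1"
  by (simp add: Suc_leI N_def)

lemma lapN: "lap h f x = nsum h f x - 2 * N * f (x::real^'n)"
  by (simp add: lap_nsum N_def)

lemma slope: "0 \<le> a \<Longrightarrow> a \<le> b \<Longrightarrow> b \<le> M + 1 \<Longrightarrow> rt b - rt a \<ge> 4 * N * l * (b - a)"
  using root_slope_ge[of m a b "M+1"] m1 M0 mult_left_mono[OF cfl, of "b-a"]
  by (simp add: mult.commute mult.left_commute)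

lemma rt_slope_d: "0 < b \<Longrightarrow> b \<le> M + 1 \<Longrightarrow> 4 * N * l \<le> (1/m) * b powr (1/m - 1)"
  using cfl powr_neg_mono[of b "M+1" m] m1 divide_right_mono[of "(M+1) powr (1/m-1)" "b powr (1/m-1)" m]
  by simp

text \<open>In the explicit scheme the new root is this function of the centre value plus
  \<open>l\<close> times the neighbour sum; its monotonicity is what makes the scheme
  monotone.\<close>

lemma G_mono:
  assumes "0 \<le> a" "a \<le> b" "b \<le> M + 1"
  shows "rt a - 2 * N * l * a \<le> rt b - 2 * N * l * b"
proof -
  have "rt b - rt a \<ge> 4 * N * l * (b - a)" using slope assms by auto
  moreover have "4 * N * l * (b - a) \<ge> 2 * N * l * (b - a)"
    using assms l0 N1 by (intro mult_right_mono) auto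
  ultimately have "rt b - rt a \<ge> 2 * N * l * (b - a)" by linarith
  then show ?thesis by (simp add: algebra_simps)
qed

definition scheme :: "real \<Rightarrow> (nat \<Rightarrow> real^'n \<Rightarrow> real) \<Rightarrow> nat \<Rightarrow> real^'n \<Rightarrow> bool" where
  "scheme h w k x \<longleftrightarrow> rt (w (Suc k) x) = rt (w k x) + l * lap h (w k) x"

lemma scheme_nsum: "scheme h w k x \<longleftrightarrow> rt (w (Suc k) x) = rt (w k x) - 2 * N * l * w k x + l * nsum h (w k) x"
  by (simp add: scheme_def lapN algebra_simps)

text \<open>Beyond the level M only the value of wb at the new time matters, so barriers may exceed M.\<close>

lemma comparison:
  fixes wa wb :: "nat \<Rightarrow> real^'n \<Rightarrow> real"
  assumes nb: "\<And>x. x \<in> V \<Longrightarrow> nbrs h x \<subseteq> X" and VX: "V \<subseteq> X"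
    and wa: "\<And>k x. k < n \<Longrightarrow> x \<in> V \<Longrightarrow> rt (wa (Suc k) x) \<le> rt (wa k x) + l * lap h (wa k) x"
    and ba: "\<And>k x. k \<le> n \<Longrightarrow> x \<in> X \<Longrightarrow> 0 \<le> wa k x \<and> wa k x \<le> M"
    and wb: "\<And>k x. k < n \<Longrightarrow> x \<in> V \<Longrightarrow> wb (Suc k) x < M \<Longrightarrow> wb k x \<le> M + 1 \<and>
       rt (wb k x) + l * lap h (wb k) x \<le> rt (wb (Suc k) x) \<and> 0 \<le> wb (Suc k) x"
    and init: "\<And>x. x \<in> X \<Longrightarrow> wa 0 x \<le> wb 0 x"
    and bd: "\<And>k x. k \<le> n \<Longrightarrow> x \<in> X - V \<Longrightarrow> wa k x \<le> wb k x"
  shows "k \<le> n \<Longrightarrow> x \<in> X \<Longrightarrow> wa k x \<le> wb k x"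
proof (induction k arbitrary: x)
  case 0 then show ?case using init by auto
next
  case (Suc k)
  show ?case
  proof (cases "x \<in> V \<and> wb (Suc k) x < M")
    case False
    then show ?thesis using bd[of "Suc k" x] ba[of "Suc k" x] Suc.prems by force
  next
    case True
    then have xV: "x \<in> V" by auto
    note wb' = wb[of k x]
    have le: "wa k x \<le> wb k x" using Suc by auto
    have "nsum h (wa k) x \<le> nsum h (wb k) x"
      using nb[OF xV] Suc by (intro nsum_mono) auto
    then have ns: "l * nsum h (wa k) x \<le> l * nsum h (wb k) x" using l0 N1 by simp
    have "rt (wa (Suc k) x) \<le> rt (wa k x) - 2 * N * l * wa k x + l * nsum h (wa k) x"
      using wa[of k x] Suc.prems xV by (simp add: lapN algebra_simps)
    also have "\<dots> \<le> rt (wb k x) - 2 * N * l * wb k x + l * nsum h (wb k) x"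
      using G_mono[OF _ le] ba[of k x] wb' True Suc.prems ns by fastforce
    also have "\<dots> \<le> rt (wb (Suc k) x)"
      using wb' True Suc.prems by (simp add: lapN algebra_simps)
    finally show ?thesis
      using root_le_imp[OF m1] ba[of "Suc k" x] Suc.prems wb' True by fastforce
  qed
qed

text \<open>\<open>a\<close>, \<open>b\<close>, \<open>c\<close> are successive values at one point,
  and \<open>y\<close>, \<open>y'\<close> bound the two successive decreases. Subtracting the two
  scheme equations reduces the claim to \<open>rt c \<ge> rt (b - y')\<close>. The loss
  \<open>P\<close> from the neighbours is paid by strict concavity together with the CFL slope when
  \<open>a \<ge> b\<close>, and by the CFL slope alone otherwise.\<close>

lemma one_sided_step:
  assumes a: "0 \<le> a" "a \<le> M" and b: "0 \<le> b" "b \<le> M" and c: "0 \<le> c"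
    and eb: "rt b = rt a - 2 * N * l * a + l * S"
    and ec: "rt c = rt b - 2 * N * l * b + l * S'"
    and S: "S' \<ge> S - P" and ab: "a - b \<le> y" and y': "0 < y'"
    and P1: "P \<le> 4 * N * y'"
    and P2: "y \<le> y' * (1 + (1 - 1/m) * y' / (4 * M))"
    and P3: "P - 2 * N * y \<le> 4 * N * (y' * (1 + (1 - 1/m) * y' / (4 * M)) - y)"
  shows "b - c \<le> y'"
\<comment> \<open>If \<open>b \<le> y'\<close>, then \<open>c \<ge> 0\<close> is enough; otherwise
  \<open>b - y'\<close> lies in the domain of the root.\<close>
proof (cases "b \<le> y'")
  case True then show ?thesis using c by linarith
next
  case False
  define s where "s = a - b"
  have lP: "l * S' \<ge> l * S - l * P" using S l0 by (simp add: right_diff_distrib[symmetric])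
  have NN: "N * l \<ge> 0" using l0 N1 by simp
  have key: "rt b - rt (b - y') - (rt a - rt b) \<ge> l * P - 2 * N * l * s"
  proof (cases "s \<ge> 0")
    case True
    let ?d = "(1/m) * b powr (1/m - 1)"
    let ?q = "y' * (1 + (1 - 1/m) * y' / (4 * M))"
    have d: "4 * N * l \<le> ?d" using rt_slope_d[of b] False y' b by auto
    have 1: "rt b - rt (b - y') \<ge> ?d * ?q"
      using root_strict_concave[OF m1 y', of b M] False b by (simp add: mult_ac)
    have 2: "rt a - rt b \<le> s * ?d"
      using root_slope_le[OF m1, of b a] False y' True by (simp add: s_def)
    have 3: "?d * (?q - y) \<ge> 4 * N * l * (?q - y)" using d P2 by (intro mult_right_mono) auto
    have "?d * (y - s) \<ge> 4 * N * l * (y - s)" using d ab by (intro mult_right_mono) (auto simp: s_def)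
    moreover have "4 * N * l * (y - s) \<ge> 2 * N * l * (y - s)" using l0 N1 ab by (intro mult_right_mono) (auto simp: s_def)
    ultimately have 4: "?d * (y - s) \<ge> 2 * N * l * (y - s)" by linarith
    have "l * (P - 2 * N * y) \<le> l * (4 * N * (?q - y))" using P3 l0 by (intro mult_left_mono) auto
    then have 5: "l * P - 2 * N * l * y \<le> 4 * N * l * (?q - y)" by (simp add: algebra_simps)
    \<comment> \<open>The splitting meets \<open>P3\<close> in the first term and the assumption
      \<open>a - b \<le> y\<close> in the second.\<close>
    have "d * q - s * d = d * (q - y) + d * (y - s)" for d q by (simp add: algebra_simps)
    then have "?d * ?q - s * ?d = ?d * (?q - y) + ?d * (y - s)" by blast
    moreover have "2 * N * l * (y - s) = 2 * N * l * y - 2 * N * l * s" by (simp add: algebra_simps)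
    ultimately show ?thesis using 1 2 3 4 5 by linarith
  next
    case neg: False
    have 1: "rt b - rt a \<ge> 4 * N * l * (b - a)" using slope[of a b] neg a b by (auto simp: s_def)
    have 2: "rt b - rt (b - y') \<ge> 4 * N * l * y'" using slope[of "b-y'" b] False y' b by auto
    have "l * P \<le> l * (4 * N * y')" using P1 l0 by (intro mult_left_mono) auto
    moreover have "2 * N * l * (b - a) \<le> 4 * N * l * (b - a)" using neg l0 N1 by (intro mult_right_mono) (auto simp: s_def)
    ultimately show ?thesis using 1 2 by (simp add: s_def algebra_simps)
  qed
  have "rt c \<ge> rt (b - y')"
    using key lP unfolding ec s_def using eb by (simp add: algebra_simps)
  then show ?thesis using root_le_imp[OF m1, of "b-y'" c] False c by auto
qed

text \<open>\<open>Y\<close> is the supersolution for the time differences: it dominates them at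
  step \<open>ka\<close> and off \<open>V\<close>, and its Laplacian does not exceed what the gain
  of \<open>root_strict_concave\<close> pays for. The scheme enters at two successive steps because
  its time difference is taken.\<close>

lemma one_sided_induct:
  fixes w Y :: "nat \<Rightarrow> real^'n \<Rightarrow> real"
  assumes nb: "\<And>x. x \<in> V \<Longrightarrow> nbrs h x \<subseteq> X" and VX: "V \<subseteq> X"
    and sch: "\<And>k x. ka \<le> k \<Longrightarrow> k < kb \<Longrightarrow> x \<in> V \<Longrightarrow> scheme h w k x \<and> scheme h w (Suc k) x"
    and bds: "\<And>k x. ka \<le> k \<Longrightarrow> k \<le> Suc kb \<Longrightarrow> x \<in> X \<Longrightarrow> 0 \<le> w k x \<and> w k x \<le> M"
    and init: "\<And>x. x \<in> X \<Longrightarrow> w ka x - w (Suc ka) x \<le> Y ka x"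
    and bd: "\<And>k x. ka \<le> k \<Longrightarrow> k \<le> kb \<Longrightarrow> x \<in> X - V \<Longrightarrow> w k x - w (Suc k) x \<le> Y k x"
    and Y: "\<And>k x. ka \<le> k \<Longrightarrow> k < kb \<Longrightarrow> x \<in> V \<Longrightarrow> 0 < Y (Suc k) x \<and> nsum h (Y k) x \<le> 4 * N * Y (Suc k) x \<and>
      Y k x \<le> Y (Suc k) x * (1 + (1 - 1/m) * Y (Suc k) x / (4 * M)) \<and>
      lap h (Y k) x \<le> 4 * N * (Y (Suc k) x * (1 + (1 - 1/m) * Y (Suc k) x / (4 * M)) - Y k x)"
  shows "ka \<le> k \<Longrightarrow> k \<le> kb \<Longrightarrow> x \<in> X \<Longrightarrow> w k x - w (Suc k) x \<le> Y k x"
proof (induction k arbitrary: x rule: dec_induct)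
  case base then show ?case using init by auto
next
  case (step k)
  show ?case
  proof (cases "x \<in> V")
    case False then show ?thesis using bd[of "Suc k" x] step by auto
  next
    case True
    have IH: "w k y - w (Suc k) y \<le> Y k y" if "y \<in> X" for y using step that by auto
    have "nsum h (\<lambda>y. w k y - Y k y) x \<le> nsum h (w (Suc k)) x"
    proof (rule nsum_mono)
      fix y assume "y \<in> nbrs h x"
      then show "w k y - Y k y \<le> w (Suc k) y" using IH[of y] nb[OF True] by auto
    qed
    then have S: "nsum h (w k) x - nsum h (Y k) x \<le> nsum h (w (Suc k)) x"
      by (simp add: nsum_def sum_subtractf[symmetric] algebra_simps)
    have kk: "ka \<le> k" "k < kb" using step by auto
    note YY = Y[OF kk True] and sc = sch[OF kk True, unfolded scheme_nsum]
    show ?thesis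
      by (rule one_sided_step[where a = "w k x" and S = "nsum h (w k) x" and S' = "nsum h (w (Suc k)) x"
            and P = "nsum h (Y k) x" and y = "Y k x"])
         (use YY sc S IH[of x] True VX bds[of k x] bds[of "Suc k" x] bds[of "Suc (Suc k)" x] kk in \<open>auto simp: lapN\<close>)
  qed
qed

end

section \<open>The interior one-sided bound in time\<close>

definition lat :: "real \<Rightarrow> (real^'n::finite) set" where
  "lat h = {x. \<forall>i. \<exists>p::int. x $ i = h * of_int p}"

lemma lat_shift:
  assumes "x \<in> lat h" shows "x + (h * of_int p) *\<^sub>R axis i 1 \<in> lat h"
  unfolding lat_def
proof (intro CollectI allI)
  fix j
  obtain q :: int where q: "x $ j = h * of_int q" using assms by (auto simp: lat_def)
  show "\<exists>r::int. (x + (h * of_int p) *\<^sub>R axis i 1) $ j = h * of_int r"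
    by (intro exI[of _ "if i = j then p + q else q"]) (auto simp: q axis_def algebra_simps)
qed

lemma lat_nbrs: "x \<in> lat h \<Longrightarrow> y \<in> nbrs h x \<Longrightarrow> y \<in> lat h"
  using lat_shift[of x h 1] lat_shift[of x h "-1"] by (elim nbrsE) auto

lemma lat_diff:
  assumes "x \<in> lat h" "y \<in> lat h" shows "\<exists>p::int. (x - y) $ i = h * of_int p"
proof -
  obtain p q :: int where "x $ i = h * of_int p" "y $ i = h * of_int q" using assms unfolding lat_def by blast
  then show ?thesis by (intro exI[of _ "p - q"]) (simp add: algebra_simps)
qed

section \<open>A cutoff that blows up on the faces of a cube\<close>

lemma lap_coord:
  fixes x c :: "real^'n::finite"
  shows "lap h (\<lambda>x. F ((x - c) $ i)) x = F ((x - c) $ i + h) + F ((x - c) $ i - h) - 2 * F ((x - c) $ i)"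
proof -
  let ?s = "(x - c) $ i"
  have "lap h (\<lambda>x. F ((x - c) $ i)) x = (\<Sum>j\<in>UNIV. if j = i then F (?s + h) + F (?s - h) - 2 * F ?s else 0)"
    unfolding lap_def by (intro sum.cong) (auto simp: axis_def algebra_simps)
  then show ?thesis by simp
qed

text \<open>The second derivative of \<open>1/p^2\<close> is \<open>6/p^4\<close>; the constant 7
  leaves room for the discretisation error once \<open>p \<ge> 20 * h\<close>. The bound is
  quadratic in the function itself, which is the form that a quadratic gain can balance.\<close>

lemma inv_square_diff2:
  fixes p h :: real
  assumes "h > 0" "p \<ge> 20 * h"
  shows "1/(p+h)\<^sup>2 + 1/(p-h)\<^sup>2 - 2 * (1/p\<^sup>2) \<le> 7 * h\<^sup>2 * (1/p\<^sup>2)\<^sup>2"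
proof -
  have p: "p > 0" "p - h > 0" "p + h > 0" using assms by auto
  define z where "z = h / p"
  have z: "0 < z" "z \<le> 1/20" using assms p by (auto simp: z_def field_simps)
  have hz: "h = z * p" using p by (simp add: z_def)
  have z2: "z\<^sup>2 \<le> 1/400" using power_mono[OF z(2), of 2] z by (simp add: power2_eq_square)
  have "z\<^sup>2 * z\<^sup>2 \<le> z\<^sup>2 * (1/400)" using z2 by (intro mult_left_mono) auto
  then have z4: "z^4 \<ge> 0" "z^4 \<le> z\<^sup>2/400" by (simp, simp add: power2_eq_square power4_eq_xxxx mult.assoc)
  have nz: "1 - z\<^sup>2 > 0" using z2 by simp
  have e: "(p-h)\<^sup>2 = p\<^sup>2 * (1-z)\<^sup>2" "(p+h)\<^sup>2 = p\<^sup>2 * (1+z)\<^sup>2" unfolding hz by (simp_all add: power2_eq_square algebra_simps)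
  have "1/(1+z)\<^sup>2 + 1/(1-z)\<^sup>2 = 2*(1+z\<^sup>2)/(1-z\<^sup>2)\<^sup>2"
  proof -
    have "1+z \<noteq> 0" "1-z \<noteq> 0" using z by auto
    moreover have "(1-z\<^sup>2)\<^sup>2 = (1+z)\<^sup>2*(1-z)\<^sup>2" by (simp add: power2_eq_square algebra_simps)
    ultimately show ?thesis by (simp add: divide_simps) (simp add: power2_eq_square algebra_simps)
  qed
  also have "\<dots> \<le> 2 + 7 * z\<^sup>2"
  proof -
    have "(2 + 7*z\<^sup>2) * (1-z\<^sup>2)\<^sup>2 = 2 + 3*z\<^sup>2 - 12*z^4 + 7*z\<^sup>2*z^4"
      by (simp add: power2_eq_square power4_eq_xxxx algebra_simps)
    moreover have "7*z\<^sup>2*z^4 \<ge> 0" by simp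
    ultimately have "2*(1+z\<^sup>2) \<le> (2 + 7*z\<^sup>2) * (1-z\<^sup>2)\<^sup>2" using z4 by argo
    then show ?thesis using nz by (simp add: divide_le_eq)
  qed
  finally have "(1/p\<^sup>2) * (1/(1+z)\<^sup>2 + 1/(1-z)\<^sup>2) \<le> (1/p\<^sup>2) * (2 + 7 * z\<^sup>2)" by (intro mult_left_mono) auto
  moreover have "(1/p\<^sup>2) * (7 * z\<^sup>2) = 7 * h\<^sup>2 * (1/p\<^sup>2)\<^sup>2" using p by (simp add: z_def field_simps power2_eq_square)
  ultimately show ?thesis unfolding e by (simp add: algebra_simps)
qed

lemma sum_squares_le_square_sum:
  fixes a :: "'a \<Rightarrow> real"
  assumes "finite J" "\<And>j. j \<in> J \<Longrightarrow> a j \<ge> 0"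
  shows "(\<Sum>j\<in>J. (a j)\<^sup>2) \<le> (\<Sum>j\<in>J. a j)\<^sup>2"
  using assms
proof (induction J rule: finite_induct)
  case (insert j J)
  then have "(\<Sum>j\<in>J. (a j)\<^sup>2) \<le> (\<Sum>j\<in>J. a j)\<^sup>2" "a j * (\<Sum>j\<in>J. a j) \<ge> 0" by (auto intro!: mult_nonneg_nonneg sum_nonneg)
  then show ?case using insert by (simp add: power2_sum)
qed simp

text \<open>Each summand blows up on a pair of opposite faces of the cube of half-side
  \<open>\<rho>\<close> about \<open>c\<close>. The exponent -2 is the one for which second
  differences are controlled by the square of the function, and one-variable summands reduce the
  Laplacian to one dimension.\<close>

definition cutoff :: "real \<Rightarrow> real^'n::finite \<Rightarrow> real^'n \<Rightarrow> real" where
  "cutoff \<rho> c x = (\<Sum>i\<in>UNIV. 1/(\<rho> - (x - c) $ i)\<^sup>2 + 1/(\<rho> + (x - c) $ i)\<^sup>2)"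

text \<open>The first bound is balanced against the quadratic gain from concavity; the second
  controls the neighbour sum by the centre value. Both need the margin \<open>20 * h\<close>; in the
  layer left out the barrier is simply larger than \<open>M\<close>.\<close>

lemma lap_cutoff:
  fixes x c :: "real^'n::finite"
  assumes h: "h > 0" and V: "\<And>i. \<bar>(x - c) $ i\<bar> \<le> \<rho> - 20 * h"
  shows "lap h (cutoff \<rho> c) x \<le> 7 * h\<^sup>2 * (cutoff \<rho> c x)\<^sup>2"
    and "lap h (cutoff \<rho> c) x \<le> (7/400) * cutoff \<rho> c x" and "cutoff \<rho> c x \<ge> 0"
proof -
  let ?a = "\<lambda>i. 1/(\<rho> - (x - c) $ i)\<^sup>2" and ?b = "\<lambda>i. 1/(\<rho> + (x - c) $ i)\<^sup>2"
  have le: "lap h (cutoff \<rho> c) x \<le> (\<Sum>i\<in>UNIV. 7 * h\<^sup>2 * (?a i)\<^sup>2 + 7 * h\<^sup>2 * (?b i)\<^sup>2)"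
  proof -
    have "lap h (cutoff \<rho> c) x = (\<Sum>i\<in>UNIV. lap h (\<lambda>x. (\<lambda>s. 1/(\<rho> - s)\<^sup>2 + 1/(\<rho> + s)\<^sup>2) ((x - c) $ i)) x)"
      unfolding cutoff_def lap_sum ..
    also have "\<dots> \<le> (\<Sum>i\<in>UNIV. 7 * h\<^sup>2 * (?a i)\<^sup>2 + 7 * h\<^sup>2 * (?b i)\<^sup>2)"
    proof (rule sum_mono)
      fix i
      have "\<rho> - (x - c) $ i \<ge> 20 * h" "\<rho> + (x - c) $ i \<ge> 20 * h" using V[of i] by auto
      moreover have "1/(\<rho> - (t+h))\<^sup>2 + 1/(\<rho> + (t+h))\<^sup>2 + (1/(\<rho> - (t-h))\<^sup>2 + 1/(\<rho> + (t-h))\<^sup>2) - 2 * (1/(\<rho> - t)\<^sup>2 + 1/(\<rho> + t)\<^sup>2)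
          \<le> 7 * h\<^sup>2 * (1/(\<rho> - t)\<^sup>2)\<^sup>2 + 7 * h\<^sup>2 * (1/(\<rho> + t)\<^sup>2)\<^sup>2" if "\<rho> - t \<ge> 20 * h" "\<rho> + t \<ge> 20 * h" for t
        using inv_square_diff2[OF h that(1)] inv_square_diff2[OF h that(2)]
        by (simp add: diff_diff_eq2 diff_diff_eq add_diff_eq add.assoc diff_add_eq algebra_simps)
      ultimately
      show "lap h (\<lambda>x. (\<lambda>s. 1/(\<rho> - s)\<^sup>2 + 1/(\<rho> + s)\<^sup>2) ((x - c) $ i)) x \<le> 7 * h\<^sup>2 * (?a i)\<^sup>2 + 7 * h\<^sup>2 * (?b i)\<^sup>2"
        using lap_coord[of h "\<lambda>s. 1/(\<rho> - s)\<^sup>2 + 1/(\<rho> + s)\<^sup>2" c i x] by presburger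
    qed
    finally show ?thesis .
  qed
  show "cutoff \<rho> c x \<ge> 0" unfolding cutoff_def by (intro sum_nonneg) auto
  have "(\<Sum>i\<in>UNIV. 7 * h\<^sup>2 * (?a i)\<^sup>2 + 7 * h\<^sup>2 * (?b i)\<^sup>2) \<le> (\<Sum>i\<in>UNIV. 7 * h\<^sup>2 * (?a i + ?b i)\<^sup>2)"
    by (intro sum_mono) (auto simp: power2_sum algebra_simps)
  also have "\<dots> = 7 * h\<^sup>2 * (\<Sum>i\<in>UNIV. (?a i + ?b i)\<^sup>2)" by (simp add: sum_distrib_left)
  also have "\<dots> \<le> 7 * h\<^sup>2 * (cutoff \<rho> c x)\<^sup>2" unfolding cutoff_def
    by (intro mult_left_mono sum_squares_le_square_sum) auto
  finally show "lap h (cutoff \<rho> c) x \<le> 7 * h\<^sup>2 * (cutoff \<rho> c x)\<^sup>2" using le by linarith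
  have p: "7 * h\<^sup>2 * (1/q\<^sup>2)\<^sup>2 \<le> (7/400) * (1/q\<^sup>2)" if "q \<ge> 20 * h" for q :: real
  proof -
    have "q\<^sup>2 \<ge> (20*h)\<^sup>2" using that h by (intro power_mono) auto
    moreover have "q > 0" using that h by linarith
    ultimately have "1/q\<^sup>2 \<le> 1/(400*h\<^sup>2)" using h by (intro divide_left_mono) (auto simp: power2_eq_square intro!: mult_pos_pos)
    then have "7*h\<^sup>2*(1/q\<^sup>2)*(1/q\<^sup>2) \<le> 7*h\<^sup>2*(1/(400*h\<^sup>2))*(1/q\<^sup>2)" by (intro mult_right_mono mult_left_mono) auto
    then show ?thesis using h by (simp add: power2_eq_square)
  qed
  have "(\<Sum>i\<in>UNIV. 7 * h\<^sup>2 * (?a i)\<^sup>2 + 7 * h\<^sup>2 * (?b i)\<^sup>2) \<le> (\<Sum>i\<in>UNIV. (7/400) * (?a i) + (7/400) * (?b i))"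
  proof (rule sum_mono)
    fix i
    have "\<rho> - (x - c) $ i \<ge> 20 * h" "\<rho> + (x - c) $ i \<ge> 20 * h" using V[of i] by auto
    then show "7 * h\<^sup>2 * (?a i)\<^sup>2 + 7 * h\<^sup>2 * (?b i)\<^sup>2 \<le> (7/400) * (?a i) + (7/400) * (?b i)" by (intro add_mono p)
  qed
  also have "\<dots> = (7/400) * cutoff \<rho> c x" unfolding cutoff_def by (simp add: sum_distrib_left algebra_simps)
  finally show "lap h (cutoff \<rho> c) x \<le> (7/400) * cutoff \<rho> c x" using le by linarith
qed

section \<open>The localised Aronson-Benilan estimate\<close>

context pme
begin

text \<open>The barrier adds \<open>1/k\<close>, the discrete solution of y' = -y^2, to the cutoff
  in space. Since \<open>K\<close> is chosen before \<open>h\<close>, \<open>w\<close> and the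
  centre, it does not depend on the data; the stability estimate rests on this.\<close>

lemma interior_one_sided:
  assumes \<rho>: "\<rho> > 0" and ts: "ts > 0"
  obtains K where "K > 0"
    "\<And>h w (c::real^'n) k1 k x. \<lbrakk>0 < h; \<forall>k x. k \<le> Suc k1 \<longrightarrow> x \<in> lat h \<longrightarrow> (\<forall>i. \<bar>(x - c) $ i\<bar> < \<rho>) \<longrightarrow> 0 \<le> w k x \<and> w k x \<le> M;
      \<forall>k x. k \<le> k1 \<longrightarrow> x \<in> lat h \<longrightarrow> (\<forall>i. \<bar>(x - c) $ i\<bar> < \<rho>) \<longrightarrow> scheme h w k x;
      k \<le> k1; ts \<le> real k * (l * h\<^sup>2); x \<in> lat h; \<forall>i. \<bar>(x - c) $ i\<bar> \<le> \<rho>/2\<rbrakk>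
      \<Longrightarrow> w k x - w (Suc k) x \<le> K * (l * h\<^sup>2)"
proof -
  define nn where "nn = 1 - 1/m"
  have nn: "nn > 0" using m1 by (simp add: nn_def field_simps)
  \<comment> \<open>Four summands, four uses: \<open>400/l\<close> covers the layer of width
    \<open>20 * h\<close> at the faces, 21 covers the first 20 time steps, \<open>8/nn\<close> pays
    for the decrease of \<open>1/k\<close>, and \<open>7/(nn*l)\<close> for the Laplacian of the
    cutoff.\<close>
  define A where "A = M * (400/l + 21 + 8/nn + 7/(nn*l))"
  have A0: "A > 0" unfolding A_def using M0 l0 nn by (intro mult_pos_pos add_pos_pos) auto
  have "A \<ge> M * (400/l)" "A \<ge> M * 21" "A \<ge> M * (8/nn)" "A \<ge> M * (7/(nn*l))"
    unfolding A_def using M0 l0 nn by (intro mult_left_mono; auto)+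
  then have A1: "l * A / 400 \<ge> M" "A / 20 \<ge> M" "nn * A \<ge> 8 * M" "nn * l * A \<ge> 7 * M"
    using l0 nn M0 by (auto simp: field_simps)
  define K where "K = A * (N * (8/\<rho>\<^sup>2) + 1/ts)"
  have K0: "K > 0" unfolding K_def using A0 N1 \<rho> ts by (intro mult_pos_pos add_nonneg_pos) auto
  have "w k x - w (Suc k) x \<le> K * (l * h\<^sup>2)"
    if h: "0 < h" and bds: "\<forall>k x. k \<le> Suc k1 \<longrightarrow> x \<in> lat h \<longrightarrow> (\<forall>i. \<bar>(x - c) $ i\<bar> < \<rho>) \<longrightarrow> 0 \<le> w k x \<and> w k x \<le> M"
      and sch: "\<forall>k x. k \<le> k1 \<longrightarrow> x \<in> lat h \<longrightarrow> (\<forall>i. \<bar>(x - c) $ i\<bar> < \<rho>) \<longrightarrow> scheme h w k x"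
      and k: "k \<le> k1" "ts \<le> real k * (l * h\<^sup>2)" and x: "x \<in> lat h" "\<forall>i. \<bar>(x - c) $ i\<bar> \<le> \<rho>/2"
    for h w k1 k and c x :: "real^'n"
  proof -
    define X where "X = {x \<in> lat h. \<forall>i. \<bar>(x - c) $ i\<bar> < \<rho>}"
    define V where "V = {x \<in> lat h. \<forall>i. \<bar>(x - c) $ i\<bar> \<le> \<rho> - 20 * h}"
    define Y where "Y = (\<lambda>k x. A * (l * h\<^sup>2 * cutoff \<rho> c x + 1 / real k))"
    have lh: "l * h\<^sup>2 > 0" using l0 h by simp
    have cp: "cutoff \<rho> c y \<ge> 0" for y unfolding cutoff_def by (intro sum_nonneg) auto
    have k0: "k \<noteq> 0" using k ts by (intro notI) auto
    have Ybig: "Y k y \<ge> M" if "k \<le> 20" "k \<noteq> 0" for k y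
    proof -
      have "A * (1/20) \<le> A * (l * h\<^sup>2 * cutoff \<rho> c y + 1 / real k)"
        using A0 lh cp[of y] that by (intro mult_left_mono add_increasing divide_left_mono) auto
      then show ?thesis using A1(2) unfolding Y_def by linarith
    qed
    have triv: "w k y - w (Suc k) y \<le> M" if "k \<le> k1" "y \<in> X" for k y
      using bds[rule_format, of k y] bds[rule_format, of "Suc k" y] that by (auto simp: X_def)
    have xX: "x \<in> X" using x \<rho> unfolding X_def by (intro CollectI conjI allI le_less_trans[OF x(2)[rule_format]]) auto
    have "w k x - w (Suc k) x \<le> Y k x"
    proof (cases "k \<le> 20")
      case True then show ?thesis using Ybig[of k x] triv[of k x] k xX k0 by auto
    next
      case False
      show ?thesis
      proof (rule one_sided_induct[where V = V and X = X and ka = 20 and kb = k1 and h = h and w = w and Y = Y])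
        fix y assume y: "y \<in> V"
        show "nbrs h y \<subseteq> X"
        proof
          fix z assume z: "z \<in> nbrs h y"
          have "\<bar>(z - c) $ i\<bar> < \<rho>" for i
          proof -
            have "\<bar>(y - c) $ i\<bar> \<le> \<rho> - 20 * h" using y by (auto simp: V_def)
            moreover have "\<bar>(z - y) $ i\<bar> \<le> h" using component_le_norm_cart[of "z-y" i] dist_nbrs[OF z] h by (simp add: dist_norm)
            ultimately show ?thesis using h by auto
          qed
          then show "z \<in> X" using lat_nbrs[OF _ z] y by (auto simp: X_def V_def)
        qed
      next
        show "V \<subseteq> X"
        proof
          fix x assume x: "x \<in> V"
          have "\<bar>(x - c) $ i\<bar> < \<rho>" for i
          proof -
            have "\<bar>(x - c) $ i\<bar> \<le> \<rho> - 20 * h" using x by (auto simp: V_def)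
            then show ?thesis using h by linarith
          qed
          then show "x \<in> X" using x by (auto simp: V_def X_def)
        qed
        then show "scheme h w k x \<and> scheme h w (Suc k) x" if "20 \<le> k" "k < k1" "x \<in> V" for k x
          using that sch by (auto simp: X_def)
        show "0 \<le> w k x \<and> w k x \<le> M" if "20 \<le> k" "k \<le> Suc k1" "x \<in> X" for k x
          using bds that by (auto simp: X_def)
        show "w 20 x - w (Suc 20) x \<le> Y 20 x" if "x \<in> X" for x
          using Ybig[of 20 x] triv[of 20 x] that False k by auto
        show "w k y - w (Suc k) y \<le> Y k y" if yX: "20 \<le> k" "k \<le> k1" "y \<in> X - V" for k y
        proof -
          have "\<not> (\<forall>i. \<bar>(y - c) $ i\<bar> \<le> \<rho> - 20 * h)" using yX unfolding X_def V_def by blast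
          then obtain i where i1: "\<bar>(y - c) $ i\<bar> > \<rho> - 20 * h" unfolding not_all not_le by blast
          have "\<bar>(y - c) $ i\<bar> < \<rho>" using yX unfolding X_def by blast
          note i = i1 this
          have "1/(20*h)\<^sup>2 \<le> 1/(\<rho> - (y - c) $ i)\<^sup>2 + 1/(\<rho> + (y - c) $ i)\<^sup>2"
          proof (cases "(y - c) $ i \<ge> 0")
            case True
            then have b: "\<rho> - (y - c) $ i \<le> 20 * h" "\<rho> - (y - c) $ i > 0" using i by linarith+
            then have "(\<rho> - (y - c) $ i)\<^sup>2 \<le> (20*h)\<^sup>2" using power_mono[OF b(1) less_imp_le[OF b(2)], of 2] by blast
            with b have "1/(20*h)\<^sup>2 \<le> 1/(\<rho> - (y - c) $ i)\<^sup>2" using h by (intro divide_left_mono) auto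
            then show ?thesis by (simp add: add_increasing2)
          next
            case False
            then have b: "\<rho> + (y - c) $ i \<le> 20 * h" "\<rho> + (y - c) $ i > 0" using i by linarith+
            then have "(\<rho> + (y - c) $ i)\<^sup>2 \<le> (20*h)\<^sup>2" using power_mono[OF b(1) less_imp_le[OF b(2)], of 2] by blast
            with b have "1/(20*h)\<^sup>2 \<le> 1/(\<rho> + (y - c) $ i)\<^sup>2" using h by (intro divide_left_mono) auto
            then show ?thesis by (simp add: add_increasing)
          qed
          also have "\<dots> \<le> cutoff \<rho> c y" unfolding cutoff_def
            by (rule member_le_sum[of i UNIV "\<lambda>i. 1/(\<rho> - (y - c) $ i)\<^sup>2 + 1/(\<rho> + (y - c) $ i)\<^sup>2"]) auto
          finally have "l * h\<^sup>2 * (1/(20*h)\<^sup>2) \<le> l * h\<^sup>2 * cutoff \<rho> c y" using lh by (intro mult_left_mono) auto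
          then have "l / 400 \<le> l * h\<^sup>2 * cutoff \<rho> c y + 1 / real k" using h
            by (simp add: power2_eq_square add_increasing2)
          then have "A * (l/400) \<le> Y k y" unfolding Y_def using A0 by (intro mult_left_mono) auto
          then show ?thesis using A1 triv[of k y] yX by (simp add: mult.commute)
        qed
        show "20 \<le> k" "k \<le> k1" "x \<in> X" using False k xX by auto
        fix k y assume ky: "20 \<le> k" "k < k1" "y \<in> V"
        define q where "q = l * h\<^sup>2 * cutoff \<rho> c y"
        define r0 where "r0 = 1 / real k"
        define r where "r = 1 / real (Suc k)"
        have q0: "q \<ge> 0" using cp[of y] lh by (simp add: q_def)
        have r: "0 < r" "r \<le> r0" "r0 \<le> 21/20 * r" using ky by (auto simp: r_def r0_def field_simps)
        have "r0 - r = r0 * r" using ky by (simp add: r_def r0_def field_simps)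
        then have r2: "r0 - r \<le> 21/20 * r * r" using mult_right_mono[OF r(3), of r] r by simp
        have Yk: "Y k y = A * (q + r0)" "Y (Suc k) y = A * (q + r)" by (auto simp: Y_def q_def r_def r0_def)
        have lapY: "lap h (Y k) y = A * (l * h\<^sup>2) * lap h (cutoff \<rho> c) y"
          unfolding Y_def by (simp add: lap_cmult lap_add lap_const)
        have Vy: "\<And>i. \<bar>(y - c) $ i\<bar> \<le> \<rho> - 20 * h" using ky by (auto simp: V_def)
        note lc = lap_cutoff[OF h Vy]
        have l1: "lap h (Y k) y \<le> (7/400) * (A * q)"
        proof -
          have "A * (l * h\<^sup>2) * lap h (cutoff \<rho> c) y \<le> A * (l * h\<^sup>2) * ((7/400) * cutoff \<rho> c y)"
            using lc(2) A0 lh by (intro mult_left_mono) auto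
          then show ?thesis unfolding lapY q_def by (simp add: mult_ac)
        qed
        have l2: "lap h (Y k) y \<le> (7/l) * A * q\<^sup>2"
        proof -
          have "A * (l * h\<^sup>2) * lap h (cutoff \<rho> c) y \<le> A * (l * h\<^sup>2) * (7 * h\<^sup>2 * (cutoff \<rho> c y)\<^sup>2)"
            using lc(1) A0 lh by (intro mult_left_mono) auto
          also have "\<dots> = (7/l) * A * q\<^sup>2" using l0 by (simp add: q_def power2_eq_square mult_ac)
          finally show ?thesis unfolding lapY .
        qed
        \<comment> \<open>\<open>(q + r)\<^sup>2 \<ge> q\<^sup>2 + r\<^sup>2\<close> separates the
          quadratic gain: the part with \<open>r\<close> absorbs the decrease from
          \<open>1/k\<close> to \<open>1/(k+1)\<close>, the part with \<open>q\<close> is kept for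
          the Laplacian.\<close>
        have D: "Y (Suc k) y * (1 + nn * Y (Suc k) y / (4 * M)) - Y k y \<ge> nn * A\<^sup>2 * q\<^sup>2 / (4*M)"
        proof -
          have "A * (r0 - r) \<le> A * (21/20 * r * r)" using r2 A0 by (intro mult_left_mono) auto
          also have "\<dots> \<le> A * (2 * r * r)" using A0 r by (intro mult_left_mono mult_right_mono) auto
          also have "\<dots> = (8 * M) * A * r\<^sup>2 / (4*M)" using M0 by (simp add: power2_eq_square field_simps)
          also have "\<dots> \<le> (nn * A) * A * r\<^sup>2 / (4*M)" using A1 A0 M0 by (intro divide_right_mono mult_right_mono) auto
          finally have 1: "A * (r0 - r) \<le> nn * A\<^sup>2 * r\<^sup>2 / (4*M)" by (simp add: power2_eq_square mult_ac)
          have "nn * A\<^sup>2 / (4*M) * (q\<^sup>2 + r\<^sup>2) \<le> nn * A\<^sup>2 / (4*M) * (q + r)\<^sup>2"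
            using nn A0 M0 q0 r by (intro mult_left_mono) (auto simp: power2_sum)
          then have 2: "nn * A\<^sup>2 * q\<^sup>2 / (4*M) + nn * A\<^sup>2 * r\<^sup>2 / (4*M) \<le> nn * A\<^sup>2 * (q + r)\<^sup>2 / (4*M)"
            by (simp add: algebra_simps add_divide_distrib)
          have "Y (Suc k) y * (1 + nn * Y (Suc k) y / (4 * M)) - Y k y = nn * A\<^sup>2 * (q+r)\<^sup>2 / (4*M) - A * (r0 - r)"
            unfolding Yk using M0 by (simp add: field_simps power2_eq_square)
          then show ?thesis using 1 2 by linarith
        qed
        have Dp: "nn * A\<^sup>2 * q\<^sup>2 / (4*M) \<ge> 0" using nn A0 M0 by simp
        have Y0: "Y (Suc k) y > 0" unfolding Yk using A0 q0 r by (intro mult_pos_pos) auto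
        have Yr: "Y k y \<le> 21/20 * Y (Suc k) y"
        proof -
          have "A * (q + r0) \<le> A * (21/20 * (q + r))" using q0 r A0 by (intro mult_left_mono) auto
          then show ?thesis unfolding Yk by (simp only: mult.left_commute)
        qed
        have "nsum h (Y k) y \<le> 4 * N * Y (Suc k) y"
        proof -
          have "A * q \<le> A * (q + r)" using A0 r by (intro mult_left_mono) auto
          then have "(7/400) * (A * q) \<le> N * Y (Suc k) y" using mult_right_mono[OF N1, of "Y (Suc k) y"] Y0 unfolding Yk by auto
          moreover have "2 * N * Y k y \<le> 2 * N * (21/20 * Y (Suc k) y)" using Yr N1 by (intro mult_left_mono) auto
          moreover have "N * Y (Suc k) y \<ge> 0" using N1 Y0 by simp
          ultimately show ?thesis using l1 unfolding lapN by (simp add: algebra_simps)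
        qed
        moreover have "lap h (Y k) y \<le> 4 * N * (Y (Suc k) y * (1 + nn * Y (Suc k) y / (4 * M)) - Y k y)"
        proof -
          have "(7/l) * A * q\<^sup>2 = 7 * M * (A * q\<^sup>2) / (l * M)" using M0 by simp
          also have "\<dots> \<le> nn * l * A * (A * q\<^sup>2) / (l * M)" using A1 A0 M0 l0 by (intro divide_right_mono mult_right_mono) auto
          also have "\<dots> = 4 * 1 * (nn * A\<^sup>2 * q\<^sup>2 / (4*M))" using l0 by (simp add: power2_eq_square mult_ac)
          also have "\<dots> \<le> 4 * N * (nn * A\<^sup>2 * q\<^sup>2 / (4*M))" using N1 Dp by (intro mult_right_mono) auto
          also have "\<dots> \<le> 4 * N * (Y (Suc k) y * (1 + nn * Y (Suc k) y / (4 * M)) - Y k y)"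
            using D N1 by (intro mult_left_mono) auto
          finally show ?thesis using l2 by linarith
        qed
        ultimately show "0 < Y (Suc k) y \<and> nsum h (Y k) y \<le> 4 * N * Y (Suc k) y \<and>
          Y k y \<le> Y (Suc k) y * (1 + (1 - 1/m) * Y (Suc k) y / (4 * M)) \<and>
          lap h (Y k) y \<le> 4 * N * (Y (Suc k) y * (1 + (1 - 1/m) * Y (Suc k) y / (4 * M)) - Y k y)"
          using Y0 D Dp unfolding nn_def by auto
      qed
    qed
    also have "Y k x \<le> K * (l * h\<^sup>2)"
    proof -
      have "cutoff \<rho> c x \<le> (\<Sum>i\<in>(UNIV::'n set). 8/\<rho>\<^sup>2)" unfolding cutoff_def
      proof (rule sum_mono)
        fix i
        have xi: "\<bar>(x - c) $ i\<bar> \<le> \<rho>/2" using x by auto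
        have q: "1/q\<^sup>2 \<le> 4/\<rho>\<^sup>2" if "q \<ge> \<rho>/2" for q
        proof -
          have "(\<rho>/2)\<^sup>2 \<le> q\<^sup>2" using that \<rho> by (intro power_mono) auto
          then have "1/q\<^sup>2 \<le> 1/(\<rho>/2)\<^sup>2" using \<rho> that by (intro divide_left_mono) (auto intro!: mult_pos_pos)
          then show ?thesis by (simp add: power2_eq_square)
        qed
        have "\<rho> - (x-c)$i \<ge> \<rho>/2" "\<rho> + (x-c)$i \<ge> \<rho>/2" using xi unfolding abs_le_iff by linarith+
        from q[OF this(1)] q[OF this(2)]
        show "1 / (\<rho> - (x - c) $ i)\<^sup>2 + 1 / (\<rho> + (x - c) $ i)\<^sup>2 \<le> 8/\<rho>\<^sup>2" by simp
      qed
      then have "cutoff \<rho> c x \<le> N * (8/\<rho>\<^sup>2)" by (simp add: N_def)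
      then have 1: "l * h\<^sup>2 * cutoff \<rho> c x \<le> l * h\<^sup>2 * (N * (8/\<rho>\<^sup>2))" using lh by (intro mult_left_mono) auto
      have "1 / real k \<le> l * h\<^sup>2 * (1/ts)" using k k0 ts by (simp add: field_simps)
      then have "A * (l * h\<^sup>2 * cutoff \<rho> c x + 1 / real k) \<le> A * (l * h\<^sup>2 * (N * (8/\<rho>\<^sup>2)) + l * h\<^sup>2 * (1/ts))"
        by (intro mult_left_mono[OF add_mono[OF 1]] less_imp_le[OF A0])
      also have "\<dots> = K * (l * h\<^sup>2)" unfolding K_def by (simp add: algebra_simps)
      finally show ?thesis unfolding Y_def .
    qed
    finally show ?thesis .
  qed
  then show ?thesis using that[of K] K0 by blast
qed

end

section \<open>Interior equicontinuity\<close>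

text \<open>Reflection argument: \<open>f\<close> is compared with its mirror image in the plane
  halfway between the two points. The difference \<open>\<phi>\<close> is odd, and a barrier of
  linear growth bounds it on a half ball; at the end point \<open>\<phi>\<close> is the difference
  to be estimated.\<close>

lemma poisson_lipschitz_dir:
  fixes f :: "real^'n::finite \<Rightarrow> real"
  assumes h: "h > 0" "h \<le> r/2" and Mf: "Mf > 0" and F: "F \<ge> 0" and y: "y \<in> lat h"
    and fb: "\<And>x. x \<in> lat h \<Longrightarrow> dist x y \<le> 2*r \<Longrightarrow> \<bar>f x\<bar> \<le> Mf"
    and fl: "\<And>x. x \<in> lat h \<Longrightarrow> dist x y < 3/2*r \<Longrightarrow> \<bar>lap h f x\<bar> \<le> F * h\<^sup>2"
    and e: "e = 1 \<or> e = (-1::real)" and k: "real k * h \<le> r"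
  shows "f (y + (e * real k * h) *\<^sub>R axis i 1) - f y
    \<le> real k * h * (2 * F * r + (3 + 4 * real CARD('n)) * Mf / r)"
proof (cases "k = 0")
  case False
  let ?N = "real CARD('n)"
  have r: "r > 0" using h by auto
  \<comment> \<open>The offset of the midpoint from \<open>y\<close> is a multiple of
    \<open>h/2\<close>, so the reflection \<open>\<sigma>\<close> in the plane through it maps the
    lattice to itself. \<open>s\<close> is the signed distance to that plane.\<close>
  define c where "c = y + (e * real k * h / 2) *\<^sub>R axis i 1"
  define s where "s = (\<lambda>x::real^'n. e * (x - c) $ i)"
  define \<sigma> where "\<sigma> = (\<lambda>x::real^'n. x - (2 * (x - c) $ i) *\<^sub>R axis i 1)"
  have ee: "e * e = 1" using e by auto
  have sy: "s x = e * (x - y) $ i - real k * h / 2" for x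
    using e by (auto simp: s_def c_def axis_def algebra_simps)
  have \<sigma>i: "(\<sigma> x - c) $ j = (if j = i then - (x - c) $ i else (x - c) $ j)" for x j
    by (auto simp: \<sigma>_def axis_def)
  have \<sigma>i': "\<sigma> x $ j - c $ j = (if j = i then - (x $ i - c $ i) else x $ j - c $ j)" for x j
    using \<sigma>i[of x j] by simp
  have n\<sigma>: "norm (\<sigma> x - c) = norm (x - c)" for x
  proof -
    have "norm ((\<sigma> x - c) $ j) = norm ((x - c) $ j)" for j unfolding \<sigma>i by (simp add: abs_minus_commute)
    then show ?thesis unfolding norm_vec_def by presburger
  qed
  have \<sigma>\<sigma>: "\<sigma> (\<sigma> x) = x" for x
    by (simp add: vec_eq_iff \<sigma>_def axis_def)
  have s\<sigma>: "s (\<sigma> x) = - s x" for x by (simp only: s_def \<sigma>i) (simp add: algebra_simps)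
  have \<sigma>lat: "\<sigma> x \<in> lat h" if xl: "x \<in> lat h" for x
  proof -
    obtain p :: int where p: "(x - y) $ i = h * of_int p" using lat_diff[OF xl y] by blast
    define q :: int where "q = (if e = 1 then int k else - int k) - 2 * p"
    have "2 * (x - c) $ i = - h * of_int q"
      using p e by (auto simp: c_def axis_def q_def algebra_simps)
    then have "\<sigma> x = x + (h * of_int q) *\<^sub>R axis i 1" by (simp add: \<sigma>_def)
    then show ?thesis using lat_shift[OF xl] by simp
  qed
  have dc: "dist c y = real k * h / 2" using e h by (auto simp: c_def dist_norm)
  then have dcy: "dist c y \<le> r/2" using k by simp
  define \<phi> where "\<phi> = (\<lambda>x. f x - f (\<sigma> x))"
  \<comment> \<open>\<open>A\<close> makes \<open>\<psi>\<close> at least \<open>2 * Mf\<close> from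
    distance \<open>r\<close> on; \<open>B\<close> outweighs the Laplacian of the quadratic term and
    the right-hand sides of \<open>f\<close> and its image, with one more \<open>A\<close> left for
    strictness.\<close>
  define A where "A = 2 * Mf / r\<^sup>2"
  define B where "B = 2 * F + 2 * ?N * A + A"
  have A0: "A > 0" using Mf r by (simp add: A_def)
  have B0: "B > 0" unfolding B_def using A0 F by (intro add_nonneg_pos add_nonneg_nonneg) auto
  \<comment> \<open>The absolute value makes the second summand odd in \<open>s\<close>, hence
    compatible with the reflection.\<close>
  define \<psi> where "\<psi> = (\<lambda>x. A * (norm (x - c))\<^sup>2 + B * (s x * (2*r - \<bar>s x\<bar>)))"
  define g where "g = (\<lambda>x. \<phi> x - \<psi> x)"
  define D where "D = {x \<in> lat h. 0 < s x \<and> norm (x - c) < r}"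
  have sn: "\<bar>s x\<bar> \<le> norm (x - c)" for x
    using component_le_norm_cart[of "x-c" i] e by (auto simp: s_def abs_mult)
  have lap\<sigma>: "lap h (\<lambda>x. f (\<sigma> x)) x = lap h f (\<sigma> x)" for x
  proof -
    have "\<sigma> (x + h *\<^sub>R axis j 1) = (if j = i then \<sigma> x - h *\<^sub>R axis j 1 else \<sigma> x + h *\<^sub>R axis j 1)"
      "\<sigma> (x - h *\<^sub>R axis j 1) = (if j = i then \<sigma> x + h *\<^sub>R axis j 1 else \<sigma> x - h *\<^sub>R axis j 1)" for j
      by (auto simp: \<sigma>_def vec_eq_iff axis_def)
    then show ?thesis by (auto simp: lap_def intro!: sum.cong)
  qed
  have half: "\<exists>p::int. s x = h/2 * of_int p" if xl: "x \<in> lat h" for x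
  proof -
    obtain p :: int where "(x - y) $ i = h * of_int p" using lat_diff[OF xl y] by blast
    then show ?thesis using e unfolding sy
      by (intro exI[of _ "(if e = 1 then 2 * p else - 2 * p) - int k"]) (auto simp: algebra_simps)
  qed
  have \<phi>b: "\<phi> x \<le> 2 * Mf" if "x \<in> lat h" "norm (x - c) \<le> 3/2*r" for x
  proof -
    have "dist x y \<le> 2*r" "dist (\<sigma> x) y \<le> 2*r"
      using dist_triangle[of x y c] dist_triangle[of "\<sigma> x" y c] that dcy n\<sigma>[of x] by (auto simp: dist_norm)
    then show ?thesis using fb[of x] fb[of "\<sigma> x"] that \<sigma>lat[of x] unfolding \<phi>_def by auto
  qed
  have main: "g x \<le> 0" if "x \<in> D" for x
  proof (rule discrete_max_principle[where D = D and h = h and \<kappa> = "A * h\<^sup>2"])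
    show "x \<in> D" by fact
    show "A * h\<^sup>2 > 0" using A0 h by simp
    show "bdd_above (g ` D)"
    proof (rule bdd_aboveI2)
      fix x assume x: "x \<in> D"
      then have "\<psi> x \<ge> 0" unfolding \<psi>_def using A0 B0 sn[of x] r
        by (intro add_nonneg_nonneg mult_nonneg_nonneg) (auto simp: D_def)
      then show "g x \<le> 2 * Mf" using \<phi>b[of x] x r by (simp add: g_def D_def)
    qed
  next
    fix x assume x: "x \<in> D" "g x > 0"
    then have xl: "x \<in> lat h" "0 < s x" "norm (x - c) < r" by (auto simp: D_def)
    obtain p :: int where p: "s x = h/2 * of_int p" using half xl by blast
    have p1: "p \<ge> 1" using xl(2) h unfolding p by (simp add: zero_less_mult_iff)
    have dxy: "dist x y < 3/2*r" "dist (\<sigma> x) y < 3/2*r"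
      using dist_triangle[of x y c] dist_triangle[of "\<sigma> x" y c] xl dcy n\<sigma>[of x] by (auto simp: dist_norm)
    have "lap h \<phi> x = lap h f x - lap h f (\<sigma> x)" by (simp only: \<phi>_def lap_diff lap\<sigma>)
    then have l1: "lap h \<phi> x \<ge> - 2 * F * h\<^sup>2" using fl[OF xl(1) dxy(1)] fl[OF \<sigma>lat[OF xl(1)] dxy(2)] by linarith
    \<comment> \<open>For \<open>p = 1\<close> the stencil crosses the plane and the second
      difference is \<open>-(3/2) * h\<^sup>2\<close>; otherwise it is
      \<open>-2 * h\<^sup>2\<close>.\<close>
    have l2: "lap h (\<lambda>x. s x * (2*r - \<bar>s x\<bar>)) x \<le> - h\<^sup>2"
    proof -
      have "lap h (\<lambda>x. s x * (2*r - \<bar>s x\<bar>)) x = (\<lambda>t. t * (2*r - \<bar>t\<bar>)) (s x + h) + (\<lambda>t. t * (2*r - \<bar>t\<bar>)) (s x - h) - 2 * (\<lambda>t. t * (2*r - \<bar>t\<bar>)) (s x)"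
        using e lap_coord[of h "\<lambda>u. (e*u) * (2*r - \<bar>e*u\<bar>)" c i x] unfolding s_def
        by (auto simp: algebra_simps)
      also have "\<dots> \<le> - h\<^sup>2"
      proof (cases "p = 1")
        case True
        then show ?thesis using h by (simp add: p power2_eq_square algebra_simps abs_if)
      next
        case False
        then have "h/2 * 2 \<le> h/2 * of_int p" using p1 h by (intro mult_left_mono) auto
        then have "s x \<ge> h" by (simp add: p)
        then show ?thesis using h by (simp add: power2_eq_square algebra_simps abs_if)
      qed
      finally show ?thesis .
    qed
    have "lap h \<psi> x = A * (2 * ?N * h\<^sup>2) + B * lap h (\<lambda>x. s x * (2*r - \<bar>s x\<bar>)) x"
      by (simp only: \<psi>_def lap_add lap_cmult lap_norm_sq)
    also have "\<dots> \<le> A * (2 * ?N * h\<^sup>2) + B * (- h\<^sup>2)" using l2 B0 by (intro add_left_mono mult_left_mono) auto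
    finally have "lap h \<psi> x \<le> (2 * ?N * A - B) * h\<^sup>2" by (simp add: algebra_simps)
    then show "A * h\<^sup>2 \<le> lap h g x" using l1 by (simp add: g_def lap_diff B_def algebra_simps)
    fix z assume z: "z \<in> nbrs h x"
    have zl: "z \<in> lat h" using lat_nbrs[OF xl(1) z] .
    show "z \<in> D \<or> g z \<le> 0"
    proof (cases "s z > 0")
      case True
      show ?thesis
      proof (cases "norm (z - c) < r")
        case True then show ?thesis using zl \<open>s z > 0\<close> by (auto simp: D_def)
      next
        case False
        have nz: "norm (z - c) \<le> 3/2*r"
          using dist_triangle[of z c x] dist_nbrs[OF z] xl h by (auto simp: dist_norm)
        have "r\<^sup>2 \<le> (norm (z-c))\<^sup>2" using False r by (intro power_mono) auto
        then have "A * r\<^sup>2 \<le> A * (norm (z-c))\<^sup>2" using A0 by simp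
        moreover have "A * r\<^sup>2 = 2 * Mf" using r by (simp add: A_def)
        moreover have "B * (s z * (2*r - \<bar>s z\<bar>)) \<ge> 0" using B0 True sn[of z] nz r by (intro mult_nonneg_nonneg) auto
        ultimately have "\<psi> z \<ge> 2 * Mf" by (simp add: \<psi>_def)
        then show ?thesis using \<phi>b[OF zl nz] by (simp add: g_def)
      qed
    next
      case False
      \<comment> \<open>A neighbour with \<open>s z \<le> 0\<close> lies on the plane, where
        \<open>\<phi>\<close> vanishes, if \<open>p\<close> is 2, and is the mirror image of
        \<open>x\<close>, where \<open>\<phi>\<close> changes sign, if \<open>p\<close> is
        1.\<close>
      have "s z = s x \<or> s z = s x + h \<or> s z = s x - h \<and> z = x - (e * h) *\<^sub>R axis i 1"
        using z e by (elim nbrsE; auto simp: s_def axis_def)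
      then have sz: "s z = s x - h" "z = x - (e * h) *\<^sub>R axis i 1" using False xl h by auto
      then have "h/2 * of_int p \<le> h/2 * 2" using False by (simp add: p)
      then have "of_int p \<le> (2::real)" using h by (subst (asm) mult_le_cancel_left_pos) auto
      then have "p = 1 \<or> p = 2" using p1 by linarith
      then have "g z \<le> 0"
      proof
        assume "p = 2"
        then have "s z = 0" using sz p by simp
        then have "(z - c) $ i = 0" using e by (auto simp: s_def)
        then have "\<sigma> z = z" by (simp add: \<sigma>_def)
        then have "\<phi> z = 0" by (simp add: \<phi>_def)
        then show ?thesis using A0 \<open>s z = 0\<close> by (simp add: g_def \<psi>_def)
      next
        assume "p = 1"
        then have "s x = h/2" using p by simp
        then have "2 * (x - c) $ i = e * h" using ee e by (auto simp: s_def)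
        then have zs: "z = \<sigma> x" using sz by (simp add: \<sigma>_def)
        have "\<phi> z = - \<phi> x" by (simp add: zs \<phi>_def \<sigma>\<sigma>)
        moreover have "\<psi> z = A * (norm (x - c))\<^sup>2 - B * (s x * (2*r - \<bar>s x\<bar>))" by (simp add: zs \<psi>_def n\<sigma> s\<sigma>)
        moreover have "A * (norm (x - c))\<^sup>2 \<ge> 0" using A0 by simp
        ultimately show ?thesis using x(2) by (simp add: g_def \<psi>_def)
      qed
      then show ?thesis ..
    qed
  qed
  define x where "x = y + (e * real k * h) *\<^sub>R axis i 1"
  have xl: "x \<in> lat h" using lat_shift[OF y, of "if e = 1 then int k else - int k" i] e by (auto simp: x_def mult_ac)
  have "x - c = (e * real k * h - e * real k * h / 2) *\<^sub>R axis i 1"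
    by (simp only: x_def c_def scaleR_left_diff_distrib) simp
  then have xc: "x - c = (e * real k * h / 2) *\<^sub>R axis i 1" by (simp add: field_simps)
  have nx: "norm (x - c) = real k * h / 2" using e h by (auto simp: xc)
  have xci: "(x - c) $ i = e * real k * h / 2" unfolding xc by (simp add: axis_def)
  have sx: "s x = real k * h / 2" using ee unfolding s_def xci by (simp flip: mult.assoc)
  have "real k * h > 0" using False h by simp
  then have xD: "x \<in> D" using xl nx sx k r by (auto simp: D_def)
  have \<sigma>x: "\<sigma> x = y" unfolding \<sigma>_def xci by (simp add: x_def)
  define t where "t = real k * h / 2"
  have t: "0 < t" "t \<le> r/2" using \<open>real k * h > 0\<close> k by (auto simp: t_def)
  have "\<phi> x \<le> \<psi> x" using main[OF xD] by (simp add: g_def)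
  then have "f x - f y \<le> A * t\<^sup>2 + B * (t * (2*r - t))" using t by (simp add: \<phi>_def \<psi>_def \<sigma>x nx sx t_def)
  also have "\<dots> \<le> A * (t * r) + B * (t * (2*r))"
    using A0 B0 t by (intro add_mono mult_left_mono) (auto simp: power2_eq_square)
  also have "\<dots> = t * r * (A + 2 * B)" by (simp add: algebra_simps)
  also have "\<dots> = 2 * t * (2 * F * r + (3 + 4 * ?N) * Mf / r)"
    unfolding B_def A_def using r by (simp add: field_simps power2_eq_square)
  finally show ?thesis by (simp add: x_def t_def)
next
  case True then show ?thesis by simp
qed

text \<open>Coordinates are exchanged one at a time. Each intermediate point is no farther from
  \<open>y\<close> than \<open>z\<close> is, so the bounds on the ball of radius \<open>3*r\<close>
  serve every one-directional step.\<close>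

lemma poisson_lipschitz:
  fixes f :: "real^'n::finite \<Rightarrow> real"
  assumes h: "h > 0" "h \<le> r/2" and Mf: "Mf > 0" and F: "F \<ge> 0" and y: "y \<in> lat h" "z \<in> lat h"
    and fb: "\<And>x. x \<in> lat h \<Longrightarrow> dist x y \<le> 3*r \<Longrightarrow> \<bar>f x\<bar> \<le> Mf"
    and fl: "\<And>x. x \<in> lat h \<Longrightarrow> dist x y < 3*r \<Longrightarrow> \<bar>lap h f x\<bar> \<le> F * h\<^sup>2"
    and yz: "dist z y \<le> r"
  shows "f z - f y \<le> real CARD('n) * dist z y * (2 * F * r + (3 + 4 * real CARD('n)) * Mf / r)"
proof -
  let ?C = "2 * F * r + (3 + 4 * real CARD('n)) * Mf / r"
  have r: "r > 0" using h by auto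
  have C0: "?C \<ge> 0" using F r Mf by (intro add_nonneg_nonneg) auto
  define Q where "Q = (\<lambda>S. (\<chi> j. if j \<in> S then z $ j else y $ j) :: real^'n)"
  have Qn: "dist (Q S) y \<le> dist z y" for S
    unfolding dist_norm by (rule norm_le_componentwise_cart) (auto simp: Q_def)
  have Ql: "Q S \<in> lat h" for S using y by (auto simp: lat_def Q_def)
  have "f (Q S) - f y \<le> real (card S) * dist z y * ?C" if "finite S" for S
    using that
  proof (induction S rule: finite_induct)
    case empty
    have "Q {} = y" by (simp add: Q_def vec_eq_iff)
    then show ?case by simp
  next
    case (insert i S)
    obtain p :: int where p: "(z - y) $ i = h * of_int p" using lat_diff[OF y(2,1)] by blast
    define e :: real where "e = (if p \<ge> 0 then 1 else -1)"
    define k where "k = nat \<bar>p\<bar>"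
    have ek: "e * real k * h = (z - y) $ i" "real k * h = \<bar>(z - y) $ i\<bar>"
      unfolding p using h by (auto simp: e_def k_def abs_mult)
    have kd: "real k * h \<le> dist z y" unfolding ek dist_norm by (rule component_le_norm_cart)
    have Qi: "Q (insert i S) = Q S + (e * real k * h) *\<^sub>R axis i 1"
      unfolding ek using insert by (auto simp: Q_def vec_eq_iff axis_def)
    have "f (Q S + (e * real k * h) *\<^sub>R axis i 1) - f (Q S) \<le> real k * h * ?C"
    proof (rule poisson_lipschitz_dir[OF h Mf F Ql])
      fix x :: "real^'n" assume x: "x \<in> lat h"
      have tr: "dist x y \<le> dist x (Q S) + r" using dist_triangle[of x y "Q S"] Qn[of S] yz by linarith
      show "\<bar>f x\<bar> \<le> Mf" if "dist x (Q S) \<le> 2*r" using that tr fb[OF x] by auto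
      show "\<bar>lap h f x\<bar> \<le> F * h\<^sup>2" if "dist x (Q S) < 3/2*r" using that tr fl[OF x] r by auto
    qed (use kd yz in \<open>auto simp: e_def\<close>)
    also have "\<dots> \<le> dist z y * ?C" using kd C0 by (rule mult_right_mono)
    finally have "f (Q (insert i S)) - f (Q S) \<le> dist z y * ?C" unfolding Qi .
    moreover have ce: "real (card (insert i S)) = real (card S) + 1" using insert by simp
    have "(a + 1) * d * c = a * d * c + d * c" for a d c :: real by (simp add: algebra_simps)
    then have "real (card (insert i S)) * dist z y * ?C = real (card S) * dist z y * ?C + dist z y * ?C"
      unfolding ce by blast
    ultimately show ?case using insert.IH by linarith
  qed
  from this[of UNIV] have "f (Q UNIV) - f y \<le> real CARD('n) * dist z y * ?C" by simp
  moreover have "Q UNIV = z" by (simp add: Q_def vec_eq_iff)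
  ultimately show ?thesis by simp
qed

text \<open>Near the boundary of the ball, where the bracket is small, the squared bump is
  subharmonic; inside, its Laplacian is at least a negative multiple of the bump. Hence the bump
  times a suitable decaying factor remains a subsolution up to the boundary of the ball.\<close>

lemma lap_quartic:
  fixes x y :: "real^'n::finite"
  assumes r0: "r0 > 0"
  shows "lap h (\<lambda>x. (1 - (norm (x - y))\<^sup>2 / r0\<^sup>2)\<^sup>2) x
    \<ge> (h\<^sup>2 / r0\<^sup>2) * (8 - (4 * real CARD('n) + 8) * (1 - (norm (x - y))\<^sup>2 / r0\<^sup>2))"
proof -
  let ?N = "real CARD('n)"
  define u where "u = (norm (x - y))\<^sup>2"
  define q where "q = 1 / r0\<^sup>2"
  have q: "q > 0" using r0 by (simp add: q_def)
  have d: "a / r0\<^sup>2 = a * q" for a by (simp add: q_def)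
  have su: "(\<Sum>i\<in>UNIV. ((x - y) $ i)\<^sup>2) = u"
    unfolding u_def norm_vec_def L2_set_def by (simp add: sum_nonneg)
  have t: "(1 - (u + 2 * h * v + h\<^sup>2) * q)\<^sup>2 + (1 - (u - 2 * h * v + h\<^sup>2) * q)\<^sup>2 - 2*(1-u*q)\<^sup>2
      = 2 * (q*h\<^sup>2)\<^sup>2 - 4*(1-u*q)*(q*h\<^sup>2) + 8 * (q*h\<^sup>2) * q * v\<^sup>2" for v
    by (simp add: power2_eq_square algebra_simps)
  have "lap h (\<lambda>x. (1 - (norm (x - y))\<^sup>2 / r0\<^sup>2)\<^sup>2) x
     = (\<Sum>i\<in>UNIV. 2 * (q*h\<^sup>2)\<^sup>2 - 4*(1-u*q)*(q*h\<^sup>2) + 8*(q*h\<^sup>2)*q*((x-y)$i)\<^sup>2)"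
    unfolding lap_def norm_axis_shift d u_def[symmetric] t ..
  also have "\<dots> = ?N * (2 * (q*h\<^sup>2)\<^sup>2 - 4*(1-u*q)*(q*h\<^sup>2)) + 8*(q*h\<^sup>2)*q*u"
    unfolding sum.distrib su[symmetric] sum_distrib_left by simp
  also have "\<dots> \<ge> (h\<^sup>2*q) * (8 - (4 * ?N + 8) * (1 - u*q))"
  proof -
    have "?N * (2 * (q*h\<^sup>2)\<^sup>2 - 4*(1-u*q)*(q*h\<^sup>2)) + 8*(q*h\<^sup>2)*q*u - (h\<^sup>2*q) * (8 - (4 * ?N + 8) * (1 - u*q)) = ?N * 2 * (q*h\<^sup>2)\<^sup>2"
      by (simp add: algebra_simps)
    then show ?thesis by (smt (verit) mult_nonneg_nonneg of_nat_0_le_iff zero_le_power2)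
  qed
  finally show ?thesis unfolding d u_def .
qed

lemma one_minus_power_ge:
  assumes "0 \<le> x" "x \<le> 1/2"
  shows "(1 - x) ^ p \<ge> exp (- 2 * x * real p)"
proof -
  have "- x - 2 * x\<^sup>2 \<le> ln (1 - x)" using ln_one_minus_pos_lower_bound[of x] assms by auto
  moreover have "x\<^sup>2 \<le> x * (1/2)" using assms mult_left_mono[of x "1/2" x] by (simp add: power2_eq_square)
  ultimately have "- 2 * x \<le> ln (1 - x)" by linarith
  then have "exp (- 2 * x) \<le> 1 - x" using assms by (subst (asm) ln_ge_iff) auto
  then have "exp (- 2 * x) ^ p \<le> (1 - x) ^ p" by (intro power_mono) auto
  then show ?thesis by (simp add: exp_of_nat_mult[symmetric] mult.commute)
qed

section \<open>How low values spread and high values decay\<close>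

context pme
begin

text \<open>The hypotheses of the equicontinuity proof on one cylinder about \<open>(y, s)\<close>,
  of the same size \<open>\<rho>\<close> in space and time. The first clause keeps step 0 out of the
  time window. The one-sided bound is built in with a free \<open>K\<close>, so that either its
  global or its interior version can be supplied.\<close>

definition reg :: "real \<Rightarrow> real \<Rightarrow> real \<Rightarrow> (nat \<Rightarrow> real^'n \<Rightarrow> real) \<Rightarrow> real^'n \<Rightarrow> nat \<Rightarrow> bool" where
  "reg K h \<rho> w y s \<longleftrightarrow> \<rho> \<le> real s * (l * h\<^sup>2) \<and> y \<in> lat h \<and>
    (\<forall>x\<in>lat h. \<forall>k. dist x y < \<rho> \<longrightarrow> \<bar>real k - real s\<bar> * (l * h\<^sup>2) < \<rho> \<longrightarrow>
       0 \<le> w k x \<and> w k x \<le> M \<and> scheme h w k x \<and> w k x - w (Suc k) x \<le> K * (l * h\<^sup>2))"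

lemma one_sided_sum:
  assumes "a \<le> b" and "\<And>j. a \<le> j \<Longrightarrow> j < b \<Longrightarrow> w j x - w (Suc j) x \<le> (c::real)"
  shows "w a x \<le> w b x + real (b - a) * c"
  using assms
proof (induction b rule: dec_induct)
  case (step b)
  then have "w a x \<le> w b x + real (b - a) * c" "w b x - w (Suc b) x \<le> c" by auto
  moreover have "real (Suc b - a) = real (b - a) + 1" using step by auto
  moreover have "(real (b - a) + 1) * c = real (b - a) * c + c" by (simp add: algebra_simps)
  ultimately show ?case by simp
qed simp

text \<open>Telescoping: diffusion is linear in \<open>w\<close>, so a time sum satisfies a Poisson
  equation whose right-hand side is a difference of two roots, bounded independently of the length
  of the sum. Continuity, the lateral lower bound and stability all use this.\<close>

lemma scheme_sum:
  assumes "a \<le> b" "\<And>j. a \<le> j \<Longrightarrow> j < b \<Longrightarrow> scheme h w j x"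
  shows "rt (w b x) - rt (w a x) = l * lap h (\<lambda>x. \<Sum>j\<in>{a..<b}. w j x) x"
proof -
  have "rt (w b x) - rt (w a x) = (\<Sum>j\<in>{a..<b}. rt (w (Suc j) x) - rt (w j x))"
    using sum_Suc_diff'[OF assms(1), of "\<lambda>j. rt (w j x)"] by simp
  also have "\<dots> = (\<Sum>j\<in>{a..<b}. l * lap h (w j) x)"
    using assms(2) by (intro sum.cong) (auto simp: scheme_def)
  finally show ?thesis by (simp add: lap_sum sum_distrib_left)
qed

text \<open>A low value propagates backwards in time by the one-sided bound, and, after averaging in time,
  sideways in space since the time averages solve a Poisson equation with bounded right-hand side.\<close>

lemma low_spreads_back:
  assumes reg: "reg K h \<rho> w y s" and K: "K \<ge> 0" and h: "h > 0" and R: "R > 0" "R \<le> \<rho>/8" "R\<^sup>2 \<le> \<rho>/8"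
    and \<tau>: "l * h\<^sup>2 \<le> R\<^sup>2/4" "h \<le> R/2" and n: "n = nat \<lfloor>R\<^sup>2 / (l * h\<^sup>2)\<rfloor>"
    and z: "z \<in> lat h" "dist z y \<le> R"
  shows "2 * n < s" and "R\<^sup>2/2 \<le> real n * (l * h\<^sup>2)" and "real n * (l * h\<^sup>2) \<le> R\<^sup>2"
    "w (s - 2*n) z \<le> w s y + 3 * K * R\<^sup>2 + N * (dist z y / R) * (4 * rt M + (3 + 4 * N) * M)"
proof -
  define \<tau> where "\<tau> = l * h\<^sup>2"
  have \<tau>0: "\<tau> > 0" using l0 h by (simp add: \<tau>_def)
  have R2: "R\<^sup>2 > 0" using R by simp
  have q1: "R\<^sup>2 / \<tau> \<ge> 4" using \<tau> \<tau>0 by (simp add: \<tau>_def[symmetric] field_simps)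
  have nr: "real n \<le> R\<^sup>2/\<tau>" "real n \<ge> R\<^sup>2/\<tau> - 1" unfolding n \<tau>_def[symmetric] using q1 by linarith+
  have "real n * \<tau> \<le> R\<^sup>2/\<tau> * \<tau>" "(R\<^sup>2/\<tau> - 1) * \<tau> \<le> real n * \<tau>" using nr \<tau>0 by (intro mult_right_mono; simp)+
  then have n1: "real n * \<tau> \<le> R\<^sup>2" "R\<^sup>2/2 \<le> real n * \<tau>" using \<tau>0 \<tau> by (auto simp: left_diff_distrib \<tau>_def[symmetric])
  show "R\<^sup>2/2 \<le> real n * (l * h\<^sup>2)" "real n * (l * h\<^sup>2) \<le> R\<^sup>2" using n1 by (auto simp: \<tau>_def)
  have n0: "real n \<ge> 3" using nr q1 by linarith
  have \<rho>s: "\<rho> \<le> real s * \<tau>" and yl: "y \<in> lat h" using reg by (auto simp: reg_def \<tau>_def)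
  have "real (2*n) * \<tau> < real s * \<tau>" using n1 R \<rho>s R2 by simp
  then show ns: "2 * n < s" using \<tau>0 by (metis mult_less_cancel_right_pos of_nat_less_iff)
  have rg: "0 \<le> w k x \<and> w k x \<le> M \<and> scheme h w k x \<and> w k x - w (Suc k) x \<le> K * \<tau>"
    if "x \<in> lat h" "dist x y < \<rho>" "s - 2*n \<le> k" "k \<le> s" for x k
  proof -
    have "\<bar>real k - real s\<bar> * \<tau> \<le> real (2*n) * \<tau>" using that ns \<tau>0 by (intro mult_right_mono) auto
    also have "\<dots> < \<rho>" using n1 R R2 by simp
    finally show ?thesis using reg that by (auto simp: reg_def \<tau>_def)
  qed
  \<comment> \<open>The window starts \<open>2*n\<close> steps before \<open>s\<close> and ends
    \<open>n\<close> steps before. The one-sided bound is used twice, from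
    \<open>w (s-2*n) z\<close> to the average at \<open>z\<close> and from the average at
    \<open>y\<close> to \<open>w s y\<close>. Since \<open>n\<close> steps last about
    \<open>R\<^sup>2\<close>, the Poisson estimate in between is scale invariant.\<close>
  define f where "f = (\<lambda>x. (1 / real n) * (\<Sum>j\<in>{s-2*n..<s-n}. w j x))"
  have card: "card {s-2*n..<s-n} = n" "s - (n + (s - 2*n)) = n" "s - (n + (s - n*2)) = n" using ns by auto
  have Mu: "rt (w k x) \<le> rt M \<and> 0 \<le> rt (w k x)" if "x \<in> lat h" "dist x y < \<rho>" "s - 2*n \<le> k" "k \<le> s" for x k
    using rg[OF that] root_mono[OF m1] by auto
  have C: "f z - f y \<le> real CARD('n) * dist z y * (2 * (2 * rt M / R\<^sup>2) * R + (3 + 4 * real CARD('n)) * M / R)"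
  proof (rule poisson_lipschitz[OF h \<tau>(2) M0 _ yl z(1)])
    show "0 \<le> 2 * rt M / R\<^sup>2" by simp
    show "dist z y \<le> R" by fact
    fix x :: "real^'n" assume x: "x \<in> lat h"
    show "\<bar>f x\<bar> \<le> M" if "dist x y \<le> 3*R"
    proof -
      have b: "0 \<le> w j x" "w j x \<le> M" if "j \<in> {s-2*n..<s-n}" for j using rg[OF x, of j] \<open>dist x y \<le> 3*R\<close> R that by auto
      have "(\<Sum>j\<in>{s-2*n..<s-n}. w j x) \<le> (\<Sum>j\<in>{s-2*n..<s-n}. M)" "0 \<le> (\<Sum>j\<in>{s-2*n..<s-n}. w j x)"
        using b by (intro sum_mono sum_nonneg; simp)+
      then show ?thesis using n0 by (auto simp: f_def card abs_le_iff field_simps)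
    qed
    show "\<bar>lap h f x\<bar> \<le> 2 * rt M / R\<^sup>2 * h\<^sup>2" if "dist x y < 3*R"
    proof -
      have dx: "dist x y < \<rho>" using that R by auto
      have "rt (w (s-n) x) - rt (w (s-2*n) x) = l * lap h (\<lambda>x. \<Sum>j\<in>{s-2*n..<s-n}. w j x) x"
        using rg[OF x dx] by (intro scheme_sum) auto
      then have "l * (real n * lap h f x) = rt (w (s-n) x) - rt (w (s-2*n) x)"
        using n0 by (simp only: f_def lap_cmult) simp
      then have "\<bar>l * (real n * lap h f x)\<bar> \<le> rt M" using Mu[OF x dx, of "s-n"] Mu[OF x dx, of "s-2*n"] ns by linarith
      then have "(real n * \<tau>) * \<bar>lap h f x\<bar> \<le> rt M * h\<^sup>2" using l0 h n0
        by (simp add: abs_mult \<tau>_def mult_ac mult_left_mono)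
      moreover have "(R\<^sup>2/2) * \<bar>lap h f x\<bar> \<le> (real n * \<tau>) * \<bar>lap h f x\<bar>" using n1 by (intro mult_right_mono) auto
      ultimately have "(R\<^sup>2/2) * \<bar>lap h f x\<bar> \<le> rt M * h\<^sup>2" by linarith
      then show ?thesis using R2 by (simp add: field_simps)
    qed
  qed
  have "real CARD('n) * dist z y * (2 * (2 * rt M / R\<^sup>2) * R + (3 + 4 * real CARD('n)) * M / R)
    = N * (dist z y / R) * (4 * rt M + (3 + 4 * N) * M)"
    unfolding N_def[symmetric] using R by (simp add: field_simps power2_eq_square)
  then have C': "f z \<le> f y + N * (dist z y / R) * (4 * rt M + (3 + 4 * N) * M)" using C by simp
  have one: "w a x \<le> w b x + 2 * K * R\<^sup>2" if x: "x \<in> lat h" "dist x y < \<rho>" and ab: "s - 2*n \<le> a" "a \<le> b" "b \<le> s" for a b x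
  proof -
    have "w a x \<le> w b x + real (b - a) * (K * \<tau>)"
      by (rule one_sided_sum) (use rg[OF x] ab in auto)
    also have "real (b - a) * (K * \<tau>) \<le> real (2*n) * (K * \<tau>)" using ab ns K \<tau>0 by (intro mult_right_mono) auto
    also have "\<dots> = 2 * K * (real n * \<tau>)" by simp
    also have "\<dots> \<le> 2 * K * R\<^sup>2" using n1 K by (intro mult_left_mono) auto
    finally show ?thesis by simp
  qed
  have one': "w a x \<le> w b x + K * R\<^sup>2" if x: "x \<in> lat h" "dist x y < \<rho>" and ab: "s - 2*n \<le> a" "a \<le> b" "b \<le> s-n" for a b x
  proof -
    have "w a x \<le> w b x + real (b - a) * (K * \<tau>)"
      by (rule one_sided_sum) (use rg[OF x] ab in auto)
    also have "real (b - a) * (K * \<tau>) \<le> real n * (K * \<tau>)" using ab ns K \<tau>0 by (intro mult_right_mono) auto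
    also have "\<dots> = K * (real n * \<tau>)" by simp
    also have "\<dots> \<le> K * R\<^sup>2" using n1 K by (intro mult_left_mono) auto
    finally show ?thesis by simp
  qed
  have "(\<Sum>j\<in>{s-2*n..<s-n}. w j y) \<le> (\<Sum>j\<in>{s-2*n..<s-n}. w s y + 2 * K * R\<^sup>2)"
    by (intro sum_mono one) (use yl R in auto)
  then have fy: "f y \<le> w s y + 2 * K * R\<^sup>2" unfolding f_def using n0 by (simp add: card field_simps)
  have "(\<Sum>j\<in>{s-2*n..<s-n}. w (s-2*n) z) \<le> (\<Sum>j\<in>{s-2*n..<s-n}. w j z + K * R\<^sup>2)"
    by (intro sum_mono one') (use z R in auto)
  then have fz: "w (s-2*n) z \<le> f z + K * R\<^sup>2" unfolding f_def using n0 by (simp add: card sum.distrib field_simps)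
  show "w (s - 2*n) z \<le> w s y + 3 * K * R\<^sup>2 + N * (dist z y / R) * (4 * rt M + (3 + 4 * N) * M)"
    using fy fz C' by linarith
qed

text \<open>A region that lies below the supremum by a fixed amount lowers the solution at its centre.\<close>

lemma barrier_decay:
  fixes w :: "nat \<Rightarrow> real^'n \<Rightarrow> real"
  assumes h: "h > 0" and y: "y \<in> lat h" and ra: "ra > 0" "2 * h \<le> ra"
    and \<Lambda>: "\<Lambda> = (4*N+8)\<^sup>2 / (32 * (4 * N * l)) / ra\<^sup>2" "\<Lambda> * (l * h\<^sup>2) \<le> 1/2"
    and \<eta>\<mu>: "0 < \<eta>" "\<eta> \<le> 1/4" "0 < \<mu>" "32 * \<mu> * h\<^sup>2 / ra\<^sup>2 \<le> \<eta>" and \<theta>: "\<mu> \<le> \<theta>" "\<theta> \<le> M"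
    and sch: "\<And>k x. k < n \<Longrightarrow> x \<in> lat h \<Longrightarrow> dist x y < ra \<Longrightarrow> scheme h w k x"
    and bds: "\<And>k x. k \<le> n \<Longrightarrow> x \<in> lat h \<Longrightarrow> dist x y < 2 * ra \<Longrightarrow> 0 \<le> w k x \<and> w k x \<le> M \<and> w k x \<le> \<theta> + \<eta>"
    and low: "\<And>x. x \<in> lat h \<Longrightarrow> dist x y < ra \<Longrightarrow> w 0 x \<le> \<theta> - \<mu>/2"
    and x: "x \<in> lat h" "dist x y \<le> ra/2"
  shows "w n x \<le> \<theta> + 2*\<eta> - (\<mu>/4) * exp (- 2 * \<Lambda> * (real n * (l * h\<^sup>2)))"
proof -
  define \<tau> where "\<tau> = l * h\<^sup>2"
  have \<tau>0: "\<tau> > 0" using l0 h by (simp add: \<tau>_def)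
  define P where "P = (\<lambda>x::real^'n. (1 - (norm (x - y))\<^sup>2 / ra\<^sup>2)\<^sup>2)"
  define q where "q = 1 - \<Lambda> * \<tau>"
  have \<Lambda>0: "\<Lambda> > 0" unfolding \<Lambda> using l0 N1 ra by simp
  have q: "1/2 \<le> q" "q < 1" using \<Lambda>(2) \<Lambda>0 \<tau>0 by (auto simp: q_def \<tau>_def[symmetric])
  \<comment> \<open>Level \<open>\<theta> + 2*\<eta>\<close> with a dent of depth
    \<open>\<mu>/2\<close> that shrinks by the factor \<open>q\<close> per step. The second
    \<open>\<eta>\<close> absorbs the values of the quartic in the layer of width
    \<open>2 * h\<close> beyond radius \<open>ra\<close>, where it grows again.\<close>
  define b where "b = (\<lambda>j x. \<theta> + 2*\<eta> - (\<mu>/2) * q^j * P x)"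
  have b00: "b 0 x = \<theta> + 2*\<eta> - (\<mu>/2) * P x" for x by (simp add: b_def)
  have P0: "P x \<ge> 0" for x by (simp add: P_def)
  have P1: "P x \<le> 1" if "dist x y < ra" for x
  proof -
    have "(norm (x-y))\<^sup>2 \<le> ra\<^sup>2" using that by (intro power_mono) (auto simp: dist_norm)
    then have "0 \<le> 1 - (norm (x - y))\<^sup>2 / ra\<^sup>2" using ra by simp
    moreover have "1 - (norm (x - y))\<^sup>2 / ra\<^sup>2 \<le> 1" by simp
    ultimately show ?thesis unfolding P_def by (simp add: power_le_one)
  qed
  have qj: "0 \<le> q^j" "q^j \<le> 1" for j using q by (auto intro: power_le_one)
  have "w n x \<le> b n x"
  proof (rule comparison[where V = "{x \<in> lat h. dist x y < ra}" and X = "{x \<in> lat h. dist x y < ra + 2 * h}" and h = h and n = n])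
    show "nbrs h x \<subseteq> {x \<in> lat h. dist x y < ra + 2 * h}" if "x \<in> {x \<in> lat h. dist x y < ra}" for x
    proof
      fix z assume z: "z \<in> nbrs h x"
      then have "dist z y < ra + 2 * h" using dist_nbrs[OF z] dist_triangle[of z y x] that h ra by auto
      then show "z \<in> {x \<in> lat h. dist x y < ra + 2 * h}" using that lat_nbrs[OF _ z] by auto
    qed
    show "{x \<in> lat h. dist x y < ra} \<subseteq> {x \<in> lat h. dist x y < ra + 2 * h}" using ra h by auto
    show "rt (w (Suc k) x) \<le> rt (w k x) + l * lap h (w k) x" if "k < n" "x \<in> {x \<in> lat h. dist x y < ra}" for k x
      using sch that by (auto simp: scheme_def)
    show "0 \<le> w k x \<and> w k x \<le> M" if "k \<le> n" "x \<in> {x \<in> lat h. dist x y < ra + 2 * h}" for k x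
      using bds that ra by auto
    show "n \<le> n" "x \<in> {x \<in> lat h. dist x y < ra + 2 * h}" using x ra h by auto
  next
    have Xb: "\<theta> + \<eta> \<le> b k x" if "\<not> dist x y < ra" "dist x y < ra + 2*h" for k x
    proof -
      define u where "u = norm (x-y) / ra"
      have u: "1 \<le> u" "u \<le> 1 + 2*h/ra" "2*h/ra \<le> 1" using that ra by (auto simp: u_def dist_norm field_simps)
      have "u\<^sup>2 - 1 = (u-1)*(u+1)" by (simp add: power2_eq_square algebra_simps)
      also have "\<dots> \<le> (2*h/ra) * 3" using u by (intro mult_mono) auto
      finally have "u\<^sup>2 - 1 \<le> 6*h/ra" by simp
      then have "(u\<^sup>2 - 1)\<^sup>2 \<le> (6*h/ra)\<^sup>2" using u by (intro power_mono) auto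
      moreover have "P x = (u\<^sup>2 - 1)\<^sup>2" by (simp add: P_def u_def power_divide power2_commute)
      ultimately have "P x \<le> 36 * h\<^sup>2/ra\<^sup>2" by (simp add: power_divide power_mult_distrib)
      then have "(\<mu>/2) * q^k * P x \<le> (\<mu>/2) * 1 * (36 * h\<^sup>2/ra\<^sup>2)"
        using \<eta>\<mu> qj[of k] P0 by (intro mult_mono) auto
      also have "\<dots> \<le> 32 * \<mu> * h\<^sup>2/ra\<^sup>2" using \<eta>\<mu> by (simp add: divide_right_mono)
      finally show ?thesis using \<eta>\<mu> unfolding b_def by linarith
    qed
    fix k x
    have X2: "dist x y < ra + 2*h \<Longrightarrow> dist x y < 2 * ra" using ra by auto
    show "w k x \<le> b k x" if "k \<le> n" "x \<in> {x \<in> lat h. dist x y < ra + 2 * h} - {x \<in> lat h. dist x y < ra}"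
      using that Xb[of x k] bds[of k x] X2 by auto
    show "w 0 x \<le> b 0 x" if "x \<in> {x \<in> lat h. dist x y < ra + 2 * h}"
    proof (cases "dist x y < ra")
      case True
      have "(\<mu>/2) * P x \<le> (\<mu>/2) * 1" using P1[OF True] \<eta>\<mu> by (intro mult_left_mono) auto
      moreover have "w 0 x \<le> \<theta> - \<mu>/2" using low that True by auto
      ultimately show ?thesis using \<eta>\<mu>(1) b00[of x] by linarith
    next
      case False
      then show ?thesis using that Xb[of x 0] bds[of 0 x] X2 by auto
    qed
  next
    fix k x assume k: "k < n" and xV: "x \<in> {x \<in> lat h. dist x y < ra}"
    have d: "dist x y < ra" using xV by auto
    define A where "A = 1 - (norm (x - y))\<^sup>2 / ra\<^sup>2"
    have PA: "P x = A\<^sup>2" by (simp add: P_def A_def)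
    have s1: "(\<mu>/2) * q^k * P x \<le> (\<mu>/2) * 1 * 1" for k using \<eta>\<mu> qj[of k] P0 P1[OF d] by (intro mult_mono) auto
    have b0: "0 \<le> b k x" "b k x \<le> M + 1" for k
    proof -
      have "(\<mu>/2) * q^k * P x \<ge> 0" using \<eta>\<mu> qj[of k] P0[of x] by simp
      then show "0 \<le> b k x" "b k x \<le> M + 1" using s1[of k] \<theta> \<eta>\<mu> unfolding b_def by linarith+
    qed
    have diff: "b (Suc k) x - b k x = (\<mu>/2) * q^k * (\<Lambda> * \<tau> * P x)" unfolding b_def q_def by (simp add: algebra_simps)
    have dp: "b (Suc k) x - b k x \<ge> 0" unfolding diff using \<eta>\<mu> qj[of k] \<Lambda>0 \<tau>0 P0[of x] by simp
    have "rt (b (Suc k) x) - rt (b k x) \<ge> 4 * N * l * (b (Suc k) x - b k x)"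
      using slope[of "b k x" "b (Suc k) x"] b0[of k] b0[of "Suc k"] dp by auto
    moreover have "l * lap h (b k) x \<le> 4 * N * l * (b (Suc k) x - b k x)"
    proof -
      have Nl: "4 * N * l > 0" using N1 l0 by simp
      have lb: "lap h (b k) x = - ((\<mu>/2) * q^k) * lap h P x"
        unfolding b_def by (simp only: lap_diff lap_const lap_cmult) simp
      define c where "c = h\<^sup>2/ra\<^sup>2"
      define X where "X = (4*N+8)*A"
      have c0: "c \<ge> 0" by (simp add: c_def)
      \<comment> \<open>Completing the square bounds \<open>X - 8\<close> by
        \<open>X\<^sup>2/32\<close>, a multiple of the bump; the 32 in \<open>\<Lambda>\<close>
        comes from here.\<close>
      have "0 \<le> (X - 16)\<^sup>2" by simp
      then have "X - 8 \<le> X\<^sup>2/32" by (simp add: power2_eq_square algebra_simps)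
      then have "c * (X - 8) \<le> c * (X\<^sup>2/32)" using c0 by (intro mult_left_mono) auto
      moreover have "lap h P x \<ge> c * (8 - X)"
        using lap_quartic[OF ra(1), of h x y] unfolding P_def A_def N_def c_def X_def .
      ultimately have "- lap h P x \<le> c * (X\<^sup>2/32)" by (simp add: algebra_simps)
      also have "\<dots> = 4 * N * (\<Lambda> * \<tau> * P x)" unfolding PA \<Lambda>(1) \<tau>_def c_def X_def using l0 N1 ra by (simp add: power_mult_distrib mult_ac)
      finally have L: "- lap h P x \<le> 4 * N * (\<Lambda> * \<tau> * P x)" .
      have "l * lap h (b k) x = l * ((\<mu>/2) * q^k) * (- lap h P x)" unfolding lb by simp
      also have "\<dots> \<le> l * ((\<mu>/2) * q^k) * (4 * N * (\<Lambda> * \<tau> * P x))"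
        using l0 \<eta>\<mu> qj[of k] by (intro mult_left_mono[OF L] mult_nonneg_nonneg) auto
      finally show ?thesis unfolding diff by (simp add: mult_ac)
    qed
    ultimately show "b k x \<le> M + 1 \<and> rt (b k x) + l * lap h (b k) x \<le> rt (b (Suc k) x) \<and> 0 \<le> b (Suc k) x"
      using b0 by (auto simp: algebra_simps)
  qed
  also have "b n x \<le> \<theta> + 2*\<eta> - (\<mu>/4) * exp (- 2 * \<Lambda> * (real n * (l * h\<^sup>2)))"
  proof -
    have "(norm (x-y))\<^sup>2 \<le> (ra/2)\<^sup>2" using x by (intro power_mono) (auto simp: dist_norm)
    then have "(norm (x-y))\<^sup>2 / ra\<^sup>2 \<le> 1/4" using ra by (simp add: power_divide field_simps)
    then have "(3/4)\<^sup>2 \<le> P x" unfolding P_def by (intro power_mono) auto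
    then have "1/2 \<le> P x" by (simp add: power2_eq_square)
    moreover have "exp (- 2 * (\<Lambda> * \<tau>) * real n) \<le> q^n" unfolding q_def
      using \<Lambda>(2) mult_nonneg_nonneg[OF less_imp_le[OF \<Lambda>0] less_imp_le[OF \<tau>0]] by (intro one_minus_power_ge) (auto simp: \<tau>_def)
    ultimately have "(\<mu>/2) * exp (- 2 * (\<Lambda> * \<tau>) * real n) * (1/2) \<le> (\<mu>/2) * q^n * P x"
      using \<eta>\<mu> qj[of n] by (intro mult_mono) auto
    moreover have e: "- 2 * (\<Lambda> * \<tau>) * real n = - 2 * \<Lambda> * (real n * (l * h\<^sup>2))" by (simp add: \<tau>_def)
    ultimately show ?thesis unfolding b_def e by linarith
  qed
  finally show ?thesis .
qed


text \<open>Interior equicontinuity, by induction on the level of the high point: once all values above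
  \<open>M - i * \<eta>\<close> near the low point are excluded, the barrier excludes the next layer.\<close>

lemma equicont:
  assumes K: "K \<ge> 0" and \<rho>: "\<rho> > 0" and \<mu>: "\<mu> > 0"
  obtains \<delta> where "\<delta> > 0" "\<And>h w y s x k. \<lbrakk>0 < h; h < \<delta>; reg K h \<rho> w y s; x \<in> lat h; dist x y < \<delta>;
    \<bar>real k - real s\<bar> * (l * h\<^sup>2) < \<delta>\<rbrakk> \<Longrightarrow> w k x < w s y + \<mu>"
proof -
  define C where "C = N * (4 * rt M + (3 + 4 * N) * M)"
  have C0: "C > 0" unfolding C_def using N1 M0 by (intro mult_pos_pos add_nonneg_pos) auto
  \<comment> \<open>\<open>p\<close> is the ratio of the radius of a ball that is surely low to the
    averaging radius \<open>R\<close>: spreading sideways costs at most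
    \<open>C * p \<le> \<mu>/4\<close>.\<close>
  define p where "p = min 1 (\<mu> / (4 * C))"
  have p: "0 < p" "p \<le> 1" "C * p \<le> \<mu>/4" using C0 \<mu> by (auto simp: p_def field_simps min_def)
  define L where "L = (4*N+8)\<^sup>2 / (32 * (4 * N * l))"
  have L0: "L > 0" unfolding L_def using N1 l0 by simp
  \<comment> \<open>\<open>E\<close> bounds from below the factor left of the dent after time
    \<open>3 * R\<^sup>2\<close>. The rate is \<open>L / (p * R)\<^sup>2\<close>, so
    \<open>R\<close> cancels; the layer height \<open>\<eta>\<close> is thus fixed before any scale,
    and finitely many layers cover all values.\<close>
  define E where "E = exp (- 6 * L / p\<^sup>2)"
  have E0: "E > 0" by (simp add: E_def)
  define \<eta> where "\<eta> = min (\<mu> * E / 16) (1/4)"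
  have \<eta>: "0 < \<eta>" "\<eta> \<le> 1/4" "2 * \<eta> < (\<mu>/4) * E" using \<mu> E0 by (auto simp: \<eta>_def min_def field_simps)
  have cl: "\<exists>\<delta>>0. \<delta> \<le> \<rho> \<and> (\<forall>h w y s x k. 0 < h \<and> h < \<delta> \<and> reg K h \<rho> w y s \<and> x \<in> lat h \<and> dist x y < \<delta> \<and>
      \<bar>real k - real s\<bar> * (l * h\<^sup>2) < \<delta> \<and> w k x > M - real i * \<eta> \<longrightarrow> w k x < w s y + \<mu>)" for i
  proof (induction i)
    case 0
    show ?case
    proof (intro exI[of _ \<rho>] conjI allI impI)
      fix h w y s x k
      assume a: "0 < h \<and> h < \<rho> \<and> reg K h \<rho> w y s \<and> x \<in> lat h \<and> dist x y < \<rho> \<and>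
        \<bar>real k - real s\<bar> * (l * h\<^sup>2) < \<rho> \<and> M - real 0 * \<eta> < w k x"
      then have "w k x \<le> M" unfolding reg_def by blast
      then show "w k x < w s y + \<mu>" using a by simp
    qed (use \<rho> in auto)
  next
    case (Suc i)
    then obtain d where d: "d > 0" "d \<le> \<rho>" and IH: "\<And>h w y s x k. \<lbrakk>0 < h; h < d; reg K h \<rho> w y s; x \<in> lat h; dist x y < d;
      \<bar>real k - real s\<bar> * (l * h\<^sup>2) < d; w k x > M - real i * \<eta>\<rbrakk> \<Longrightarrow> w k x < w s y + \<mu>" by blast
    \<comment> \<open>\<open>R \<le> d/8\<close> keeps the averaging cylinder inside the region of
      the induction hypothesis; the last entry makes the one-sided loss
      \<open>3 * K * R\<^sup>2\<close> at most \<open>3 * \<mu>/16\<close>.\<close>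
    define R where "R = min 1 (min (d/8) (\<mu> / (16 * (K+1))))"
    have mn: "min a (min b c) \<le> a" "min a (min b c) \<le> b" "min a (min b c) \<le> c" for a b c :: real by auto
    have mn6: "min a (min b (min c (min d (min e f)))) \<le> a" "min a (min b (min c (min d (min e f)))) \<le> b" "min a (min b (min c (min d (min e f)))) \<le> c" "min a (min b (min c (min d (min e f)))) \<le> d" "min a (min b (min c (min d (min e f)))) \<le> e" "min a (min b (min c (min d (min e f)))) \<le> f" for a b c d e f :: real by auto
    have cancel: "k * (a / (b * k)) = a / b" if "k > 0" for a b k :: real using that by simp
    have R: "0 < R" "R \<le> 1" "R \<le> d/8" "R \<le> \<mu> / (16 * (K+1))" subgoal using d \<mu> K by (simp add: R_def) by (simp_all only: R_def mn)
    have R2: "R\<^sup>2 \<le> R" using R by (simp add: power2_eq_square mult_left_le)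
    have R20: "R\<^sup>2 > 0" using R by simp
    have KR: "3 * K * R\<^sup>2 \<le> 3 * \<mu>/16"
    proof -
      have "K * R\<^sup>2 \<le> (K + 1) * (\<mu> / (16 * (K+1)))" using R R2 K by (intro mult_mono) auto
      then show ?thesis using cancel[of "K+1" \<mu> 16] K by linarith
    qed
    define r0 where "r0 = p * R"
    have r0: "0 < r0" "r0 \<le> R" using p R by (auto simp: r0_def mult_le_cancel_right1)
    define \<Lambda> where "\<Lambda> = L / r0\<^sup>2"
    have \<Lambda>0: "\<Lambda> > 0" using L0 r0 by (simp add: \<Lambda>_def)
    define \<delta> where "\<delta> = min 1 (min (r0/2) (min (R\<^sup>2/(4*(l+1))) (min (1/(2*\<Lambda>*(l+1))) (min (\<eta>*r0\<^sup>2/(32*\<mu>)) (R\<^sup>2/2)))))"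
    have \<delta>0: "\<delta> > 0" using r0 R20 \<Lambda>0 l0 \<eta> \<mu> by (simp add: \<delta>_def)
    have \<delta>: "\<delta> \<le> 1" "\<delta> \<le> r0/2" "\<delta> \<le> R\<^sup>2/(4*(l+1))" "\<delta> \<le> 1/(2*\<Lambda>*(l+1))" "\<delta> \<le> \<eta>*r0\<^sup>2/(32*\<mu>)" "\<delta> \<le> R\<^sup>2/2"
      unfolding \<delta>_def by (rule mn6)+
    have \<delta>d: "\<delta> < d" using \<delta>(6) R2 R by linarith
    show ?case
    proof (intro exI[of _ \<delta>] conjI allI impI)
      show "\<delta> > 0" "\<delta> \<le> \<rho>" using \<delta>0 \<delta>d d by auto
      fix h w y s x k
      assume a: "0 < h \<and> h < \<delta> \<and> reg K h \<rho> w y s \<and> x \<in> lat h \<and> dist x y < \<delta> \<and>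
        \<bar>real k - real s\<bar> * (l * h\<^sup>2) < \<delta> \<and> M - real (Suc i) * \<eta> < w k x"
      then have h: "0 < h" "h < \<delta>" and rg: "reg K h \<rho> w y s" and xl: "x \<in> lat h" and xy: "dist x y < \<delta>"
        and ks: "\<bar>real k - real s\<bar> * (l * h\<^sup>2) < \<delta>" and hi: "M - real (Suc i) * \<eta> < w k x" by auto
      define \<tau> where "\<tau> = l * h\<^sup>2"
      have \<tau>0: "\<tau> > 0" using h l0 by (simp add: \<tau>_def)
      have "h * h \<le> h * 1" using h \<delta>(1) by (intro mult_left_mono) auto
      then have hh: "h\<^sup>2 \<le> \<delta>" using h unfolding power2_eq_square by linarith
      have \<tau>l: "\<tau> \<le> (l+1) * \<delta>" unfolding \<tau>_def using hh l0 by (intro mult_mono) auto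
      have "(l+1) * \<delta> \<le> (l+1) * (R\<^sup>2/(4*(l+1)))" using \<delta> l0 by (intro mult_left_mono) auto
      then have \<tau>1: "\<tau> \<le> R\<^sup>2/4" using \<tau>l l0 cancel[of "l+1" "R\<^sup>2" 4] by linarith
      have "\<Lambda> * \<tau> \<le> \<Lambda> * ((l+1) * (1/(2*\<Lambda>*(l+1))))"
        using \<tau>l \<delta>(4) l0 \<Lambda>0 mult_left_mono[OF \<delta>(4), of "l+1"] by (intro mult_left_mono) auto
      moreover have "\<Lambda> * ((l+1) * (1/(2*\<Lambda>*(l+1)))) = 1/2" using cancel[of "l+1" 1 "2*\<Lambda>"] l0 \<Lambda>0 by simp
      ultimately have \<tau>2: "\<Lambda> * \<tau> \<le> 1/2" by linarith
      have h1: "2 * h \<le> r0" "h \<le> R/2" using h \<delta> r0 by auto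
      have h2: "32 * \<mu> * h\<^sup>2 / r0\<^sup>2 \<le> \<eta>"
      proof -
        have "32 * \<mu> * h\<^sup>2 \<le> 32 * \<mu> * (\<eta>*r0\<^sup>2/(32*\<mu>))" using hh \<delta>(5) \<mu> by (intro mult_left_mono) auto
        then show ?thesis using \<mu> r0 by (simp add: divide_le_eq)
      qed
      show "w k x < w s y + \<mu>"
      proof (rule ccontr)
        assume "\<not> w k x < w s y + \<mu>"
        then have ge: "w k x \<ge> w s y + \<mu>" by simp
        define \<theta> where "\<theta> = w k x"
        have rgd: "0 \<le> w k x \<and> w k x \<le> M \<and> scheme h w k x" if "x \<in> lat h" "dist x y < d" "\<bar>real k - real s\<bar> * \<tau> < d" for x k
          using rg that d unfolding reg_def \<tau>_def by (meson less_le_trans)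
        have yl: "y \<in> lat h" using rg by (auto simp: reg_def)
        have \<theta>M: "\<theta> \<le> M" "0 \<le> w s y" using rgd[OF xl] xy ks \<delta>d rgd[OF yl, of s] d by (auto simp: \<theta>_def \<tau>_def)
        have \<theta>i: "\<theta> \<le> M - real i * \<eta>"
          using IH[OF h(1) _ rg xl, of k] h \<delta>d xy ks ge unfolding \<theta>_def by linarith
        \<comment> \<open>A value above \<open>\<theta> + \<eta>\<close> would belong to the levels
          already treated, hence be smaller than \<open>w s y + \<mu>\<close>, which is at most
          \<open>\<theta>\<close>.\<close>
        have sup: "w k' x' \<le> \<theta> + \<eta>" if "x' \<in> lat h" "dist x' y < d" "\<bar>real k' - real s\<bar> * \<tau> < d" for x' k'
        proof (rule ccontr)
          assume "\<not> w k' x' \<le> \<theta> + \<eta>"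
          moreover have "\<theta> + \<eta> > M - real i * \<eta>" using hi by (simp add: \<theta>_def algebra_simps)
          ultimately have "w k' x' < w s y + \<mu>" using IH[OF h(1) _ rg that(1,2)] h \<delta>d that(3) by (simp add: \<tau>_def)
          then show False using \<open>\<not> w k' x' \<le> \<theta> + \<eta>\<close> ge \<eta> unfolding \<theta>_def by linarith
        qed
        define n where "n = nat \<lfloor>R\<^sup>2 / (l * h\<^sup>2)\<rfloor>"
        have lsb: "2 * n < s" "R\<^sup>2/2 \<le> real n * (l * h\<^sup>2)" "real n * (l * h\<^sup>2) \<le> R\<^sup>2"
          "z \<in> lat h \<Longrightarrow> dist z y \<le> R \<Longrightarrow> w (s - 2*n) z \<le> w s y + 3 * K * R\<^sup>2 + N * (dist z y / R) * (4 * rt M + (3 + 4 * N) * M)" for z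
          using low_spreads_back[OF rg K h(1) R(1) _ _ _ h1(2) n_def] yl R R2 d \<tau>1 R(1)
          by (auto simp: \<tau>_def)
        \<comment> \<open>The barrier starts at step \<open>j\<close>, when a whole ball is low, and
          runs to \<open>k\<close>, which may lie before or after \<open>s\<close>; in either case
          \<open>k\<close> is not before \<open>j\<close> and the elapsed time is at most
          \<open>3 * R\<^sup>2\<close>.\<close>
        define j where "j = s - 2*n"
        have low: "w j z \<le> \<theta> - \<mu>/2" if "z \<in> lat h" "dist z y < r0" for z
        proof -
          have "dist z y / R \<le> p" using that R by (simp add: r0_def divide_le_eq)
          then have "N * (dist z y / R) * (4 * rt M + (3 + 4 * N) * M) \<le> N * p * (4 * rt M + (3 + 4 * N) * M)"
            using N1 M0 by (intro mult_right_mono mult_left_mono) auto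
          also have "\<dots> = C * p" by (simp add: C_def)
          finally have "w j z \<le> w s y + 3 * \<mu>/16 + \<mu>/4" using lsb(4)[OF that(1)] that(2) r0 KR p(3) unfolding j_def by linarith
          then show ?thesis using ge \<mu> unfolding \<theta>_def by linarith
        qed
        have "(real s - real k) * \<tau> \<le> \<bar>real k - real s\<bar> * \<tau>" using \<tau>0 by (intro mult_right_mono) auto
        also have "\<dots> < R\<^sup>2/2" using ks \<delta>(6) by (simp add: \<tau>_def)
        also have "\<dots> \<le> real n * \<tau>" using lsb(2) by (simp add: \<tau>_def)
        finally have "real s - real k < real n" using \<tau>0 by simp
        then have kj: "j \<le> k" using lsb(1) unfolding j_def by linarith
        have tm: "\<bar>real q - real s\<bar> * \<tau> < d" if "j \<le> q" "q \<le> k" for q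
        proof -
          have "\<bar>real q - real s\<bar> \<le> max (real (2*n)) \<bar>real k - real s\<bar>" using that lsb(1) unfolding j_def by linarith
          then have "\<bar>real q - real s\<bar> * \<tau> \<le> max (real (2*n)) \<bar>real k - real s\<bar> * \<tau>" using \<tau>0 by (intro mult_right_mono) auto
          also have "\<dots> < d"
          proof (cases "real (2*n) \<le> \<bar>real k - real s\<bar>")
            case True then show ?thesis using ks \<delta>d by (simp add: \<tau>_def max_def)
          next
            case False
            have "real (2*n) * \<tau> \<le> 2 * R\<^sup>2" using lsb(3) by (simp add: \<tau>_def)
            then show ?thesis using False R R2 d by (simp add: max_def)
          qed
          finally show ?thesis .
        qed
        have r0d: "2 * r0 < d" using r0 R d by linarith
        have "w (j + (k - j)) x \<le> \<theta> + 2*\<eta> - (\<mu>/4) * exp (- 2 * \<Lambda> * (real (k - j) * (l * h\<^sup>2)))"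
        proof (rule barrier_decay[where w = "\<lambda>q. w (j + q)" and y = y and ra = r0])
          show "\<Lambda> = (4 * N + 8)\<^sup>2 / (32 * (4 * N * l)) / r0\<^sup>2" by (simp add: \<Lambda>_def L_def)
          show "\<Lambda> * (l * h\<^sup>2) \<le> 1/2" using \<tau>2 by (simp add: \<tau>_def)
          show "\<mu> \<le> \<theta>" using ge \<theta>M unfolding \<theta>_def by linarith
          show "scheme h (\<lambda>q. w (j + q)) q z" if "q < k - j" "z \<in> lat h" "dist z y < r0" for q z
            using rgd[of z "j+q"] that tm[of "j+q"] r0d r0 unfolding scheme_def by auto
          show "0 \<le> w (j + q) z \<and> w (j + q) z \<le> M \<and> w (j + q) z \<le> \<theta> + \<eta>" if "q \<le> k - j" "z \<in> lat h" "dist z y < 2 * r0" for q z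
          proof -
            have "dist z y < d" "\<bar>real (j+q) - real s\<bar> * \<tau> < d" using that r0d tm[of "j+q"] kj by auto
            then show ?thesis using rgd[OF that(2)] sup[OF that(2)] by blast
          qed
          show "w (j + 0) z \<le> \<theta> - \<mu>/2" if "z \<in> lat h" "dist z y < r0" for z using low that by simp
        qed (use h yl r0 h1 \<eta> \<mu> h2 \<theta>M xl xy \<delta>(2) in auto)
        then have f: "(\<mu>/4) * exp (- 2 * \<Lambda> * (real (k - j) * \<tau>)) \<le> 2 * \<eta>" using kj by (simp add: \<theta>_def \<tau>_def)
        have "real (k - j) * \<tau> = (real k - real s) * \<tau> + 2 * (real n * \<tau>)" using kj lsb(1) by (simp add: j_def of_nat_diff algebra_simps)
        also have "(real k - real s) * \<tau> \<le> R\<^sup>2"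
        proof -
          have "(real k - real s) * \<tau> \<le> \<bar>real k - real s\<bar> * \<tau>" using \<tau>0 by (intro mult_right_mono) auto
          then show ?thesis using ks \<delta>(6) R20 unfolding \<tau>_def by linarith
        qed
        also have "real n * \<tau> \<le> R\<^sup>2" using lsb(3) by (simp add: \<tau>_def)
        finally have "real (k - j) * \<tau> \<le> 3 * R\<^sup>2" by simp
        then have "2 * \<Lambda> * (real (k - j) * \<tau>) \<le> 2 * \<Lambda> * (3 * R\<^sup>2)" using \<Lambda>0 by (intro mult_left_mono) auto
        also have "\<dots> = 6 * L / p\<^sup>2" using R p by (simp add: \<Lambda>_def r0_def power_mult_distrib field_simps)
        finally have "E \<le> exp (- 2 * \<Lambda> * (real (k - j) * \<tau>))" by (simp add: E_def)
        then have "(\<mu>/4) * E \<le> (\<mu>/4) * exp (- 2 * \<Lambda> * (real (k - j) * \<tau>))" using \<mu> by (intro mult_left_mono) auto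
        then show False using f \<eta> by linarith
      qed
    qed
  qed
  \<comment> \<open>With \<open>i * \<eta> > M\<close> the level is negative, so every value counts
    as high.\<close>
  obtain i where i: "M < real i * \<eta>" using reals_Archimedean3[OF \<eta>(1)] by blast
  obtain \<delta> where \<delta>: "\<delta> > 0" "\<delta> \<le> \<rho>" and D: "\<And>h w y s x k. \<lbrakk>0 < h; h < \<delta>; reg K h \<rho> w y s; x \<in> lat h; dist x y < \<delta>;
      \<bar>real k - real s\<bar> * (l * h\<^sup>2) < \<delta>; w k x > M - real i * \<eta>\<rbrakk> \<Longrightarrow> w k x < w s y + \<mu>" using cl[of i] by blast
  show ?thesis
  proof (rule that[OF \<delta>(1)])
    fix h w y s x k
    assume a: "0 < h" "h < \<delta>" "reg K h \<rho> w y s" "x \<in> lat h" "dist x y < \<delta>" "\<bar>real k - real s\<bar> * (l * h\<^sup>2) < \<delta>"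
    then have "0 \<le> w k x" using \<delta> unfolding reg_def by (meson less_le_trans)
    then show "w k x < w s y + \<mu>" using D[OF a] i by auto
  qed
qed

end

section \<open>The discrete Dirichlet problem and boundary barriers\<close>

text \<open>Lower corner of the lattice cell of \<open>x\<close>. Composition with it turns lattice
  functions into step functions on the whole space, which can be integrated against Lebesgue
  measure.\<close>

definition rnd :: "real \<Rightarrow> real^'n::finite \<Rightarrow> real^'n" where
  "rnd h x = (\<chi> i. h * of_int \<lfloor>x $ i / h\<rfloor>)"

lemma rnd_lat [simp]: "rnd h x \<in> lat h"
  by (auto simp: rnd_def lat_def)

lemma rnd_id: "h > 0 \<Longrightarrow> x \<in> lat h \<Longrightarrow> rnd h x = x"
proof -
  assume h: "h > 0" and x: "x \<in> lat h"
  have "h * of_int \<lfloor>x $ i / h\<rfloor> = x $ i" for i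
  proof -
    obtain p :: int where "x $ i = h * of_int p" using x by (auto simp: lat_def)
    then show ?thesis using h by simp
  qed
  then show ?thesis by (simp add: rnd_def vec_eq_iff)
qed

lemma rnd_shift:
  assumes "h > 0"
  shows "rnd h (x + h *\<^sub>R axis i 1) = rnd h x + h *\<^sub>R axis i 1"
    and "rnd h (x - h *\<^sub>R axis i 1) = rnd h x - h *\<^sub>R axis i 1"
proof -
  have "\<lfloor>(a + h) / h\<rfloor> = \<lfloor>a / h\<rfloor> + 1" "\<lfloor>(a - h) / h\<rfloor> = \<lfloor>a / h\<rfloor> - 1" for a
    using assms by (simp_all add: add_divide_distrib diff_divide_distrib)
  then show "rnd h (x + h *\<^sub>R axis i 1) = rnd h x + h *\<^sub>R axis i 1"
    "rnd h (x - h *\<^sub>R axis i 1) = rnd h x - h *\<^sub>R axis i 1"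
    by (auto simp: rnd_def vec_eq_iff axis_def distrib_left right_diff_distrib)
qed

lemma dist_rnd:
  fixes x :: "real^'n::finite"
  assumes "h > 0"
  shows "dist x (rnd h x) \<le> real CARD('n) * h"
proof -
  have "\<bar>(x - rnd h x) $ i\<bar> \<le> h" for i
  proof -
    have "h * of_int \<lfloor>x $ i / h\<rfloor> \<le> x $ i" "x $ i < h * of_int \<lfloor>x $ i / h\<rfloor> + h"
      using floor_divide_lower[OF assms, of "x $ i"] floor_divide_upper[OF assms, of "x $ i"] by (simp_all add: algebra_simps)
    then show ?thesis by (simp add: rnd_def)
  qed
  then have "(\<Sum>i\<in>UNIV. \<bar>(x - rnd h x) $ i\<bar>) \<le> (\<Sum>i\<in>(UNIV::'n set). h)" by (intro sum_mono) auto
  then show ?thesis using norm_le_l1_cart[of "x - rnd h x"] by (simp add: dist_norm)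
qed

lemma lap_rnd:
  assumes "h > 0" shows "lap h (\<lambda>x. f (rnd h x)) x = lap h f (rnd h x)"
  unfolding lap_def rnd_shift[OF assms] ..

text \<open>Admissible data: bounded, Lipschitz in space and time, and semiconvex in space in a form
  that the lattice Laplacian sees at every mesh size. Semiconvexity bounds the decrease in the first
  time step.\<close>

definition good :: "real \<Rightarrow> real \<Rightarrow> ('n::finite pt \<Rightarrow> real) \<Rightarrow> bool" where
  "good M \<Lambda> \<Psi> \<longleftrightarrow> 0 < \<Lambda> \<and> (\<forall>z. 0 \<le> \<Psi> z \<and> \<Psi> z \<le> M) \<and> (\<forall>z z'. \<bar>\<Psi> z - \<Psi> z'\<bar> \<le> \<Lambda> * dist z z') \<and>
     (\<forall>h x t. 0 < h \<longrightarrow> lap h (\<lambda>x. \<Psi> (x, t)) x \<ge> - \<Lambda> * h\<^sup>2)"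

lemma good_lip:
  assumes "good M \<Lambda> \<Psi>"
  shows "\<bar>\<Psi> (x, t) - \<Psi> (x', t')\<bar> \<le> \<Lambda> * dist x x' + \<Lambda> * \<bar>t - t'\<bar>"
proof -
  have "dist (x, t) (x', t') \<le> dist x x' + \<bar>t - t'\<bar>"
    unfolding dist_Pair_Pair using sqrt_sum_squares_le_sum_abs[of "dist x x'" "dist t t'"] by (simp add: dist_real_def)
  then have "\<Lambda> * dist (x, t) (x', t') \<le> \<Lambda> * (dist x x' + \<bar>t - t'\<bar>)" using assms by (intro mult_left_mono) (auto simp: good_def)
  then show ?thesis using assms unfolding good_def by (metis distrib_left order_trans)
qed

text \<open>Exterior ball condition with one radius for all frontier points: \<open>y\<close> is the
  centre of an open ball that misses \<open>U\<close> and touches it at \<open>x0\<close>.\<close>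

definition extball :: "(real^'n::finite) set \<Rightarrow> real \<Rightarrow> bool" where
  "extball U r \<longleftrightarrow> 0 < r \<and> (\<forall>x0\<in>frontier U. \<exists>y. dist x0 y = r \<and> (\<forall>x\<in>U. r \<le> dist x y))"

text \<open>Turns the Lipschitz cone of the data into a paraboloid, whose lattice Laplacian is
  constant, at the cost of \<open>\<epsilon>/2\<close>.\<close>

lemma young: "\<epsilon> > 0 \<Longrightarrow> \<Lambda> * a \<le> \<epsilon>/2 + \<Lambda>\<^sup>2 / (2*\<epsilon>) * (a::real)\<^sup>2"
proof -
  assume e: "\<epsilon> > 0"
  have "0 \<le> (\<Lambda> * a - \<epsilon>)\<^sup>2 / (2*\<epsilon>)" using e by simp
  also have "\<dots> = \<Lambda>\<^sup>2 / (2*\<epsilon>) * a\<^sup>2 - \<Lambda> * a + \<epsilon>/2" using e by (simp add: power2_eq_square field_simps)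
  finally show ?thesis by simp
qed

section \<open>Exponentials for the exterior ball barrier\<close>

lemma cosh_quadratic: "exp s + exp (- s) \<ge> 2 + (s::real)\<^sup>2"
proof -
  have sh: "exp u - exp (-u) \<ge> 2 * u" if "u \<ge> 0" for u :: real
  proof -
    have e: "1 + u + u\<^sup>2/2 \<le> exp u" using exp_lower_Taylor_quadratic[OF that] .
    have p: "1 + u + u\<^sup>2/2 > 0" using that by (simp add: add_pos_nonneg)
    have "exp (-u) \<le> 1 / (1 + u + u\<^sup>2/2)" unfolding exp_minus inverse_eq_divide using e p by (intro divide_left_mono) auto
    also have "\<dots> \<le> 1 - u + u\<^sup>2/2"
    proof -
      have "(1 - u + u\<^sup>2/2) * (1 + u + u\<^sup>2/2) = 1 + (u\<^sup>2/2)\<^sup>2" by (simp add: power2_eq_square field_simps)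
      then have "1 \<le> (1 - u + u\<^sup>2/2) * (1 + u + u\<^sup>2/2)" by simp
      then show ?thesis using p by (simp add: divide_le_eq)
    qed
    finally show ?thesis using e by linarith
  qed
  \<comment> \<open>The square on the left is \<open>exp s + exp (-s) - 2\<close>, so the linear
    bound \<open>sh\<close> at half the argument suffices.\<close>
  have "(exp (s/2) - exp (-(s/2)))\<^sup>2 \<ge> s\<^sup>2"
  proof (cases "s \<ge> 0")
    case True
    then have "s \<le> exp (s/2) - exp (-(s/2))" using sh[of "s/2"] by simp
    then show ?thesis using True by (rule power_mono)
  next
    case False
    then have "-s \<le> exp (-(s/2)) - exp (s/2)" using sh[of "-s/2"] by simp
    then have "(-s)\<^sup>2 \<le> (exp (-(s/2)) - exp (s/2))\<^sup>2" using False by (intro power_mono) auto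
    then show ?thesis by (simp add: power2_commute)
  qed
  moreover have "(exp (s/2) - exp (-(s/2)))\<^sup>2 = exp s + exp (-s) - 2"
  proof -
    have "exp (s/2) * exp (s/2) = exp s" "exp (-(s/2)) * exp (-(s/2)) = exp (-s)" "exp (s/2) * exp (-(s/2)) = 1"
      by (simp_all flip: exp_add)
    then show ?thesis by (simp add: power2_eq_square left_diff_distrib right_diff_distrib mult.commute)
  qed
  ultimately show ?thesis by simp
qed

text \<open>In the continuum the bracket of the Laplacian is 4 \<alpha>^2 |x-y|^2 - 2 n \<alpha>,
  \<open>n\<close> the dimension. Outside radius \<open>r\<close> the choice of
  \<open>\<alpha>\<close> makes the first term at least 8 n \<alpha>; discretisation costs a quarter
  of it, which still leaves 4 n \<alpha>.\<close>

lemma lap_gauss: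
  fixes x y :: "real^'n::finite"
  assumes \<alpha>: "\<alpha> = 2 * real CARD('n) / r\<^sup>2" and r: "r > 0" and h: "\<alpha> * h\<^sup>2 \<le> 1/4" and x: "r \<le> dist x y"
  shows "lap h (\<lambda>x. exp (- \<alpha> * (norm (x - y))\<^sup>2)) x \<ge> 4 * real CARD('n) * \<alpha> * exp (- \<alpha> * (norm (x - y))\<^sup>2) * h\<^sup>2"
proof -
  let ?N = "real CARD('n)"
  define E where "E = exp (- \<alpha> * (norm (x - y))\<^sup>2)"
  have \<alpha>0: "\<alpha> > 0" using \<alpha> r by simp
  have E0: "E > 0" by (simp add: E_def)
  define a where "a = \<alpha> * h\<^sup>2"
  have a: "0 \<le> a" "a \<le> 1/4" using \<alpha>0 h by (auto simp: a_def)
  have su: "(\<Sum>i\<in>UNIV. ((x - y) $ i)\<^sup>2) = (norm (x-y))\<^sup>2"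
    unfolding norm_vec_def L2_set_def by (simp add: sum_nonneg)
  have t: "exp (- \<alpha> * ((norm (x - y))\<^sup>2 + 2 * h * s' + h\<^sup>2)) + exp (- \<alpha> * ((norm (x - y))\<^sup>2 - 2 * h * s' + h\<^sup>2)) - 2 * exp (- \<alpha> * (norm (x - y))\<^sup>2)
     \<ge> E * (- 2 * a + 3 * \<alpha> * a * s'\<^sup>2)" for s'
  proof -
    define c where "c = 2 * \<alpha> * h * s'"
    have "exp (- \<alpha> * ((norm (x - y))\<^sup>2 + 2 * h * s' + h\<^sup>2)) = E * (exp (-a) * exp (-c))"
      "exp (- \<alpha> * ((norm (x - y))\<^sup>2 - 2 * h * s' + h\<^sup>2)) = E * (exp (-a) * exp c)"
      unfolding E_def a_def c_def exp_add[symmetric] by (simp_all add: algebra_simps)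
    then have "exp (- \<alpha> * ((norm (x - y))\<^sup>2 + 2 * h * s' + h\<^sup>2)) + exp (- \<alpha> * ((norm (x - y))\<^sup>2 - 2 * h * s' + h\<^sup>2)) - 2 * exp (- \<alpha> * (norm (x - y))\<^sup>2)
      = E * (exp (-a) * (exp c + exp (-c)) - 2)" unfolding E_def[symmetric] by (simp add: algebra_simps)
    moreover have "exp (-a) * (exp c + exp (-c)) \<ge> (1 - a) * (2 + c\<^sup>2)"
      using exp_ge_add_one_self[of "-a"] cosh_quadratic[of c] a by (intro mult_mono) auto
    moreover have "(1 - a) * (2 + c\<^sup>2) - 2 \<ge> - 2 * a + 3 * \<alpha> * a * s'\<^sup>2"
    proof -
      have "c\<^sup>2 = 4 * \<alpha> * a * s'\<^sup>2" by (simp add: c_def a_def power2_eq_square)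
      moreover have "(3/4) * c\<^sup>2 \<le> (1 - a) * c\<^sup>2" using a by (intro mult_right_mono) auto
      ultimately show ?thesis by (simp add: algebra_simps)
    qed
    ultimately show ?thesis using mult_left_mono[of "- 2 * a + 3 * \<alpha> * a * s'\<^sup>2" "exp (-a) * (exp c + exp (-c)) - 2" E] E0 by simp
  qed
  have "lap h (\<lambda>x. exp (- \<alpha> * (norm (x - y))\<^sup>2)) x \<ge> (\<Sum>i\<in>UNIV. E * (- 2 * a + 3 * \<alpha> * a * ((x - y) $ i)\<^sup>2))"
    unfolding lap_def norm_axis_shift by (intro sum_mono t)
  moreover have "(\<Sum>i\<in>UNIV. E * (- 2 * a + 3 * \<alpha> * a * ((x - y) $ i)\<^sup>2)) = E * (?N * (- 2 * a) + 3 * \<alpha> * a * (norm (x-y))\<^sup>2)"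
    unfolding sum_distrib_left[symmetric] sum.distrib su by simp
  moreover have "4 * ?N * \<alpha> * E * h\<^sup>2 \<le> E * (?N * (- 2 * a) + 3 * \<alpha> * a * (norm (x-y))\<^sup>2)"
  proof -
    have "r\<^sup>2 \<le> (norm (x-y))\<^sup>2" using x r by (intro power_mono) (auto simp: dist_norm)
    then have "3 * \<alpha> * a * r\<^sup>2 \<le> 3 * \<alpha> * a * (norm (x-y))\<^sup>2" using \<alpha>0 a by (intro mult_left_mono) auto
    moreover have "\<alpha> * r\<^sup>2 = 2 * ?N" using \<alpha> r by simp
    moreover have "3 * \<alpha> * a * r\<^sup>2 = 3 * a * (\<alpha> * r\<^sup>2)" by simp
    ultimately have "4 * ?N * a \<le> ?N * (- 2 * a) + 3 * \<alpha> * a * (norm (x-y))\<^sup>2" by simp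
    then have "E * (4 * ?N * a) \<le> E * (?N * (- 2 * a) + 3 * \<alpha> * a * (norm (x-y))\<^sup>2)" using E0 by (intro mult_left_mono) auto
    then show ?thesis by (simp add: a_def mult_ac)
  qed
  ultimately show ?thesis unfolding E_def by linarith
qed

section \<open>The discrete Dirichlet solution and its one-sided bound\<close>

context pme
begin

text \<open>Defined on the whole space and constant on lattice cells. Outside \<open>U\<close> the
  data are copied at the current time, so every neighbour of a point of \<open>U\<close> has a
  value. That the argument of the maximum is nonnegative is \<open>step_bounds\<close>, whence the
  scheme holds exactly in \<open>U\<close>.\<close>

primrec dsol :: "real \<Rightarrow> (real^'n) set \<Rightarrow> real \<Rightarrow> ('n pt \<Rightarrow> real) \<Rightarrow> nat \<Rightarrow> real^'n \<Rightarrow> real" where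
  "dsol h U t0 \<Psi> 0 = (\<lambda>x. \<Psi> (rnd h x, t0))"
| "dsol h U t0 \<Psi> (Suc k) = (\<lambda>x. if rnd h x \<in> U
     then (max 0 (rt (dsol h U t0 \<Psi> k x) + l * lap h (dsol h U t0 \<Psi> k) x)) powr m
     else \<Psi> (rnd h x, t0 + real (Suc k) * (l * h\<^sup>2)))"

declare dsol.simps [simp del]

text \<open>A monotone scheme preserves the constants 0 and \<open>M\<close>: the centre term and
  the neighbour sum are compared separately with those of the constants.\<close>

lemma step_bounds:
  fixes f :: "real^'n \<Rightarrow> real"
  assumes "\<forall>x. 0 \<le> f x \<and> f x \<le> M"
  shows "0 \<le> rt (f x) + l * lap h f x" and "rt (f x) + l * lap h f x \<le> rt M"
proof -
  have e: "rt (f x) + l * lap h f x = (rt (f x) - 2 * N * l * f x) + l * nsum h f x"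
    by (simp add: lapN algebra_simps)
  have "nsum h (\<lambda>_. 0) x \<le> nsum h f x" "nsum h f x \<le> nsum h (\<lambda>_. M) x"
    using assms by (intro nsum_mono; simp)+
  then have n: "0 \<le> nsum h f x" "nsum h f x \<le> 2 * N * M" by (simp_all add: nsum_const N_def)
  have "0 \<le> rt (f x) - 2 * N * l * f x" using G_mono[of 0 "f x"] assms[rule_format, of x] by simp
  then show "0 \<le> rt (f x) + l * lap h f x" unfolding e using n l0 by simp
  have "rt (f x) - 2 * N * l * f x \<le> rt M - 2 * N * l * M" using G_mono[of "f x" M] assms[rule_format, of x] by simp
  moreover have "l * nsum h f x \<le> l * (2 * N * M)" using n l0 by (intro mult_left_mono) auto
  ultimately show "rt (f x) + l * lap h f x \<le> rt M" unfolding e by (simp add: algebra_simps)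
qed

lemma dsol_bounds:
  assumes "\<forall>z. 0 \<le> \<Psi> z \<and> \<Psi> z \<le> M"
  shows "0 \<le> dsol h U t0 \<Psi> k x \<and> dsol h U t0 \<Psi> k x \<le> M"
proof (induction k arbitrary: x)
  case (Suc k)
  let ?v = "rt (dsol h U t0 \<Psi> k x) + l * lap h (dsol h U t0 \<Psi> k) x"
  have "0 \<le> ?v" "?v \<le> rt M" using step_bounds[of "dsol h U t0 \<Psi> k" x h] Suc by auto
  then have "?v powr m \<le> (rt M) powr m" using m1 by (intro powr_mono2) auto
  also have "(rt M) powr m = M" using M0 m1 by (simp add: powr_powr)
  finally show ?case using assms \<open>0 \<le> ?v\<close> by (auto simp: dsol.simps)
qed (use assms in \<open>auto simp: dsol.simps\<close>)

lemma dsol_scheme: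
  assumes "\<forall>z. 0 \<le> \<Psi> z \<and> \<Psi> z \<le> M" and "rnd h x \<in> U"
  shows "scheme h (dsol h U t0 \<Psi>) k x"
proof -
  have "0 \<le> rt (dsol h U t0 \<Psi> k x) + l * lap h (dsol h U t0 \<Psi> k) x"
    using step_bounds(1)[of "dsol h U t0 \<Psi> k" x h] dsol_bounds[OF assms(1)] by blast
  then show ?thesis unfolding scheme_def using assms(2) m1 by (simp add: powr_powr dsol.simps)
qed

lemma dsol_outside: "rnd h x \<notin> U \<Longrightarrow> dsol h U t0 \<Psi> k x = \<Psi> (rnd h x, t0 + real k * (l * h\<^sup>2))"
  by (cases k) (auto simp: dsol.simps)

lemma dsol_rnd:
  assumes "h > 0" shows "dsol h U t0 \<Psi> k (rnd h x) = dsol h U t0 \<Psi> k x"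
proof (induction k arbitrary: x)
  case 0 then show ?case using assms by (simp add: rnd_id dsol.simps)
next
  case (Suc k)
  have "dsol h U t0 \<Psi> k = (\<lambda>x. dsol h U t0 \<Psi> k (rnd h x))" using Suc by auto
  then have "lap h (dsol h U t0 \<Psi> k) x = lap h (dsol h U t0 \<Psi> k) (rnd h x)"
    using lap_rnd[OF assms, of "dsol h U t0 \<Psi> k" x] by simp
  then show ?case using assms Suc by (simp add: rnd_id dsol.simps)
qed

lemma dsol_mono:
  assumes "h > 0" "\<forall>z. 0 \<le> \<Psi> z \<and> \<Psi> z \<le> M" "\<forall>z. 0 \<le> \<Phi> z \<and> \<Phi> z \<le> M" "\<And>z. \<Psi> z \<le> \<Phi> z"
  shows "dsol h U t0 \<Psi> k x \<le> dsol h U t0 \<Phi> k x"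
proof (rule comparison[where V = "{x. rnd h x \<in> U}" and X = UNIV and h = h and n = k])
  show "rt (dsol h U t0 \<Psi> (Suc k) x) \<le> rt (dsol h U t0 \<Psi> k x) + l * lap h (dsol h U t0 \<Psi> k) x"
    if "x \<in> {x. rnd h x \<in> U}" for k x
    using dsol_scheme[OF assms(2), where h=h] that unfolding scheme_def by auto
  show "dsol h U t0 \<Phi> k x \<le> M + 1 \<and>
     rt (dsol h U t0 \<Phi> k x) + l * lap h (dsol h U t0 \<Phi> k) x \<le> rt (dsol h U t0 \<Phi> (Suc k) x) \<and> 0 \<le> dsol h U t0 \<Phi> (Suc k) x"
    if "x \<in> {x. rnd h x \<in> U}" for k x
    using dsol_scheme[OF assms(3), where h=h] that dsol_bounds[OF assms(3), of h U t0 k x] dsol_bounds[OF assms(3), of h U t0 "Suc k" x]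
    by (auto simp: scheme_def)
qed (use assms dsol_bounds[OF assms(2)] in \<open>auto simp: dsol_outside dsol.simps(1)\<close>)

text \<open>A constant serves as barrier. Initially it comes from semiconvexity, the CFL slope
  turning a difference of roots into one of values, hence \<open>\<Lambda> / (4 * N * l)\<close>;
  off \<open>U\<close> it is the Lipschitz bound in time. Unlike the interior estimate it holds up
  to the boundary but depends on \<open>\<Lambda>\<close>.\<close>

lemma dsol_one_sided:
  assumes h: "h > 0" and g: "good M \<Lambda> \<Psi>"
  shows "dsol h U t0 \<Psi> k x - dsol h U t0 \<Psi> (Suc k) x \<le> (\<Lambda> + \<Lambda> / (4 * N * l)) * (l * h\<^sup>2)"
proof -
  define K where "K = \<Lambda> + \<Lambda> / (4 * N * l)"
  have \<Lambda>: "\<Lambda> > 0" and pb: "\<forall>z. 0 \<le> \<Psi> z \<and> \<Psi> z \<le> M" and sc: "\<And>x t. lap h (\<lambda>x. \<Psi> (x, t)) x \<ge> - \<Lambda> * h\<^sup>2"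
    using g h by (auto simp: good_def)
  have Nl: "4 * N * l > 0" using N1 l0 by simp
  have K0: "K > 0" "\<Lambda> \<le> K" "\<Lambda> / (4 * N * l) \<le> K" using \<Lambda> Nl by (auto simp: K_def intro!: add_pos_pos)
  have \<tau>: "l * h\<^sup>2 > 0" using l0 h by simp
  let ?w = "dsol h U t0 \<Psi>"
  have out: "?w k x - ?w (Suc k) x \<le> K * (l * h\<^sup>2)" if "rnd h x \<notin> U" for k x
  proof -
    have "?w k x - ?w (Suc k) x \<le> \<Lambda> * \<bar>t0 + real k * (l * h\<^sup>2) - (t0 + real (Suc k) * (l * h\<^sup>2))\<bar>"
      unfolding dsol_outside[OF that] using good_lip[OF g, of "rnd h x" "t0 + real k * (l * h\<^sup>2)" "rnd h x" "t0 + real (Suc k) * (l * h\<^sup>2)"] by simp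
    also have "\<bar>t0 + real k * (l * h\<^sup>2) - (t0 + real (Suc k) * (l * h\<^sup>2))\<bar> = l * h\<^sup>2"
      using \<tau> by (simp add: algebra_simps)
    also have "\<Lambda> * (l * h\<^sup>2) \<le> K * (l * h\<^sup>2)" using K0 \<tau> by (intro mult_right_mono) auto
    finally show ?thesis .
  qed
  show ?thesis unfolding K_def[symmetric]
  proof (rule one_sided_induct[where V = "{x. rnd h x \<in> U}" and X = UNIV and ka = 0 and kb = k and h = h and Y = "\<lambda>_ _. K * (l * h\<^sup>2)"])
    show "?w 0 x - ?w (Suc 0) x \<le> K * (l * h\<^sup>2)" for x
    proof (cases "rnd h x \<in> U \<and> ?w (Suc 0) x \<le> ?w 0 x")
      case False
      moreover have "K * (l * h\<^sup>2) \<ge> 0" using K0 \<tau> by simp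
      ultimately show ?thesis using out[of x 0] by fastforce
    next
      case True
      have "rt (?w (Suc 0) x) = rt (?w 0 x) + l * lap h (?w 0) x"
        using dsol_scheme[OF pb, of h x U t0 0] True unfolding scheme_def by auto
      moreover have "lap h (?w 0) x \<ge> - \<Lambda> * h\<^sup>2" using sc lap_rnd[OF h, of "\<lambda>x. \<Psi> (x, t0)" x] by (simp add: dsol.simps(1))
      then have "l * lap h (?w 0) x \<ge> l * (- \<Lambda> * h\<^sup>2)" using l0 by (intro mult_left_mono) auto
      ultimately have "rt (?w 0 x) - rt (?w (Suc 0) x) \<le> \<Lambda> * (l * h\<^sup>2)" by (simp add: mult_ac)
      moreover have "rt (?w 0 x) - rt (?w (Suc 0) x) \<ge> 4 * N * l * (?w 0 x - ?w (Suc 0) x)"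
        using slope[of "?w (Suc 0) x" "?w 0 x"] True dsol_bounds[OF pb, of h U t0 0 x] dsol_bounds[OF pb, of h U t0 "Suc 0" x] by auto
      ultimately have "4 * N * l * (?w 0 x - ?w (Suc 0) x) \<le> \<Lambda> * (l * h\<^sup>2)" by linarith
      then have "?w 0 x - ?w (Suc 0) x \<le> \<Lambda> * (l * h\<^sup>2) / (4 * N * l)" by (subst pos_le_divide_eq[OF Nl]) (simp only: mult.commute)
      also have "\<dots> = (\<Lambda> / (4 * N * l)) * (l * h\<^sup>2)" by simp
      also have "\<dots> \<le> K * (l * h\<^sup>2)" using K0 \<tau> by (intro mult_right_mono) auto
      finally show ?thesis .
    qed
    show "scheme h ?w k x \<and> scheme h ?w (Suc k) x" if "x \<in> {x. rnd h x \<in> U}" for k x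
      using dsol_scheme[OF pb, where h=h] that by auto
    show "0 \<le> ?w k x \<and> ?w k x \<le> M" for k x using dsol_bounds[OF pb] .
    show "?w k x - ?w (Suc k) x \<le> K * (l * h\<^sup>2)" if "x \<in> UNIV - {x. rnd h x \<in> U}" for k x using out that by auto
    fix x :: "real^'n"
    let ?Y = "K * (l * h\<^sup>2)"
    have Y: "?Y > 0" using K0 \<tau> by simp
    have "0 \<le> (1 - 1/m) * ?Y / (4 * M)" using m1 M0 Y by simp
    then have "?Y * 1 \<le> ?Y * (1 + (1 - 1/m) * ?Y / (4 * M))" using Y by (intro mult_left_mono) auto
    then have Y2: "?Y \<le> ?Y * (1 + (1 - 1/m) * ?Y / (4 * M))" by simp
    moreover have "0 \<le> 4 * N * (?Y * (1 + (1 - 1/m) * ?Y / (4 * M)) - ?Y)" using Y2 N1 by (intro mult_nonneg_nonneg) auto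
    ultimately show "0 < ?Y \<and> nsum h (\<lambda>_. ?Y) x \<le> 4 * N * ?Y \<and> ?Y \<le> ?Y * (1 + (1 - 1/m) * ?Y / (4 * M)) \<and>
        lap h (\<lambda>_. ?Y) x \<le> 4 * N * (?Y * (1 + (1 - 1/m) * ?Y / (4 * M)) - ?Y)"
      using Y N1 by (simp only: lap_const nsum_const N_def[symmetric]) simp
  qed auto
qed

lemma dsol_one_sided_sum:
  assumes h: "h > 0" and g: "good M \<Lambda> \<Psi>" and "j \<le> k"
  shows "dsol h U t0 \<Psi> j x \<le> dsol h U t0 \<Psi> k x + (\<Lambda> + \<Lambda> / (4 * N * l)) * ((real k - real j) * (l * h\<^sup>2))"
proof -
  define K where "K = \<Lambda> + \<Lambda> / (4 * N * l)"
  have "dsol h U t0 \<Psi> j x \<le> dsol h U t0 \<Psi> k x + real (k - j) * (K * (l * h\<^sup>2))"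
    using one_sided_sum[OF assms(3), of "dsol h U t0 \<Psi>" x "K * (l * h\<^sup>2)"] dsol_one_sided[OF h g] unfolding K_def by blast
  then show ?thesis unfolding K_def[symmetric] using assms(3) by (simp add: of_nat_diff mult.left_commute)
qed

end

text \<open>Packages finitely many smallness conditions on the mesh: a pair \<open>(a, b)\<close>
  stands for \<open>a * h \<le> b\<close>.\<close>

lemma small_pos:
  fixes cs :: "(real \<times> real) list"
  assumes "\<forall>p\<in>set cs. snd p > 0"
  obtains \<delta> where "\<delta> > 0" "\<delta> \<le> 1" "\<And>h. 0 < h \<Longrightarrow> h \<le> \<delta> \<Longrightarrow> \<forall>p\<in>set cs. fst p * h \<le> snd p"
proof -
  have "\<exists>\<delta>>0. \<delta> \<le> 1 \<and> (\<forall>h. 0 < h \<and> h \<le> \<delta> \<longrightarrow> (\<forall>p\<in>set cs. fst p * h \<le> snd p))"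
    using assms
  proof (induction cs)
    case Nil then show ?case by (intro exI[of _ 1]) auto
  next
    case (Cons p cs)
    then obtain d where d: "d > 0" "d \<le> 1" "\<forall>h. 0 < h \<and> h \<le> d \<longrightarrow> (\<forall>p\<in>set cs. fst p * h \<le> snd p)" by auto
    define e where "e = min d (snd p / (\<bar>fst p\<bar> + 1))"
    have e0: "e > 0" using d Cons.prems by (simp add: e_def)
    have "fst p * h \<le> snd p" if "0 < h" "h \<le> e" for h
    proof -
      have "h \<le> snd p / (\<bar>fst p\<bar> + 1)" using that by (simp add: e_def)
      then have "(\<bar>fst p\<bar> + 1) * h \<le> snd p" by (simp add: pos_le_divide_eq mult.commute)
      moreover have "fst p * h \<le> (\<bar>fst p\<bar> + 1) * h" using that by (intro mult_right_mono) auto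
      ultimately show ?thesis by linarith
    qed
    then show ?case using d e0 by (intro exI[of _ e]) (auto simp: e_def)
  qed
  then obtain \<delta> where "\<delta> > 0" "\<delta> \<le> 1" "\<forall>h. 0 < h \<and> h \<le> \<delta> \<longrightarrow> (\<forall>p\<in>set cs. fst p * h \<le> snd p)" by blast
  then show ?thesis by (intro that[of \<delta>]) auto
qed

text \<open>Vanishes on the sphere of radius \<open>r\<close> about \<open>y\<close> and is positive
  outside; for the \<open>\<alpha>\<close> of \<open>lap_gauss\<close> it is also strictly
  superharmonic there when the mesh is small.\<close>

definition gbar :: "real \<Rightarrow> real \<Rightarrow> real^'n::finite \<Rightarrow> real^'n \<Rightarrow> real" where
  "gbar \<alpha> r y x = exp (- \<alpha> * r\<^sup>2) - exp (- \<alpha> * (norm (x - y))\<^sup>2)"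

text \<open>Lattice neighbours of \<open>U\<close> may enter the exterior ball by \<open>h\<close>;
  by the second bound the barrier is then only slightly negative. The third makes it small near the
  contact point. Both use that \<open>exp (- \<alpha> * a)\<close> has slope at most
  \<open>\<alpha>\<close> in \<open>a \<ge> 0\<close>.\<close>

lemma gbar_props:
  fixes x y :: "real^'n::finite"
  assumes \<alpha>: "\<alpha> > 0" and r: "r > 0"
  shows "r \<le> dist x y \<Longrightarrow> 0 \<le> gbar \<alpha> r y x"
    and "0 \<le> h \<Longrightarrow> h \<le> r \<Longrightarrow> r - h \<le> dist x y \<Longrightarrow> - (2 * \<alpha> * r * h) \<le> gbar \<alpha> r y x"
    and "0 \<le> h \<Longrightarrow> h \<le> r \<Longrightarrow> dist x y \<le> r + h \<Longrightarrow> gbar \<alpha> r y x \<le> 3 * \<alpha> * r * h"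
proof -
  define s where "s = dist x y"
  have g: "gbar \<alpha> r y x = exp (- \<alpha> * r\<^sup>2) - exp (- \<alpha> * s\<^sup>2)" by (simp add: gbar_def s_def dist_norm)
  have s0: "s \<ge> 0" by (simp add: s_def)
  have ge: "0 \<le> gbar \<alpha> r y x" if "r \<le> s"
  proof -
    have "r\<^sup>2 \<le> s\<^sup>2" using that r by (intro power_mono) auto
    then show ?thesis unfolding g using \<alpha> by simp
  qed
  show "r \<le> dist x y \<Longrightarrow> 0 \<le> gbar \<alpha> r y x" using ge by (simp add: s_def)
  have d: "exp (- \<alpha> * a) - exp (- \<alpha> * b) \<le> \<alpha> * (b - a)" if "0 \<le> a" "a \<le> b" for a b
  proof -
    have "1 + (- (\<alpha> * (b - a))) \<le> exp (- (\<alpha> * (b - a)))" by (rule exp_ge_add_one_self)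
    then have 1: "1 - exp (- (\<alpha> * (b - a))) \<le> \<alpha> * (b - a)" by simp
    have "exp (- \<alpha> * a) - exp (- \<alpha> * b) = exp (- \<alpha> * a) * (1 - exp (- (\<alpha> * (b - a))))"
    proof -
      have "- \<alpha> * b = - \<alpha> * a + (- (\<alpha> * (b - a)))" by (simp add: algebra_simps)
      then have "exp (- \<alpha> * b) = exp (- \<alpha> * a) * exp (- (\<alpha> * (b - a)))" by (metis exp_add)
      then show ?thesis by (simp add: algebra_simps)
    qed
    also have "\<dots> \<le> 1 * (1 - exp (- (\<alpha> * (b - a))))" using that \<alpha> by (intro mult_right_mono) auto
    finally show ?thesis using 1 by simp
  qed
  show "0 \<le> h \<Longrightarrow> h \<le> r \<Longrightarrow> r - h \<le> dist x y \<Longrightarrow> - (2 * \<alpha> * r * h) \<le> gbar \<alpha> r y x"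
  proof -
    assume h: "0 \<le> h" "h \<le> r" "r - h \<le> dist x y"
    show ?thesis
    proof (cases "r \<le> s")
      case True
      have "2 * \<alpha> * r * h \<ge> 0" using \<alpha> r h by simp
      then show ?thesis using ge[OF True] by linarith
    next
      case False
      have "exp (- \<alpha> * s\<^sup>2) - exp (- \<alpha> * r\<^sup>2) \<le> \<alpha> * (r\<^sup>2 - s\<^sup>2)" using False s0 by (intro d power_mono) auto
      also have "r\<^sup>2 - s\<^sup>2 = (r - s) * (r + s)" by (simp add: power2_eq_square algebra_simps)
      also have "\<alpha> * ((r - s) * (r + s)) \<le> \<alpha> * (h * (2 * r))"
        using False s0 \<alpha> h r by (intro mult_left_mono mult_mono) (auto simp: s_def)
      also have "\<dots> = 2 * \<alpha> * r * h" by simp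
      finally show ?thesis unfolding g by linarith
    qed
  qed
  show "0 \<le> h \<Longrightarrow> h \<le> r \<Longrightarrow> dist x y \<le> r + h \<Longrightarrow> gbar \<alpha> r y x \<le> 3 * \<alpha> * r * h"
  proof -
    assume h: "0 \<le> h" "h \<le> r" "dist x y \<le> r + h"
    have nn: "3 * \<alpha> * r * h \<ge> 0" using \<alpha> r h by simp
    show ?thesis
    proof (cases "r \<le> s")
      case True
      have "gbar \<alpha> r y x \<le> \<alpha> * (s\<^sup>2 - r\<^sup>2)" unfolding g using True r by (intro d power_mono) auto
      also have "s\<^sup>2 - r\<^sup>2 = (s - r) * (s + r)" by (simp add: power2_eq_square algebra_simps)
      also have "\<alpha> * ((s - r) * (s + r)) \<le> \<alpha> * (h * (3 * r))"
        using True \<alpha> h r by (intro mult_left_mono mult_mono) (auto simp: s_def)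
      also have "\<dots> = 3 * \<alpha> * r * h" by simp
      finally show ?thesis .
    next
      case False
      have "s\<^sup>2 \<le> r\<^sup>2" using False s0 by (intro power_mono) auto
      then have "gbar \<alpha> r y x \<le> 0" unfolding g using \<alpha> by simp
      then show ?thesis using nn by linarith
    qed
  qed
qed

lemma lap_gbar:
  fixes x y :: "real^'n::finite"
  assumes \<alpha>: "\<alpha> = 2 * real CARD('n) / r\<^sup>2" and r: "r > 0" and h: "\<alpha> * h\<^sup>2 \<le> 1/4" and x: "r \<le> dist x y" "dist x y \<le> D"
  shows "lap h (gbar \<alpha> r y) x \<le> - (4 * real CARD('n) * \<alpha> * exp (- \<alpha> * D\<^sup>2)) * h\<^sup>2"
proof -
  have \<alpha>0: "\<alpha> > 0" using \<alpha> r by simp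
  have "lap h (gbar \<alpha> r y) x = - lap h (\<lambda>x. exp (- \<alpha> * (norm (x - y))\<^sup>2)) x"
    unfolding gbar_def lap_diff lap_const by simp
  also have "\<dots> \<le> - (4 * real CARD('n) * \<alpha> * exp (- \<alpha> * (norm (x - y))\<^sup>2) * h\<^sup>2)"
    using lap_gauss[OF \<alpha> r h x(1)] by simp
  also have "\<dots> \<le> - (4 * real CARD('n) * \<alpha> * exp (- \<alpha> * D\<^sup>2) * h\<^sup>2)"
  proof -
    have "(norm (x-y))\<^sup>2 \<le> D\<^sup>2" using x by (intro power_mono) (auto simp: dist_norm)
    then have "exp (- \<alpha> * D\<^sup>2) \<le> exp (- \<alpha> * (norm (x-y))\<^sup>2)" using \<alpha>0 by simp
    then have "4 * real CARD('n) * \<alpha> * exp (- \<alpha> * D\<^sup>2) * h\<^sup>2 \<le> 4 * real CARD('n) * \<alpha> * exp (- \<alpha> * (norm (x - y))\<^sup>2) * h\<^sup>2"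
      using \<alpha>0 by (intro mult_right_mono mult_left_mono) auto
    then show ?thesis by simp
  qed
  finally show ?thesis by simp
qed

section \<open>Barriers at the initial time and at the lateral boundary\<close>

context pme
begin

text \<open>A paraboloid that rises linearly in time. Diffusion raises the root by
  \<open>2 * N * C\<close> per unit of time, while rising with speed \<open>K\<close> raises it by
  at least \<open>4 * N * l * K\<close>; this yields the summand \<open>C / (2*l)\<close> of the
  speed.\<close>

lemma dsol_initial_upper:
  assumes h: "h > 0" and g: "good M \<Lambda> \<Psi>" and \<epsilon>: "\<epsilon> > 0" and x: "x \<in> lat h"
  shows "dsol h U t0 \<Psi> k x \<le> \<Psi> (x, t0) + \<epsilon> + (\<Lambda> + (\<Lambda>\<^sup>2 / (2*\<epsilon>)) / (2*l)) * (real k * (l * h\<^sup>2))"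
proof -
  define C where "C = \<Lambda>\<^sup>2 / (2*\<epsilon>)"
  define K where "K = \<Lambda> + C / (2*l)"
  define \<tau> where "\<tau> = l * h\<^sup>2"
  have \<tau>0: "\<tau> > 0" using h l0 by (simp add: \<tau>_def)
  have \<Lambda>: "\<Lambda> > 0" and pb: "\<forall>z. 0 \<le> \<Psi> z \<and> \<Psi> z \<le> M" using g by (auto simp: good_def)
  have C0: "C \<ge> 0" using \<epsilon> by (simp add: C_def)
  have K0: "K > 0" "\<Lambda> \<le> K" "C / (2*l) \<le> K" using \<Lambda> C0 l0 by (auto simp: K_def intro!: add_pos_nonneg)
  define b where "b = (\<lambda>k z. \<Psi> (x, t0) + \<epsilon> + K * (real k * \<tau>) + C * (norm (z - x))\<^sup>2)"
  have bd: "\<Psi> (z, t0 + real k * \<tau>) \<le> b k z" for k z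
  proof -
    have "\<Psi> (z, t0 + real k * \<tau>) \<le> \<Psi> (x, t0) + \<Lambda> * dist z x + \<Lambda> * (real k * \<tau>)"
      using good_lip[OF g, of z "t0 + real k * \<tau>" x t0] \<tau>0 by simp
    moreover have "\<Lambda> * dist z x \<le> \<epsilon>/2 + C * (norm (z - x))\<^sup>2" using young[OF \<epsilon>, of \<Lambda> "dist z x"] by (simp add: C_def dist_norm)
    moreover have "\<Lambda> * (real k * \<tau>) \<le> K * (real k * \<tau>)" using K0 \<tau>0 by (intro mult_right_mono) auto
    ultimately show ?thesis using \<epsilon> unfolding b_def by linarith
  qed
  have bdiff: "b (Suc k) z - b k z = K * \<tau>" for k z by (simp add: b_def algebra_simps)
  have b0: "0 \<le> b k z" for k z using bd[of z k] pb by (meson order_trans)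
  have "dsol h U t0 \<Psi> k x \<le> b k x"
  proof (rule comparison[where V = "lat h \<inter> U" and X = "lat h" and h = h and n = k])
    show "nbrs h z \<subseteq> lat h" if "z \<in> lat h \<inter> U" for z using lat_nbrs that by blast
    show "rt (dsol h U t0 \<Psi> (Suc k) z) \<le> rt (dsol h U t0 \<Psi> k z) + l * lap h (dsol h U t0 \<Psi> k) z" if "z \<in> lat h \<inter> U" for k z
      using dsol_scheme[OF pb, of h z U t0 k] that rnd_id[OF h, of z] by (auto simp: scheme_def)
    show "0 \<le> dsol h U t0 \<Psi> k z \<and> dsol h U t0 \<Psi> k z \<le> M" for k z using dsol_bounds[OF pb] .
    show "dsol h U t0 \<Psi> 0 z \<le> b 0 z" if "z \<in> lat h" for z
      using bd[of z 0] rnd_id[OF h that] by (simp add: dsol.simps(1))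
    show "dsol h U t0 \<Psi> k z \<le> b k z" if "z \<in> lat h - lat h \<inter> U" for k z
      using bd[of z k] rnd_id[OF h, of z] that dsol_outside[of h z U t0 \<Psi> k] by (simp add: \<tau>_def)
    fix k z assume M: "b (Suc k) z < M"
    have le: "b k z \<le> b (Suc k) z" using bdiff[of k z] K0 \<tau>0 by (smt (verit) mult_pos_pos)
    have "rt (b (Suc k) z) - rt (b k z) \<ge> 4 * N * l * (K * \<tau>)"
      using slope[of "b k z" "b (Suc k) z"] b0[of k z] le M bdiff[of k z] by simp
    moreover have "4 * N * l * (K * \<tau>) \<ge> 4 * N * l * (C / (2*l) * \<tau>)" using K0 \<tau>0 N1 l0 by (intro mult_left_mono mult_right_mono) auto
    moreover have "4 * N * l * (C / (2*l) * \<tau>) = 2 * N * C * \<tau>" using l0 by simp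
    moreover have "l * lap h (b k) z = 2 * N * C * \<tau>"
      unfolding b_def by (simp only: lap_add lap_const lap_cmult lap_norm_sq N_def) (simp add: \<tau>_def)
    ultimately show "b k z \<le> M + 1 \<and> rt (b k z) + l * lap h (b k) z \<le> rt (b (Suc k) z) \<and> 0 \<le> b (Suc k) z"
      using le M b0[of "Suc k" z] by (intro conjI; linarith)
  qed (use x in auto)
  then show ?thesis by (simp add: b_def K_def C_def \<tau>_def)
qed

text \<open>The barrier is a paraboloid in space and time about the contact point and the final
  step, plus a multiple of \<open>gbar\<close>. Before step \<open>k\<close> it falls in time, which
  is costly where the root is steep; it is therefore kept above \<open>\<epsilon>\<close>, where the
  slope is at most \<open>dd\<close>, and \<open>gbar\<close> pays for the fall.\<close>

lemma lateral_upper: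
  assumes g: "good M \<Lambda> \<Psi>" and r: "r > 0" and T1: "T1 > 0" and \<epsilon>: "\<epsilon> > 0" and U: "\<forall>x\<in>U. norm x \<le> D"
  obtains \<delta> where "\<delta> > 0" "\<And>h x0 y x k. \<lbrakk>0 < h; h < \<delta>; dist x0 y = r; norm x0 \<le> D; \<forall>x\<in>U. r \<le> dist x y;
     x \<in> lat h; x \<in> U; dist x x0 < \<delta>; real k * (l * h\<^sup>2) \<le> T1\<rbrakk> \<Longrightarrow> dsol h U t0 \<Psi> k x \<le> \<Psi> (x0, t0 + real k * (l * h\<^sup>2)) + 4 * \<epsilon>"
proof -
  define C where "C = \<Lambda>\<^sup>2 / (2*\<epsilon>)"
  define \<alpha> where "\<alpha> = 2 * real CARD('n) / r\<^sup>2"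
  define c0 where "c0 = 4 * N * \<alpha> * exp (- \<alpha> * (2*D+r)\<^sup>2)"
  define dd where "dd = (1/m) * \<epsilon> powr (1/m - 1)"
  \<comment> \<open>Chosen so that \<open>K * c0\<close> equals the Laplacian
    \<open>2 * N * C\<close> of the paraboloid plus the largest rate of fall of the root,
    \<open>2 * C * T1 * dd\<close>.\<close>
  define K where "K = (2 * N * C + 2 * C * T1 * dd) / c0"
  have \<Lambda>: "\<Lambda> > 0" and pb: "\<forall>z. 0 \<le> \<Psi> z \<and> \<Psi> z \<le> M" using g by (auto simp: good_def)
  have \<alpha>0: "\<alpha> > 0" using r by (simp add: \<alpha>_def)
  have c00: "c0 > 0" using \<alpha>0 N1 by (simp add: c0_def)
  have C0: "C > 0" using \<epsilon> \<Lambda> by (simp add: C_def)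
  have dd0: "dd \<ge> 0" using m1 by (simp add: dd_def)
  have K0: "K \<ge> 0" unfolding K_def using C0 c00 T1 dd0 N1 by (intro divide_nonneg_pos add_nonneg_nonneg mult_nonneg_nonneg) auto
  obtain \<delta> where \<delta>: "\<delta> > 0" "\<delta> \<le> 1" and sm0: "\<And>h. 0 < h \<Longrightarrow> h \<le> \<delta> \<Longrightarrow> \<forall>p\<in>set [(\<alpha>, 1/4), (2*\<alpha>*r*K, \<epsilon>), (1, r), (2*C*T1*l, 1), (C, \<epsilon>), (3*\<alpha>*r*K, \<epsilon>)]. fst p * h \<le> snd p"
    by (rule small_pos[of "[(\<alpha>, 1/4), (2*\<alpha>*r*K, \<epsilon>), (1, r), (2*C*T1*l, 1), (C, \<epsilon>), (3*\<alpha>*r*K, \<epsilon>)]"]) (use \<epsilon> r in auto)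
  have sm: "\<alpha> * h \<le> 1/4 \<and> 2*\<alpha>*r*K * h \<le> \<epsilon> \<and> 1 * h \<le> r \<and> 2*C*T1*l * h \<le> 1 \<and> C * h \<le> \<epsilon> \<and> 3*\<alpha>*r*K * h \<le> \<epsilon>" if "0 < h" "h \<le> \<delta>" for h
    using sm0[OF that] by simp
  show ?thesis
  proof (rule that[OF \<delta>(1)])
    fix h x0 y x k
    assume h: "0 < h" "h < \<delta>" and y: "dist x0 y = r" and x0: "norm x0 \<le> D" and Uy: "\<forall>x\<in>U. r \<le> dist x y"
      and x: "x \<in> lat h" "x \<in> U" "dist x x0 < \<delta>" and k: "real k * (l * h\<^sup>2) \<le> T1"
    define \<tau> where "\<tau> = l * h\<^sup>2"
    have \<tau>0: "\<tau> > 0" using h l0 by (simp add: \<tau>_def)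
    have hh: "h\<^sup>2 \<le> h" using h \<delta> by (simp add: power2_eq_square mult_left_le)
    have "\<alpha> * h \<le> 1/4" "2*C*T1*l*h \<le> 1" using sm[of h] h by auto
    moreover have "\<alpha> * h\<^sup>2 \<le> \<alpha> * h" "2*C*T1*l*h\<^sup>2 \<le> 2*C*T1*l*h" using hh \<alpha>0 C0 T1 l0 by (intro mult_left_mono; simp)+
    ultimately have h1: "\<alpha> * h\<^sup>2 \<le> 1/4" and h2: "2*C*T1*\<tau> \<le> 1" by (auto simp: \<tau>_def mult_ac)
    have h3: "2*\<alpha>*r*K*h \<le> \<epsilon>" "h \<le> r" using sm[of h] h by auto
    define P0 where "P0 = \<Psi> (x0, t0 + real k * \<tau>)"
    define A where "A = gbar \<alpha> r y"
    \<comment> \<open>One \<open>\<epsilon>\<close> covers the two uses of \<open>young\<close>, the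
      other the negative part of \<open>gbar\<close>; together they also keep \<open>b\<close> above
      \<open>\<epsilon>\<close>.\<close>
    define b where "b = (\<lambda>j z. P0 + 2 * \<epsilon> + C * ((real j - real k) * \<tau>)\<^sup>2 + C * (norm (z - x0))\<^sup>2 + K * A z)"
    define X where "X = {z \<in> lat h. r - h \<le> dist z y}"
    have KA: "K * A z \<ge> - \<epsilon>" if "r - h \<le> dist z y" for z
    proof -
      have "K * A z \<ge> K * (- (2 * \<alpha> * r * h))"
        unfolding A_def using gbar_props(2)[OF \<alpha>0 r, of h z y] h h3 that K0 by (intro mult_left_mono) auto
      then show ?thesis using h3 by (simp add: mult_ac)
    qed
    have bd: "\<Psi> (z, t0 + real j * \<tau>) \<le> b j z" if "r - h \<le> dist z y" for j z
    proof -
      have "\<Psi> (z, t0 + real j * \<tau>) \<le> P0 + \<Lambda> * dist z x0 + \<Lambda> * \<bar>(real j - real k) * \<tau>\<bar>"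
        using good_lip[OF g, of z "t0 + real j * \<tau>" x0 "t0 + real k * \<tau>"] by (simp add: P0_def left_diff_distrib)
      moreover have "\<Lambda> * dist z x0 \<le> \<epsilon>/2 + C * (norm (z - x0))\<^sup>2" using young[OF \<epsilon>, of \<Lambda> "dist z x0"] by (simp add: C_def dist_norm)
      moreover have "\<Lambda> * \<bar>(real j - real k) * \<tau>\<bar> \<le> \<epsilon>/2 + C * ((real j - real k) * \<tau>)\<^sup>2" using young[OF \<epsilon>, of \<Lambda> "\<bar>(real j - real k) * \<tau>\<bar>"] by (simp add: C_def)
      ultimately show ?thesis using KA[OF that] unfolding b_def by linarith
    qed
    have P00: "P0 \<ge> 0" using pb by (simp add: P0_def)
    have b\<epsilon>: "\<epsilon> \<le> b j z" if "r - h \<le> dist z y" for j z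
    proof -
      have "0 \<le> C * ((real j - real k) * \<tau>)\<^sup>2" "0 \<le> C * (norm (z - x0))\<^sup>2" using C0 by auto
      then show ?thesis using KA[OF that] P00 unfolding b_def by linarith
    qed
    have "dsol h U t0 \<Psi> k x \<le> b k x"
    proof (rule comparison[where V = "lat h \<inter> U" and X = X and h = h and n = k])
      show "nbrs h z \<subseteq> X" if "z \<in> lat h \<inter> U" for z
      proof
        fix z' assume z': "z' \<in> nbrs h z"
        have "r \<le> dist z y" using Uy that by auto
        then have "r - h \<le> dist z' y" using dist_nbrs[OF z'] dist_triangle[of z y z'] h by (simp add: dist_commute)
        then show "z' \<in> X" using lat_nbrs[OF _ z'] that by (auto simp: X_def)
      qed
      show "lat h \<inter> U \<subseteq> X" using Uy h by (force simp: X_def)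
      show "x \<in> X" using x Uy h by (force simp: X_def)
      show "k \<le> k" by simp
      show "rt (dsol h U t0 \<Psi> (Suc k) z) \<le> rt (dsol h U t0 \<Psi> k z) + l * lap h (dsol h U t0 \<Psi> k) z" if "z \<in> lat h \<inter> U" for k z
        using dsol_scheme[OF pb, of h z U t0 k] that rnd_id[OF h(1), of z] by (auto simp: scheme_def)
      show "0 \<le> dsol h U t0 \<Psi> k z \<and> dsol h U t0 \<Psi> k z \<le> M" for k z using dsol_bounds[OF pb] .
      show "dsol h U t0 \<Psi> 0 z \<le> b 0 z" if "z \<in> X" for z
        using bd[of z 0] rnd_id[OF h(1), of z] that by (simp add: dsol.simps(1) X_def)
      show "dsol h U t0 \<Psi> j z \<le> b j z" if "z \<in> X - lat h \<inter> U" for j z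
        using bd[of z j] rnd_id[OF h(1), of z] that dsol_outside[of h z U t0 \<Psi> j] by (simp add: \<tau>_def X_def)
      fix j z assume j: "j < k" and z: "z \<in> lat h \<inter> U" and Mb: "b (Suc j) z < M"
      have zr: "r \<le> dist z y" "r - h \<le> dist z y" using Uy z h by force+
      have zD: "dist z y \<le> 2*D + r"
        using U z x0 y dist_triangle[of z y x0] norm_triangle_ineq4[of z x0] by (force simp: dist_norm)
      define c where "c = 2 * C * T1 * \<tau>"
      have c0': "c \<ge> 0" using C0 T1 \<tau>0 by (simp add: c_def)
      have diff: "b j z - b (Suc j) z \<le> c"
      proof -
        have "b j z - b (Suc j) z = C * \<tau> * ((2 * (real k - real j) - 1) * \<tau>)"
          unfolding b_def by (simp add: power2_eq_square algebra_simps)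
        also have "\<dots> \<le> C * \<tau> * (2 * T1)"
        proof (intro mult_left_mono)
          have "(2 * (real k - real j) - 1) * \<tau> \<le> (2 * real k) * \<tau>" using \<tau>0 by (intro mult_right_mono) auto
          then show "(2 * (real k - real j) - 1) * \<tau> \<le> 2 * T1" using k by (simp add: \<tau>_def)
        qed (use C0 \<tau>0 in auto)
        finally show ?thesis by (simp add: c_def mult_ac)
      qed
      have b1: "b j z \<le> M + 1" using diff h2 Mb by (simp add: c_def)
      have "rt (b j z) - rt (b (Suc j) z) \<le> c * dd"
      proof (cases "b (Suc j) z \<le> b j z")
        case True
        have e1: "\<epsilon> \<le> b (Suc j) z" using b\<epsilon>[OF zr(2)] .
        have "rt (b j z) - rt (b (Suc j) z) \<le> (b j z - b (Suc j) z) * ((1/m) * b (Suc j) z powr (1/m - 1))"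
          using root_slope_le[OF m1 _ True] e1 \<epsilon> by auto
        also have "\<dots> \<le> c * dd" unfolding dd_def
          using powr_neg_mono[OF \<epsilon> e1 m1] diff m1 True by (intro mult_mono) auto
        finally show ?thesis .
      next
        case False
        then have "rt (b j z) \<le> rt (b (Suc j) z)" using b\<epsilon>[OF zr(2), of j] \<epsilon> by (intro root_mono[OF m1]) auto
        moreover have "c * dd \<ge> 0" using c0' dd0 by simp
        ultimately show ?thesis by linarith
      qed
      moreover have "l * lap h (b j) z \<le> - (c * dd)"
      proof -
        have "lap h (b j) z = C * (2 * N * h\<^sup>2) + K * lap h A z"
          unfolding b_def by (simp add: lap_add lap_const lap_cmult lap_norm_sq N_def)
        also have "\<dots> \<le> C * (2 * N * h\<^sup>2) + K * (- c0 * h\<^sup>2)"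
          using lap_gbar[OF \<alpha>_def r h1 zr(1) zD] K0 unfolding A_def c0_def N_def by (intro add_left_mono mult_left_mono) auto
        also have "\<dots> = (2 * N * C - K * c0) * h\<^sup>2" by (simp add: algebra_simps)
        also have "K * c0 = 2 * N * C + 2 * C * T1 * dd" using c00 by (simp add: K_def)
        finally have "lap h (b j) z \<le> - (2 * C * T1 * dd) * h\<^sup>2" by simp
        then have "l * lap h (b j) z \<le> l * (- (2 * C * T1 * dd) * h\<^sup>2)" using l0 by (intro mult_left_mono) auto
        then show ?thesis by (simp add: c_def \<tau>_def mult_ac)
      qed
      ultimately show "b j z \<le> M + 1 \<and> rt (b j z) + l * lap h (b j) z \<le> rt (b (Suc j) z) \<and> 0 \<le> b (Suc j) z"
        using b1 b\<epsilon>[OF zr(2), of "Suc j"] \<epsilon> by auto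
    qed
    also have "b k x \<le> P0 + 4 * \<epsilon>"
    proof -
      define e where "e = dist x x0"
      have e: "0 \<le> e" "e \<le> \<delta>" using x by (auto simp: e_def)
      have eC: "C * \<delta> \<le> \<epsilon>" "3*\<alpha>*r*K*\<delta> \<le> \<epsilon>" "\<delta> \<le> r" using sm[of \<delta>] \<delta> by auto
      have "C * e\<^sup>2 \<le> C * \<delta>"
      proof -
        have "e * e \<le> \<delta> * 1" using e \<delta> by (intro mult_mono) auto
        then show ?thesis using C0 by (simp add: power2_eq_square)
      qed
      moreover have "K * A x \<le> K * (3 * \<alpha> * r * \<delta>)"
        unfolding A_def using gbar_props(3)[OF \<alpha>0 r, of \<delta> x y] dist_triangle[of x y x0] y e \<delta> eC K0
        by (intro mult_left_mono) (auto simp: e_def)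
      ultimately show ?thesis using eC unfolding b_def e_def by (simp add: dist_norm mult_ac)
    qed
    finally show "dsol h U t0 \<Psi> k x \<le> \<Psi> (x0, t0 + real k * (l * h\<^sup>2)) + 4 * \<epsilon>" by (simp add: P0_def \<tau>_def)
  qed
qed

text \<open>A lower barrier for \<open>w\<close> itself would have to follow the degenerate equation
  near zero. Instead the average over the last time \<open>\<sigma>\<close> is bounded below: its
  Laplacian is at most \<open>(2 * rt M / \<sigma>) * h\<^sup>2\<close>, which \<open>gbar\<close>
  outweighs. The one-sided bound then passes from the average to the last value at the cost of a
  multiple of \<open>\<sigma>\<close>.\<close>

lemma lateral_lower:
  assumes g: "good M \<Lambda> \<Psi>" and r: "r > 0" and \<sigma>: "\<sigma> > 0" and \<epsilon>: "\<epsilon> > 0" and U: "\<forall>x\<in>U. norm x \<le> D"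
  obtains \<delta> where "\<delta> > 0" "\<And>h x0 y x k. \<lbrakk>0 < h; h < \<delta>; dist x0 y = r; norm x0 \<le> D; \<forall>x\<in>U. r \<le> dist x y;
     x \<in> lat h; x \<in> U; dist x x0 < \<delta>; \<sigma> \<le> real k * (l * h\<^sup>2)\<rbrakk> \<Longrightarrow>
     dsol h U t0 \<Psi> k x \<ge> \<Psi> (x0, t0 + real k * (l * h\<^sup>2)) - 4 * \<epsilon> - (2 * \<Lambda> + \<Lambda> / (4 * N * l)) * \<sigma>"
proof -
  define C where "C = \<Lambda>\<^sup>2 / (2*\<epsilon>)"
  define \<alpha> where "\<alpha> = 2 * real CARD('n) / r\<^sup>2"
  define c0 where "c0 = 4 * N * \<alpha> * exp (- \<alpha> * (2*D+r)\<^sup>2)"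
  \<comment> \<open>The summand 1 leaves a Laplacian of at least \<open>h\<^sup>2\<close> for
    \<open>G\<close>, the strictness that \<open>discrete_max_principle\<close> asks for.\<close>
  define K where "K = (2 * N * C + 2 * rt M / \<sigma> + 1) / c0"
  define K1 where "K1 = \<Lambda> + \<Lambda> / (4 * N * l)"
  have \<Lambda>: "\<Lambda> > 0" and pb: "\<forall>z. 0 \<le> \<Psi> z \<and> \<Psi> z \<le> M" using g by (auto simp: good_def)
  have K10: "K1 > 0" unfolding K1_def using \<Lambda> N1 l0 by (intro add_pos_nonneg) auto
  have \<alpha>0: "\<alpha> > 0" using r by (simp add: \<alpha>_def)
  have c00: "c0 > 0" using \<alpha>0 N1 by (simp add: c0_def)
  have C0: "C > 0" using \<epsilon> \<Lambda> by (simp add: C_def)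
  have K0: "K > 0" unfolding K_def using C0 c00 N1 \<sigma> by (intro divide_pos_pos add_nonneg_pos add_nonneg_nonneg mult_nonneg_nonneg) auto
  obtain \<delta> where \<delta>: "\<delta> > 0" "\<delta> \<le> 1" and sm0: "\<And>h. 0 < h \<Longrightarrow> h \<le> \<delta> \<Longrightarrow> \<forall>p\<in>set [(\<alpha>, 1/4), (2*\<alpha>*r*K, \<epsilon>), (1, r), (l, \<sigma>/4), (C, \<epsilon>), (3*\<alpha>*r*K, \<epsilon>)]. fst p * h \<le> snd p"
    by (rule small_pos[of "[(\<alpha>, 1/4), (2*\<alpha>*r*K, \<epsilon>), (1, r), (l, \<sigma>/4), (C, \<epsilon>), (3*\<alpha>*r*K, \<epsilon>)]"]) (use \<epsilon> r \<sigma> in auto)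
  have sm: "\<alpha> * h \<le> 1/4 \<and> 2*\<alpha>*r*K * h \<le> \<epsilon> \<and> 1 * h \<le> r \<and> l * h \<le> \<sigma>/4 \<and> C * h \<le> \<epsilon> \<and> 3*\<alpha>*r*K * h \<le> \<epsilon>" if "0 < h" "h \<le> \<delta>" for h
    using sm0[OF that] by simp
  show ?thesis
  proof (rule that[OF \<delta>(1)])
    fix h x0 y x k
    assume h: "0 < h" "h < \<delta>" and y: "dist x0 y = r" and x0: "norm x0 \<le> D" and Uy: "\<forall>x\<in>U. r \<le> dist x y"
      and x: "x \<in> lat h" "x \<in> U" "dist x x0 < \<delta>" and k: "\<sigma> \<le> real k * (l * h\<^sup>2)"
    define \<tau> where "\<tau> = l * h\<^sup>2"
    have \<tau>0: "\<tau> > 0" using h l0 by (simp add: \<tau>_def)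
    have hh: "h\<^sup>2 \<le> h" using h \<delta> by (simp add: power2_eq_square mult_left_le)
    have "\<alpha> * h \<le> 1/4" "l*h \<le> \<sigma>/4" using sm[of h] h by auto
    moreover have "\<alpha> * h\<^sup>2 \<le> \<alpha> * h" "l*h\<^sup>2 \<le> l*h" using hh \<alpha>0 l0 by (intro mult_left_mono; simp)+
    ultimately have h1: "\<alpha> * h\<^sup>2 \<le> 1/4" and h2: "\<tau> \<le> \<sigma>/4" by (auto simp: \<tau>_def)
    have h3: "2*\<alpha>*r*K*h \<le> \<epsilon>" "h \<le> r" using sm[of h] h by auto
    define n where "n = nat \<lfloor>\<sigma> / \<tau>\<rfloor>"
    have q1: "\<sigma> / \<tau> \<ge> 4" using h2 \<tau>0 by (simp add: field_simps)
    have nr: "real n \<le> \<sigma>/\<tau>" "real n \<ge> \<sigma>/\<tau> - 1" unfolding n_def using q1 by linarith+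
    have "real n * \<tau> \<le> \<sigma>/\<tau> * \<tau>" "(\<sigma>/\<tau> - 1) * \<tau> \<le> real n * \<tau>" using nr \<tau>0 by (intro mult_right_mono; simp)+
    then have n1: "real n * \<tau> \<le> \<sigma>" "\<sigma>/2 \<le> real n * \<tau>" using \<tau>0 h2 by (auto simp: left_diff_distrib)
    have n0: "real n \<ge> 3" using nr q1 by linarith
    have "real n * \<tau> \<le> real k * \<tau>" using n1 k by (simp add: \<tau>_def)
    then have nk: "n \<le> k" using \<tau>0 by simp
    define w where "w = dsol h U t0 \<Psi>"
    define f where "f = (\<lambda>z. (1 / real n) * (\<Sum>j\<in>{k-n..<k}. w j z))"
    have card: "card {k-n..<k} = n" "k - (k - n) = n" using nk by auto
    have wb: "0 \<le> w j z" "w j z \<le> M" for j z using dsol_bounds[OF pb] by (auto simp: w_def)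
    have f0: "f z \<ge> 0" for z unfolding f_def using wb by (simp add: sum_nonneg)
    define P0 where "P0 = \<Psi> (x0, t0 + real k * \<tau>)"
    have P0M: "P0 \<le> M" using pb by (simp add: P0_def)
    define A where "A = gbar \<alpha> r y"
    define B where "B = P0 - \<Lambda> * \<sigma> - 2 * \<epsilon>"
    define G where "G = (\<lambda>z. B - C * (norm (z - x0))\<^sup>2 - K * A z - f z)"
    have Gx: "G x \<le> 0"
    proof (rule discrete_max_principle[where D = "lat h \<inter> U" and h = h and \<kappa> = "h\<^sup>2"])
      show "x \<in> lat h \<inter> U" using x by auto
      show "h\<^sup>2 > 0" using h by simp
      show "bdd_above (G ` (lat h \<inter> U))"
      proof (rule bdd_aboveI2)
        fix z assume z: "z \<in> lat h \<inter> U"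
        have "K * A z \<ge> 0" unfolding A_def using gbar_props(1)[OF \<alpha>0 r, of z y] Uy z K0 by simp
        moreover have "C * (norm (z - x0))\<^sup>2 \<ge> 0" using C0 by simp
        ultimately show "G z \<le> B" using f0[of z] by (simp add: G_def)
      qed
      fix z assume z: "z \<in> lat h \<inter> U"
      have zr: "r \<le> dist z y" using Uy z by auto
      have zD: "dist z y \<le> 2*D + r"
        using U z x0 y dist_triangle[of z y x0] norm_triangle_ineq4[of z x0] by (force simp: dist_norm)
      have lf: "lap h f z \<le> (2 * rt M / \<sigma>) * h\<^sup>2"
      proof -
        have "rt (w k z) - rt (w (k-n) z) = l * lap h (\<lambda>x. \<Sum>j\<in>{k-n..<k}. w j x) z"
          using dsol_scheme[OF pb, of h z U t0] z rnd_id[OF h(1), of z] unfolding w_def by (intro scheme_sum) auto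
        then have "l * (real n * lap h f z) = rt (w k z) - rt (w (k-n) z)"
          using n0 by (simp only: f_def lap_cmult) simp
        also have "\<dots> \<le> rt M" using root_mono[OF m1 wb(1)[of k z] wb(2)[of k z]] powr_ge_zero[of "w (k-n) z" "1/m"] by linarith
        finally have "h\<^sup>2 * (l * (real n * lap h f z)) \<le> h\<^sup>2 * rt M" by (intro mult_left_mono) auto
        then have m1: "(real n * \<tau>) * lap h f z \<le> rt M * h\<^sup>2" by (simp add: \<tau>_def mult_ac)
        show ?thesis
        proof (cases "lap h f z \<ge> 0")
          case True
          have "(\<sigma>/2) * lap h f z \<le> (real n * \<tau>) * lap h f z" using n1 True by (intro mult_right_mono) auto
          then have "(\<sigma>/2) * lap h f z \<le> rt M * h\<^sup>2" using m1 by linarith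
          then show ?thesis using \<sigma> by (simp add: field_simps)
        next
          case False
          have "(2 * rt M / \<sigma>) * h\<^sup>2 \<ge> 0" using \<sigma> by simp
          then show ?thesis using False by linarith
        qed
      qed
      have "lap h G z = - (C * (2 * N * h\<^sup>2)) - K * lap h A z - lap h f z"
        unfolding G_def by (simp add: lap_diff lap_const lap_cmult lap_norm_sq N_def)
      moreover have "K * lap h A z \<le> K * (- c0 * h\<^sup>2)"
        using lap_gbar[OF \<alpha>_def r h1 zr zD] K0 unfolding A_def c0_def N_def by (intro mult_left_mono) auto
      moreover have "K * c0 = 2 * N * C + 2 * rt M / \<sigma> + 1" using c00 by (simp add: K_def)
      then have "K * (- c0 * h\<^sup>2) = - (2 * N * C + 2 * rt M / \<sigma> + 1) * h\<^sup>2" by (metis (no_types, lifting) mult.assoc mult_minus_left mult_minus_right)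
      moreover have "- (2 * N * C + 2 * rt M / \<sigma> + 1) * h\<^sup>2 = - (C * (2 * N * h\<^sup>2)) - (2 * rt M / \<sigma>) * h\<^sup>2 - h\<^sup>2"
        by (simp add: algebra_simps)
      ultimately show "h\<^sup>2 \<le> lap h G z" using lf by linarith
      fix z' assume z': "z' \<in> nbrs h z"
      show "z' \<in> lat h \<inter> U \<or> G z' \<le> 0"
      proof (cases "z' \<in> U")
        case True then show ?thesis using lat_nbrs[OF _ z'] z by auto
      next
        case False
        have zl: "z' \<in> lat h" using lat_nbrs[OF _ z'] z by auto
        have zr': "r - h \<le> dist z' y" using zr dist_nbrs[OF z'] dist_triangle[of z y z'] h by (simp add: dist_commute)
        have KA: "K * A z' \<ge> - \<epsilon>"
        proof -
          have "K * A z' \<ge> K * (- (2 * \<alpha> * r * h))"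
            unfolding A_def using gbar_props(2)[OF \<alpha>0 r, of h z' y] h h3 zr' K0 by (intro mult_left_mono) auto
          then show ?thesis using h3 by (simp add: mult_ac)
        qed
        have wj: "w j z' \<ge> P0 - \<Lambda> * dist z' x0 - \<Lambda> * \<sigma>" if "j \<in> {k-n..<k}" for j
        proof -
          have "w j z' = \<Psi> (z', t0 + real j * \<tau>)" unfolding w_def \<tau>_def
            using dsol_outside[of h z' U t0 \<Psi> j] rnd_id[OF h(1) zl] False by simp
          also have "\<dots> \<ge> P0 - \<Lambda> * dist z' x0 - \<Lambda> * \<bar>(real j - real k) * \<tau>\<bar>"
            using good_lip[OF g, of z' "t0 + real j * \<tau>" x0 "t0 + real k * \<tau>"] by (simp add: P0_def left_diff_distrib)
          moreover have "\<bar>(real j - real k) * \<tau>\<bar> \<le> \<sigma>"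
          proof -
            have "\<bar>(real j - real k) * \<tau>\<bar> = \<bar>real j - real k\<bar> * \<tau>" using \<tau>0 by (simp add: abs_mult)
            also have "\<dots> \<le> real n * \<tau>" using that nk \<tau>0 by (intro mult_right_mono) auto
            finally show ?thesis using n1 by linarith
          qed
          then have "\<Lambda> * \<bar>(real j - real k) * \<tau>\<bar> \<le> \<Lambda> * \<sigma>" using \<Lambda> by simp
          ultimately show ?thesis by linarith
        qed
        have "(\<Sum>j\<in>{k-n..<k}. P0 - \<Lambda> * dist z' x0 - \<Lambda> * \<sigma>) \<le> (\<Sum>j\<in>{k-n..<k}. w j z')" using wj by (rule sum_mono)
        then have "real n * (P0 - \<Lambda> * dist z' x0 - \<Lambda> * \<sigma>) \<le> real n * f z'" unfolding f_def using n0 card by simp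
        then have "P0 - \<Lambda> * dist z' x0 - \<Lambda> * \<sigma> \<le> f z'" using n0 by (simp add: mult_le_cancel_left)
        moreover have "\<Lambda> * dist z' x0 \<le> \<epsilon>/2 + C * (norm (z' - x0))\<^sup>2" using young[OF \<epsilon>, of \<Lambda> "dist z' x0"] by (simp add: C_def dist_norm)
        ultimately show ?thesis using KA \<epsilon> unfolding G_def B_def by auto
      qed
    qed
    have fx: "f x \<ge> P0 - \<Lambda> * \<sigma> - 4 * \<epsilon>"
    proof -
      define e where "e = dist x x0"
      have e: "0 \<le> e" "e \<le> \<delta>" using x by (auto simp: e_def)
      have eC: "C * \<delta> \<le> \<epsilon>" "3*\<alpha>*r*K*\<delta> \<le> \<epsilon>" "\<delta> \<le> r" using sm[of \<delta>] \<delta> by auto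
      have "C * e\<^sup>2 \<le> C * \<delta>"
      proof -
        have "e * e \<le> \<delta> * 1" using e \<delta> by (intro mult_mono) auto
        then show ?thesis using C0 by (simp add: power2_eq_square)
      qed
      moreover have "K * A x \<le> K * (3 * \<alpha> * r * \<delta>)"
        unfolding A_def using gbar_props(3)[OF \<alpha>0 r, of \<delta> x y] dist_triangle[of x y x0] y e \<delta> eC K0
        by (intro mult_left_mono) (auto simp: e_def)
      moreover have "K * (3 * \<alpha> * r * \<delta>) \<le> \<epsilon>" using eC by (simp add: mult_ac)
      ultimately show ?thesis using eC Gx unfolding G_def B_def e_def by (simp add: dist_norm)
    qed
    have "f x \<le> w k x + K1 * \<sigma>"
    proof -
      have "w j x \<le> w k x + K1 * \<sigma>" if "j \<in> {k-n..<k}" for j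
      proof -
        have "w j x \<le> w k x + K1 * ((real k - real j) * \<tau>)"
          using dsol_one_sided_sum[OF h(1) g, of j k U t0 x] that by (simp add: w_def K1_def \<tau>_def)
        moreover have "(real k - real j) * \<tau> \<le> real n * \<tau>" using that nk \<tau>0 by (intro mult_right_mono) auto
        then have "K1 * ((real k - real j) * \<tau>) \<le> K1 * \<sigma>" using n1 K10 by (intro mult_left_mono) auto
        ultimately show ?thesis by linarith
      qed
      then have "(\<Sum>j\<in>{k-n..<k}. w j x) \<le> (\<Sum>j\<in>{k-n..<k}. w k x + K1 * \<sigma>)" by (rule sum_mono)
      then have "real n * f x \<le> real n * (w k x + K1 * \<sigma>)" unfolding f_def using n0 card by simp
      then show ?thesis using n0 by (simp add: mult_le_cancel_left)
    qed
    moreover have "(2 * \<Lambda> + \<Lambda> / (4 * N * l)) * \<sigma> = \<Lambda> * \<sigma> + K1 * \<sigma>" by (simp add: K1_def distrib_right)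
    ultimately show "dsol h U t0 \<Psi> k x \<ge> \<Psi> (x0, t0 + real k * (l * h\<^sup>2)) - 4 * \<epsilon> - (2 * \<Lambda> + \<Lambda> / (4 * N * l)) * \<sigma>"
      using fx unfolding w_def P0_def \<tau>_def by linarith
  qed
qed

end

section \<open>Passage to the limit\<close>

lemma segment_meets_frontier:
  fixes x z :: "'a::euclidean_space"
  assumes "z \<in> closure U" "x \<notin> U"
  obtains x0 where "x0 \<in> frontier U" "dist x x0 \<le> dist x z"
proof (cases "x \<in> closure U")
  case True
  then have "x \<in> frontier U" using assms interior_subset by (auto simp: frontier_def)
  then show ?thesis using that[of x] by simp
next
  case False
  have "closed_segment x z \<inter> frontier (closure U) \<noteq> {}"
  proof (rule connected_Int_frontier)
    show "closed_segment x z \<inter> closure U \<noteq> {}" using assms(1) by auto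
    show "closed_segment x z - closure U \<noteq> {}" using False by auto
  qed simp
  then obtain x0 where x0: "x0 \<in> closed_segment x z" "x0 \<in> frontier (closure U)" by auto
  have "x0 \<in> frontier U" using x0(2) interior_mono[OF closure_subset, of U] by (auto simp: frontier_def)
  moreover have "dist x x0 \<le> dist x z" using x0(1) by (metis dist_commute segment_bound(1) dist_norm)
  ultimately show ?thesis using that by blast
qed

section \<open>Attainment of the data and convergent subsequences\<close>

context pme
begin

text \<open>Joins the barriers. Close to the initial time the initial barrier and the one-sided
  bound are used. Near the lateral boundary the lower barrier works from time
  \<open>\<sigma>\<close> on, and before that the one-sided bound, starting from the data at
  \<open>t0\<close>, takes over.\<close>

lemma boundary_close:
  assumes g: "good M \<Lambda> \<Psi>" and ext: "extball U r" and T1: "T1 > 0" and \<mu>: "\<mu> > 0" and U: "\<forall>x\<in>U. norm x \<le> D"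
  obtains \<delta> where "\<delta> > 0" "\<And>h x k. \<lbrakk>0 < h; h < \<delta>; x \<in> lat h; real k * (l * h\<^sup>2) \<le> T1;
     real k * (l * h\<^sup>2) < \<delta> \<or> (\<exists>x0\<in>frontier U. dist x x0 < \<delta>)\<rbrakk> \<Longrightarrow>
     \<bar>dsol h U t0 \<Psi> k x - \<Psi> (x, t0 + real k * (l * h\<^sup>2))\<bar> \<le> \<mu>"
proof -
  define \<epsilon> where "\<epsilon> = \<mu>/16"
  have \<epsilon>: "\<epsilon> > 0" using \<mu> by (simp add: \<epsilon>_def)
  define K1 where "K1 = \<Lambda> + \<Lambda> / (4 * N * l)"
  define B where "B = \<Lambda> + (\<Lambda>\<^sup>2 / (2*\<epsilon>)) / (2*l)"
  have \<Lambda>: "\<Lambda> > 0" and pb: "\<forall>z. 0 \<le> \<Psi> z \<and> \<Psi> z \<le> M" using g by (auto simp: good_def)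
  have K10: "K1 > 0" unfolding K1_def using \<Lambda> N1 l0 by (intro add_pos_nonneg) auto
  have B0: "B > 0" unfolding B_def using \<Lambda> \<epsilon> l0 by (intro add_pos_nonneg) auto
  have cancel: "k * (\<mu> / (4 * k)) = \<mu>/4" if "k > 0" for k :: real using that by simp
  \<comment> \<open>Makes the time loss
    \<open>(2 * \<Lambda> + \<Lambda> / (4 * N * l)) * \<sigma>\<close> of
    \<open>lateral_lower\<close> equal to \<open>\<mu>/4\<close>.\<close>
  define \<sigma> where "\<sigma> = \<mu> / (4 * (K1 + \<Lambda>))"
  have \<sigma>: "\<sigma> > 0" "(K1 + \<Lambda>) * \<sigma> = \<mu>/4"
    unfolding \<sigma>_def using cancel[of "K1 + \<Lambda>"] \<mu> K10 \<Lambda> by (simp, linarith)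
  have r: "r > 0" using ext by (simp add: extball_def)
  obtain d1 where d1: "d1 > 0" "\<And>h x0 y x k. \<lbrakk>0 < h; h < d1; dist x0 y = r; norm x0 \<le> D; \<forall>x\<in>U. r \<le> dist x y;
     x \<in> lat h; x \<in> U; dist x x0 < d1; real k * (l * h\<^sup>2) \<le> T1\<rbrakk> \<Longrightarrow> dsol h U t0 \<Psi> k x \<le> \<Psi> (x0, t0 + real k * (l * h\<^sup>2)) + 4 * \<epsilon>"
    using lateral_upper[OF g r T1 \<epsilon> U] by metis
  obtain d2 where d2: "d2 > 0" "\<And>h x0 y x k. \<lbrakk>0 < h; h < d2; dist x0 y = r; norm x0 \<le> D; \<forall>x\<in>U. r \<le> dist x y;
     x \<in> lat h; x \<in> U; dist x x0 < d2; \<sigma> \<le> real k * (l * h\<^sup>2)\<rbrakk> \<Longrightarrow>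
     dsol h U t0 \<Psi> k x \<ge> \<Psi> (x0, t0 + real k * (l * h\<^sup>2)) - 4 * \<epsilon> - (2 * \<Lambda> + \<Lambda> / (4 * N * l)) * \<sigma>"
    using lateral_lower[OF g r \<sigma>(1) \<epsilon> U] by metis
  define \<delta> where "\<delta> = min (min d1 d2) (\<mu> / (4 * (B + \<Lambda> + K1)))"
  have \<delta>: "\<delta> > 0" "\<delta> \<le> d1" "\<delta> \<le> d2" "(B + \<Lambda> + K1) * \<delta> \<le> \<mu>/4"
  proof -
    have "B + \<Lambda> + K1 > 0" using B0 \<Lambda> K10 by simp
    then have "(B + \<Lambda> + K1) * \<delta> \<le> (B + \<Lambda> + K1) * (\<mu> / (4 * (B + \<Lambda> + K1)))" by (intro mult_left_mono) (auto simp: \<delta>_def)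
    also have "\<dots> = \<mu>/4" using \<open>B + \<Lambda> + K1 > 0\<close> by (rule cancel)
    finally show "(B + \<Lambda> + K1) * \<delta> \<le> \<mu>/4" .
    show "\<delta> > 0" using d1(1) d2(1) \<mu> \<open>B + \<Lambda> + K1 > 0\<close> by (simp add: \<delta>_def)
  qed (auto simp: \<delta>_def)
  have "B * \<delta> \<ge> 0" "\<Lambda> * \<delta> \<ge> 0" "K1 * \<delta> \<ge> 0" using B0 \<Lambda> K10 \<delta> by auto
  then have \<delta>s: "B * \<delta> + \<Lambda> * \<delta> \<le> \<mu>/4" "K1 * \<delta> + \<Lambda> * \<delta> \<le> \<mu>/4" "\<Lambda> * \<delta> \<le> \<mu>/4" using \<delta>(4) by (auto simp: distrib_right)
  show ?thesis
  proof (rule that[OF \<delta>(1)])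
    fix h x k
    assume h: "0 < h" "h < \<delta>" and x: "x \<in> lat h" and k: "real k * (l * h\<^sup>2) \<le> T1"
      and c: "real k * (l * h\<^sup>2) < \<delta> \<or> (\<exists>x0\<in>frontier U. dist x x0 < \<delta>)"
    define t where "t = real k * (l * h\<^sup>2)"
    have t0: "t \<ge> 0" using l0 by (simp add: t_def)
    let ?w = "dsol h U t0 \<Psi> k x"
    have init: "\<Psi> (x, t0) - K1 * t \<le> ?w" "?w \<le> \<Psi> (x, t0) + \<epsilon> + B * t" "\<bar>\<Psi> (x, t0) - \<Psi> (x, t0 + t)\<bar> \<le> \<Lambda> * t"
    proof -
      have "dsol h U t0 \<Psi> 0 x = \<Psi> (x, t0)" using rnd_id[OF h(1) x] by (simp add: dsol.simps(1))
      then show "\<Psi> (x, t0) - K1 * t \<le> ?w" using dsol_one_sided_sum[OF h(1) g, of 0 k U t0 x] by (simp add: K1_def t_def)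
      show "?w \<le> \<Psi> (x, t0) + \<epsilon> + B * t" using dsol_initial_upper[OF h(1) g \<epsilon> x] by (simp add: B_def t_def)
      show "\<bar>\<Psi> (x, t0) - \<Psi> (x, t0 + t)\<bar> \<le> \<Lambda> * t" using good_lip[OF g, of x t0 x "t0 + t"] t0 by simp
    qed
    show "\<bar>?w - \<Psi> (x, t0 + real k * (l * h\<^sup>2))\<bar> \<le> \<mu>" unfolding t_def[symmetric]
    proof (cases "x \<in> U")
      case False
      then have "?w = \<Psi> (x, t0 + t)" using dsol_outside[of h x U t0 \<Psi> k] rnd_id[OF h(1) x] by (simp add: t_def)
      then show "\<bar>?w - \<Psi> (x, t0 + t)\<bar> \<le> \<mu>" using \<mu> by simp
    next
      case True
      show "\<bar>?w - \<Psi> (x, t0 + t)\<bar> \<le> \<mu>"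
      proof (cases "t < \<delta>")
        case True
        have "B * t \<le> B * \<delta>" "\<Lambda> * t \<le> \<Lambda> * \<delta>" "K1 * t \<le> K1 * \<delta>" using True B0 \<Lambda> K10 by (auto intro!: mult_left_mono)
        then show ?thesis using init \<delta>s \<mu> unfolding \<epsilon>_def by linarith
      next
        case False
        then obtain x0 where x0: "x0 \<in> frontier U" "dist x x0 < \<delta>" using c by (auto simp: t_def)
        then obtain y where y: "dist x0 y = r" "\<forall>x\<in>U. r \<le> dist x y" using ext by (auto simp: extball_def)
        have "closure U \<subseteq> cball 0 D" using U by (intro closure_minimal) auto
        then have nx0: "norm x0 \<le> D" using x0(1) by (auto simp: frontier_def)
        have lx: "\<bar>\<Psi> (x0, t0 + t) - \<Psi> (x, t0 + t)\<bar> \<le> \<mu>/4"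
        proof -
          have "\<bar>\<Psi> (x0, t0 + t) - \<Psi> (x, t0 + t)\<bar> \<le> \<Lambda> * dist x x0" using good_lip[OF g, of x0 "t0+t" x "t0+t"] by (simp add: dist_commute)
          moreover have "\<Lambda> * dist x x0 \<le> \<Lambda> * \<delta>" using x0 \<Lambda> by simp
          ultimately show ?thesis using \<delta>s by linarith
        qed
        have up: "?w \<le> \<Psi> (x0, t0 + t) + 4 * \<epsilon>"
          using d1(2)[OF h(1) _ y(1) nx0 y(2) x \<open>x \<in> U\<close> _ k] h x0 \<delta> by (simp add: t_def)
        have "?w \<ge> \<Psi> (x, t0 + t) - 3 * \<mu>/4"
        proof (cases "\<sigma> \<le> t")
          case True
          have "?w \<ge> \<Psi> (x0, t0 + t) - 4 * \<epsilon> - (2 * \<Lambda> + \<Lambda> / (4 * N * l)) * \<sigma>"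
            using d2(2)[OF h(1) _ y(1) nx0 y(2) x \<open>x \<in> U\<close>, of k] h x0 \<delta> True by (simp add: t_def)
          moreover have "(2 * \<Lambda> + \<Lambda> / (4 * N * l)) * \<sigma> = \<mu>/4" unfolding \<sigma>(2)[symmetric] K1_def by simp
          ultimately show ?thesis using lx unfolding \<epsilon>_def by linarith
        next
          case False
          have "K1 * t \<le> K1 * \<sigma>" "\<Lambda> * t \<le> \<Lambda> * \<sigma>" using False K10 \<Lambda> by auto
          then show ?thesis using init \<sigma>(2) \<mu> by (simp add: distrib_right)
        qed
        then show ?thesis using up lx \<mu> unfolding \<epsilon>_def by linarith
      qed
    qed
  qed
qed

text \<open>A step function in time as well as in space; \<open>nat\<close> sends times before
  \<open>t0\<close> to the initial level.\<close>

definition wfun :: "(real^'n) set \<Rightarrow> real \<Rightarrow> ('n pt \<Rightarrow> real) \<Rightarrow> real \<Rightarrow> 'n pt \<Rightarrow> real" where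
  "wfun U t0 \<Psi> h z = dsol h U t0 \<Psi> (nat \<lfloor>(snd z - t0) / (l * h\<^sup>2)\<rfloor>) (fst z)"

lemma step_time:
  assumes "h > 0" "t0 \<le> t"
  shows "real (nat \<lfloor>(t - t0) / (l * h\<^sup>2)\<rfloor>) * (l * h\<^sup>2) \<le> t - t0"
    and "t - t0 < real (nat \<lfloor>(t - t0) / (l * h\<^sup>2)\<rfloor>) * (l * h\<^sup>2) + l * h\<^sup>2"
proof -
  have \<tau>: "l * h\<^sup>2 > 0" using assms l0 by simp
  have "(t - t0) / (l * h\<^sup>2) \<ge> 0" using assms \<tau> by simp
  then have e: "real (nat \<lfloor>(t - t0) / (l * h\<^sup>2)\<rfloor>) = of_int \<lfloor>(t - t0) / (l * h\<^sup>2)\<rfloor>" by simp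
  show "real (nat \<lfloor>(t - t0) / (l * h\<^sup>2)\<rfloor>) * (l * h\<^sup>2) \<le> t - t0"
    unfolding e by (rule floor_divide_lower[OF \<tau>])
  show "t - t0 < real (nat \<lfloor>(t - t0) / (l * h\<^sup>2)\<rfloor>) * (l * h\<^sup>2) + l * h\<^sup>2"
    unfolding e using floor_divide_upper[OF \<tau>, of "t - t0"] by (simp add: distrib_right)
qed

text \<open>Step functions are not continuous, so the modulus holds for each tolerance once the mesh
  is small, with \<open>\<delta>\<close> independent of the mesh. Near the parabolic boundary both
  values are close to the data; elsewhere \<open>equicont\<close> applies with the global one-sided
  bound.\<close>

lemma asymptotic_equicont:
  assumes g: "good M \<Lambda> \<Psi>" and ext: "extball U r" and T: "T > 0" and \<mu>: "\<mu> > 0" and U: "\<forall>x\<in>U. norm x \<le> D"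
  obtains \<delta> where "\<delta> > 0" "\<And>h z z'. \<lbrakk>0 < h; h < \<delta>; z \<in> closure U \<times> {t0..t0+T}; z' \<in> closure U \<times> {t0..t0+T}; dist z z' < \<delta>\<rbrakk>
     \<Longrightarrow> \<bar>wfun U t0 \<Psi> h z - wfun U t0 \<Psi> h z'\<bar> \<le> \<mu>"
    "\<And>h z. \<lbrakk>0 < h; h < \<delta>; z \<in> pbdry U t0 (t0+T)\<rbrakk> \<Longrightarrow> \<bar>wfun U t0 \<Psi> h z - \<Psi> z\<bar> \<le> \<mu>"
proof -
  have \<Lambda>: "\<Lambda> > 0" and pb: "\<forall>z. 0 \<le> \<Psi> z \<and> \<Psi> z \<le> M" using g by (auto simp: good_def)
  define K where "K = \<Lambda> + \<Lambda> / (4 * N * l)"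
  have K0: "K \<ge> 0" unfolding K_def using \<Lambda> N1 l0 by (intro add_nonneg_nonneg) auto
  have T1: "T + 1 > 0" using T by simp
  have \<mu>4: "\<mu>/4 > 0" using \<mu> by simp
  obtain db where db: "db > 0" and BC: "\<And>h x k. \<lbrakk>0 < h; h < db; x \<in> lat h; real k * (l * h\<^sup>2) \<le> T+1;
     real k * (l * h\<^sup>2) < db \<or> (\<exists>x0\<in>frontier U. dist x x0 < db)\<rbrakk> \<Longrightarrow>
     \<bar>dsol h U t0 \<Psi> k x - \<Psi> (x, t0 + real k * (l * h\<^sup>2))\<bar> \<le> \<mu>/4"
    using boundary_close[OF g ext T1 \<mu>4 U] by metis
  \<comment> \<open>Half of \<open>db\<close>: if one point is within \<open>\<rho>\<close> of the
    parabolic boundary, the other, less than \<open>db/2\<close> away, is still within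
    \<open>db\<close>.\<close>
  define \<rho> where "\<rho> = db/2"
  have \<rho>: "\<rho> > 0" using db by (simp add: \<rho>_def)
  obtain de where de: "de > 0" and EQ: "\<And>h w y s x k. \<lbrakk>0 < h; h < de; reg K h \<rho> w y s; x \<in> lat h; dist x y < de;
    \<bar>real k - real s\<bar> * (l * h\<^sup>2) < de\<rbrakk> \<Longrightarrow> w k x < w s y + \<mu>" using equicont[OF K0 \<rho> \<mu>] by metis
  define d where "d = min (min (db/2) de) (\<mu> / (4*\<Lambda>))"
  have d: "d > 0" "d \<le> db/2" "d \<le> de" "\<Lambda> * d \<le> \<mu>/4"
  proof -
    show "d > 0" "d \<le> db/2" "d \<le> de" unfolding d_def using db de \<mu> \<Lambda> min.cobounded1 min.cobounded2 by (simp, meson min.bounded_iff order_refl, meson min.bounded_iff order_refl)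
    have "\<Lambda> * d \<le> \<Lambda> * (\<mu> / (4*\<Lambda>))" unfolding d_def using \<Lambda> by (intro mult_left_mono) auto
    then show "\<Lambda> * d \<le> \<mu>/4" using \<Lambda> by simp
  qed
  obtain \<eta> where \<eta>: "\<eta> > 0" "\<eta> \<le> 1" and sm0: "\<And>h. 0 < h \<Longrightarrow> h \<le> \<eta> \<Longrightarrow> \<forall>p\<in>set [(2*N, d/4), (l, d/4), (1, d/4), (2*l, 1)]. fst p * h \<le> snd p"
    by (rule small_pos[of "[(2*N, d/4), (l, d/4), (1, d/4), (2*l, 1)]"]) (use d in auto)
  have sm: "2*N*h \<le> d/4" "l * h\<^sup>2 \<le> d/4" "h \<le> d/4" "l * h\<^sup>2 \<le> 1" if "0 < h" "h \<le> \<eta>" for h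
  proof -
    have hh: "h\<^sup>2 \<le> h" using that \<eta> by (simp add: power2_eq_square mult_left_le)
    have "l * h\<^sup>2 \<le> l * h" using hh l0 by simp
    moreover have "2*N*h \<le> d/4" "l*h \<le> d/4" "h \<le> d/4" "2*l*h \<le> 1" using sm0[OF that] by auto
    moreover have "l * h \<ge> 0" using that l0 by simp
    ultimately show "2*N*h \<le> d/4" "l * h\<^sup>2 \<le> d/4" "h \<le> d/4" "l * h\<^sup>2 \<le> 1" by auto
  qed
  have one: "wfun U t0 \<Psi> h z \<le> wfun U t0 \<Psi> h z' + \<mu>"
    if h: "0 < h" "h < \<eta>" and z: "z \<in> closure U \<times> {t0..t0+T}" "z' \<in> closure U \<times> {t0..t0+T}" "dist z z' < d/4" for h z z'
  proof -
    define \<tau> where "\<tau> = l * h\<^sup>2"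
    have \<tau>0: "\<tau> > 0" using h l0 by (simp add: \<tau>_def)
    define x where "x = rnd h (fst z)"
    define y where "y = rnd h (fst z')"
    define k where "k = nat \<lfloor>(snd z - t0) / (l * h\<^sup>2)\<rfloor>"
    define s where "s = nat \<lfloor>(snd z' - t0) / (l * h\<^sup>2)\<rfloor>"
    define w where "w = dsol h U t0 \<Psi>"
    have we: "wfun U t0 \<Psi> h z = w k x" "wfun U t0 \<Psi> h z' = w s y"
      unfolding wfun_def x_def y_def k_def s_def w_def by (simp_all add: dsol_rnd[OF h(1)])
    have xl: "x \<in> lat h" "y \<in> lat h" by (auto simp: x_def y_def)
    have sh: "2*N*h \<le> d/4" "\<tau> \<le> d/4" "h \<le> d/4" "\<tau> \<le> 1" using sm[of h] h by (auto simp: \<tau>_def)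
    have dx: "dist (fst z) x \<le> N * h" "dist (fst z') y \<le> N * h" using dist_rnd[OF h(1)] by (auto simp: x_def y_def N_def)
    have dz: "dist (fst z) (fst z') < d/4" "dist (snd z) (snd z') < d/4"
      using dist_fst_le[of z z'] dist_snd_le[of z z'] z(3) by linarith+
    have xy: "dist x y < d/2"
    proof -
      have "dist x y \<le> dist x (fst z) + dist (fst z) (fst z') + dist (fst z') y"
        using dist_triangle[of x y "fst z"] dist_triangle[of "fst z" y "fst z'"] by linarith
      then show ?thesis using dx dz sh by (simp add: dist_commute)
    qed
    have tz: "t0 \<le> snd z" "snd z \<le> t0 + T" "t0 \<le> snd z'" "snd z' \<le> t0 + T" using z by (auto simp: mem_Times_iff)
    have st: "real k * \<tau> \<le> snd z - t0" "snd z - t0 < real k * \<tau> + \<tau>" "real s * \<tau> \<le> snd z' - t0" "snd z' - t0 < real s * \<tau> + \<tau>"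
      using step_time[OF h(1) tz(1)] step_time[OF h(1) tz(3)] by (auto simp: k_def s_def \<tau>_def)
    have kT: "real k * \<tau> \<le> T + 1" "real s * \<tau> \<le> T + 1" using st tz by auto
    have ks: "\<bar>real k * \<tau> - real s * \<tau>\<bar> < d/2" using st dz(2) sh unfolding dist_real_def by linarith
    show ?thesis
    proof (cases "real s * \<tau> < \<rho> \<or> (\<exists>x0\<in>frontier U. dist y x0 < \<rho>)")
      case True
      have bs: "real s * \<tau> < db \<or> (\<exists>x0\<in>frontier U. dist y x0 < db)" using True \<rho> by (force simp: \<rho>_def)
      have bk: "real k * \<tau> < db \<or> (\<exists>x0\<in>frontier U. dist x x0 < db)"
      proof (cases "real s * \<tau> < \<rho>")
        case True then show ?thesis using ks d by (auto simp: \<rho>_def)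
      next
        case False
        then obtain x0 where "x0 \<in> frontier U" "dist y x0 < \<rho>" using \<open>real s * \<tau> < \<rho> \<or> _\<close> by auto
        moreover have "dist x x0 \<le> dist x y + dist y x0" by (rule dist_triangle)
        ultimately show ?thesis using xy d by (force simp: \<rho>_def)
      qed
      have "h < db" using sh d h db by linarith
      then have 1: "\<bar>w k x - \<Psi> (x, t0 + real k * \<tau>)\<bar> \<le> \<mu>/4" "\<bar>w s y - \<Psi> (y, t0 + real s * \<tau>)\<bar> \<le> \<mu>/4"
        using BC[OF h(1) _ xl(1), of k] BC[OF h(1) _ xl(2), of s] kT bs bk unfolding w_def \<tau>_def by auto
      have "\<bar>\<Psi> (x, t0 + real k * \<tau>) - \<Psi> (y, t0 + real s * \<tau>)\<bar> \<le> \<Lambda> * dist x y + \<Lambda> * \<bar>real k * \<tau> - real s * \<tau>\<bar>"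
        using good_lip[OF g, of x "t0 + real k * \<tau>" y "t0 + real s * \<tau>"] by simp
      also have "\<dots> \<le> \<Lambda> * (d/2) + \<Lambda> * (d/2)" using xy ks \<Lambda> by (intro add_mono mult_left_mono) auto
      finally have "\<bar>\<Psi> (x, t0 + real k * \<tau>) - \<Psi> (y, t0 + real s * \<tau>)\<bar> \<le> \<mu>/4" using d by simp
      then show ?thesis unfolding we using 1 by linarith
    next
      case False
      \<comment> \<open>\<open>y\<close> itself is in \<open>U\<close>, being close to the point
        \<open>fst z'\<close> of the closure and away from the frontier; a segment leaving
        \<open>U\<close> would meet the frontier too early.\<close>
      have inU: "z \<in> U" if "dist z y < \<rho>" for z
      proof (rule ccontr)
        assume "z \<notin> U"
        have yU: "y \<in> U"
        proof (rule ccontr)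
          assume "y \<notin> U"
          moreover have "fst z' \<in> closure U" using z by (auto simp: mem_Times_iff)
          ultimately obtain x0 where "x0 \<in> frontier U" "dist y x0 \<le> dist y (fst z')" using segment_meets_frontier by blast
          moreover have "dist y (fst z') < \<rho>" using dx(2) sh d db N1 h by (simp add: dist_commute \<rho>_def)
          ultimately show False using False by force
        qed
        obtain x0 where "x0 \<in> frontier U" "dist z x0 \<le> dist z y" using segment_meets_frontier[OF _ \<open>z \<notin> U\<close>, of y] yU closure_subset by blast
        have "closed_segment y z \<inter> frontier U \<noteq> {}"
          by (rule connected_Int_frontier) (use yU \<open>z \<notin> U\<close> in auto)
        then obtain x1 where x1: "x1 \<in> closed_segment y z" "x1 \<in> frontier U" by auto
        have "dist y x1 \<le> dist y z" using x1(1) by (metis dist_commute segment_bound(1) dist_norm)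
        then show False using False x1 that by (force simp: dist_commute)
      qed
      have "reg K h \<rho> w y s" unfolding reg_def
      proof (intro conjI ballI allI impI)
        show "\<rho> \<le> real s * (l * h\<^sup>2)" using False by (auto simp: \<tau>_def)
        show "y \<in> lat h" by fact
        fix z :: "real^'n" and j assume zl: "z \<in> lat h" and "dist z y < \<rho>"
        then have "rnd h z \<in> U" using inU[of z] rnd_id[OF h(1) zl] by simp
        then show "scheme h w j z" unfolding w_def using dsol_scheme[OF pb] by blast
        show "0 \<le> w j z" "w j z \<le> M" unfolding w_def using dsol_bounds[OF pb] by auto
        show "w j z - w (Suc j) z \<le> K * (l * h\<^sup>2)" unfolding w_def K_def by (rule dsol_one_sided[OF h(1) g])
      qed
      moreover have "\<bar>real k - real s\<bar> * \<tau> < de"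
      proof -
        have "\<bar>real k - real s\<bar> * \<tau> = \<bar>real k * \<tau> - real s * \<tau>\<bar>" using \<tau>0 by (simp add: left_diff_distrib[symmetric] abs_mult)
        then show ?thesis using ks d by linarith
      qed
      moreover have "h < de" "dist x y < de" using sh d xy h by linarith+
      ultimately have "w k x < w s y + \<mu>" using EQ[OF h(1) _ _ xl(1)] by (simp add: \<tau>_def)
      then show ?thesis unfolding we by simp
    qed
  qed
  show ?thesis
  proof (rule that[of "min \<eta> (d/4)"])
    show "min \<eta> (d/4) > 0" using \<eta> d by simp
    show "\<bar>wfun U t0 \<Psi> h z - wfun U t0 \<Psi> h z'\<bar> \<le> \<mu>"
      if "0 < h" "h < min \<eta> (d/4)" "z \<in> closure U \<times> {t0..t0+T}" "z' \<in> closure U \<times> {t0..t0+T}" "dist z z' < min \<eta> (d/4)" for h z z'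
      using one[of h z z'] one[of h z' z] that by (auto simp: dist_commute)
    show "\<bar>wfun U t0 \<Psi> h z - \<Psi> z\<bar> \<le> \<mu>" if h: "0 < h" "h < min \<eta> (d/4)" and z: "z \<in> pbdry U t0 (t0+T)" for h z
    proof -
      define \<tau> where "\<tau> = l * h\<^sup>2"
      have \<tau>0: "\<tau> > 0" using h l0 by (simp add: \<tau>_def)
      have sh: "2*N*h \<le> d/4" "\<tau> \<le> d/4" "h \<le> d/4" "\<tau> \<le> 1" using sm[of h] h by (auto simp: \<tau>_def)
      define x where "x = rnd h (fst z)"
      define k where "k = nat \<lfloor>(snd z - t0) / (l * h\<^sup>2)\<rfloor>"
      have tz: "t0 \<le> snd z" "snd z \<le> t0 + T" using z T by (auto simp: pbdry_def)
      have st: "real k * \<tau> \<le> snd z - t0" "snd z - t0 < real k * \<tau> + \<tau>"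
        using step_time[OF h(1) tz(1)] by (auto simp: k_def \<tau>_def)
      have dx: "dist (fst z) x \<le> N * h" using dist_rnd[OF h(1)] by (auto simp: x_def N_def)
      have we: "wfun U t0 \<Psi> h z = dsol h U t0 \<Psi> k x"
        unfolding wfun_def x_def k_def by (simp add: dsol_rnd[OF h(1)])
      have "real k * \<tau> < db \<or> (\<exists>x0\<in>frontier U. dist x x0 < db)"
      proof (cases "snd z = t0")
        case True then show ?thesis using st db by auto
      next
        case False
        then have "fst z \<in> frontier U" using z by (auto simp: pbdry_def)
        moreover have "dist x (fst z) < db" using dx sh d db N1 h by (simp add: dist_commute)
        ultimately show ?thesis by auto
      qed
      moreover have "h < db" using sh d db h by linarith
      moreover have "real k * \<tau> \<le> T + 1" using st tz by auto
      ultimately have 1: "\<bar>dsol h U t0 \<Psi> k x - \<Psi> (x, t0 + real k * \<tau>)\<bar> \<le> \<mu>/4"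
        using BC[OF h(1), of x k] by (simp add: \<tau>_def x_def)
      have "\<bar>\<Psi> (x, t0 + real k * \<tau>) - \<Psi> (fst z, snd z)\<bar> \<le> \<Lambda> * dist x (fst z) + \<Lambda> * \<bar>t0 + real k * \<tau> - snd z\<bar>"
        by (rule good_lip[OF g])
      also have "\<dots> \<le> \<Lambda> * (d/2) + \<Lambda> * (d/2)"
      proof -
        have "N * h \<ge> 0" using N1 h by simp
        then show ?thesis using dx st sh \<Lambda> d by (intro add_mono mult_left_mono) (auto simp: dist_commute)
      qed
      finally have "\<bar>\<Psi> (x, t0 + real k * \<tau>) - \<Psi> z\<bar> \<le> \<Lambda> * d" by simp
      then show ?thesis using 1 d(4) \<mu> unfolding we by linarith
    qed
  qed
qed

text \<open>Arzela-Ascoli for discontinuous functions: a diagonal subsequence converges on a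
  countable dense set, and the asymptotic modulus carries convergence to every point and continuity
  to the limit.\<close>

lemma wfun_limit:
  assumes g: "good M \<Lambda> \<Psi>" and ext: "extball U r" and T: "T > 0" and U: "\<forall>x\<in>U. norm x \<le> D"
    and hs: "\<And>n. hs n > 0" "hs \<longlonglongrightarrow> 0"
  obtains s \<omega> where "strict_mono (s::nat\<Rightarrow>nat)" "\<And>z. z \<in> closure U \<times> {t0..t0+T} \<Longrightarrow> (\<lambda>n. wfun U t0 \<Psi> (hs (s n)) z) \<longlonglongrightarrow> \<omega> z"
    "continuous_on (closure U \<times> {t0..t0+T}) \<omega>" "\<And>z. z \<in> pbdry U t0 (t0+T) \<Longrightarrow> \<omega> z = \<Psi> z"
proof -
  define S where "S = closure U \<times> {t0..t0+T}"
  have pb: "\<forall>z. 0 \<le> \<Psi> z \<and> \<Psi> z \<le> M" using g by (auto simp: good_def)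
  define f where "f = (\<lambda>n. wfun U t0 \<Psi> (hs n))"
  have fb: "norm (f n z) \<le> M" for n z using dsol_bounds[OF pb] by (simp add: f_def wfun_def)
  obtain Q where Q: "countable Q" "Q \<subseteq> S" "S \<subseteq> closure Q" using separable[of S] by blast
  obtain s where s: "strict_mono (s::nat\<Rightarrow>nat)" "\<And>x. x \<in> Q \<Longrightarrow> \<exists>l. (\<lambda>n. f (s n) x) \<longlonglongrightarrow> l"
    using function_convergent_subsequence[OF Q(1), of f M] fb by blast
  have hss: "(\<lambda>n. hs (s n)) \<longlonglongrightarrow> 0" using LIMSEQ_subseq_LIMSEQ[OF hs(2) s(1)] by (simp add: o_def)
  have small: "\<forall>\<^sub>F n in sequentially. hs (s n) < \<delta>" if "\<delta> > 0" for \<delta>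
    using order_tendstoD(2)[OF hss that] .
  have conv: "convergent (\<lambda>n. f (s n) z)" if z: "z \<in> S" for z
  proof (rule Cauchy_convergent, rule metric_CauchyI)
    fix e :: real assume e: "e > 0"
    obtain \<delta> where \<delta>: "\<delta> > 0" "\<And>h z z'. \<lbrakk>0 < h; h < \<delta>; z \<in> S; z' \<in> S; dist z z' < \<delta>\<rbrakk> \<Longrightarrow> \<bar>wfun U t0 \<Psi> h z - wfun U t0 \<Psi> h z'\<bar> \<le> e/8"
      using asymptotic_equicont[OF g ext T _ U, of "e/8" t0] e unfolding S_def by (metis divide_pos_pos zero_less_numeral)
    obtain q where q: "q \<in> Q" "dist q z < \<delta>" using Q(3) z \<delta>(1) by (metis closure_approachable subsetD)
    obtain N1 where N1: "\<And>n. n \<ge> N1 \<Longrightarrow> hs (s n) < \<delta>" using small[OF \<delta>(1)] by (auto simp: eventually_sequentially)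
    have "Cauchy (\<lambda>n. f (s n) q)" using s(2)[OF q(1)] convergentI convergent_Cauchy by blast
    then obtain N2 where N2: "\<And>m n. m \<ge> N2 \<Longrightarrow> n \<ge> N2 \<Longrightarrow> dist (f (s m) q) (f (s n) q) < e/8"
      using metric_CauchyD[of "\<lambda>n. f (s n) q" "e/8"] e by auto
    have near: "\<bar>f (s n) z - f (s n) q\<bar> \<le> e/8" if "n \<ge> N1" for n
      unfolding f_def using \<delta>(2)[of "hs (s n)" z q] hs(1) N1[OF that] z q Q(2) by (auto simp: dist_commute)
    show "\<exists>K. \<forall>m\<ge>K. \<forall>n\<ge>K. dist (f (s m) z) (f (s n) z) < e"
    proof (intro exI[of _ "max N1 N2"] allI impI)
      fix m n assume mn: "max N1 N2 \<le> m" "max N1 N2 \<le> n"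
      then have "m \<ge> N1" "n \<ge> N1" "m \<ge> N2" "n \<ge> N2" by auto
      then show "dist (f (s m) z) (f (s n) z) < e"
        using near[of m] near[of n] N2[of m n] e unfolding dist_real_def by linarith
    qed
  qed
  define \<omega> where "\<omega> = (\<lambda>z. lim (\<lambda>n. f (s n) z))"
  have lim: "(\<lambda>n. f (s n) z) \<longlonglongrightarrow> \<omega> z" if "z \<in> S" for z
    using conv[OF that] unfolding \<omega>_def by (simp add: convergent_LIMSEQ_iff)
  have cont: "continuous_on S \<omega>" unfolding continuous_on_iff
  proof (intro ballI allI impI)
    fix z e :: "_" assume z: "z \<in> S" and e: "(e::real) > 0"
    obtain \<delta> where \<delta>: "\<delta> > 0" "\<And>h z z'. \<lbrakk>0 < h; h < \<delta>; z \<in> S; z' \<in> S; dist z z' < \<delta>\<rbrakk> \<Longrightarrow> \<bar>wfun U t0 \<Psi> h z - wfun U t0 \<Psi> h z'\<bar> \<le> e/2"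
      using asymptotic_equicont[OF g ext T _ U, of "e/2" t0] e unfolding S_def by (metis half_gt_zero)
    have "dist (\<omega> z') (\<omega> z) \<le> e/2" if z': "z' \<in> S" "dist z' z < \<delta>" for z'
    proof -
      have "(\<lambda>n. \<bar>f (s n) z' - f (s n) z\<bar>) \<longlonglongrightarrow> \<bar>\<omega> z' - \<omega> z\<bar>" by (intro tendsto_intros lim z z')
      moreover have "\<forall>\<^sub>F n in sequentially. \<bar>f (s n) z' - f (s n) z\<bar> \<le> e/2"
        using small[OF \<delta>(1)] by eventually_elim (use \<delta>(2) hs(1) z z' in \<open>auto simp: f_def\<close>)
      ultimately show ?thesis unfolding dist_real_def using tendsto_upperbound trivial_limit_sequentially by blast
    qed
    then show "\<exists>d>0. \<forall>z'\<in>S. dist z' z < d \<longrightarrow> dist (\<omega> z') (\<omega> z) < e"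
      using \<delta>(1) e by (intro exI[of _ \<delta>]) force
  qed
  have bd: "\<omega> z = \<Psi> z" if z: "z \<in> pbdry U t0 (t0+T)" for z
  proof (rule ccontr)
    assume ne: "\<omega> z \<noteq> \<Psi> z"
    have zS: "z \<in> S" using z T by (auto simp: S_def pbdry_def frontier_def)
    define e where "e = \<bar>\<omega> z - \<Psi> z\<bar> / 2"
    have e: "e > 0" using ne by (simp add: e_def)
    obtain \<delta> where \<delta>: "\<delta> > 0" "\<And>h z. \<lbrakk>0 < h; h < \<delta>; z \<in> pbdry U t0 (t0+T)\<rbrakk> \<Longrightarrow> \<bar>wfun U t0 \<Psi> h z - \<Psi> z\<bar> \<le> e"
      using asymptotic_equicont[OF g ext T e U, of t0] by metis
    have "(\<lambda>n. \<bar>f (s n) z - \<Psi> z\<bar>) \<longlonglongrightarrow> \<bar>\<omega> z - \<Psi> z\<bar>" by (intro tendsto_intros lim zS)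
    moreover have "\<forall>\<^sub>F n in sequentially. \<bar>f (s n) z - \<Psi> z\<bar> \<le> e"
      using small[OF \<delta>(1)] by eventually_elim (use \<delta>(2) hs(1) z in \<open>auto simp: f_def\<close>)
    ultimately have "\<bar>\<omega> z - \<Psi> z\<bar> \<le> e" using tendsto_upperbound trivial_limit_sequentially by blast
    moreover have "a \<le> a/2 \<Longrightarrow> 0 < a/2 \<Longrightarrow> False" for a :: real by simp
    ultimately show False using e unfolding e_def by blast
  qed
  show ?thesis using that[OF s(1), of \<omega>] lim cont bd unfolding S_def f_def by blast
qed

end

section \<open>Square integrable functions and test functions\<close>

definition L2 :: "('a::euclidean_space \<Rightarrow> real) \<Rightarrow> bool" where
  "L2 f \<longleftrightarrow> f \<in> borel_measurable lborel \<and> integrable lborel (\<lambda>x. (f x)\<^sup>2)"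

lemma L2_mult:
  assumes "L2 f" "L2 g" shows "integrable lborel (\<lambda>x. f x * g x)"
proof (rule Bochner_Integration.integrable_bound[where f = "\<lambda>x. (f x)\<^sup>2 + (g x)\<^sup>2"])
  show "integrable lborel (\<lambda>x. (f x)\<^sup>2 + (g x)\<^sup>2)" using assms by (auto simp: L2_def)
  show "(\<lambda>x. f x * g x) \<in> borel_measurable lborel" using assms by (auto simp: L2_def)
  have "\<bar>a * b\<bar> \<le> a\<^sup>2 + b\<^sup>2" for a b :: real
  proof -
    have "2 * (\<bar>a\<bar> * \<bar>b\<bar>) \<le> a\<^sup>2 + b\<^sup>2" using sum_squares_bound[of "\<bar>a\<bar>" "\<bar>b\<bar>"] by simp
    moreover have "0 \<le> \<bar>a\<bar> * \<bar>b\<bar>" by simp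
    ultimately show ?thesis unfolding abs_mult by linarith
  qed
  then show "AE x in lborel. norm (f x * g x) \<le> norm ((f x)\<^sup>2 + (g x)\<^sup>2)" by auto
qed

lemma L2_cmult: "L2 f \<Longrightarrow> L2 (\<lambda>x. c * f x)"
  by (auto simp: L2_def power_mult_distrib)

lemma L2_add:
  assumes "L2 f" "L2 g" shows "L2 (\<lambda>x. f x + g x)"
proof -
  have "integrable lborel (\<lambda>x. (f x)\<^sup>2 + (g x)\<^sup>2 + 2 * (f x * g x))"
    using assms L2_mult[OF assms] by (auto simp: L2_def)
  then show ?thesis using assms unfolding L2_def power2_sum by (auto simp: mult.assoc)
qed

lemma L2_diff: "L2 f \<Longrightarrow> L2 g \<Longrightarrow> L2 (\<lambda>x. f x - g x)"
  using L2_add[of f "\<lambda>x. -1 * g x"] L2_cmult[of g "-1"] by simp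

text \<open>Young's form of Cauchy-Schwarz; \<open>c\<close> is chosen according to which factor is
  small.\<close>

lemma L2_mult_bound:
  assumes "L2 f" "L2 g" "c > 0"
  shows "2 * \<bar>\<integral>x. f x * g x \<partial>lborel\<bar> \<le> c * (\<integral>x. (f x)\<^sup>2 \<partial>lborel) + (\<integral>x. (g x)\<^sup>2 \<partial>lborel) / c"
proof -
  have i: "integrable lborel (\<lambda>x. c * (f x)\<^sup>2 + (g x)\<^sup>2 / c)" using assms by (auto simp: L2_def)
  have "2 * \<bar>a * b\<bar> \<le> c * a\<^sup>2 + b\<^sup>2 / c" for a b :: real
  proof -
    have "0 \<le> (c * \<bar>a\<bar> - \<bar>b\<bar>)\<^sup>2 / c" using assms by simp
    also have "\<dots> = c * a\<^sup>2 + b\<^sup>2 / c - 2 * \<bar>a * b\<bar>" using assms by (simp add: power2_diff power_mult_distrib field_simps abs_mult power2_eq_square)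
    finally show ?thesis by simp
  qed
  then have le: "norm (2 * (f x * g x)) \<le> c * (f x)\<^sup>2 + (g x)\<^sup>2 / c" for x by (simp add: abs_mult)
  have "norm (\<integral>x. 2 * (f x * g x) \<partial>lborel) \<le> (\<integral>x. c * (f x)\<^sup>2 + (g x)\<^sup>2 / c \<partial>lborel)"
    by (rule order_trans[OF Bochner_Integration.integral_norm_bound integral_mono]) (use L2_mult[OF assms(1,2)] i le in auto)
  also have "\<dots> = c * (\<integral>x. (f x)\<^sup>2 \<partial>lborel) + (\<integral>x. (g x)\<^sup>2 \<partial>lborel) / c" using assms by (simp add: L2_def)
  finally show ?thesis by (simp add: abs_mult)
qed

lemma L2_bounded_support:
  assumes "f \<in> borel_measurable lborel" "S \<in> sets lborel" "emeasure lborel S < \<infinity>"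
    and "\<And>x. \<bar>f x\<bar> \<le> C" "\<And>x. x \<notin> S \<Longrightarrow> f x = 0"
  shows "L2 f" "integrable lborel f" "(\<integral>x. (f x)\<^sup>2 \<partial>lborel) \<le> C\<^sup>2 * measure lborel S"
proof -
  have C0: "C \<ge> 0" using assms(4) by (meson abs_ge_zero order_trans)
  have i: "integrable lborel (\<lambda>x. C\<^sup>2 * indicator S x)" "integrable lborel (\<lambda>x. C * indicator S x)" using assms by auto
  have b: "(f x)\<^sup>2 \<le> C\<^sup>2 * indicator S x" for x
    using assms(4)[of x] assms(5)[of x] power_mono[of "\<bar>f x\<bar>" C 2] by (cases "x \<in> S") auto
  have b': "norm (f x) \<le> C * indicator S x" for x
    using assms(4)[of x] assms(5)[of x] by (cases "x \<in> S") auto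
  have i2: "integrable lborel (\<lambda>x. (f x)\<^sup>2)"
    by (rule Bochner_Integration.integrable_bound[OF i(1)]) (use assms(1) b C0 in \<open>auto simp: abs_mult\<close>)
  then show "L2 f" using assms(1) by (simp add: L2_def)
  show "integrable lborel f"
    by (rule Bochner_Integration.integrable_bound[OF i(2)]) (use assms(1) b' C0 in \<open>auto simp: abs_mult\<close>)
  have "(\<integral>x. (f x)\<^sup>2 \<partial>lborel) \<le> (\<integral>x. C\<^sup>2 * indicator S x \<partial>lborel)"
    by (rule integral_mono[OF i2 i(1) b])
  then show "(\<integral>x. (f x)\<^sup>2 \<partial>lborel) \<le> C\<^sup>2 * measure lborel S" using assms by simp
qed

text \<open>Riesz-Fischer. Along a rapidly Cauchy subsequence the increments are summable in mean,
  thanks to the common support of finite measure, so it converges almost everywhere; Fatou's lemma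
  upgrades this to mean square convergence of the whole sequence.\<close>

lemma L2_complete:
  fixes f :: "nat \<Rightarrow> 'a::euclidean_space \<Rightarrow> real"
  assumes L2: "\<And>n. L2 (f n)" and S: "S \<in> sets lborel" "emeasure lborel S < \<infinity>" "\<And>n x. x \<notin> S \<Longrightarrow> f n x = 0"
    and Cauchy: "\<And>e. e > 0 \<Longrightarrow> \<exists>N. \<forall>m n. N \<le> m \<longrightarrow> N \<le> n \<longrightarrow> (\<integral>x. (f m x - f n x)\<^sup>2 \<partial>lborel) \<le> e"
  obtains g where "L2 g" "\<And>x. x \<notin> S \<Longrightarrow> g x = 0" "\<And>e. e > 0 \<Longrightarrow> \<exists>N. \<forall>n\<ge>N. (\<integral>x. (f n x - g x)\<^sup>2 \<partial>lborel) \<le> e"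
proof -
  have mf: "f n \<in> borel_measurable lborel" for n using L2 by (auto simp: L2_def)
  have "\<exists>N. \<forall>m n. N \<le> m \<longrightarrow> N \<le> n \<longrightarrow> (\<integral>x. (f m x - f n x)\<^sup>2 \<partial>lborel) \<le> (1/4)^k" for k using Cauchy[of "(1/4)^k"] by simp
  then obtain N where N: "\<And>k m n. N k \<le> m \<Longrightarrow> N k \<le> n \<Longrightarrow> (\<integral>x. (f m x - f n x)\<^sup>2 \<partial>lborel) \<le> (1/4)^k" by metis
  define r where "r = (\<lambda>k. k + (\<Sum>j\<le>k. N j))"
  have rN: "N k \<le> r k" "N k \<le> r (Suc k)" for k
  proof -
    have "N k \<le> (\<Sum>j\<le>k. N j)" by (rule member_le_sum) auto
    then show "N k \<le> r k" by (simp add: r_def)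
    then show "N k \<le> r (Suc k)" by (simp add: r_def)
  qed
  define d where "d = (\<lambda>k x. f (r (Suc k)) x - f (r k) x)"
  have dL2: "L2 (d k)" for k unfolding d_def by (intro L2_diff L2)
  have [measurable]: "d k \<in> borel_measurable borel" "f k \<in> borel_measurable borel" for k using dL2[of k] mf[of k] by (auto simp: L2_def)
  have d2: "(\<integral>x. (d k x)\<^sup>2 \<partial>lborel) \<le> (1/4)^k" for k unfolding d_def using N[of k "r (Suc k)" "r k"] rN by blast
  have mS: "measure lborel S \<ge> 0" by simp
  have indL2: "L2 (indicator S :: 'a \<Rightarrow> real)" using S by (intro L2_bounded_support[where S = S and C = 1]) (auto simp: indicator_def)
  have absL2: "L2 (\<lambda>x. \<bar>d k x\<bar>)" for k using dL2[of k] by (auto simp: L2_def)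
  have dS: "\<bar>d k x\<bar> = \<bar>d k x\<bar> * indicator S x" for k x using S(3) by (auto simp: d_def indicator_def)
  have idk: "integrable lborel (\<lambda>x. \<bar>d k x\<bar>)" for k using L2_mult[OF absL2 indL2, of k] dS[of k] by simp
  \<comment> \<open>The weight \<open>2^k\<close> balances the mean square \<open>(1/4)^k\<close> of
    the increment against the measure of \<open>S\<close>.\<close>
  have L1: "(\<integral>x. \<bar>d k x\<bar> \<partial>lborel) \<le> (1/2)^k * (1 + measure lborel S)" for k
  proof -
    have "2 * \<bar>\<integral>x. \<bar>d k x\<bar> * indicator S x \<partial>lborel\<bar> \<le> 2^k * (\<integral>x. \<bar>d k x\<bar>\<^sup>2 \<partial>lborel) + (\<integral>x. (indicator S x)\<^sup>2 \<partial>lborel) / 2^k"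
      by (rule L2_mult_bound[OF absL2 indL2]) simp
    also have "(\<integral>x. (indicator S x :: real)\<^sup>2 \<partial>lborel) = measure lborel S"
    proof -
      have "(indicator S x :: real)\<^sup>2 = indicator S x" for x :: 'a by (simp add: indicator_def)
      then show ?thesis using S by simp
    qed
    also have "2^k * (\<integral>x. \<bar>d k x\<bar>\<^sup>2 \<partial>lborel) \<le> 2^k * (1/4)^k" using d2[of k] by simp
    also have "(2::real)^k * (1/4)^k = (1/2)^k" by (simp add: power_mult_distrib[symmetric])
    finally have "2 * \<bar>\<integral>x. \<bar>d k x\<bar> \<partial>lborel\<bar> \<le> (1/2)^k * (1 + measure lborel S)" unfolding dS[symmetric]
      by (simp add: field_simps power_divide)
    then show ?thesis by (smt (verit) zero_le_mult_iff zero_le_power mS)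
  qed
  have AE: "AE x in lborel. summable (\<lambda>k. \<bar>d k x\<bar>)"
  proof -
    have "(\<integral>\<^sup>+x. (\<Sum>k. ennreal \<bar>d k x\<bar>) \<partial>lborel) = (\<Sum>k. \<integral>\<^sup>+x. ennreal \<bar>d k x\<bar> \<partial>lborel)"
      by (rule nn_integral_suminf) auto
    also have "\<dots> \<le> (\<Sum>k. ennreal ((1/2)^k * (1 + measure lborel S)))"
    proof (intro suminf_le summableI)
      fix k show "(\<integral>\<^sup>+x. ennreal \<bar>d k x\<bar> \<partial>lborel) \<le> ennreal ((1/2)^k * (1 + measure lborel S))"
        by (subst nn_integral_eq_integral[OF idk]) (use L1[of k] in \<open>auto intro: ennreal_leI\<close>)
    qed
    also have "\<dots> < \<infinity>"
    proof -
      have "summable (\<lambda>k. (1/2::real)^k * (1 + measure lborel S))" by (intro summable_mult2 summable_geometric) simp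
      then show ?thesis by (subst suminf_ennreal2) (auto simp: mS)
    qed
    finally have "AE x in lborel. (\<Sum>k. ennreal \<bar>d k x\<bar>) \<noteq> \<infinity>"
      by (intro nn_integral_noteq_infinite) auto
    then show ?thesis by eventually_elim (intro summable_suminf_not_top; simp)
  qed
  have tel: "f (r n) x = f (r 0) x + (\<Sum>k<n. d k x)" for n x
    unfolding d_def by (induction n) auto
  define g where "g = (\<lambda>x. lim (\<lambda>n. f (r n) x))"
  have mg: "g \<in> borel_measurable lborel" unfolding g_def by measurable
  have lim: "AE x in lborel. (\<lambda>n. f (r n) x) \<longlonglongrightarrow> g x"
    using AE
  proof eventually_elim
    case (elim x)
    then have "summable (\<lambda>k. d k x)" by (rule summable_rabs_cancel)
    then have "(\<lambda>n. f (r 0) x + (\<Sum>k<n. d k x)) \<longlonglongrightarrow> f (r 0) x + (\<Sum>k. d k x)" by (intro tendsto_intros summable_LIMSEQ)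
    moreover have "(\<lambda>n. f (r n) x) = (\<lambda>n. f (r 0) x + (\<Sum>k<n. d k x))" by (rule ext) (rule tel)
    ultimately have "convergent (\<lambda>n. f (r n) x)" by (metis convergentI)
    then show ?case by (simp add: g_def convergent_LIMSEQ_iff)
  qed
  have gS: "g x = 0" if "x \<notin> S" for x using S(3)[OF that] by (simp add: g_def)
  have fatou: "integrable lborel (\<lambda>x. (f n x - g x)\<^sup>2) \<and> (\<integral>x. (f n x - g x)\<^sup>2 \<partial>lborel) \<le> e"
    if e: "e \<ge> 0" and n: "\<forall>\<^sub>F k in sequentially. (\<integral>x. (f n x - f (r k) x)\<^sup>2 \<partial>lborel) \<le> e" for n e
  proof -
    have "(\<integral>\<^sup>+x. ennreal ((f n x - g x)\<^sup>2) \<partial>lborel) = (\<integral>\<^sup>+x. liminf (\<lambda>k. ennreal ((f n x - f (r k) x)\<^sup>2)) \<partial>lborel)"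
    proof (rule nn_integral_cong_AE)
      show "AE x in lborel. ennreal ((f n x - g x)\<^sup>2) = liminf (\<lambda>k. ennreal ((f n x - f (r k) x)\<^sup>2))"
        using lim
      proof eventually_elim
        case (elim x)
        have "(\<lambda>k. ennreal ((f n x - f (r k) x)\<^sup>2)) \<longlonglongrightarrow> ennreal ((f n x - g x)\<^sup>2)"
          by (intro tendsto_ennrealI tendsto_intros elim)
        then show ?case by (rule lim_imp_Liminf[OF sequentially_bot, symmetric])
      qed
    qed
    also have "\<dots> \<le> liminf (\<lambda>k. \<integral>\<^sup>+x. ennreal ((f n x - f (r k) x)\<^sup>2) \<partial>lborel)"
      by (rule nn_integral_liminf) (use mf in measurable)
    also have "\<dots> \<le> ennreal e"
    proof (rule Liminf_le)
      show "\<forall>\<^sub>F k in sequentially. (\<integral>\<^sup>+x. ennreal ((f n x - f (r k) x)\<^sup>2) \<partial>lborel) \<le> ennreal e"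
        using n
      proof eventually_elim
        case (elim k)
        have "integrable lborel (\<lambda>x. (f n x - f (r k) x)\<^sup>2)" using L2_diff[OF L2 L2] by (simp add: L2_def)
        then show ?case using elim by (subst nn_integral_eq_integral) (auto intro: ennreal_leI)
      qed
    qed simp
    finally have le: "(\<integral>\<^sup>+x. ennreal ((f n x - g x)\<^sup>2) \<partial>lborel) \<le> ennreal e" .
    then have i: "integrable lborel (\<lambda>x. (f n x - g x)\<^sup>2)"
      using mf mg by (intro integrableI_bounded) (auto intro: le_less_trans)
    then show ?thesis using le e by (simp add: nn_integral_eq_integral)
  qed
  have main: "\<exists>N. \<forall>n\<ge>N. integrable lborel (\<lambda>x. (f n x - g x)\<^sup>2) \<and> (\<integral>x. (f n x - g x)\<^sup>2 \<partial>lborel) \<le> e" if e: "e > 0" for e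
  proof -
    obtain K where K: "\<And>m n. K \<le> m \<Longrightarrow> K \<le> n \<Longrightarrow> (\<integral>x. (f m x - f n x)\<^sup>2 \<partial>lborel) \<le> e" using Cauchy[OF e] by blast
    have rk: "k \<le> r k" for k by (simp add: r_def)
    have "\<forall>\<^sub>F k in sequentially. (\<integral>x. (f n x - f (r k) x)\<^sup>2 \<partial>lborel) \<le> e" if "K \<le> n" for n
      using eventually_ge_at_top[of K] by eventually_elim (rule K[OF that order_trans[OF _ rk]])
    then show ?thesis using fatou[of e] e by (intro exI[of _ K]) auto
  qed
  obtain n where n: "integrable lborel (\<lambda>x. (f n x - g x)\<^sup>2)" using main[of 1] by auto
  have "L2 (\<lambda>x. f n x - g x)" using n mf mg by (auto simp: L2_def)
  from L2_diff[OF L2[of n] this] have "L2 (\<lambda>x. f n x - (f n x - g x))" .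
  moreover have "(\<lambda>x. f n x - (f n x - g x)) = g" by auto
  ultimately have "L2 g" by metis
  then show ?thesis using that[of g] gS main by metis
qed

text \<open>Weak compactness by minimal norm: elements of nearly least norm in a decreasing sequence
  of convex sets are Cauchy by the parallelogram law, and their limit represents the limit
  functional.\<close>

lemma L2_weak_limit:
  fixes G :: "nat \<Rightarrow> 'a::euclidean_space \<Rightarrow> real"
  assumes L2: "\<And>n. L2 (G n)" and S: "S \<in> sets lborel" "emeasure lborel S < \<infinity>" "\<And>n x. x \<notin> S \<Longrightarrow> G n x = 0"
    and bd: "\<And>n. (\<integral>x. (G n x)\<^sup>2 \<partial>lborel) \<le> C"
    and T: "\<And>\<phi>. \<phi> \<in> T \<Longrightarrow> L2 \<phi>" and lim: "\<And>\<phi>. \<phi> \<in> T \<Longrightarrow> (\<lambda>n. \<integral>x. G n x * \<phi> x \<partial>lborel) \<longlonglongrightarrow> L \<phi>"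
  obtains g where "L2 g" "\<And>x. x \<notin> S \<Longrightarrow> g x = 0" "\<And>\<phi>. \<phi> \<in> T \<Longrightarrow> (\<integral>x. g x * \<phi> x \<partial>lborel) = L \<phi>"
proof -
  let ?I = "\<lambda>f. \<integral>x. (f x)\<^sup>2 \<partial>(lborel :: 'a measure)"
  \<comment> \<open>\<open>W n\<close> stands in for the closed convex hull of the tail from
    \<open>n\<close> on: it collects the functions that satisfy, for each \<open>\<phi>\<close>,
    every error bound shared by the whole tail. Its midpoint convexity is
    \<open>mid\<close>.\<close>
  define W where "W = (\<lambda>n. {f. L2 f \<and> (\<forall>x. x \<notin> S \<longrightarrow> f x = 0) \<and>
     (\<forall>\<phi>\<in>T. \<forall>e. (\<forall>j\<ge>n. \<bar>(\<integral>x. G j x * \<phi> x \<partial>lborel) - L \<phi>\<bar> \<le> e) \<longrightarrow> \<bar>(\<integral>x. f x * \<phi> x \<partial>lborel) - L \<phi>\<bar> \<le> e)})"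
  have GW: "G n \<in> W n" for n unfolding W_def using L2 S(3) by auto
  have Wmono: "W k \<subseteq> W n" if "n \<le> k" for n k unfolding W_def using that by (auto 0 3)
  have mid: "(\<lambda>x. (f x + f' x) / 2) \<in> W n" if f: "f \<in> W n" "f' \<in> W n" for f f' n
  proof -
    have l: "L2 f" "L2 f'" using f by (auto simp: W_def)
    have "L2 (\<lambda>x. (1/2) * (f x + f' x))" by (intro L2_cmult L2_add l)
    moreover have "\<bar>(\<integral>x. (f x + f' x) / 2 * \<phi> x \<partial>lborel) - L \<phi>\<bar> \<le> e"
      if \<phi>: "\<phi> \<in> T" and e: "\<forall>j\<ge>n. \<bar>(\<integral>x. G j x * \<phi> x \<partial>lborel) - L \<phi>\<bar> \<le> e" for \<phi> e
    proof -
      have i: "integrable lborel (\<lambda>x. f x * \<phi> x)" "integrable lborel (\<lambda>x. f' x * \<phi> x)" using L2_mult T[OF \<phi>] l by auto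
      have "(\<integral>x. (f x + f' x) / 2 * \<phi> x \<partial>lborel) = (\<integral>x. (f x * \<phi> x + f' x * \<phi> x) / 2 \<partial>lborel)"
        by (intro Bochner_Integration.integral_cong) (auto simp: field_simps)
      also have "\<dots> = ((\<integral>x. f x * \<phi> x \<partial>lborel) + (\<integral>x. f' x * \<phi> x \<partial>lborel)) / 2" using i by simp
      finally have "(\<integral>x. (f x + f' x) / 2 * \<phi> x \<partial>lborel) = ((\<integral>x. f x * \<phi> x \<partial>lborel) + (\<integral>x. f' x * \<phi> x \<partial>lborel)) / 2" .
      moreover have "\<bar>(\<integral>x. f x * \<phi> x \<partial>lborel) - L \<phi>\<bar> \<le> e" "\<bar>(\<integral>x. f' x * \<phi> x \<partial>lborel) - L \<phi>\<bar> \<le> e"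
        using f \<phi> e by (auto simp: W_def)
      moreover have "a = (b + c) / 2 \<Longrightarrow> \<bar>b - y\<bar> \<le> e \<Longrightarrow> \<bar>c - y\<bar> \<le> e \<Longrightarrow> \<bar>a - y\<bar> \<le> e" for a b c y :: real by argo
      ultimately show ?thesis by blast
    qed
    ultimately show ?thesis using f unfolding W_def by auto
  qed
  \<comment> \<open>The least squared norms increase with \<open>n\<close> and are bounded by
    \<open>C\<close>, hence converge; this makes the right-hand side of \<open>par\<close>
    small.\<close>
  define d where "d = (\<lambda>n. Inf (?I ` W n))"
  have bb: "bdd_below (?I ` W n)" for n by (rule bdd_belowI2[of _ 0]) simp
  have dle: "d n \<le> ?I f" if "f \<in> W n" for f n unfolding d_def using that bb by (intro cInf_lower) auto
  have dmono: "d n \<le> d k" if "n \<le> k" for n k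
    unfolding d_def by (rule cInf_superset_mono) (use GW[of k] bb Wmono[OF that] in auto)
  have dC: "d n \<le> C" for n using dle[OF GW] bd order_trans by blast
  define q where "q = (\<lambda>n. 1 / real (Suc n))"
  have "\<exists>f\<in>W n. ?I f < d n + q n" for n
  proof -
    have "Inf (?I ` W n) < d n + q n" by (simp add: d_def q_def)
    then show ?thesis using cInf_lessD[of "?I ` W n"] GW[of n] by blast
  qed
  then obtain f where f: "\<And>n. f n \<in> W n" "\<And>n. ?I (f n) < d n + q n" by metis
  have fL: "L2 (f n)" "x \<notin> S \<Longrightarrow> f n x = 0" for n x using f(1)[of n] by (auto simp: W_def)
  have par: "?I (\<lambda>x. f n x - f k x) \<le> 2 * (d k - d n) + 2 * q n + 2 * q k" if "n \<le> k" for n k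
  proof -
    have i: "integrable lborel (\<lambda>x. (f n x)\<^sup>2)" "integrable lborel (\<lambda>x. (f k x)\<^sup>2)" "integrable lborel (\<lambda>x. ((f n x + f k x)/2)\<^sup>2)"
      using fL(1)[of n] fL(1)[of k] L2_cmult[OF L2_add[OF fL(1)[of n] fL(1)[of k]], of "1/2"] by (auto simp: L2_def)
    have "(a - b)\<^sup>2 = 2 * a\<^sup>2 + 2 * b\<^sup>2 - 4 * ((a + b)/2)\<^sup>2" for a b :: real
    proof -
      have e: "4 * ((a + b)/2)\<^sup>2 = (a + b)\<^sup>2" by (simp add: power_divide)
      show ?thesis unfolding e by (simp add: power2_eq_square algebra_simps)
    qed
    then have "?I (\<lambda>x. f n x - f k x) = (\<integral>x. 2 * (f n x)\<^sup>2 + 2 * (f k x)\<^sup>2 - 4 * ((f n x + f k x)/2)\<^sup>2 \<partial>lborel)" by presburger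
    also have "\<dots> = 2 * ?I (f n) + 2 * ?I (f k) - 4 * ?I (\<lambda>x. (f n x + f k x)/2)"
      using i by simp
    finally have "?I (\<lambda>x. f n x - f k x) = 2 * ?I (f n) + 2 * ?I (f k) - 4 * ?I (\<lambda>x. (f n x + f k x)/2)" .
    moreover have "d n \<le> ?I (\<lambda>x. (f n x + f k x)/2)"
      using mid[of "f n" n "f k"] f(1) Wmono[OF that] by (intro dle) auto
    moreover have "y = 2 * a + 2 * b - 4 * c \<Longrightarrow> dn \<le> c \<Longrightarrow> a < dn + qn \<Longrightarrow> b < dk + qk \<Longrightarrow> y \<le> 2 * (dk - dn) + 2 * qn + 2 * qk"
      for y a b c dn dk qn qk :: real by argo
    ultimately show ?thesis using f(2)[of n] f(2)[of k] by blast
  qed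
  have incd: "incseq d" using dmono by (auto simp: incseq_def)
  obtain dl where "d \<longlonglongrightarrow> dl" by (rule incseq_convergent[OF incd, of C]) (use dC in auto)
  then have dconv: "convergent d" by (rule convergentI)
  have Cau: "\<exists>N. \<forall>m n. N \<le> m \<longrightarrow> N \<le> n \<longrightarrow> ?I (\<lambda>x. f m x - f n x) \<le> e" if e: "e > 0" for e
  proof -
    have "Cauchy d" using dconv by (simp add: Cauchy_convergent_iff)
    then obtain N1 where N1: "\<And>m n. N1 \<le> m \<Longrightarrow> N1 \<le> n \<Longrightarrow> \<bar>d m - d n\<bar> < e/8"
      using metric_CauchyD[of d "e/8"] e by (auto simp: dist_real_def)
    obtain N2 where N2: "q N2 < e/8" using reals_Archimedean[of "e/8"] e by (auto simp: inverse_eq_divide q_def)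
    have sm: "q n < e/8" if "N2 \<le> n" for n
    proof -
      have "q n \<le> q N2" unfolding q_def using that by (intro divide_left_mono) auto
      then show ?thesis using N2 by linarith
    qed
    have one: "?I (\<lambda>x. f m x - f n x) \<le> e" if mn: "max N1 N2 \<le> m" "m \<le> n" for m n
    proof -
      have le: "N1 \<le> m" "N1 \<le> n" "N2 \<le> m" "N2 \<le> n" using mn by auto
      have "d n - d m < e/8" using N1[OF le(2,1)] by (simp only: abs_less_iff)
      then show ?thesis using par[OF mn(2)] sm[OF le(3)] sm[OF le(4)] e by argo
    qed
    have "?I (\<lambda>x. f m x - f n x) \<le> e" if "max N1 N2 \<le> m" "max N1 N2 \<le> n" for m n
    proof (cases "m \<le> n")
      case True then show ?thesis using one that by auto
    next
      case False
      have "(f m x - f n x)\<^sup>2 = (f n x - f m x)\<^sup>2" for x by (rule power2_commute)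
      then show ?thesis using one[of n m] that False by simp
    qed
    then show ?thesis by blast
  qed
  obtain g where g: "L2 g" "\<And>x. x \<notin> S \<Longrightarrow> g x = 0" "\<And>e. e > 0 \<Longrightarrow> \<exists>N. \<forall>n\<ge>N. ?I (\<lambda>x. f n x - g x) \<le> e"
  proof (rule L2_complete[OF fL(1) S(1,2) fL(2) Cau])
    fix g assume g: "L2 g" "\<And>x. x \<notin> S \<Longrightarrow> g x = 0" "\<And>e. 0 < e \<Longrightarrow> \<exists>N. \<forall>n\<ge>N. ?I (\<lambda>x. f n x - g x) \<le> e"
    show thesis by (rule that[OF g])
  qed
  have "(\<integral>x. g x * \<phi> x \<partial>lborel) = L \<phi>" if \<phi>: "\<phi> \<in> T" for \<phi>
  proof (rule ccontr)
    assume ne: "(\<integral>x. g x * \<phi> x \<partial>lborel) \<noteq> L \<phi>"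
    define e where "e = \<bar>(\<integral>x. g x * \<phi> x \<partial>lborel) - L \<phi>\<bar> / 4"
    have e: "e > 0" using ne by (simp add: e_def)
    define B where "B = ?I \<phi> + 1"
    have B: "B > 0" "?I \<phi> \<le> B" by (auto simp: B_def intro: add_nonneg_pos)
    obtain N1 where N1: "\<And>j. N1 \<le> j \<Longrightarrow> \<bar>(\<integral>x. G j x * \<phi> x \<partial>lborel) - L \<phi>\<bar> < e"
      using LIMSEQ_D[OF lim[OF \<phi>] e] by auto
    obtain N2 where N2: "\<And>n. N2 \<le> n \<Longrightarrow> ?I (\<lambda>x. f n x - g x) \<le> e\<^sup>2 / B" using g(3)[of "e\<^sup>2/B"] e B by auto
    define n where "n = max N1 N2"
    have a: "\<bar>(\<integral>x. f n x * \<phi> x \<partial>lborel) - L \<phi>\<bar> \<le> e"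
    proof -
      have "\<forall>j\<ge>n. \<bar>(\<integral>x. G j x * \<phi> x \<partial>lborel) - L \<phi>\<bar> \<le> e" using N1 by (force simp: n_def)
      then show ?thesis using f(1)[of n] \<phi> by (auto simp: W_def)
    qed
    have "2 * \<bar>\<integral>x. (f n x - g x) * \<phi> x \<partial>lborel\<bar> \<le> (B/e) * ?I (\<lambda>x. f n x - g x) + ?I \<phi> / (B/e)"
      using e B by (intro L2_mult_bound L2_diff fL(1) g(1) T[OF \<phi>]) auto
    also have "(B/e) * ?I (\<lambda>x. f n x - g x) \<le> (B/e) * (e\<^sup>2/B)" using N2[of n] e B by (intro mult_left_mono) (auto simp: n_def)
    also have "(B/e) * (e\<^sup>2/B) = e" using e B by (simp add: power2_eq_square)
    also have "?I \<phi> / (B/e) \<le> e" using e B by (simp add: field_simps)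
    finally have "\<bar>\<integral>x. (f n x - g x) * \<phi> x \<partial>lborel\<bar> \<le> e" by simp
    moreover have "(\<integral>x. (f n x - g x) * \<phi> x \<partial>lborel) = (\<integral>x. f n x * \<phi> x \<partial>lborel) - (\<integral>x. g x * \<phi> x \<partial>lborel)"
      unfolding left_diff_distrib by (rule Bochner_Integration.integral_diff) (intro L2_mult fL(1) g(1) T[OF \<phi>])+
    ultimately have "\<bar>(\<integral>x. g x * \<phi> x \<partial>lborel) - L \<phi>\<bar> \<le> 2 * e" using a by linarith
    moreover have "a \<le> 2 * (a/4) \<Longrightarrow> a/4 > 0 \<Longrightarrow> False" for a :: real by simp
    ultimately show False using e unfolding e_def by blast
  qed
  note fin = this
  show ?thesis by (rule that[OF g(1) g(2) fin])
qed

section \<open>Translations, test functions and difference quotients\<close>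

lemma lborel_integral_shift:
  fixes f :: "'a::euclidean_space \<Rightarrow> real"
  assumes "f \<in> borel_measurable borel"
  shows "(\<integral>z. f (z + c) \<partial>lborel) = (\<integral>z. f z \<partial>lborel)"
proof -
  have "(\<integral>z. f z \<partial>lborel) = (\<integral>z. f z \<partial>(distr lborel borel ((+) c)))" by (simp add: lborel_distr_plus)
  also have "\<dots> = (\<integral>z. f (c + z) \<partial>lborel)" using assms by (intro integral_distr) auto
  finally show ?thesis by (simp add: add.commute)
qed

lemma lborel_integrable_shift:
  fixes f :: "'a::euclidean_space \<Rightarrow> real"
  assumes "f \<in> borel_measurable borel"
  shows "integrable lborel (\<lambda>z. f (z + c)) \<longleftrightarrow> integrable lborel f"
proof -
  have "integrable lborel f \<longleftrightarrow> integrable (distr lborel borel ((+) c)) f" by (simp add: lborel_distr_plus)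
  also have "\<dots> \<longleftrightarrow> integrable lborel (\<lambda>z. f (c + z))" using assms by (intro integrable_distr_eq) auto
  finally show ?thesis by (simp add: add.commute)
qed

lemma iter_pd_append: "iter_pd f (vs @ ws) = iter_pd (iter_pd f ws) vs"
  by (induction vs) auto

lemma smooth_pd:
  assumes "smooth f" "b \<in> Basis" shows "smooth (pd f b)"
  unfolding smooth_def
proof (intro allI impI)
  fix vs :: "'a list" assume "set vs \<subseteq> Basis"
  then have "set (vs @ [b]) \<subseteq> Basis" using assms by auto
  then have "(\<forall>z. iter_pd f (vs @ [b]) differentiable (at z)) \<and> continuous_on UNIV (iter_pd f (vs @ [b]))"
    using assms(1) unfolding smooth_def by blast
  then show "(\<forall>z. iter_pd (pd f b) vs differentiable (at z)) \<and> continuous_on UNIV (iter_pd (pd f b) vs)"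
    by (simp add: iter_pd_append)
qed

lemma smooth_basic:
  assumes "smooth f"
  shows "f differentiable (at z)" "continuous_on UNIV f"
  using assms[unfolded smooth_def, rule_format, of "[]"] by auto

lemma pd_zero_outside:
  assumes "z \<notin> closure {z. f z \<noteq> 0}" shows "pd f b z = 0"
proof -
  have "open (- closure {z. f z \<noteq> 0})" by auto
  then have ev: "\<forall>\<^sub>F y in nhds z. f y = 0"
    using assms closure_subset[of "{z. f z \<noteq> 0}"] by (auto simp: eventually_nhds)
  have "(f has_derivative (\<lambda>_. 0)) (at z)"
  proof (rule has_derivative_transform_eventually[where f = "\<lambda>_. 0"])
    show "\<forall>\<^sub>F y in at z. 0 = f y" using ev by (auto simp: eventually_at_filter elim: eventually_mono)
    show "0 = f z" using ev by (auto dest: eventually_nhds_x_imp_x)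
  qed auto
  then show ?thesis unfolding pd_def by (simp add: frechet_derivative_at[symmetric])
qed

lemma test_fun_pd:
  assumes "test_fun D f" "b \<in> Basis" shows "test_fun D (pd f b)"
proof -
  have "{z. pd f b z \<noteq> 0} \<subseteq> closure {z. f z \<noteq> 0}" using pd_zero_outside by blast
  then have c: "closure {z. pd f b z \<noteq> 0} \<subseteq> closure {z. f z \<noteq> 0}" by (simp add: closure_minimal)
  then have "compact (closure {z. pd f b z \<noteq> 0})" using assms(1) compact_Int_closed[of "closure {z. f z \<noteq> 0}" "closure {z. pd f b z \<noteq> 0}"]
    unfolding test_fun_def by (simp add: Int_absorb1)
  then show ?thesis using assms c smooth_pd unfolding test_fun_def by blast
qed

lemma test_fun_bounded:
  assumes "test_fun D f"
  obtains B R where "B > 0" "\<And>z. \<bar>f z\<bar> \<le> B" "R > 0" "\<And>z. R < norm z \<Longrightarrow> f z = 0"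
proof -
  let ?K = "closure {z. f z \<noteq> 0}"
  have K: "compact ?K" and c: "continuous_on UNIV f" using assms smooth_basic by (auto simp: test_fun_def)
  have "compact (f ` ?K)" using K c by (intro compact_continuous_image continuous_on_subset[OF c]) auto
  then obtain B where B: "B > 0" "\<forall>y\<in>f ` ?K. norm y \<le> B" using compact_imp_bounded bounded_pos by metis
  obtain R where R: "R > 0" "\<forall>z\<in>?K. norm z \<le> R" using compact_imp_bounded[OF K] bounded_pos by metis
  have out: "f z = 0" if "z \<notin> ?K" for z using that closure_subset[of "{z. f z \<noteq> 0}"] by auto
  have "\<bar>f z\<bar> \<le> B" for z using B out[of z] by (cases "z \<in> ?K") auto
  moreover have "f z = 0" if "R < norm z" for z using R out[of z] that by force
  ultimately show ?thesis using that[of B R] B R by blast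
qed

lemma test_fun_measurable: "test_fun D f \<Longrightarrow> f \<in> borel_measurable borel"
  using smooth_basic by (auto simp: test_fun_def intro: borel_measurable_continuous_onI)

lemma test_fun_L2: "test_fun D (f :: 'a::euclidean_space \<Rightarrow> real) \<Longrightarrow> L2 f"
proof -
  assume f: "test_fun D f"
  obtain B R where BR: "B > 0" "\<And>z. \<bar>f z\<bar> \<le> B" "R > 0" "\<And>z. R < norm z \<Longrightarrow> f z = 0" using test_fun_bounded[OF f] by metis
  show "L2 f"
    by (rule L2_bounded_support[where S = "cball 0 R" and C = B]) (use BR test_fun_measurable[OF f] in \<open>auto simp: not_le intro: emeasure_bounded_finite[simplified]\<close>)
qed

lemma line_derivative:
  assumes "smooth f"
  shows "((\<lambda>s. f (z + s *\<^sub>R b)) has_real_derivative pd f b (z + s *\<^sub>R b)) (at s)"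
proof -
  have "(f has_derivative frechet_derivative f (at (z + s *\<^sub>R b))) (at (z + s *\<^sub>R b))"
    using smooth_basic(1)[OF assms] by (simp add: frechet_derivative_works)
  moreover have "((\<lambda>s. z + s *\<^sub>R b) has_derivative (\<lambda>t. t *\<^sub>R b)) (at s)" by (auto intro!: derivative_eq_intros)
  ultimately have "((\<lambda>s. f (z + s *\<^sub>R b)) has_derivative (\<lambda>t. frechet_derivative f (at (z + s *\<^sub>R b)) (t *\<^sub>R b))) (at s)"
    by (rule has_derivative_compose[rotated])
  moreover have "frechet_derivative f (at (z + s *\<^sub>R b)) (t *\<^sub>R b) = pd f b (z + s *\<^sub>R b) * t" for t
    using linear_cmul[OF linear_frechet_derivative[OF smooth_basic(1)[OF assms]]] by (simp add: pd_def)
  ultimately show ?thesis by (simp add: has_field_derivative_def)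
qed

lemma diff_quotient_tendsto:
  assumes "smooth f" "s \<longlonglongrightarrow> 0" "\<And>n. s n \<noteq> 0"
  shows "(\<lambda>n. (f (z + s n *\<^sub>R b) - f z) / s n) \<longlonglongrightarrow> pd f b z"
proof -
  have "((\<lambda>s. f (z + s *\<^sub>R b)) has_real_derivative pd f b z) (at 0)" using line_derivative[OF assms(1), of z b 0] by simp
  then have "((\<lambda>t. (f (z + t *\<^sub>R b) - f z) / t) \<longlongrightarrow> pd f b z) (at 0)" by (simp add: has_field_derivative_iff)
  moreover have "filterlim s (at 0) sequentially" using assms by (simp add: filterlim_at)
  ultimately show ?thesis by (rule filterlim_compose)
qed

lemma diff_quotient_bound:
  assumes "smooth f" "\<And>z. \<bar>pd f b z\<bar> \<le> B" "s \<noteq> 0"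
  shows "\<bar>(f (z + s *\<^sub>R b) - f z) / s\<bar> \<le> B"
proof -
  have pos: "\<bar>f (z + s *\<^sub>R b) - f z\<bar> \<le> B * s" if s: "s > 0" for s z
  proof -
    obtain \<xi> where "f (z + s *\<^sub>R b) - f (z + 0 *\<^sub>R b) = (s - 0) * pd f b (z + \<xi> *\<^sub>R b)"
      using MVT2[OF s, of "\<lambda>s. f (z + s *\<^sub>R b)" "\<lambda>s. pd f b (z + s *\<^sub>R b)"] line_derivative[OF assms(1)] by auto
    then have "\<bar>f (z + s *\<^sub>R b) - f z\<bar> = s * \<bar>pd f b (z + \<xi> *\<^sub>R b)\<bar>" using s by (simp add: abs_mult)
    also have "\<dots> \<le> s * B" using assms(2) s by (intro mult_left_mono) auto
    finally show ?thesis by (simp add: mult.commute)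
  qed
  show ?thesis
  proof (cases "s > 0")
    case True then show ?thesis using pos[OF True, of z] by (simp add: abs_divide divide_le_eq mult.commute)
  next
    case False
    then have s: "- s > 0" using assms by auto
    have "z + s *\<^sub>R b + (- s) *\<^sub>R b = z" by simp
    then have "\<bar>f z - f (z + s *\<^sub>R b)\<bar> \<le> B * (- s)" using pos[OF s, of "z + s *\<^sub>R b"] by metis
    then have "\<bar>f (z + s *\<^sub>R b) - f z\<bar> \<le> B * \<bar>s\<bar>" using s by (simp add: abs_minus_commute)
    then show ?thesis using assms(3) by (simp add: abs_divide divide_le_eq)
  qed
qed

text \<open>Dominated convergence. \<open>F n\<close> converges on \<open>D\<close> only; elsewhere
  the difference quotients tend to 0, since the support of \<open>f\<close> is a closed subset of
  \<open>D\<close>, and boundedness of \<open>F n\<close> is enough.\<close>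

lemma dq_limit:
  fixes f :: "'a::euclidean_space \<Rightarrow> real"
  assumes f: "test_fun D f" and b: "b \<in> Basis" and D: "open D"
    and F: "\<And>n. F n \<in> borel_measurable borel" "G \<in> borel_measurable borel" "\<And>n z. \<bar>F n z\<bar> \<le> C"
    and lim: "\<And>z. z \<in> D \<Longrightarrow> (\<lambda>n. F n z) \<longlonglongrightarrow> G z"
    and s: "s \<longlonglongrightarrow> 0" "\<And>n. s n \<noteq> 0" "\<And>n. \<bar>s n\<bar> \<le> 1"
  shows "(\<lambda>n. \<integral>z. F n z * ((f (z + s n *\<^sub>R b) - f z) / s n) \<partial>lborel) \<longlonglongrightarrow> (\<integral>z. G z * pd f b z \<partial>lborel)"
proof -
  have sm: "smooth f" using f by (auto simp: test_fun_def)
  obtain B R where BR: "B > 0" "\<And>z. \<bar>pd f b z\<bar> \<le> B" "R > 0" "\<And>z. R < norm z \<Longrightarrow> pd f b z = 0"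
    using test_fun_bounded[OF test_fun_pd[OF f b]] by metis
  obtain B' R' where BR': "R' > 0" "\<And>z. R' < norm z \<Longrightarrow> f z = 0" using test_fun_bounded[OF f] by metis
  have C0: "C \<ge> 0" using F(3)[of 0 0] by linarith
  have [measurable]: "f \<in> borel_measurable borel" "pd f b \<in> borel_measurable borel" "\<And>n. F n \<in> borel_measurable borel" "G \<in> borel_measurable borel"
    using test_fun_measurable f test_fun_pd[OF f b] F by auto
  show ?thesis
  proof (rule integral_dominated_convergence[where w = "\<lambda>z. C * B * indicator (cball 0 (R' + 1)) z"])
    show "integrable lborel (\<lambda>z. C * B * indicator (cball 0 (R' + 1)) z)"
      by (intro integrable_mult_right integrable_real_indicator emeasure_bounded_finite) auto
    show "AE z in lborel. (\<lambda>n. F n z * ((f (z + s n *\<^sub>R b) - f z) / s n)) \<longlonglongrightarrow> G z * pd f b z"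
    proof (rule AE_I2)
      fix z
      have dq: "(\<lambda>n. (f (z + s n *\<^sub>R b) - f z) / s n) \<longlonglongrightarrow> pd f b z" by (rule diff_quotient_tendsto[OF sm s(1,2)])
      show "(\<lambda>n. F n z * ((f (z + s n *\<^sub>R b) - f z) / s n)) \<longlonglongrightarrow> G z * pd f b z"
      proof (cases "z \<in> D")
        case True then show ?thesis by (intro tendsto_mult dq lim)
      next
        case False
        let ?K = "closure {z. f z \<noteq> 0}"
        have zK: "z \<notin> ?K" using False f by (auto simp: test_fun_def)
        have p0: "pd f b z = 0" using pd_zero_outside[OF zK] .
        have "(\<lambda>n. (f (z + s n *\<^sub>R b) - f z) / s n) \<longlonglongrightarrow> 0" using dq p0 by simp
        then have "(\<lambda>n. C * \<bar>(f (z + s n *\<^sub>R b) - f z) / s n\<bar>) \<longlonglongrightarrow> C * \<bar>0\<bar>" by (intro tendsto_intros)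
        then have c0: "(\<lambda>n. C * \<bar>(f (z + s n *\<^sub>R b) - f z) / s n\<bar>) \<longlonglongrightarrow> 0" by simp
        have "(\<lambda>n. F n z * ((f (z + s n *\<^sub>R b) - f z) / s n)) \<longlonglongrightarrow> 0"
        proof (rule Lim_null_comparison[OF _ c0])
          show "\<forall>\<^sub>F n in sequentially. norm (F n z * ((f (z + s n *\<^sub>R b) - f z) / s n)) \<le> C * \<bar>(f (z + s n *\<^sub>R b) - f z) / s n\<bar>"
            using F(3) by (intro always_eventually allI) (simp only: real_norm_def abs_mult, intro mult_right_mono, auto)
        qed
        then show ?thesis using p0 by simp
      qed
    qed
    show "AE z in lborel. norm (F n z * ((f (z + s n *\<^sub>R b) - f z) / s n)) \<le> C * B * indicator (cball 0 (R' + 1)) z" for n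
    proof (rule AE_I2)
      fix z
      show "norm (F n z * ((f (z + s n *\<^sub>R b) - f z) / s n)) \<le> C * B * indicator (cball 0 (R' + 1)) z"
      proof (cases "z \<in> cball 0 (R'+1)")
        case True
        have "\<bar>F n z\<bar> * \<bar>(f (z + s n *\<^sub>R b) - f z) / s n\<bar> \<le> C * B"
          using F(3) C0 diff_quotient_bound[OF sm BR(2) s(2)] by (intro mult_mono) auto
        then show ?thesis using True by (simp only: real_norm_def abs_mult) simp
      next
        case False
        then have nz: "norm z > R' + 1" by (simp add: not_le)
        have "norm (s n *\<^sub>R b) \<le> 1" using s(3)[of n] b by (simp add: norm_Basis)
        then have "norm (z + s n *\<^sub>R b) > R'" using norm_triangle_ineq2[of z "- (s n *\<^sub>R b)"] nz by simp
        then have "f (z + s n *\<^sub>R b) = 0" "f z = 0" using BR' nz by auto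
        then show ?thesis using False by simp
      qed
    qed
  qed (use BR in measurable)
qed

section \<open>Weak solutions of the Dirichlet problem\<close>

lemma measure_lborel_Times:
  fixes A :: "'a::euclidean_space set" and B :: "'b::euclidean_space set"
  assumes "A \<in> sets borel" "B \<in> sets borel"
  shows "measure lborel (A \<times> B) = measure lborel A * measure lborel B"
proof -
  have "emeasure (lborel \<Otimes>\<^sub>M lborel) (A \<times> B) = emeasure lborel A * emeasure lborel B"
    using assms by (intro lborel.emeasure_pair_measure_Times) auto
  then show ?thesis by (simp add: lborel_prod measure_def enn2real_mult)
qed

lemma rnd_measurable: "rnd h \<in> borel_measurable borel"
proof -
  have "rnd h = (\<lambda>x::real^'a. \<Sum>i\<in>UNIV. (h * of_int \<lfloor>x $ i / h\<rfloor>) *\<^sub>R axis i 1)"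
    by (auto simp: fun_eq_iff rnd_def vec_eq_iff axis_def if_distrib[of "\<lambda>x. _ * x"] cong: if_cong)
  moreover have [measurable]: "(\<lambda>x::real^'a. x $ i) \<in> borel_measurable borel" for i
    by (intro borel_measurable_continuous_onI continuous_intros)
  have "(\<lambda>x::real^'a. \<Sum>i\<in>UNIV. (h * of_int \<lfloor>x $ i / h\<rfloor>) *\<^sub>R axis i 1 :: real^'a) \<in> borel_measurable borel"
    by measurable
  ultimately show ?thesis by simp
qed

lemma integrable_bounded_mult:
  fixes a b :: "'a::euclidean_space \<Rightarrow> real"
  assumes "a \<in> borel_measurable borel" "b \<in> borel_measurable borel" and ab: "\<And>z. \<bar>a z\<bar> \<le> A" "\<And>z. \<bar>b z\<bar> \<le> B"
    and S: "\<And>z. z \<notin> S \<Longrightarrow> b z = 0" "S \<in> sets lborel" "emeasure lborel S < \<infinity>"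
  shows "integrable lborel (\<lambda>z. a z * b z)"
proof (rule L2_bounded_support(2)[where S = S and C = "A * B"])
  show "\<bar>a z * b z\<bar> \<le> A * B" for z
  proof -
    have "A \<ge> 0" using ab(1)[of z] by linarith
    then show ?thesis unfolding abs_mult using ab[of z] by (intro mult_mono) auto
  qed
qed (use assms in auto)

section \<open>Step functions and the energy estimate\<close>

context pme
begin

lemma good_continuous: "good M \<Lambda> \<Psi> \<Longrightarrow> continuous_on UNIV \<Psi>"
proof -
  assume g: "good M \<Lambda> \<Psi>"
  show ?thesis unfolding continuous_on_iff
  proof (intro ballI allI impI)
    fix z and e :: real assume e: "e > 0"
    have L: "\<Lambda> > 0" "\<And>z z'. \<bar>\<Psi> z - \<Psi> z'\<bar> \<le> \<Lambda> * dist z z'" using g by (auto simp: good_def)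
    have "dist (\<Psi> z') (\<Psi> z) < e" if "dist z' z < e / \<Lambda>" for z'
    proof -
      have "\<Lambda> * dist z' z < e" using that L by (simp add: field_simps)
      then show ?thesis using L(2)[of z' z] by (simp add: dist_real_def)
    qed
    then show "\<exists>d>0. \<forall>x'\<in>UNIV. dist x' z < d \<longrightarrow> dist (\<Psi> x') (\<Psi> z) < e" using e L by (intro exI[of _ "e/\<Lambda>"]) auto
  qed
qed

lemma dsol_measurable:
  assumes g: "good M \<Lambda> \<Psi>" and U: "open U"
  shows "dsol h U t0 \<Psi> k \<in> borel_measurable borel"
proof -
  have [measurable]: "rnd h \<in> borel_measurable borel" "\<Psi> \<in> borel_measurable borel" "U \<in> sets borel"
    using rnd_measurable borel_measurable_continuous_onI[OF good_continuous[OF g]] U by auto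
  have P: "(\<lambda>x. \<Psi> (rnd h x, t)) \<in> borel_measurable borel" for t
  proof -
    have "(\<lambda>x. (rnd h x, t)) \<in> borel_measurable borel" by (intro borel_measurable_Pair) auto
    then show ?thesis by measurable
  qed
  show ?thesis
  proof (induction k)
    case 0 then show ?case using P by (simp add: dsol.simps)
  next
    case (Suc k)
    note [measurable] = Suc P
    have [measurable]: "(\<lambda>x. dsol h U t0 \<Psi> k (x + c)) \<in> borel_measurable borel" "(\<lambda>x. dsol h U t0 \<Psi> k (x - c)) \<in> borel_measurable borel" for c
      by measurable
    have [measurable]: "lap h (dsol h U t0 \<Psi> k) \<in> borel_measurable borel" unfolding lap_def by measurable
    show ?case unfolding dsol.simps by measurable
  qed
qed

lemma wfun_measurable:
  assumes g: "good M \<Lambda> \<Psi>" and U: "open U"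
  shows "wfun U t0 \<Psi> h \<in> borel_measurable borel"
proof -
  have [measurable]: "dsol h U t0 \<Psi> k \<in> borel_measurable borel" for k by (rule dsol_measurable[OF g U])
  have [measurable]: "(fst :: 'n pt \<Rightarrow> _) \<in> borel_measurable borel" "(snd :: 'n pt \<Rightarrow> _) \<in> borel_measurable borel"
    by (auto intro!: borel_measurable_continuous_onI continuous_on_fst continuous_on_snd continuous_on_id)
  show ?thesis unfolding wfun_def
    by (rule measurable_compose_countable[where f = "\<lambda>k z. dsol h U t0 \<Psi> k (fst z)"]) measurable
qed

text \<open>The data sampled exactly as \<open>wfun\<close> samples the solution, so that the
  difference of the two vanishes wherever the lattice point is outside \<open>U\<close>.\<close>

definition pfun :: "real \<Rightarrow> ('n pt \<Rightarrow> real) \<Rightarrow> real \<Rightarrow> 'n pt \<Rightarrow> real" where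
  "pfun t0 \<Psi> h z = \<Psi> (rnd h (fst z), t0 + real (nat \<lfloor>(snd z - t0) / (l * h\<^sup>2)\<rfloor>) * (l * h\<^sup>2))"

lemma pfun_measurable:
  assumes g: "good M \<Lambda> \<Psi>"
  shows "pfun t0 \<Psi> h \<in> borel_measurable borel"
proof -
  have [measurable]: "rnd h \<in> borel_measurable borel" "\<Psi> \<in> borel_measurable borel"
    using rnd_measurable borel_measurable_continuous_onI[OF good_continuous[OF g]] by auto
  have [measurable]: "(fst :: 'n pt \<Rightarrow> _) \<in> borel_measurable borel" "(snd :: 'n pt \<Rightarrow> _) \<in> borel_measurable borel"
    by (auto intro!: borel_measurable_continuous_onI continuous_on_fst continuous_on_snd continuous_on_id)
  have "(\<lambda>z::'n pt. (rnd h (fst z), t0 + real (nat \<lfloor>(snd z - t0) / (l * h\<^sup>2)\<rfloor>) * (l * h\<^sup>2))) \<in> borel_measurable borel"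
    by (intro borel_measurable_Pair) measurable
  then show ?thesis unfolding pfun_def by measurable
qed

lemma wfun_outside: "rnd h (fst z) \<notin> U \<Longrightarrow> wfun U t0 \<Psi> h z = pfun t0 \<Psi> h z"
  by (simp add: wfun_def pfun_def dsol_outside)

lemma next_step:
  assumes "h > 0" "t0 \<le> t"
  shows "nat \<lfloor>(t + l * h\<^sup>2 - t0) / (l * h\<^sup>2)\<rfloor> = Suc (nat \<lfloor>(t - t0) / (l * h\<^sup>2)\<rfloor>)"
proof -
  have \<tau>: "l * h\<^sup>2 > 0" using assms l0 by simp
  have "t + l * h\<^sup>2 - t0 = (t - t0) + l * h\<^sup>2" by simp
  then have "(t + l * h\<^sup>2 - t0) / (l * h\<^sup>2) = ((t - t0) + l * h\<^sup>2) / (l * h\<^sup>2)" by (rule arg_cong)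
  also have "\<dots> = (t - t0) / (l * h\<^sup>2) + 1" unfolding add_divide_distrib using assms l0 by simp
  finally have "(t + l * h\<^sup>2 - t0) / (l * h\<^sup>2) = (t - t0) / (l * h\<^sup>2) + 1" .
  moreover have "(t - t0) / (l * h\<^sup>2) \<ge> 0" using assms \<tau> by simp
  ultimately show ?thesis by (simp add: Suc_nat_eq_nat_zadd1)
qed

lemma wfun_step:
  assumes h: "h > 0" and t: "t0 \<le> snd z" and pb: "\<forall>z. 0 \<le> \<Psi> z \<and> \<Psi> z \<le> M" and U: "rnd h (fst z) \<in> U"
  shows "rt (wfun U t0 \<Psi> h (z + (0, l * h\<^sup>2))) = rt (wfun U t0 \<Psi> h z)
    + l * (\<Sum>i\<in>UNIV. wfun U t0 \<Psi> h (z + h *\<^sub>R (axis i 1, 0)) + wfun U t0 \<Psi> h (z - h *\<^sub>R (axis i 1, 0)) - 2 * wfun U t0 \<Psi> h z)"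
  using dsol_scheme[OF pb U, of t0 "nat \<lfloor>(snd z - t0) / (l * h\<^sup>2)\<rfloor>"] next_step[OF h t]
  by (simp add: scheme_def wfun_def lap_def)

text \<open>The ratio \<open>rt x / x\<close> decreases. Near zero a difference of roots is not
  controlled by the difference of values, but its product with \<open>a\<close> is, and the time
  term of the energy estimate contains this product.\<close>

lemma root_decrease:
  assumes "0 \<le> b" "b \<le> a"
  shows "(rt a - rt b) * a \<le> rt a * (a - b)"
proof (cases "b = 0")
  case True then show ?thesis using m1 by simp
next
  case False
  then have b: "b > 0" and a: "a > 0" using assms by auto
  have "a powr (1/m - 1) \<le> b powr (1/m - 1)" using powr_neg_mono[OF b assms(2) m1] .
  then have "(a * b) * a powr (1/m - 1) \<le> (a * b) * b powr (1/m - 1)" using a b by (intro mult_left_mono) auto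
  moreover have "a * a powr (1/m - 1) = rt a" "b * b powr (1/m - 1) = rt b"
    using a b by (simp_all add: powr_mult_base)
  ultimately have "rt a * b \<le> rt b * a" by (metis (no_types, lifting) mult.assoc mult.commute)
  then show ?thesis by (simp add: algebra_simps)
qed

text \<open>The scheme is tested with \<open>v\<close>, the solution minus the data, which vanishes
  outside \<open>U\<close>. Summation by parts in space gives squared differences; the time term is
  of the order of the time step \<open>l * h\<^sup>2\<close>, so division by
  \<open>h\<^sup>2\<close> leaves a constant free of the mesh.\<close>

lemma energy:
  assumes g: "good M \<Lambda> \<Psi>" and UD: "\<forall>x\<in>U. norm x \<le> D" and U: "open U" and T: "T > 0"
  obtains C where "\<And>h i. 0 < h \<Longrightarrow> N * h + h \<le> 1 \<Longrightarrow>
     (\<integral>z. indicator (cball 0 (D+2) \<times> {t0..<t0+T}) z * ((wfun U t0 \<Psi> h (z + h *\<^sub>R (axis i 1, 0)) - wfun U t0 \<Psi> h z) / h)\<^sup>2 \<partial>lborel) \<le> C"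
proof -
  define Q where "Q = (cball 0 (D+2) \<times> {t0..<t0+T} :: 'n pt set)"
  define vol where "vol = measure lborel (cball 0 (D+2) :: (real^'n) set)"
  define K1 where "K1 = \<Lambda> + \<Lambda> / (4 * N * l)"
  \<comment> \<open>Bound of the time term per unit of time step: the decrease of \<open>w\<close>,
    the variation of the data in time, and what telescoping leaves at the final time.\<close>
  define c1 where "c1 = (rt M * K1 + rt M * \<Lambda>) * measure lborel Q + rt M * M * vol"
  define C where "C = N * \<Lambda>\<^sup>2 * measure lborel Q + 2 * c1"
  have \<Lambda>: "\<Lambda> > 0" and pb: "\<forall>z. 0 \<le> \<Psi> z \<and> \<Psi> z \<le> M" using g by (auto simp: good_def)
  have K10: "K1 > 0" unfolding K1_def using \<Lambda> N1 l0 by (intro add_pos_nonneg) auto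
  have Qb: "Q \<in> sets borel" by (auto simp: Q_def intro!: borel_Times)
  have Qf: "emeasure lborel Q < \<infinity>" unfolding Q_def by (intro emeasure_bounded_finite bounded_Times) auto
  have Qs: "Q \<in> sets lborel" using Qb by simp
  have "(\<integral>z. indicator Q z * ((wfun U t0 \<Psi> h (z + h *\<^sub>R (axis i 1, 0)) - wfun U t0 \<Psi> h z) / h)\<^sup>2 \<partial>lborel) \<le> C"
    if h: "0 < h" "N * h + h \<le> 1" for h i
  proof -
    define \<tau> where "\<tau> = l * h\<^sup>2"
    have \<tau>0: "\<tau> > 0" using h l0 by (simp add: \<tau>_def)
    define e where "e = (\<lambda>i. h *\<^sub>R ((axis i 1, 0) :: 'n pt))"
    define et where "et = ((0, \<tau>) :: 'n pt)"
    define w where "w = wfun U t0 \<Psi> h"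
    define P where "P = pfun t0 \<Psi> h"
    define V where "V = {z :: 'n pt. rnd h (fst z) \<in> U \<and> t0 \<le> snd z \<and> snd z < t0 + T}"
    have [measurable]: "w \<in> borel_measurable borel" "P \<in> borel_measurable borel" "rnd h \<in> borel_measurable borel" "U \<in> sets borel" "Q \<in> sets borel"
      using wfun_measurable[OF g U] pfun_measurable[OF g] rnd_measurable U Qb by (auto simp: w_def P_def)
    have [measurable]: "(fst :: 'n pt \<Rightarrow> _) \<in> borel_measurable borel" "(snd :: 'n pt \<Rightarrow> _) \<in> borel_measurable borel"
      by (auto intro!: borel_measurable_continuous_onI continuous_on_fst continuous_on_snd continuous_on_id)
    have [measurable]: "V \<in> sets borel" unfolding V_def by measurable
    have wb: "0 \<le> w z" "w z \<le> M" for z using dsol_bounds[OF pb] by (auto simp: w_def wfun_def)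
    have Pb: "0 \<le> P z" "P z \<le> M" for z using pb by (auto simp: P_def pfun_def)
    have ub: "0 \<le> rt (w z)" "rt (w z) \<le> rt M" for z using root_mono[OF m1 wb] by auto
    have uab: "\<bar>rt (w z) - rt (w z')\<bar> \<le> rt M" for z z' using ub[of z] ub[of z'] by linarith
    have VQ: "z \<in> Q" if "z \<in> V" for z
    proof -
      have "norm (rnd h (fst z)) \<le> D" using that UD by (auto simp: V_def)
      moreover have "dist (fst z) (rnd h (fst z)) \<le> N * h" using dist_rnd[OF h(1)] by (simp add: N_def)
      ultimately have "norm (fst z) \<le> D + 1" using norm_triangle_sub[of "fst z" "rnd h (fst z)"] h by (simp add: dist_norm)
      then show ?thesis using that by (auto simp: V_def Q_def mem_Times_iff)
    qed
    have VQ': "z \<in> Q" if "z + e i \<in> V" for z i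
    proof -
      have "norm (rnd h (fst (z + e i))) \<le> D" using that UD by (auto simp: V_def)
      moreover have "dist (fst (z + e i)) (rnd h (fst (z + e i))) \<le> N * h" using dist_rnd[OF h(1)] by (simp add: N_def)
      ultimately have "norm (fst (z + e i)) \<le> D + N * h" using norm_triangle_sub[of "fst (z + e i)" "rnd h (fst (z + e i))"] by (simp add: dist_norm)
      moreover have "norm (fst z) \<le> norm (fst (z + e i)) + h"
        using norm_triangle_sub[of "fst z" "fst (z + e i)"] h by (simp add: e_def)
      ultimately have "norm (fst z) \<le> D + 1" using h by linarith
      then show ?thesis using that by (auto simp: V_def Q_def mem_Times_iff e_def)
    qed
    define v where "v = (\<lambda>z. indicator V z * (w z - P z))"
    have vm[measurable]: "v \<in> borel_measurable borel" unfolding v_def by measurable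
    have vb: "\<bar>v z\<bar> \<le> M" for z using wb[of z] Pb[of z] by (auto simp: v_def indicator_def)
    have vQ: "v z = 0" if "z \<notin> Q" for z using VQ[of z] that by (auto simp: v_def indicator_def)
    have vJ: "v z = w z - P z" if "t0 \<le> snd z" "snd z < t0 + T" for z
      using that wfun_outside[of h z U t0 \<Psi>] by (auto simp: v_def V_def indicator_def w_def P_def)
    define E where "E = (\<lambda>i z. w (z + e i) - w z)"
    have [measurable]: "E i \<in> borel_measurable borel" for i unfolding E_def by measurable
    have Eb: "\<bar>E i z\<bar> \<le> M" for i z using wb[of z] wb[of "z + e i"] by (auto simp: E_def)
    have Qi: "emeasure lborel ((\<lambda>z. z + e i) -` Q) < \<infinity>" "(\<lambda>z. z + e i) -` Q \<in> sets lborel" for i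
    proof -
      have "(\<lambda>z. z + e i) -` Q = (\<lambda>z. - e i + z) ` Q" by (auto simp: image_iff) (metis add.commute diff_add_cancel uminus_add_conv_diff)
      moreover have "bounded ((\<lambda>z. - e i + z) ` Q)" unfolding Q_def by (intro bounded_translation bounded_Times) auto
      ultimately show "emeasure lborel ((\<lambda>z. z + e i) -` Q) < \<infinity>" by (simp only: emeasure_bounded_finite)
      have "(\<lambda>z. z + e i) -` Q \<inter> space borel \<in> sets borel" by measurable
      then show "(\<lambda>z. z + e i) -` Q \<in> sets lborel" by simp
    qed
    have i1: "integrable lborel (\<lambda>z. E i z * v z)" for i by (rule integrable_bounded_mult[OF _ _ Eb vb vQ Qs Qf]) auto
    have i2: "integrable lborel (\<lambda>z. E i z * v (z + e i))" for i
      by (rule integrable_bounded_mult[OF _ _ Eb, where B = M and S = "(\<lambda>z. z + e i) -` Q"]) (use vb vQ Qi in auto)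
    have i3: "integrable lborel (\<lambda>z. E i (z - e i) * v z)" for i by (rule integrable_bounded_mult[OF _ _ Eb vb vQ Qs Qf]) auto
    have parts: "(\<integral>z. E i z * (v (z + e i) - v z) \<partial>lborel) = - (\<integral>z. (w (z + e i) + w (z - e i) - 2 * w z) * v z \<partial>lborel)" for i
    proof -
      have "(\<integral>z. E i z * v (z + e i) \<partial>lborel) = (\<integral>z. (\<lambda>z. E i z * v (z + e i)) (z + (- e i)) \<partial>lborel)"
        by (rule lborel_integral_shift[symmetric]) auto
      also have "\<dots> = (\<integral>z. E i (z - e i) * v z \<partial>lborel)" by simp
      finally have s: "(\<integral>z. E i z * v (z + e i) \<partial>lborel) = (\<integral>z. E i (z - e i) * v z \<partial>lborel)" .
      have "(\<integral>z. E i z * (v (z + e i) - v z) \<partial>lborel) = (\<integral>z. E i z * v (z + e i) \<partial>lborel) - (\<integral>z. E i z * v z \<partial>lborel)"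
        unfolding right_diff_distrib by (rule Bochner_Integration.integral_diff[OF i2 i1])
      also have "\<dots> = (\<integral>z. E i (z - e i) * v z - E i z * v z \<partial>lborel)"
        unfolding s by (rule Bochner_Integration.integral_diff[OF i3 i1, symmetric])
      also have "\<dots> = (\<integral>z. - ((w (z + e i) + w (z - e i) - 2 * w z) * v z) \<partial>lborel)"
        by (intro Bochner_Integration.integral_cong) (auto simp: E_def algebra_simps)
      finally show ?thesis by simp
    qed
    have i4: "integrable lborel (\<lambda>z. (w (z + e i) + w (z - e i) - 2 * w z) * v z)" for i
    proof -
      have "integrable lborel (\<lambda>z. E i z * v z - E i (z - e i) * v z)" by (rule Bochner_Integration.integrable_diff[OF i1 i3])
      then show ?thesis by (simp add: E_def algebra_simps)
    qed
    have "l * (\<Sum>i\<in>UNIV. \<integral>z. E i z * (v (z + e i) - v z) \<partial>lborel)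
       = - (\<integral>z. l * (\<Sum>i\<in>UNIV. (w (z + e i) + w (z - e i) - 2 * w z) * v z) \<partial>lborel)"
      unfolding parts using i4 by (simp add: sum_negf)
    also have "\<dots> = - (\<integral>z. (rt (w (z + et)) - rt (w z)) * v z \<partial>lborel)"
    proof -
      have "l * (\<Sum>i\<in>UNIV. (w (z + e i) + w (z - e i) - 2 * w z) * v z) = (rt (w (z + et)) - rt (w z)) * v z" for z
      proof (cases "z \<in> V")
        case True
        then have "rt (w (z + et)) = rt (w z) + l * (\<Sum>i\<in>UNIV. w (z + e i) + w (z - e i) - 2 * w z)"
          unfolding w_def et_def \<tau>_def e_def using wfun_step[OF h(1) _ pb] by (auto simp: V_def)
        then show ?thesis by (simp add: sum_distrib_right[symmetric])
      qed (simp add: v_def)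
      then show ?thesis by simp
    qed
    also have "\<dots> = (\<integral>z. (rt (w z) - rt (w (z + et))) * v z \<partial>lborel)"
      by (subst integral_minus[symmetric]) (intro Bochner_Integration.integral_cong; auto simp: algebra_simps)
    finally have id1: "l * (\<Sum>i\<in>UNIV. \<integral>z. E i z * (v (z + e i) - v z) \<partial>lborel) = (\<integral>z. (rt (w z) - rt (w (z + et))) * v z \<partial>lborel)" .
    \<comment> \<open>Summation by parts in time for the root times the data: the increments of
      \<open>F\<close> telescope, and the remaining term carries the time difference of the data,
      which is of size \<open>\<tau>\<close>.\<close>
    define F where "F = (\<lambda>z. rt (w z) * P z)"
    have [measurable]: "F \<in> borel_measurable borel" unfolding F_def by measurable
    have Fb: "0 \<le> F z" "F z \<le> rt M * M" for z
      unfolding F_def using ub[of z] Pb[of z] by (auto intro!: mult_mono mult_nonneg_nonneg)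
    define c where "c = rt M * K1 * \<tau> + rt M * \<Lambda> * \<tau>"
    have c0: "c \<ge> 0" unfolding c_def using K10 \<Lambda> \<tau>0 by (intro add_nonneg_nonneg mult_nonneg_nonneg) auto
    have pt: "(rt (w z) - rt (w (z + et))) * v z \<le> c * indicator Q z + (indicator V z * F (z + et) - indicator V z * F z)" for z
    proof (cases "z \<in> V")
      case False
      then show ?thesis using c0 by (simp add: v_def)
    next
      case True
      then have tz: "t0 \<le> snd z" by (auto simp: V_def)
      define a where "a = w z"
      define b where "b = w (z + et)"
      have ab: "a - b \<le> K1 * \<tau>"
        unfolding a_def b_def w_def wfun_def et_def K1_def \<tau>_def using dsol_one_sided[OF h(1) g] next_step[OF h(1) tz] by simp
      have 1: "(rt a - rt b) * a \<le> rt M * K1 * \<tau>"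
      proof (cases "b \<le> a")
        case True
        have "(rt a - rt b) * a \<le> rt a * (a - b)" using root_decrease[OF _ True] wb by (simp add: b_def)
        also have "\<dots> \<le> rt M * (K1 * \<tau>)" using ub[of z] ab True by (intro mult_mono) (auto simp: a_def)
        finally show ?thesis by simp
      next
        case False
        then have "rt a \<le> rt b" using wb by (intro root_mono[OF m1]) (auto simp: a_def)
        then have "(rt a - rt b) * a \<le> 0" using wb by (intro mult_nonpos_nonneg) (auto simp: a_def)
        also have "0 \<le> rt M * K1 * \<tau>" using K10 \<tau>0 by simp
        finally show ?thesis .
      qed
      have 2: "P (z + et) - P z \<ge> - (\<Lambda> * \<tau>)"
      proof -
        define k where "k = nat \<lfloor>(snd z - t0) / (l * h\<^sup>2)\<rfloor>"
        have e1: "P (z + et) = \<Psi> (rnd h (fst z), t0 + real (Suc k) * (l * h\<^sup>2))" "P z = \<Psi> (rnd h (fst z), t0 + real k * (l * h\<^sup>2))"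
          unfolding P_def pfun_def et_def \<tau>_def using next_step[OF h(1) tz] by (simp_all del: of_nat_Suc add: k_def)
        have "\<bar>P (z + et) - P z\<bar> \<le> \<Lambda> * dist (rnd h (fst z)) (rnd h (fst z)) + \<Lambda> * \<bar>(t0 + real (Suc k) * (l * h\<^sup>2)) - (t0 + real k * (l * h\<^sup>2))\<bar>"
          unfolding e1 by (rule good_lip[OF g])
        also have "\<dots> = \<Lambda> * \<tau>" using \<tau>0 by (simp add: \<tau>_def[symmetric] algebra_simps)
        finally show ?thesis by linarith
      qed
      have 3: "rt b * (P (z + et) - P z) \<ge> - (rt M * \<Lambda> * \<tau>)"
      proof -
        have "rt b * (P (z + et) - P z) \<ge> rt b * (- (\<Lambda> * \<tau>))" using 2 ub[of "z + et"] by (intro mult_left_mono) (auto simp: b_def)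
        moreover have "rt b * (\<Lambda> * \<tau>) \<le> rt M * (\<Lambda> * \<tau>)" using ub[of "z+et"] \<Lambda> \<tau>0 by (intro mult_right_mono) (auto simp: b_def)
        ultimately show ?thesis by simp
      qed
      have "(rt a - rt b) * (a - P z) = (rt a - rt b) * a + (F (z + et) - F z) - rt b * (P (z + et) - P z)"
        by (simp add: F_def a_def b_def algebra_simps)
      then have "(rt a - rt b) * (a - P z) \<le> c + (F (z + et) - F z)" using 1 3 unfolding c_def by linarith
      then show ?thesis using True VQ[OF True] by (simp add: v_def a_def b_def)
    qed
    have iv: "integrable lborel (\<lambda>z. (rt (w z) - rt (w (z + et))) * v z)"
      by (rule integrable_bounded_mult[OF _ _ _ vb vQ Qs Qf, where A = "rt M"]) (use uab in auto)
    have iQ: "integrable lborel (\<lambda>z. c * indicator Q z)" using Qs Qf by auto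
    have iF: "integrable lborel (\<lambda>z. F z * indicator S z)" if "S \<in> sets lborel" "emeasure lborel S < \<infinity>" for S
      by (rule integrable_bounded_mult[where A = "rt M * M" and B = 1 and S = S]) (use Fb that in \<open>auto simp: indicator_def\<close>)
    have Vs: "V \<in> sets lborel" by simp
    have Vf: "emeasure lborel V < \<infinity>" using le_less_trans[OF emeasure_mono[of V Q lborel] Qf] VQ Qs by blast
    have iF1: "integrable lborel (\<lambda>z. F (z + et) * indicator V z)"
      by (rule integrable_bounded_mult[where A = "rt M * M" and B = 1 and S = V]) (use Fb Vs Vf in \<open>auto simp: indicator_def\<close>)
    \<comment> \<open>Shifting by one time step moves \<open>V\<close> by \<open>\<tau>\<close>;
      what leaves \<open>V\<close> lies in a layer of thickness \<open>\<tau>\<close> at the final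
      time.\<close>
    have strip: "(\<integral>z. F (z + et) * indicator V z \<partial>lborel) - (\<integral>z. F z * indicator V z \<partial>lborel) \<le> rt M * M * (vol * \<tau>)"
    proof -
      define S where "S = (cball 0 (D+2) \<times> {t0+T..<t0+T+\<tau>} :: 'n pt set)"
      have S: "S \<in> sets lborel" "emeasure lborel S < \<infinity>"
        unfolding S_def by (auto intro!: borel_Times) (intro emeasure_bounded_finite[unfolded infinity_ennreal_def] bounded_Times, auto)
      have mS: "measure lborel S = vol * \<tau>"
        unfolding S_def vol_def using \<tau>0 by (subst measure_lborel_Times) auto
      have "(\<integral>z. F (z + et) * indicator V z \<partial>lborel) = (\<integral>z. (\<lambda>z. F z * indicator V (z - et)) (z + et) \<partial>lborel)" by simp
      also have "\<dots> = (\<integral>z. F z * indicator V (z - et) \<partial>lborel)" by (rule lborel_integral_shift) measurable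
      also have "\<dots> \<le> (\<integral>z. F z * indicator V z + rt M * M * indicator S z \<partial>lborel)"
      proof (rule integral_mono)
        have "integrable lborel (\<lambda>z. (\<lambda>z. F (z + et) * indicator V z) (z + (- et)))"
          using iF1 by (subst lborel_integrable_shift) auto
        then show "integrable lborel (\<lambda>z. F z * indicator V (z - et))" by simp
        show "integrable lborel (\<lambda>z. F z * indicator V z + rt M * M * indicator S z)" using iF[OF Vs Vf] S by auto
        fix z
        have "z \<in> V \<or> z \<in> S" if "z - et \<in> V"
        proof -
          have "z - et \<in> Q" using VQ that by auto
          then show ?thesis using that \<tau>0 by (auto simp: V_def S_def Q_def et_def mem_Times_iff)
        qed
        then show "F z * indicator V (z - et) \<le> F z * indicator V z + rt M * M * indicator S z"
          using Fb[of z] M0 by (auto simp: indicator_def)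
      qed
      also have "\<dots> = (\<integral>z. F z * indicator V z \<partial>lborel) + rt M * M * measure lborel S" using iF[OF Vs Vf] S by simp
      finally show ?thesis by (simp add: mS)
    qed
    have "(\<integral>z. (rt (w z) - rt (w (z + et))) * v z \<partial>lborel) \<le> (\<integral>z. c * indicator Q z + (F (z + et) * indicator V z - F z * indicator V z) \<partial>lborel)"
    proof (rule integral_mono[OF iv])
      show "integrable lborel (\<lambda>z. c * indicator Q z + (F (z + et) * indicator V z - F z * indicator V z))"
        using iQ iF1 iF[OF Vs Vf] by auto
    qed (use pt in \<open>auto simp: mult.commute\<close>)
    also have "\<dots> = c * measure lborel Q + ((\<integral>z. F (z + et) * indicator V z \<partial>lborel) - (\<integral>z. F z * indicator V z \<partial>lborel))"
      using iQ iF1 iF[OF Vs Vf] Qs Qf by simp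
    also have "\<dots> \<le> \<tau> * c1" using strip unfolding c_def c1_def by (simp add: algebra_simps)
    finally have up: "(\<integral>z. (rt (w z) - rt (w (z + et))) * v z \<partial>lborel) \<le> \<tau> * c1" .
    have low: "(\<integral>z. E i z * (v (z + e i) - v z) \<partial>lborel) \<ge> (1/2) * (\<integral>z. indicator Q z * (E i z)\<^sup>2 \<partial>lborel) - (1/2) * (\<Lambda>\<^sup>2 * h\<^sup>2 * measure lborel Q)" for i
    proof -
      have iE: "integrable lborel (\<lambda>z. (E i z)\<^sup>2 * indicator Q z)"
      proof (rule integrable_bounded_mult[where A = "M\<^sup>2" and B = 1 and S = Q])
        show "\<bar>(E i z)\<^sup>2\<bar> \<le> M\<^sup>2" for z using Eb[of i z] by (simp add: abs_le_square_iff[symmetric])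
      qed (use Qs Qf in \<open>auto simp: indicator_def\<close>)
      have pw: "E i z * (v (z + e i) - v z) \<ge> (1/2) * ((E i z)\<^sup>2 * indicator Q z) - (1/2) * (\<Lambda>\<^sup>2 * h\<^sup>2 * indicator Q z)" for z
      proof (cases "z \<in> Q")
        case False
        then have "v (z + e i) = 0" "v z = 0" using VQ'[of z i] vQ[of z] by (auto simp: v_def indicator_def)
        then show ?thesis using False by simp
      next
        case True
        then have tz: "t0 \<le> snd z" "snd z < t0 + T" by (auto simp: Q_def)
        define p where "p = P (z + e i) - P z"
        have "v (z + e i) - v z = E i z - p"
          using vJ[of z] vJ[of "z + e i"] tz by (simp add: E_def p_def e_def)
        moreover have "\<bar>p\<bar> \<le> \<Lambda> * h"
        proof -
          have "fst (z + e i) = fst z + h *\<^sub>R axis i 1" "snd (z + e i) = snd z" by (auto simp: e_def)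
          then have "\<bar>p\<bar> \<le> \<Lambda> * dist (rnd h (fst z) + h *\<^sub>R axis i 1) (rnd h (fst z)) + \<Lambda> * \<bar>(t0 + real (nat \<lfloor>(snd z - t0) / (l * h\<^sup>2)\<rfloor>) * (l * h\<^sup>2)) - (t0 + real (nat \<lfloor>(snd z - t0) / (l * h\<^sup>2)\<rfloor>) * (l * h\<^sup>2))\<bar>"
            unfolding p_def P_def pfun_def using good_lip[OF g] by (simp only: rnd_shift[OF h(1)])
          also have "\<dots> = \<Lambda> * h" using h by (simp add: dist_norm)
          finally show ?thesis .
        qed
        then have "p\<^sup>2 \<le> (\<Lambda> * h)\<^sup>2" using abs_le_square_iff[of p "\<Lambda> * h"] \<Lambda> h by simp
        \<comment> \<open>Half of the square is kept; the increment \<open>p\<close> of the data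
          costs half of its own square.\<close>
        moreover have "E i z * (E i z - p) = (1/2) * (E i z)\<^sup>2 - (1/2) * p\<^sup>2 + (1/2) * (E i z - p)\<^sup>2"
          by (simp add: power2_eq_square field_simps)
        moreover have "(E i z - p)\<^sup>2 \<ge> 0" by simp
        moreover have "q \<le> r \<Longrightarrow> y = (1/2) * s - (1/2) * q + (1/2) * t \<Longrightarrow> t \<ge> 0 \<Longrightarrow> y \<ge> (1/2) * s - (1/2) * r" for y q r s t :: real by argo
        ultimately have "E i z * (v (z + e i) - v z) \<ge> (1/2) * (E i z)\<^sup>2 - (1/2) * (\<Lambda> * h)\<^sup>2" by metis
        then show ?thesis using True by (simp add: power_mult_distrib)
      qed
      have iEv: "integrable lborel (\<lambda>z. E i z * (v (z + e i) - v z))"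
        unfolding right_diff_distrib using i1 i2 by auto
      have iQ2: "integrable lborel (\<lambda>z. \<Lambda>\<^sup>2 * h\<^sup>2 * indicator Q z)" using Qs Qf by auto
      have "(\<integral>z. (1/2) * ((E i z)\<^sup>2 * indicator Q z) - (1/2) * (\<Lambda>\<^sup>2 * h\<^sup>2 * indicator Q z) \<partial>lborel) \<le> (\<integral>z. E i z * (v (z + e i) - v z) \<partial>lborel)"
        by (rule integral_mono[OF _ iEv pw]) (use iE iQ2 in auto)
      also have "(\<integral>z. (1/2) * ((E i z)\<^sup>2 * indicator Q z) - (1/2) * (\<Lambda>\<^sup>2 * h\<^sup>2 * indicator Q z) \<partial>lborel)
         = (1/2) * (\<integral>z. (E i z)\<^sup>2 * indicator Q z \<partial>lborel) - (1/2) * (\<Lambda>\<^sup>2 * h\<^sup>2 * measure lborel Q)"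
        using iE iQ2 Qs Qf by simp
      finally show ?thesis by (simp add: mult.commute)
    qed
    define I where "I = (\<lambda>i. \<integral>z. indicator Q z * (E i z)\<^sup>2 \<partial>lborel)"
    have I0: "I i \<ge> 0" for i unfolding I_def by (intro Bochner_Integration.integral_nonneg) auto
    have "(\<Sum>i\<in>UNIV. (1/2) * I i - (1/2) * (\<Lambda>\<^sup>2 * h\<^sup>2 * measure lborel Q)) \<le> (\<Sum>i\<in>UNIV. \<integral>z. E i z * (v (z + e i) - v z) \<partial>lborel)"
      unfolding I_def by (intro sum_mono low)
    then have "l * (\<Sum>i\<in>UNIV. (1/2) * I i - (1/2) * (\<Lambda>\<^sup>2 * h\<^sup>2 * measure lborel Q)) \<le> l * (\<Sum>i\<in>UNIV. \<integral>z. E i z * (v (z + e i) - v z) \<partial>lborel)"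
      using l0 by (intro mult_left_mono) auto
    also have "\<dots> \<le> \<tau> * c1" using id1 up by simp
    finally have "l * (\<Sum>i\<in>UNIV. (1/2) * I i - (1/2) * (\<Lambda>\<^sup>2 * h\<^sup>2 * measure lborel Q)) \<le> l * (h\<^sup>2 * c1)" by (simp add: \<tau>_def)
    then have "(\<Sum>i\<in>UNIV. (1/2) * I i - (1/2) * (\<Lambda>\<^sup>2 * h\<^sup>2 * measure lborel Q)) \<le> h\<^sup>2 * c1" using l0 by simp
    moreover define q where "q = \<Lambda>\<^sup>2 * h\<^sup>2 * measure lborel Q"
    moreover have "(\<Sum>i\<in>(UNIV::'n set). (1/2) * I i - (1/2) * q) = (1/2) * (\<Sum>i\<in>UNIV. I i) - N * ((1/2) * q)"
      by (simp add: sum_subtractf sum_distrib_left N_def)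
    ultimately have "(1/2) * (\<Sum>i\<in>UNIV. I i) - N * ((1/2) * q) \<le> h\<^sup>2 * c1" by simp
    moreover have "h\<^sup>2 * C = N * q + 2 * (h\<^sup>2 * c1)" by (simp add: C_def q_def algebra_simps)
    moreover have "(1/2) * a - b * ((1/2) * c) \<le> d \<Longrightarrow> y = b * c + 2 * d \<Longrightarrow> a \<le> y" for a b c d y :: real by argo
    ultimately have "(\<Sum>i\<in>UNIV. I i) \<le> h\<^sup>2 * C" by blast
    moreover have "I i \<le> (\<Sum>i\<in>UNIV. I i)" by (rule member_le_sum) (use I0 in auto)
    ultimately have Ii: "I i \<le> h\<^sup>2 * C" by linarith
    have "(\<integral>z. indicator Q z * ((w (z + e i) - w z) / h)\<^sup>2 \<partial>lborel) = (\<integral>z. (1/h\<^sup>2) * (indicator Q z * (E i z)\<^sup>2) \<partial>lborel)"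
      by (intro Bochner_Integration.integral_cong) (auto simp: E_def power_divide)
    also have "\<dots> = (1/h\<^sup>2) * I i" by (simp add: I_def)
    also have "\<dots> \<le> C" using Ii h by (simp add: field_simps)
    finally show ?thesis unfolding w_def e_def .
  qed
  then show ?thesis using that unfolding Q_def by blast
qed

end

lemma dq_L2:
  fixes f :: "'a::euclidean_space \<Rightarrow> real"
  assumes f: "test_fun D f" and b: "b \<in> Basis" and s: "s \<longlonglongrightarrow> 0" "\<And>n. s n \<noteq> 0" "\<And>n. \<bar>s n\<bar> \<le> 1"
  shows "L2 (\<lambda>z. (f (z + s n *\<^sub>R b) - f z) / s n)"
    and "(\<lambda>n. \<integral>z. ((f (z + s n *\<^sub>R b) - f z) / s n - pd f b z)\<^sup>2 \<partial>lborel) \<longlonglongrightarrow> 0"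
proof -
  have sm: "smooth f" using f by (auto simp: test_fun_def)
  obtain B R where BR: "B > 0" "\<And>z. \<bar>pd f b z\<bar> \<le> B" "R > 0" "\<And>z. R < norm z \<Longrightarrow> pd f b z = 0"
    using test_fun_bounded[OF test_fun_pd[OF f b]] by metis
  obtain B' R' where BR': "R' > 0" "\<And>z. R' < norm z \<Longrightarrow> f z = 0" using test_fun_bounded[OF f] by metis
  have [measurable]: "f \<in> borel_measurable borel" "pd f b \<in> borel_measurable borel"
    using test_fun_measurable f test_fun_pd[OF f b] by auto
  define S where "S = cball (0::'a) (max R R' + 1)"
  have S: "S \<in> sets lborel" "emeasure lborel S < \<infinity>"
    unfolding S_def by (simp, intro emeasure_bounded_finite, simp)
  define q where "q = (\<lambda>n z. (f (z + s n *\<^sub>R b) - f z) / s n)"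
  have [measurable]: "q n \<in> borel_measurable borel" for n unfolding q_def by measurable
  have qb: "\<bar>q n z\<bar> \<le> B" for n z unfolding q_def by (rule diff_quotient_bound[OF sm BR(2) s(2)])
  have qS: "q n z = 0" "pd f b z = 0" if "z \<notin> S" for n z
  proof -
    have nz: "norm z > max R R' + 1" using that by (simp add: S_def not_le)
    then show "pd f b z = 0" using BR(4)[of z] by simp
    have "norm (s n *\<^sub>R b) \<le> 1" using s(3)[of n] b by (simp add: norm_Basis)
    then have "norm (z + s n *\<^sub>R b) > R'" using norm_triangle_ineq2[of z "- (s n *\<^sub>R b)"] nz by simp
    then have "f (z + s n *\<^sub>R b) = 0" "f z = 0" using BR' nz by auto
    then show "q n z = 0" by (simp add: q_def)
  qed
  have "L2 (q n)" by (rule L2_bounded_support(1)[where S = S and C = B]) (use S qb qS in auto)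
  then show "L2 (\<lambda>z. (f (z + s n *\<^sub>R b) - f z) / s n)" unfolding q_def .
  have "(\<lambda>n. \<integral>z. (q n z - pd f b z)\<^sup>2 \<partial>lborel) \<longlonglongrightarrow> (\<integral>z. (0::real) \<partial>(lborel :: 'a measure))"
  proof (rule integral_dominated_convergence[where w = "\<lambda>z. (2*B)\<^sup>2 * indicator S z"])
    show "integrable lborel (\<lambda>z. (2*B)\<^sup>2 * indicator S z)" using S by auto
    show "AE z in lborel. (\<lambda>n. (q n z - pd f b z)\<^sup>2) \<longlonglongrightarrow> 0"
    proof (rule AE_I2)
      fix z
      have "(\<lambda>n. (q n z - pd f b z)\<^sup>2) \<longlonglongrightarrow> (pd f b z - pd f b z)\<^sup>2" unfolding q_def
        by (intro tendsto_intros diff_quotient_tendsto[OF sm s(1,2)])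
      then show "(\<lambda>n. (q n z - pd f b z)\<^sup>2) \<longlonglongrightarrow> 0" by simp
    qed
    show "AE z in lborel. norm ((q n z - pd f b z)\<^sup>2) \<le> (2*B)\<^sup>2 * indicator S z" for n
    proof (rule AE_I2)
      fix z
      have "\<bar>q n z - pd f b z\<bar> \<le> \<bar>2*B\<bar>" using qb[of n z] BR(2)[of z] BR(1) by linarith
      then have "(q n z - pd f b z)\<^sup>2 \<le> (2*B)\<^sup>2" by (simp only: abs_le_square_iff)
      then show "norm ((q n z - pd f b z)\<^sup>2) \<le> (2*B)\<^sup>2 * indicator S z" using qS(1)[of z n] qS(2)[of z] by (cases "z \<in> S") auto
    qed
  qed auto
  then show "(\<lambda>n. \<integral>z. ((f (z + s n *\<^sub>R b) - f z) / s n - pd f b z)\<^sup>2 \<partial>lborel) \<longlonglongrightarrow> 0" by (simp add: q_def)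
qed

section \<open>Existence for the Dirichlet problem\<close>

context pme
begin

text \<open>Pointwise limits handle \<open>\<omega>\<close> and its root; the gradient is a weak
  limit of difference quotients bounded by \<open>energy\<close>. The mesh sizes are given in
  advance and a subsequence is returned, so that two sets of data can share one sequence.\<close>

theorem dirichlet_solution:
  assumes g: "good M \<Lambda> \<Psi>" and ext: "extball U r" and U: "open U" and UD: "\<forall>x\<in>U. norm x \<le> D" and T: "T > 0"
    and hs: "\<And>n. hs n > 0" "hs \<longlonglongrightarrow> 0"
  obtains s \<omega> where "strict_mono (s::nat\<Rightarrow>nat)" "\<And>z. z \<in> closure U \<times> {t0..t0+T} \<Longrightarrow> (\<lambda>n. wfun U t0 \<Psi> (hs (s n)) z) \<longlonglongrightarrow> \<omega> z"
    "continuous_on (closure U \<times> {t0..t0+T}) \<omega>" "\<And>z. z \<in> pbdry U t0 (t0+T) \<Longrightarrow> \<omega> z = \<Psi> z" "\<And>z. 0 \<le> \<omega> z \<and> \<omega> z \<le> M"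
    "weak_sol m (cyl U t0 (t0+T)) (\<lambda>z. rt (\<omega> z))"
proof -
  define S where "S = closure U \<times> {t0..t0+T}"
  define D0 where "D0 = cyl U t0 (t0+T)"
  define Q where "Q = (cball 0 (D+2) \<times> {t0..<t0+T} :: 'n pt set)"
  have pb: "\<forall>z. 0 \<le> \<Psi> z \<and> \<Psi> z \<le> M" using g by (auto simp: good_def)
  have D0S: "D0 \<subseteq> S" using closure_subset[of U] by (auto simp: D0_def S_def cyl_def)
  have D0o: "open D0" unfolding D0_def cyl_def using U by (intro open_Times) auto
  have D0Q: "D0 \<subseteq> Q" using UD by (force simp: D0_def Q_def cyl_def)
  have Qs: "Q \<in> sets lborel" and Qf: "emeasure lborel Q < \<infinity>"
    unfolding Q_def by (auto intro!: borel_Times) (intro emeasure_bounded_finite[unfolded infinity_ennreal_def] bounded_Times, auto)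
  obtain s0 \<omega>0 where s0: "strict_mono (s0::nat\<Rightarrow>nat)" and lim0: "\<And>z. z \<in> S \<Longrightarrow> (\<lambda>n. wfun U t0 \<Psi> (hs (s0 n)) z) \<longlonglongrightarrow> \<omega>0 z"
    and cont0: "continuous_on S \<omega>0" and bd0: "\<And>z. z \<in> pbdry U t0 (t0+T) \<Longrightarrow> \<omega>0 z = \<Psi> z"
    using wfun_limit[OF g ext T UD hs, of t0] unfolding S_def by metis
  have "(\<lambda>n. hs (s0 n)) \<longlonglongrightarrow> 0" using LIMSEQ_subseq_LIMSEQ[OF hs(2) s0] by (simp add: o_def)
  moreover have N2: "1 / (N + 1) > 0" using N1 by simp
  ultimately obtain n0 where n0: "\<And>n. n \<ge> n0 \<Longrightarrow> hs (s0 n) < 1 / (N + 1)"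
    using order_tendstoD(2)[of "\<lambda>n. hs (s0 n)" 0 sequentially "1/(N+1)"] by (auto simp: eventually_sequentially)
  \<comment> \<open>Shifted so that every mesh size meets the smallness condition of
    \<open>energy\<close>.\<close>
  define s where "s = (\<lambda>n. s0 (n + n0))"
  have smono: "strict_mono s" using s0 by (auto simp: s_def strict_mono_def)
  define h where "h = (\<lambda>n. hs (s n))"
  have h0: "h n > 0" for n using hs by (simp add: h_def)
  have hN: "N * h n + h n \<le> 1" for n
  proof -
    have "h n < 1 / (N + 1)" using n0[of "n + n0"] by (simp add: h_def s_def)
    then show ?thesis using N1 by (simp add: field_simps)
  qed
  have h1: "h n \<le> 1" for n using hN[of n] N1 h0[of n] by (smt (verit) mult_nonneg_nonneg)
  have hlim: "h \<longlonglongrightarrow> 0" using LIMSEQ_subseq_LIMSEQ[OF hs(2) smono] by (simp add: o_def h_def)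
  have lim: "(\<lambda>n. wfun U t0 \<Psi> (h n) z) \<longlonglongrightarrow> \<omega>0 z" if "z \<in> S" for z
    using LIMSEQ_ignore_initial_segment[OF lim0[OF that], of n0] by (simp add: h_def s_def)
  \<comment> \<open>Zero off \<open>S\<close>, which makes \<open>\<omega>\<close> Borel on the
    whole space.\<close>
  define \<omega> where "\<omega> = (\<lambda>z. if z \<in> S then \<omega>0 z else 0)"
  define w where "w = (\<lambda>n. wfun U t0 \<Psi> (h n))"
  have wm[measurable]: "w n \<in> borel_measurable borel" for n unfolding w_def by (rule wfun_measurable[OF g U])
  have wb: "0 \<le> w n z" "w n z \<le> M" for n z using dsol_bounds[OF pb] by (auto simp: w_def wfun_def)
  have ub: "0 \<le> rt (w n z)" "rt (w n z) \<le> rt M" for n z using root_mono[OF m1 wb] by auto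
  have limw: "(\<lambda>n. w n z) \<longlonglongrightarrow> \<omega> z" if "z \<in> S" for z using lim[OF that] that by (simp add: w_def \<omega>_def)
  have \<omega>b: "0 \<le> \<omega> z \<and> \<omega> z \<le> M" for z
  proof (cases "z \<in> S")
    case True
    show ?thesis using tendsto_lowerbound[OF limw[OF True], of 0] tendsto_upperbound[OF limw[OF True], of M] wb by auto
  qed (use M0 in \<open>simp add: \<omega>_def\<close>)
  have cont\<omega>: "continuous_on S \<omega>" using cont0 by (rule continuous_on_eq) (simp add: \<omega>_def)
  have Sc: "S \<in> sets borel" unfolding S_def by (auto intro!: borel_Times)
  have \<omega>m[measurable]: "\<omega> \<in> borel_measurable borel" unfolding \<omega>_def
    using Sc cont0 by (intro borel_measurable_continuous_on_if) auto
  have limu: "(\<lambda>n. rt (w n z)) \<longlonglongrightarrow> rt (\<omega> z)" if "z \<in> S" for z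
    using limw[OF that] wb m1 by (intro tendsto_powr') auto
  have pw: "rt (\<omega> z) powr m = \<omega> z" for z using \<omega>b[of z] m1 by (simp add: powr_powr)
  obtain C where C: "\<And>h i. 0 < h \<Longrightarrow> N * h + h \<le> 1 \<Longrightarrow>
     (\<integral>z. indicator Q z * ((wfun U t0 \<Psi> h (z + h *\<^sub>R (axis i 1, 0)) - wfun U t0 \<Psi> h z) / h)\<^sup>2 \<partial>lborel) \<le> C"
    by (fact energy[OF g UD U T, of t0, folded Q_def])
  define b where "b = (\<lambda>i::'n. (axis i 1, 0) :: 'n pt)"
  define bt where "bt = ((0, 1) :: 'n pt)"
  have bB: "b i \<in> Basis" "bt \<in> Basis" for i by (auto simp: b_def bt_def Basis_prod_def axis_in_Basis_iff)
  define E where "E = (\<lambda>i n z. (w n (z + h n *\<^sub>R b i) - w n z) / h n)"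
  have Em[measurable]: "E i n \<in> borel_measurable borel" for i n unfolding E_def by measurable
  have Eb: "\<bar>E i n z\<bar> \<le> M / h n" for i n z
    unfolding E_def abs_divide using wb[of n z] wb[of n "z + h n *\<^sub>R b i"] h0[of n] by (intro divide_mono) auto
  define G where "G = (\<lambda>i n z. indicator Q z * E i n z)"
  have Gm: "G i n \<in> borel_measurable lborel" for i n unfolding G_def using Qs by measurable
  have GL: "L2 (G i n)" for i n
  proof (rule L2_bounded_support(1)[OF Gm Qs Qf])
    have "M / h n \<ge> 0" using M0 h0[of n] by simp
    then show "\<bar>G i n z\<bar> \<le> M / h n" for z using Eb[of i n z] by (auto simp: G_def indicator_def)
  qed (simp add: G_def)
  have GC: "(\<integral>z. (G i n z)\<^sup>2 \<partial>lborel) \<le> C" for i n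
  proof -
    have "(\<integral>z. (G i n z)\<^sup>2 \<partial>lborel) = (\<integral>z. indicator Q z * (E i n z)\<^sup>2 \<partial>lborel)"
      by (intro Bochner_Integration.integral_cong) (auto simp: G_def indicator_def)
    then show ?thesis using C[OF h0 hN] by (simp add: E_def w_def b_def)
  qed
  have out: "\<phi> z = 0" if "test_fun D0 \<phi>" "z \<notin> D0" for \<phi> z
    using that closure_subset[of "{z. \<phi> z \<noteq> 0}"] by (auto simp: test_fun_def)
  have shiftint: "(\<integral>z. (a (z + c) - a z) * \<phi> z \<partial>lborel) = (\<integral>z. a z * (\<phi> (z - c) - \<phi> z) \<partial>lborel)"
    if \<phi>: "test_fun D0 \<phi>" and [measurable]: "a \<in> borel_measurable borel" and ab: "\<And>z. \<bar>a z\<bar> \<le> A" for a \<phi> c A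
  proof -
    obtain B R where BR: "\<And>z. \<bar>\<phi> z\<bar> \<le> B" "\<And>z. R < norm z \<Longrightarrow> \<phi> z = 0" using test_fun_bounded[OF \<phi>] by metis
    have [measurable]: "\<phi> \<in> borel_measurable borel" using test_fun_measurable[OF \<phi>] .
    have fin: "cball (0::'n pt) R' \<in> sets lborel" "emeasure lborel (cball (0::'n pt) R') < \<infinity>" for R'
      by (simp, intro emeasure_bounded_finite, simp)
    have i1: "integrable lborel (\<lambda>z. a z * \<phi> z)"
      by (rule integrable_bounded_mult[where A = A and B = B and S = "cball 0 R"]) (use ab BR fin in \<open>auto simp: not_le\<close>)
    have i2: "integrable lborel (\<lambda>z. a (z + c) * \<phi> z)"
      by (rule integrable_bounded_mult[where A = A and B = B and S = "cball 0 R"]) (use ab BR fin in \<open>auto simp: not_le\<close>)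
    have e: "(\<integral>z. (\<lambda>z. a (z + c) * \<phi> z) (z + (- c)) \<partial>lborel) = (\<integral>z. a (z + c) * \<phi> z \<partial>lborel)"
      by (rule lborel_integral_shift) measurable
    have "integrable lborel (\<lambda>z. (\<lambda>z. a (z + c) * \<phi> z) (z + (- c)))" using i2 by (subst lborel_integrable_shift) auto
    then have i3: "integrable lborel (\<lambda>z. a z * \<phi> (z - c))" by simp
    have "(\<integral>z. (a (z + c) - a z) * \<phi> z \<partial>lborel) = (\<integral>z. a (z + c) * \<phi> z \<partial>lborel) - (\<integral>z. a z * \<phi> z \<partial>lborel)"
      unfolding left_diff_distrib by (rule Bochner_Integration.integral_diff[OF i2 i1])
    also have "\<dots> = (\<integral>z. a z * \<phi> (z - c) \<partial>lborel) - (\<integral>z. a z * \<phi> z \<partial>lborel)" using e by simp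
    also have "\<dots> = (\<integral>z. a z * (\<phi> (z - c) - \<phi> z) \<partial>lborel)"
      unfolding right_diff_distrib by (rule Bochner_Integration.integral_diff[OF i3 i1, symmetric])
    finally show ?thesis .
  qed
  have wab: "\<bar>w n z\<bar> \<le> M" for n z using wb[of n z] by simp
  \<comment> \<open>Translation moves the difference to the test function, with step
    \<open>- h n\<close>; the weak limit of \<open>G i\<close> is thereby the weak derivative of
    \<open>\<omega>\<close>.\<close>
  have Glim: "(\<lambda>n. \<integral>z. G i n z * \<phi> z \<partial>lborel) \<longlonglongrightarrow> - (\<integral>z. \<omega> z * pd \<phi> (b i) z \<partial>lborel)" if \<phi>: "test_fun D0 \<phi>" for \<phi> i
  proof -
    have eq: "(\<integral>z. G i n z * \<phi> z \<partial>lborel) = - (\<integral>z. w n z * ((\<phi> (z + (- h n) *\<^sub>R b i) - \<phi> z) / (- h n)) \<partial>lborel)" for n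
    proof -
      have "(\<integral>z. G i n z * \<phi> z \<partial>lborel) = (\<integral>z. (1 / h n) * ((w n (z + h n *\<^sub>R b i) - w n z) * \<phi> z) \<partial>lborel)"
      proof (intro Bochner_Integration.integral_cong refl)
        fix z show "G i n z * \<phi> z = (1 / h n) * ((w n (z + h n *\<^sub>R b i) - w n z) * \<phi> z)"
          using out[OF \<phi>, of z] D0Q by (cases "z \<in> D0") (auto simp: G_def E_def)
      qed
      also have "\<dots> = (1 / h n) * (\<integral>z. (w n (z + h n *\<^sub>R b i) - w n z) * \<phi> z \<partial>lborel)" by simp
      also have "\<dots> = (1 / h n) * (\<integral>z. w n z * (\<phi> (z - h n *\<^sub>R b i) - \<phi> z) \<partial>lborel)"
        by (subst shiftint[OF \<phi> wm wab]) (rule refl)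
      also have "\<dots> = (\<integral>z. (1 / h n) * (w n z * (\<phi> (z - h n *\<^sub>R b i) - \<phi> z)) \<partial>lborel)" by simp
      also have "\<dots> = (\<integral>z. - (w n z * ((\<phi> (z + (- h n) *\<^sub>R b i) - \<phi> z) / (- h n))) \<partial>lborel)"
        by (intro Bochner_Integration.integral_cong refl) simp
      finally show ?thesis by simp
    qed
    have mh: "(\<lambda>n. - h n) \<longlonglongrightarrow> 0" using tendsto_minus[OF hlim] by simp
    have "(\<lambda>n. \<integral>z. w n z * ((\<phi> (z + (- h n) *\<^sub>R b i) - \<phi> z) / (- h n)) \<partial>lborel) \<longlonglongrightarrow> (\<integral>z. \<omega> z * pd \<phi> (b i) z \<partial>lborel)"
    proof (rule dq_limit[OF \<phi> bB(1) D0o wm \<omega>m wab, where s = "\<lambda>n. - h n"])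
      show "(\<lambda>n. w n z) \<longlonglongrightarrow> \<omega> z" if "z \<in> D0" for z using limw[OF subsetD[OF D0S that]] .
      show "- h n \<noteq> 0" "\<bar>- h n\<bar> \<le> 1" for n using h0[of n] h1[of n] by auto
    qed (rule mh)
    then show ?thesis unfolding eq by (rule tendsto_minus)
  qed
  have "\<exists>\<gamma>. L2 \<gamma> \<and> (\<forall>z. z \<notin> Q \<longrightarrow> \<gamma> z = 0) \<and> (\<forall>\<phi>. test_fun D0 \<phi> \<longrightarrow> (\<integral>z. \<gamma> z * \<phi> z \<partial>lborel) = - (\<integral>z. \<omega> z * pd \<phi> (b i) z \<partial>lborel))" for i
  proof (rule L2_weak_limit[where G = "G i" and S = Q and C = C and T = "{\<phi>. test_fun D0 \<phi>}" and L = "\<lambda>\<phi>. - (\<integral>z. \<omega> z * pd \<phi> (b i) z \<partial>lborel)"])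
    fix \<gamma> assume "L2 \<gamma>" "\<And>z. z \<notin> Q \<Longrightarrow> \<gamma> z = 0" "\<And>\<phi>. \<phi> \<in> {\<phi>. test_fun D0 \<phi>} \<Longrightarrow> (\<integral>z. \<gamma> z * \<phi> z \<partial>lborel) = - (\<integral>z. \<omega> z * pd \<phi> (b i) z \<partial>lborel)"
    then show ?thesis by (intro exI[of _ \<gamma>]) auto
  qed (use GL Qs Qf GC Glim test_fun_L2 in \<open>auto simp: G_def\<close>)
  then have "\<exists>\<gamma>. \<forall>i. L2 (\<gamma> i) \<and> (\<forall>z. z \<notin> Q \<longrightarrow> \<gamma> i z = 0) \<and> (\<forall>\<phi>. test_fun D0 \<phi> \<longrightarrow> (\<integral>z. \<gamma> i z * \<phi> z \<partial>lborel) = - (\<integral>z. \<omega> z * pd \<phi> (b i) z \<partial>lborel))"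
    by (intro choice allI)
  then obtain \<gamma> where \<gamma>: "\<And>i. L2 (\<gamma> i)" "\<And>i z. z \<notin> Q \<Longrightarrow> \<gamma> i z = 0"
    "\<And>i \<phi>. test_fun D0 \<phi> \<Longrightarrow> (\<integral>z. \<gamma> i z * \<phi> z \<partial>lborel) = - (\<integral>z. \<omega> z * pd \<phi> (b i) z \<partial>lborel)" by blast
  have eqn: "(\<integral>z. rt (\<omega> z) * pd \<phi> bt z \<partial>lborel) = (\<Sum>i\<in>UNIV. \<integral>z. \<gamma> i z * pd \<phi> (b i) z \<partial>lborel)" if \<phi>: "test_fun D0 \<phi>" for \<phi>
  proof -
    let ?K = "closure {z. \<phi> z \<noteq> 0}"
    have \<phi>m[measurable]: "\<phi> \<in> borel_measurable borel" using test_fun_measurable[OF \<phi>] .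
    obtain B R where BR: "\<And>z. \<bar>\<phi> z\<bar> \<le> B" "\<And>z. R < norm z \<Longrightarrow> \<phi> z = 0" using test_fun_bounded[OF \<phi>] by metis
    \<comment> \<open>A neighbourhood of the support stays in \<open>D0\<close>; once
      \<open>N * h n < \<eta>\<close>, rounding a point where \<open>\<phi>\<close> is nonzero stays
      in \<open>U\<close>, and the scheme holds there.\<close>
    obtain \<eta> where \<eta>: "\<eta> > 0" "(\<Union>z\<in>?K. ball z \<eta>) \<subseteq> D0"
      using compact_subset_open_imp_ball_epsilon_subset[OF _ D0o, of ?K] \<phi> by (auto simp: test_fun_def)
    define q where "q = (\<lambda>i n z. (\<phi> (z + h n *\<^sub>R b i) - \<phi> z) / h n)"
    define \<tau> where "\<tau> = (\<lambda>n. l * (h n)\<^sup>2)"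
    have \<tau>0: "\<tau> n > 0" for n using h0[of n] l0 by (simp add: \<tau>_def)
    have \<tau>lim: "\<tau> \<longlonglongrightarrow> 0"
    proof -
      have "(\<lambda>n. l * (h n)\<^sup>2) \<longlonglongrightarrow> l * 0\<^sup>2" by (intro tendsto_intros hlim)
      then show ?thesis by (simp add: \<tau>_def)
    qed
    have l1: "l \<le> 1"
    proof -
      have "(M+1) powr (1/m - 1) \<le> 1 powr (1/m - 1)" using M0 m1 by (intro powr_neg_mono) auto
      then have "(1/m) * (M+1) powr (1/m - 1) \<le> 1 * 1" using m1 by (intro mult_mono) auto
      then have "4 * N * l \<le> 1" using cfl by linarith
      moreover have "l \<le> 4 * N * l" using N1 l0 by simp
      ultimately show ?thesis by linarith
    qed
    have \<tau>1: "\<tau> n \<le> 1" for n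
    proof -
      have "(h n)\<^sup>2 \<le> 1" using h1[of n] h0[of n] by (simp add: power_le_one)
      then show ?thesis unfolding \<tau>_def using l1 l0 mult_mono[of l 1 "(h n)\<^sup>2" 1] by simp
    qed
    have "\<forall>\<^sub>F n in sequentially. N * h n < \<eta>"
    proof -
      have "(\<lambda>n. N * h n) \<longlonglongrightarrow> N * 0" by (intro tendsto_intros hlim)
      then show ?thesis using order_tendstoD(2)[of "\<lambda>n. N * h n" 0 sequentially \<eta>] \<eta> by simp
    qed
    then have discrete: "\<forall>\<^sub>F n in sequentially. (\<integral>z. rt (w n z) * ((\<phi> (z + (- \<tau> n) *\<^sub>R bt) - \<phi> z) / (- \<tau> n)) \<partial>lborel)
        = (\<Sum>i\<in>UNIV. \<integral>z. G i n z * q i n z \<partial>lborel)"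
    proof eventually_elim
      case (elim n)
      define u where "u = (\<lambda>z. rt (w n z))"
      have [measurable]: "u \<in> borel_measurable borel" unfolding u_def by measurable
      have uab: "\<bar>u z\<bar> \<le> rt M" for z using ub[of n z] by (simp add: u_def)
      have pt: "(u (z + \<tau> n *\<^sub>R bt) - u z) * \<phi> z = l * (\<Sum>i\<in>UNIV. (w n (z + h n *\<^sub>R b i) + w n (z - h n *\<^sub>R b i) - 2 * w n z) * \<phi> z)" for z
      proof (cases "\<phi> z = 0")
        case False
        then have zK: "z \<in> ?K" using closure_subset[of "{z. \<phi> z \<noteq> 0}"] by auto
        have "dist z (rnd (h n) (fst z), snd z) < \<eta>"
          using dist_rnd[OF h0[of n], of "fst z"] elim by (cases z) (simp add: dist_Pair_Pair N_def)
        then have "(rnd (h n) (fst z), snd z) \<in> D0" using \<eta>(2) zK unfolding mem_ball[symmetric] by blast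
        then have "rnd (h n) (fst z) \<in> U" "t0 \<le> snd z" by (auto simp: D0_def cyl_def)
        from wfun_step[OF h0 this(2) pb this(1)]
        have "u (z + \<tau> n *\<^sub>R bt) = u z + l * (\<Sum>i\<in>UNIV. w n (z + h n *\<^sub>R b i) + w n (z - h n *\<^sub>R b i) - 2 * w n z)"
          by (simp add: u_def w_def b_def bt_def \<tau>_def)
        then show ?thesis by (simp add: sum_distrib_right[symmetric])
      qed simp
      have fin: "cball (0::'n pt) R' \<in> sets lborel" "emeasure lborel (cball (0::'n pt) R') < \<infinity>" for R'
        by (simp, intro emeasure_bounded_finite, simp)
      have intb: "integrable lborel (\<lambda>z. a z * \<phi> z)" if [measurable]: "a \<in> borel_measurable borel" and "\<And>z. \<bar>a z\<bar> \<le> A" for a A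
        by (rule integrable_bounded_mult[where A = A and B = B and S = "cball 0 R"]) (use that BR fin in \<open>auto simp: not_le\<close>)
      define e where "e = (\<lambda>i. h n *\<^sub>R b i)"
      define d where "d = (\<lambda>i z. w n (z + e i) - w n z)"
      have [measurable]: "d i \<in> borel_measurable borel" for i unfolding d_def by measurable
      have db: "\<bar>d i z\<bar> \<le> M" for i z using wb[of n z] wb[of n "z + e i"] by (auto simp: d_def)
      have per: "(\<integral>z. (w n (z + e i) + w n (z - e i) - 2 * w n z) * \<phi> z \<partial>lborel) = - (\<integral>z. d i z * (\<phi> (z + e i) - \<phi> z) \<partial>lborel)" for i
      proof -
        have "(\<integral>z. (d i (z + (- e i)) - d i z) * \<phi> z \<partial>lborel) = (\<integral>z. d i z * (\<phi> (z - (- e i)) - \<phi> z) \<partial>lborel)"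
          by (rule shiftint[OF \<phi> _ db]) measurable
        moreover have "(\<integral>z. (w n (z + e i) + w n (z - e i) - 2 * w n z) * \<phi> z \<partial>lborel) = (\<integral>z. - ((d i (z + (- e i)) - d i z) * \<phi> z) \<partial>lborel)"
          by (intro Bochner_Integration.integral_cong refl) (simp add: d_def algebra_simps)
        ultimately show ?thesis by simp
      qed
      have int2: "integrable lborel (\<lambda>z. (w n (z + e i) + w n (z - e i) - 2 * w n z) * \<phi> z)" for i
      proof (rule intb)
        show "\<bar>w n (z + e i) + w n (z - e i) - 2 * w n z\<bar> \<le> 2 * M" for z
          using wb[of n z] wb[of n "z + e i"] wb[of n "z - e i"] by linarith
      qed measurable
      have "(\<integral>z. u z * (\<phi> (z - \<tau> n *\<^sub>R bt) - \<phi> z) \<partial>lborel) = (\<integral>z. (u (z + \<tau> n *\<^sub>R bt) - u z) * \<phi> z \<partial>lborel)"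
        by (rule shiftint[OF \<phi> _ uab, symmetric]) measurable
      also have "\<dots> = (\<integral>z. l * (\<Sum>i\<in>UNIV. (w n (z + e i) + w n (z - e i) - 2 * w n z) * \<phi> z) \<partial>lborel)"
        unfolding pt e_def ..
      also have "\<dots> = l * (\<Sum>i\<in>UNIV. - (\<integral>z. d i z * (\<phi> (z + e i) - \<phi> z) \<partial>lborel))"
        using int2 per by simp
      also have "\<dots> = l * (\<Sum>i\<in>UNIV. - ((h n)\<^sup>2 * (\<integral>z. G i n z * q i n z \<partial>lborel)))"
      proof -
        have "(\<integral>z. d i z * (\<phi> (z + e i) - \<phi> z) \<partial>lborel) = (\<integral>z. (h n)\<^sup>2 * (G i n z * q i n z) \<partial>lborel)" for i
        proof (intro Bochner_Integration.integral_cong refl)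
          fix z
          have zQ: "z \<in> Q" if "\<phi> (z + e i) \<noteq> \<phi> z"
          proof (cases "z \<in> D0")
            case True then show ?thesis using D0Q by auto
          next
            case False
            then have "z + e i \<in> D0" using out[OF \<phi>] that by metis
            then have "fst z + h n *\<^sub>R axis i 1 \<in> U" "t0 < snd z" "snd z < t0 + T" by (auto simp: D0_def cyl_def e_def b_def mem_Times_iff)
            moreover from this have "norm (fst z + h n *\<^sub>R axis i 1) \<le> D" using UD by auto
            moreover have "norm (fst z) \<le> norm (fst z + h n *\<^sub>R axis i 1) + h n"
              using norm_triangle_sub[of "fst z" "fst z + h n *\<^sub>R axis i 1"] h0[of n] by simp
            ultimately show ?thesis using h1[of n] by (auto simp: Q_def mem_Times_iff)
          qed
          have hh: "h n \<noteq> 0" using h0[of n] by simp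
          show "d i z * (\<phi> (z + e i) - \<phi> z) = (h n)\<^sup>2 * (G i n z * q i n z)"
          proof (cases "z \<in> Q")
            case True then show ?thesis using hh by (simp add: d_def G_def E_def q_def e_def power2_eq_square)
          next
            case False then show ?thesis using zQ by (auto simp: G_def)
          qed
        qed
        then show ?thesis by simp
      qed
      also have "\<dots> = - (\<tau> n * (\<Sum>i\<in>UNIV. \<integral>z. G i n z * q i n z \<partial>lborel))"
        by (simp add: \<tau>_def sum_negf sum_distrib_left mult.assoc)
      finally have eq: "(\<integral>z. u z * (\<phi> (z - \<tau> n *\<^sub>R bt) - \<phi> z) \<partial>lborel) = - (\<tau> n * (\<Sum>i\<in>UNIV. \<integral>z. G i n z * q i n z \<partial>lborel))" .
      have "(\<integral>z. rt (w n z) * ((\<phi> (z + (- \<tau> n) *\<^sub>R bt) - \<phi> z) / (- \<tau> n)) \<partial>lborel) = (\<integral>z. (- 1 / \<tau> n) * (u z * (\<phi> (z - \<tau> n *\<^sub>R bt) - \<phi> z)) \<partial>lborel)"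
        by (intro Bochner_Integration.integral_cong refl) (simp add: u_def)
      also have "\<dots> = (- 1 / \<tau> n) * (\<integral>z. u z * (\<phi> (z - \<tau> n *\<^sub>R bt) - \<phi> z) \<partial>lborel)" by simp
      also have "\<dots> = (\<Sum>i\<in>UNIV. \<integral>z. G i n z * q i n z \<partial>lborel)" unfolding eq using \<tau>0[of n] by simp
      finally show ?case .
    qed
    have L: "(\<lambda>n. \<integral>z. rt (w n z) * ((\<phi> (z + (- \<tau> n) *\<^sub>R bt) - \<phi> z) / (- \<tau> n)) \<partial>lborel) \<longlonglongrightarrow> (\<integral>z. rt (\<omega> z) * pd \<phi> bt z \<partial>lborel)"
    proof (rule dq_limit[OF \<phi> bB(2) D0o, where s = "\<lambda>n. - \<tau> n"])
      show "(\<lambda>z. rt (w n z)) \<in> borel_measurable borel" for n by measurable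
      show "(\<lambda>z. rt (\<omega> z)) \<in> borel_measurable borel" by measurable
      show "\<bar>rt (w n z)\<bar> \<le> rt M" for n z using ub[of n z] by simp
      show "(\<lambda>n. rt (w n z)) \<longlonglongrightarrow> rt (\<omega> z)" if "z \<in> D0" for z using limu[OF subsetD[OF D0S that]] .
      show "(\<lambda>n. - \<tau> n) \<longlonglongrightarrow> 0" using tendsto_minus[OF \<tau>lim] by simp
      show "- \<tau> n \<noteq> 0" "\<bar>- \<tau> n\<bar> \<le> 1" for n using \<tau>0[of n] \<tau>1[of n] by auto
    qed
    \<comment> \<open>Product of a weakly and a strongly convergent sequence: the error pairs the
      bounded \<open>G i n\<close> with a difference that tends to 0 in mean square.\<close>
    have R: "(\<lambda>n. \<integral>z. G i n z * q i n z \<partial>lborel) \<longlonglongrightarrow> (\<integral>z. \<gamma> i z * pd \<phi> (b i) z \<partial>lborel)" for i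
    proof -
      have hne: "h n \<noteq> 0" "\<bar>h n\<bar> \<le> 1" for n using h0[of n] h1[of n] by auto
      have p\<phi>: "test_fun D0 (pd \<phi> (b i))" by (rule test_fun_pd[OF \<phi> bB(1)])
      have qL: "L2 (q i n)" for n unfolding q_def by (rule dq_L2(1)[OF \<phi> bB(1) hlim hne])
      have q2: "(\<lambda>n. \<integral>z. (q i n z - pd \<phi> (b i) z)\<^sup>2 \<partial>lborel) \<longlonglongrightarrow> 0" unfolding q_def by (rule dq_L2(2)[OF \<phi> bB(1) hlim hne])
      have pL: "L2 (pd \<phi> (b i))" by (rule test_fun_L2[OF p\<phi>])
      have a: "(\<lambda>n. \<integral>z. G i n z * pd \<phi> (b i) z \<partial>lborel) \<longlonglongrightarrow> (\<integral>z. \<gamma> i z * pd \<phi> (b i) z \<partial>lborel)"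
        unfolding \<gamma>(3)[OF p\<phi>] by (rule Glim[OF p\<phi>])
      have bnd: "(\<lambda>n. \<integral>z. G i n z * (q i n z - pd \<phi> (b i) z) \<partial>lborel) \<longlonglongrightarrow> 0"
      proof (rule LIMSEQ_I)
        fix e :: real assume e: "e > 0"
        have C0: "C \<ge> 0" using GC[of i 0] by (meson Bochner_Integration.integral_nonneg order_trans zero_le_power2)
        define c where "c = e / (C + 1)"
        have c: "c > 0" "c * C < e" using e C0 by (auto simp: c_def field_simps)
        obtain n1 where n1: "\<And>n. n \<ge> n1 \<Longrightarrow> (\<integral>z. (q i n z - pd \<phi> (b i) z)\<^sup>2 \<partial>lborel) < c * e"
          using order_tendstoD(2)[OF q2, of "c*e"] c e by (auto simp: eventually_sequentially)
        show "\<exists>no. \<forall>n\<ge>no. norm ((\<integral>z. G i n z * (q i n z - pd \<phi> (b i) z) \<partial>lborel) - 0) < e"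
        proof (intro exI[of _ n1] allI impI)
          fix n assume n: "n \<ge> n1"
          have "2 * \<bar>\<integral>z. G i n z * (q i n z - pd \<phi> (b i) z) \<partial>lborel\<bar> \<le> c * (\<integral>z. (G i n z)\<^sup>2 \<partial>lborel) + (\<integral>z. (q i n z - pd \<phi> (b i) z)\<^sup>2 \<partial>lborel) / c"
            by (rule L2_mult_bound[OF GL L2_diff[OF qL pL] c(1)])
          also have "c * (\<integral>z. (G i n z)\<^sup>2 \<partial>lborel) \<le> c * C" using GC c by (intro mult_left_mono) auto
          also have "(\<integral>z. (q i n z - pd \<phi> (b i) z)\<^sup>2 \<partial>lborel) / c \<le> e" using n1[OF n] c by (simp add: field_simps)
          finally have "2 * \<bar>\<integral>z. G i n z * (q i n z - pd \<phi> (b i) z) \<partial>lborel\<bar> < 2 * e" using c(2) by simp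
          then show "norm ((\<integral>z. G i n z * (q i n z - pd \<phi> (b i) z) \<partial>lborel) - 0) < e" by simp
        qed
      qed
      have "(\<integral>z. G i n z * q i n z \<partial>lborel) = (\<integral>z. G i n z * pd \<phi> (b i) z \<partial>lborel) + (\<integral>z. G i n z * (q i n z - pd \<phi> (b i) z) \<partial>lborel)" for n
      proof -
        have "(\<integral>z. G i n z * pd \<phi> (b i) z \<partial>lborel) + (\<integral>z. G i n z * (q i n z - pd \<phi> (b i) z) \<partial>lborel)
          = (\<integral>z. G i n z * pd \<phi> (b i) z + G i n z * (q i n z - pd \<phi> (b i) z) \<partial>lborel)"
          by (rule Bochner_Integration.integral_add[symmetric]) (intro L2_mult GL pL L2_diff qL)+
        then show ?thesis by (simp add: algebra_simps)
      qed
      then show ?thesis using tendsto_add[OF a bnd] by simp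
    qed
    have "(\<lambda>n. \<Sum>i\<in>UNIV. \<integral>z. G i n z * q i n z \<partial>lborel) \<longlonglongrightarrow> (\<Sum>i\<in>UNIV. \<integral>z. \<gamma> i z * pd \<phi> (b i) z \<partial>lborel)"
      by (intro tendsto_sum R)
    then have "(\<lambda>n. \<integral>z. rt (w n z) * ((\<phi> (z + (- \<tau> n) *\<^sub>R bt) - \<phi> z) / (- \<tau> n)) \<partial>lborel) \<longlonglongrightarrow> (\<Sum>i\<in>UNIV. \<integral>z. \<gamma> i z * pd \<phi> (b i) z \<partial>lborel)"
      by (rule Lim_transform_eventually) (use discrete in \<open>auto elim: eventually_mono\<close>)
    then show ?thesis using L LIMSEQ_unique by blast
  qed
  have ws: "weak_sol m D0 (\<lambda>z. rt (\<omega> z))"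
    unfolding weak_sol_def
  proof (intro conjI exI[of _ "\<lambda>z. \<chi> i. \<gamma> i z"] allI impI ballI)
    show "0 \<le> rt (\<omega> z)" for z by simp
    show "continuous_on D0 (\<lambda>z. rt (\<omega> z))"
      using continuous_on_subset[OF cont\<omega> D0S] \<omega>b m1 by (intro continuous_on_powr') (auto intro: continuous_intros)
    fix V t1 t2 assume V: "open V \<and> t1 < t2 \<and> cc (cyl V t1 t2) D0"
    have Vb: "cyl V t1 t2 \<in> sets borel" using V unfolding cyl_def by (intro borel_open open_Times) auto
    have VD: "cyl V t1 t2 \<subseteq> D0" using V closure_subset[of "cyl V t1 t2"] unfolding cc_def by blast
    show "set_borel_measurable lborel (cyl V t1 t2) (\<lambda>z. rt (\<omega> z) powr m)"
      unfolding set_borel_measurable_def using Vb by measurable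
    show "set_integrable lborel (cyl V t1 t2) (\<lambda>z. (rt (\<omega> z) powr m)\<^sup>2)"
      unfolding set_integrable_def pw
    proof (rule L2_bounded_support(2)[where S = Q and C = "M\<^sup>2"])
      show "(\<lambda>z. indicat_real (cyl V t1 t2) z *\<^sub>R (\<omega> z)\<^sup>2) \<in> borel_measurable lborel" using Vb by measurable
      show "\<bar>indicat_real (cyl V t1 t2) z *\<^sub>R (\<omega> z)\<^sup>2\<bar> \<le> M\<^sup>2" for z
        using \<omega>b[of z] power_mono[of "\<omega> z" M 2] by (auto simp: indicator_def)
      show "indicat_real (cyl V t1 t2) z *\<^sub>R (\<omega> z)\<^sup>2 = 0" if "z \<notin> Q" for z using that VD D0Q by (auto simp: indicator_def)
    qed (use Qs Qf in auto)
    have \<gamma>m: "\<gamma> i \<in> borel_measurable borel" for i using \<gamma>(1)[of i] by (auto simp: L2_def)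
    show "set_borel_measurable lborel (cyl V t1 t2) (\<lambda>z. (\<chi> i. \<gamma> i z) $ i)" for i
      unfolding set_borel_measurable_def using Vb \<gamma>m[of i] by simp
    show "set_integrable lborel (cyl V t1 t2) (\<lambda>z. ((\<chi> i. \<gamma> i z) $ i)\<^sup>2)" for i
      unfolding set_integrable_def using integrable_mult_indicator[of "cyl V t1 t2" lborel "\<lambda>z. (\<gamma> i z)\<^sup>2"] \<gamma>(1)[of i] Vb
      by (simp add: L2_def)
  next
    fix \<phi> assume \<phi>: "test_fun D0 \<phi>"
    have bd: "pd \<phi> (b i) = dx \<phi> i" "pd \<phi> bt = dt \<phi>" for i by (simp_all add: b_def bt_def dx_def dt_def)
    have ind: "indicat_real D0 z * (x * \<phi> z) = x * \<phi> z" "indicat_real D0 z * (x * pd \<phi> (b i) z) = x * pd \<phi> (b i) z"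
      "indicat_real D0 z * (x * pd \<phi> bt z) = x * pd \<phi> bt z" for z x i
      using out[OF \<phi>, of z] out[OF test_fun_pd[OF \<phi> bB(1)], of z i] out[OF test_fun_pd[OF \<phi> bB(2)], of z] by (auto simp: indicator_def)
    show "(LINT z:D0|lborel. rt (\<omega> z) powr m * dx \<phi> i z) = - (LINT z:D0|lborel. (\<chi> i. \<gamma> i z) $ i * \<phi> z)" for i
      unfolding set_lebesgue_integral_def bd[symmetric] pw using \<gamma>(3)[OF \<phi>, of i] by (simp add: ind)
    have iu: "integrable lborel (\<lambda>z. rt (\<omega> z) * pd \<phi> bt z)"
    proof -
      have pt: "test_fun D0 (pd \<phi> bt)" by (rule test_fun_pd[OF \<phi> bB(2)])
      obtain B R where BR: "\<And>z. \<bar>pd \<phi> bt z\<bar> \<le> B" "\<And>z. R < norm z \<Longrightarrow> pd \<phi> bt z = 0" using test_fun_bounded[OF pt] by metis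
      have fin: "cball (0::'n pt) R \<in> sets lborel" "emeasure lborel (cball (0::'n pt) R) < \<infinity>"
        by (simp, intro emeasure_bounded_finite, simp)
      have ru: "\<bar>rt (\<omega> z)\<bar> \<le> rt M" for z using root_mono[OF m1, of "\<omega> z" M] \<omega>b[of z] by simp
      show ?thesis
        by (rule integrable_bounded_mult[where A = "rt M" and B = B and S = "cball 0 R"]) (use ru BR fin test_fun_measurable[OF pt] in \<open>auto simp: not_le\<close>)
    qed
    have i\<gamma>: "integrable lborel (\<lambda>z. \<gamma> i z * pd \<phi> (b i) z)" for i
      by (rule L2_mult[OF \<gamma>(1) test_fun_L2[OF test_fun_pd[OF \<phi> bB(1)]]])
    have "(LINT z:D0|lborel. - rt (\<omega> z) * dt \<phi> z + (\<Sum>i\<in>UNIV. (\<chi> i. \<gamma> i z) $ i * dx \<phi> i z))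
      = (\<integral>z. - (rt (\<omega> z) * pd \<phi> bt z) + (\<Sum>i\<in>UNIV. \<gamma> i z * pd \<phi> (b i) z) \<partial>lborel)"
      unfolding set_lebesgue_integral_def bd[symmetric]
      proof (intro Bochner_Integration.integral_cong refl)
        fix z
        show "indicat_real D0 z *\<^sub>R (- rt (\<omega> z) * pd \<phi> bt z + (\<Sum>i\<in>UNIV. (\<chi> i. \<gamma> i z) $ i * pd \<phi> (b i) z))
          = - (rt (\<omega> z) * pd \<phi> bt z) + (\<Sum>i\<in>UNIV. \<gamma> i z * pd \<phi> (b i) z)"
          using out[OF test_fun_pd[OF \<phi> bB(1)], of z] out[OF test_fun_pd[OF \<phi> bB(2)], of z] by (cases "z \<in> D0") simp_all
      qed
    also have "\<dots> = - (\<integral>z. rt (\<omega> z) * pd \<phi> bt z \<partial>lborel) + (\<Sum>i\<in>UNIV. \<integral>z. \<gamma> i z * pd \<phi> (b i) z \<partial>lborel)"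
      using iu i\<gamma> by simp
    finally show "(LINT z:D0|lborel. - rt (\<omega> z) * dt \<phi> z + (\<Sum>i\<in>UNIV. (\<chi> i. \<gamma> i z) $ i * dx \<phi> i z)) = 0"
      using eqn[OF \<phi>] by simp
  qed
  show ?thesis
  proof (rule that[of s \<omega>])
    show "\<omega> z = \<Psi> z" if "z \<in> pbdry U t0 (t0+T)" for z
      using bd0[OF that] that T by (auto simp: \<omega>_def S_def pbdry_def frontier_def)
  qed (use smono limw cont\<omega> \<omega>b ws in \<open>auto simp: S_def D0_def w_def h_def\<close>)
qed

end

section \<open>Comparison of viscosity sub- and supersolutions\<close>

text \<open>Subadditivity of the root, from \<open>t \<le> t powr (1/m)\<close> on
  \<open>[0,1]\<close> applied to the shares of \<open>b\<close> and \<open>\<epsilon>\<close> in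
  their sum.\<close>

lemma root_diff_le:
  fixes m :: real
  assumes "m > 1" "0 \<le> b" "b \<le> a" "a \<le> b + \<epsilon>"
  shows "a powr (1/m) - b powr (1/m) \<le> \<epsilon> powr (1/m)"
proof (cases "b + \<epsilon> = 0")
  case True
  then have "a = 0" "b = 0" using assms by auto
  then show ?thesis by simp
next
  case False
  define s where "s = b + \<epsilon>"
  have s: "s > 0" "0 \<le> \<epsilon>" using False assms by (auto simp: s_def)
  have le: "t \<le> t powr (1/m)" if "0 \<le> t" "t \<le> 1" for t :: real
    using powr_mono'[of "1/m" 1 t] assms that by simp
  have "1 = b / s + \<epsilon> / s" using s by (simp add: s_def add_divide_distrib[symmetric])
  also have "\<dots> \<le> (b / s) powr (1/m) + (\<epsilon> / s) powr (1/m)"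
    using s assms by (intro add_mono le) (auto simp: s_def)
  also have "\<dots> = (b powr (1/m) + \<epsilon> powr (1/m)) / s powr (1/m)"
    using s assms by (simp add: powr_divide add_divide_distrib)
  finally have "s powr (1/m) \<le> b powr (1/m) + \<epsilon> powr (1/m)" using s by (simp add: field_simps)
  moreover have "a powr (1/m) \<le> s powr (1/m)" using assms by (intro root_mono) (auto simp: s_def)
  ultimately show ?thesis by simp
qed

text \<open>At each point the maximum equals one of its two branches and lies above that branch
  elsewhere, so \<open>lap_mono\<close> gives semiconvexity with the same
  \<open>\<Lambda>\<close>.\<close>

lemma good_truncate:
  assumes g: "good M \<Lambda> \<Psi>" and \<epsilon>: "\<epsilon> > 0"
  shows "good M \<Lambda> (\<lambda>z. max 0 (\<Psi> z - \<epsilon>))"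
  unfolding good_def
proof (intro conjI allI impI)
  show "0 < \<Lambda>" using g by (simp add: good_def)
  fix z z' :: "'a pt"
  have "0 \<le> \<Psi> z" "\<Psi> z \<le> M" "\<bar>\<Psi> z - \<Psi> z'\<bar> \<le> \<Lambda> * dist z z'" using g unfolding good_def by blast+
  then show "0 \<le> max 0 (\<Psi> z - \<epsilon>)" "max 0 (\<Psi> z - \<epsilon>) \<le> M" "\<bar>max 0 (\<Psi> z - \<epsilon>) - max 0 (\<Psi> z' - \<epsilon>)\<bar> \<le> \<Lambda> * dist z z'"
    using \<epsilon> by auto
next
  fix h t :: real and x :: "real^'a" assume h: "0 < h"
  show "- \<Lambda> * h\<^sup>2 \<le> lap h (\<lambda>x. max 0 (\<Psi> (x, t) - \<epsilon>)) x"
  proof (cases "\<Psi> (x, t) - \<epsilon> \<le> 0")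
    case True
    have "lap h (\<lambda>_. 0) x \<le> lap h (\<lambda>x. max 0 (\<Psi> (x, t) - \<epsilon>)) x" using True by (intro lap_mono) auto
    moreover have "0 \<le> \<Lambda> * h\<^sup>2" using g by (auto simp: good_def)
    ultimately show ?thesis by (simp add: lap_const)
  next
    case False
    have "lap h (\<lambda>x. \<Psi> (x, t) - \<epsilon>) x \<le> lap h (\<lambda>x. max 0 (\<Psi> (x, t) - \<epsilon>)) x" using False by (intro lap_mono) auto
    moreover have "- \<Lambda> * h\<^sup>2 \<le> lap h (\<lambda>x. \<Psi> (x, t)) x" using g h by (auto simp: good_def)
    ultimately show ?thesis by (simp add: lap_diff lap_const)
  qed
qed

section \<open>Sup-convolution as admissible data\<close>

lemma parabola_lipschitz:
  fixes k c M a b :: real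
  assumes k: "k > 0" and c: "0 \<le> c" "c \<le> M" and a: "0 \<le> a" and d: "\<bar>a - b\<bar> \<le> d" and b: "0 \<le> b"
  shows "max 0 (c - k * a\<^sup>2) \<le> max 0 (c - k * b\<^sup>2) + (3 * M + 3 * k) * d"
proof (cases "c - k * a\<^sup>2 \<le> 0 \<or> b \<le> a")
  case True
  have "0 \<le> (3 * M + 3 * k) * d" using k c d by auto
  moreover have "k * b\<^sup>2 \<le> k * a\<^sup>2" if "b \<le> a" using that b k by (intro mult_left_mono power_mono) auto
  ultimately show ?thesis using True by auto
next
  case False
  \<comment> \<open>Only the part above zero remains, where \<open>k * a\<^sup>2 \<le> M\<close>
    bounds the slope of the parabola; for \<open>d > 1\<close> the height \<open>M\<close> itself is
    enough.\<close>
  then have ab: "a < b" "k * a\<^sup>2 \<le> M" "max 0 (c - k * a\<^sup>2) = c - k * a\<^sup>2" using c by auto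
  have e: "(3 * M + 3 * k) * d = 3 * (M * d) + 3 * (k * d)" by (simp add: algebra_simps)
  have pos: "0 \<le> M * d" "0 \<le> k * d" using k c d by auto
  show ?thesis
  proof (cases "d \<le> 1")
    case True
    have ka: "k * a \<le> M + k"
    proof (cases "a \<le> 1")
      case True
      then have "k * a \<le> k * 1" using k by (intro mult_left_mono) auto
      then show ?thesis using c by simp
    next
      case False
      then have "k * a * 1 \<le> k * a * a" using k a by (intro mult_left_mono) auto
      then show ?thesis using ab(2) k unfolding power2_eq_square mult.assoc by linarith
    qed
    have bd: "b \<le> a + d" using d by auto
    have "b * b \<le> (a + d) * (a + d)" using bd b by (intro mult_mono) auto
    also have "\<dots> = a * a + (2 * a * d + d * d)" by (simp add: algebra_simps)
    also have "d * d \<le> 1 * d" using True d by (intro mult_right_mono) auto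
    finally have "k * (b * b) \<le> k * (a * a + (2 * a * d + d))" using k by (intro mult_left_mono) auto
    also have "\<dots> = k * (a * a) + 2 * (k * a * d) + k * d" by (simp add: algebra_simps)
    finally have 1: "k * (b * b) \<le> k * (a * a) + 2 * (k * a * d) + k * d" .
    have "k * a * d \<le> (M + k) * d" using ka d by (intro mult_right_mono) auto
    also have "(M + k) * d = M * d + k * d" by (simp add: algebra_simps)
    finally have "k * b\<^sup>2 \<le> k * a\<^sup>2 + 3 * (M * d) + 3 * (k * d)" using 1 pos unfolding power2_eq_square by linarith
    then show ?thesis unfolding e using ab(3) by simp
  next
    case False
    have "M * 1 \<le> M * d" using False c by (intro mult_left_mono) auto
    moreover have "0 \<le> k * a\<^sup>2" using k by simp
    ultimately show ?thesis unfolding e using ab(3) pos c by (auto simp: max_def)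
  qed
qed

text \<open>Sup-convolution over \<open>K\<close>, cut off at zero so that the data stay
  nonnegative.\<close>

definition supconv :: "'n::finite pt set \<Rightarrow> ('n pt \<Rightarrow> real) \<Rightarrow> real \<Rightarrow> 'n pt \<Rightarrow> real" where
  "supconv K f k z = (SUP y\<in>K. max 0 (f y - k * (dist z y)\<^sup>2))"

lemma supconv_bounds:
  assumes ne: "K \<noteq> {}" and f: "\<forall>y\<in>K. 0 \<le> f y \<and> f y \<le> M" and k: "k > 0"
  shows "y \<in> K \<Longrightarrow> max 0 (f y - k * (dist z y)\<^sup>2) \<le> supconv K f k z"
    and "(\<And>y. y \<in> K \<Longrightarrow> max 0 (f y - k * (dist z y)\<^sup>2) \<le> B) \<Longrightarrow> supconv K f k z \<le> B"
    and "0 \<le> supconv K f k z" and "supconv K f k z \<le> M"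
proof -
  have le: "max 0 (f y - k * (dist z y)\<^sup>2) \<le> M" if "y \<in> K" for y
  proof -
    have "0 \<le> k * (dist z y)\<^sup>2" using k by simp
    then show ?thesis using f that by force
  qed
  then have bdd: "bdd_above ((\<lambda>y. max 0 (f y - k * (dist z y)\<^sup>2)) ` K)" by (rule bdd_aboveI2)
  show 1: "max 0 (f y - k * (dist z y)\<^sup>2) \<le> supconv K f k z" if "y \<in> K" for y
    unfolding supconv_def using bdd that by (rule cSUP_upper2) simp
  show "supconv K f k z \<le> B" if "\<And>y. y \<in> K \<Longrightarrow> max 0 (f y - k * (dist z y)\<^sup>2) \<le> B" for B
    unfolding supconv_def using ne that by (rule cSUP_least)
  show "supconv K f k z \<le> M" unfolding supconv_def using ne le by (rule cSUP_least)
  obtain y where "y \<in> K" using ne by auto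
  then show "0 \<le> supconv K f k z" using 1[of y] by simp
qed

text \<open>Each paraboloid has lattice Laplacian -2 n k h^2, \<open>n\<close> the dimension, and
  the neighbour sum of the supremum dominates that of every member; this is semiconvexity. The
  resulting \<open>\<Lambda>\<close> grows with \<open>k\<close>.\<close>

lemma supconv_good:
  fixes K :: "'n::finite pt set"
  assumes ne: "K \<noteq> {}" and f: "\<forall>y\<in>K. 0 \<le> f y \<and> f y \<le> M" and k: "k > 0"
  shows "good M (3 * M + (2 * real CARD('n) + 3) * k) (supconv K f k)"
proof -
  let ?N = "real CARD('n)" and ?\<Psi> = "supconv K f k"
  note sc = supconv_bounds[OF ne f k]
  have M: "0 \<le> M" using ne f by fastforce
  have kN: "0 \<le> 2 * ?N * k" using k by simp
  have L: "3 * M + (2 * ?N + 3) * k = 3 * M + 3 * k + 2 * ?N * k" by (simp add: algebra_simps)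
  have lip: "?\<Psi> z \<le> ?\<Psi> z' + (3 * M + 3 * k) * dist z z'" for z z'
  proof (rule sc(2))
    fix y assume y: "y \<in> K"
    have "max 0 (f y - k * (dist z y)\<^sup>2) \<le> max 0 (f y - k * (dist z' y)\<^sup>2) + (3 * M + 3 * k) * dist z z'"
      using bspec[OF f y] k abs_dist_diff_le[of z y z'] by (intro parabola_lipschitz) (auto simp: dist_commute)
    then show "max 0 (f y - k * (dist z y)\<^sup>2) \<le> ?\<Psi> z' + (3 * M + 3 * k) * dist z z'" using sc(1)[OF y, of z'] by linarith
  qed
  have lap: "- (2 * ?N * k) * h\<^sup>2 \<le> lap h (\<lambda>x. ?\<Psi> (x, t)) x" for h t and x :: "real^'n"
  proof -
    have N0: "?N > 0" by simp
    have "2 * ?N * ?\<Psi> (x, t) \<le> nsum h (\<lambda>x. ?\<Psi> (x, t)) x + 2 * ?N * k * h\<^sup>2"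
    proof -
      have "?\<Psi> (x, t) \<le> (nsum h (\<lambda>x. ?\<Psi> (x, t)) x + 2 * ?N * k * h\<^sup>2) / (2 * ?N)"
      proof (rule sc(2))
        fix y assume y: "y \<in> K"
        define q where "q = (\<lambda>x. f y - k * (dist (x, t) y)\<^sup>2)"
        have "q = (\<lambda>x. (f y - k * (t - snd y)\<^sup>2) - k * (norm (x - fst y))\<^sup>2)"
          by (cases y) (auto simp: q_def dist_Pair_Pair dist_real_def dist_norm[where 'a = "real^'n"] fun_eq_iff distrib_left)
        then have lq: "lap h q x = - (2 * ?N * k) * h\<^sup>2"
          by (simp add: lap_diff lap_const lap_cmult lap_norm_sq)
        have "nsum h q x \<le> nsum h (\<lambda>x. ?\<Psi> (x, t)) x"
        proof (rule nsum_mono)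
          fix x' show "q x' \<le> ?\<Psi> (x', t)" using sc(1)[OF y, of "(x', t)"] by (simp add: q_def)
        qed
        then have 1: "2 * ?N * q x \<le> nsum h (\<lambda>x. ?\<Psi> (x, t)) x + 2 * ?N * k * h\<^sup>2" using lq by (simp add: lap_nsum)
        have "nsum h (\<lambda>_. 0) x \<le> nsum h (\<lambda>x. ?\<Psi> (x, t)) x" using sc(3) by (intro nsum_mono) auto
        then have 2: "0 \<le> nsum h (\<lambda>x. ?\<Psi> (x, t)) x + 2 * ?N * k * h\<^sup>2" using k by (simp add: nsum_const)
        have "2 * ?N * max 0 (q x) \<le> nsum h (\<lambda>x. ?\<Psi> (x, t)) x + 2 * ?N * k * h\<^sup>2" using 1 2 by (auto simp: max_def)
        then show "max 0 (f y - k * (dist (x, t) y)\<^sup>2) \<le> (nsum h (\<lambda>x. ?\<Psi> (x, t)) x + 2 * ?N * k * h\<^sup>2) / (2 * ?N)"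
          using N0 unfolding q_def by (subst pos_le_divide_eq) (simp, simp only: mult.commute)
      qed
      then show ?thesis using N0 by (simp add: pos_le_divide_eq mult.commute)
    qed
    then show ?thesis by (simp add: lap_nsum)
  qed
  show ?thesis unfolding good_def L
  proof (intro conjI allI impI)
    show "0 < 3 * M + 3 * k + 2 * ?N * k" using M k kN by linarith
    fix z z' :: "'n pt"
    show "0 \<le> ?\<Psi> z" "?\<Psi> z \<le> M" using sc(3,4) by auto
    have "(3 * M + 3 * k) * dist z z' \<le> (3 * M + 3 * k + 2 * ?N * k) * dist z z'" using kN by (intro mult_right_mono) auto
    then show "\<bar>?\<Psi> z - ?\<Psi> z'\<bar> \<le> (3 * M + 3 * k + 2 * ?N * k) * dist z z'"
      using lip[of z z'] lip[of z' z] by (simp add: dist_commute)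
  next
    fix h t :: real and x :: "real^'n"
    have "- (3 * M + 3 * k + 2 * ?N * k) * h\<^sup>2 \<le> - (2 * ?N * k) * h\<^sup>2" using M k by (intro mult_right_mono) auto
    then show "- (3 * M + 3 * k + 2 * ?N * k) * h\<^sup>2 \<le> lap h (\<lambda>x. ?\<Psi> (x, t)) x" using lap[of h t x] by linarith
  qed
qed

text \<open>Large \<open>k\<close> confines the supremum to nearby points. Pairs
  \<open>(z, y)\<close> with \<open>f y \<ge> g z + \<epsilon>\<close> stay at a distance
  \<open>c\<close> from the diagonal by semicontinuity and compactness, and for them the paraboloid
  is at most zero once \<open>k * c\<^sup>2 \<ge> M\<close>.\<close>

lemma supconv_approx:
  fixes K :: "'n::finite pt set"
  assumes ne: "K \<noteq> {}" and K: "compact K" and f: "\<forall>y\<in>K. 0 \<le> f y \<and> f y \<le> M" and g: "\<And>y. y \<in> K \<Longrightarrow> 0 \<le> g y"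
    and usc: "\<And>z c. z \<in> K \<Longrightarrow> f z < c \<Longrightarrow> \<exists>d>0. \<forall>y\<in>K. dist y z < d \<longrightarrow> f y < c"
    and lsc: "\<And>z c. z \<in> K \<Longrightarrow> c < g z \<Longrightarrow> \<exists>d>0. \<forall>y\<in>K. dist y z < d \<longrightarrow> c < g y"
    and fg: "\<And>z. z \<in> K \<Longrightarrow> f z < g z + \<epsilon>" and \<epsilon>: "\<epsilon> > 0"
  obtains k where "k > 0" "\<And>z. z \<in> K \<Longrightarrow> f z \<le> supconv K f k z" "\<And>z. z \<in> K \<Longrightarrow> supconv K f k z \<le> g z + \<epsilon>"
proof -
  \<comment> \<open>\<open>B\<close> itself need not be closed; its closure is compact and is shown
    to miss the diagonal.\<close>
  define B where "B = {p\<in>K \<times> K. g (fst p) + \<epsilon> \<le> f (snd p)}"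
  have cB: "compact (closure B)"
    using compact_Times[OF K K] by (intro compact_closure[THEN iffD2] bounded_subset[OF compact_imp_bounded]) (auto simp: B_def)
  have BK: "closure B \<subseteq> K \<times> K"
    using compact_Times[OF K K] by (intro closure_minimal compact_imp_closed) (auto simp: B_def)
  have diag: "fst p \<noteq> snd p" if p: "p \<in> closure B" for p
  proof
    assume e: "fst p = snd p"
    define z where "z = fst p"
    have pz: "p = (z, z)" using e by (simp add: z_def prod_eq_iff)
    have z: "z \<in> K" using BK p pz by auto
    define \<theta> where "\<theta> = (g z + \<epsilon> - f z) / 2"
    have \<theta>: "\<theta> > 0" "f z + \<theta> = g z - \<theta> + \<epsilon>" using fg[OF z] by (auto simp: \<theta>_def field_simps)
    obtain d1 where d1: "d1 > 0" "\<forall>y\<in>K. dist y z < d1 \<longrightarrow> f y < f z + \<theta>" using usc[OF z, of "f z + \<theta>"] \<theta> by auto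
    obtain d2 where d2: "d2 > 0" "\<forall>y\<in>K. dist y z < d2 \<longrightarrow> g z - \<theta> < g y" using lsc[OF z, of "g z - \<theta>"] \<theta> by auto
    obtain q where q: "q \<in> B" "dist q p < min d1 d2" using p d1(1) d2(1) by (metis closure_approachable min_less_iff_conj)
    have "dist (fst q) z < d2" "dist (snd q) z < d1"
      using q(2) dist_fst_le[of q p] dist_snd_le[of q p] by (auto simp: pz)
    then have "f (snd q) < f z + \<theta>" "g z - \<theta> < g (fst q)" using q(1) d1 d2 by (auto simp: B_def)
    then show False using q(1) \<theta> by (auto simp: B_def)
  qed
  obtain c where c: "c > 0" "\<And>z y. (z, y) \<in> B \<Longrightarrow> c \<le> dist z y"
  proof (cases "closure B = {}")
    case True then show ?thesis using that[of 1] by auto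
  next
    case False
    have "continuous_on (closure B) (\<lambda>p. dist (fst p) (snd p))" by (intro continuous_intros)
    from continuous_attains_inf[OF cB False this]
    obtain p where p: "p \<in> closure B" "\<forall>q\<in>closure B. dist (fst p) (snd p) \<le> dist (fst q) (snd q)" by blast
    show ?thesis
    proof (rule that[of "dist (fst p) (snd p)"])
      show "0 < dist (fst p) (snd p)" using diag[OF p(1)] by simp
      show "dist (fst p) (snd p) \<le> dist z y" if "(z, y) \<in> B" for z y using p(2) that closure_subset[of B] by fastforce
    qed
  qed
  define k where "k = (\<bar>M\<bar> + 1) / c\<^sup>2"
  have k: "k > 0" "k * c\<^sup>2 \<ge> M" using c by (auto simp: k_def)
  note sc = supconv_bounds[OF ne f k(1)]
  show thesis
  proof (rule that[OF k(1)])
    fix z assume z: "z \<in> K"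
    show "f z \<le> supconv K f k z" using sc(1)[OF z, of z] by simp
    show "supconv K f k z \<le> g z + \<epsilon>"
    proof (rule sc(2))
      fix y assume y: "y \<in> K"
      show "max 0 (f y - k * (dist z y)\<^sup>2) \<le> g z + \<epsilon>"
      proof (cases "(z, y) \<in> B")
        case True
        have "c\<^sup>2 \<le> (dist z y)\<^sup>2" using c(1) c(2)[OF True] by (intro power_mono) auto
        then have "k * c\<^sup>2 \<le> k * (dist z y)\<^sup>2" using k by (intro mult_left_mono) auto
        then have "f y - k * (dist z y)\<^sup>2 \<le> 0" using k bspec[OF f y] by linarith
        then show ?thesis using g[OF z] \<epsilon> by simp
      next
        case False
        then have "f y < g z + \<epsilon>" using y z by (auto simp: B_def)
        moreover have "0 \<le> k * (dist z y)\<^sup>2" using k by simp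
        ultimately show ?thesis using g[OF z] \<epsilon> by auto
      qed
    qed
  qed
qed

text \<open>However rough \<open>\<Omega>\<close> is, the points farther than \<open>r\<close> from
  the complement form a domain with exterior balls of radius \<open>r\<close>: they are centred at
  nearest points of the complement.\<close>

lemma inner_domain:
  fixes \<Omega> :: "(real^'n::finite) set"
  assumes \<Omega>: "open \<Omega>" "bounded \<Omega>" and r: "r > 0"
  defines "U \<equiv> {x. r < infdist x (- \<Omega>)}"
  shows "open U" "closure U \<subseteq> \<Omega>" "extball U r" "\<And>x. x \<in> frontier U \<Longrightarrow> infdist x (- \<Omega>) = r" "\<And>x. x \<in> closure U \<Longrightarrow> r \<le> infdist x (- \<Omega>)"
proof -
  have ne: "- \<Omega> \<noteq> {}" using \<Omega>(2) not_bounded_UNIV by (metis Compl_empty_eq double_complement)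
  have cl: "closed (- \<Omega>)" using \<Omega>(1) by (simp add: closed_def)
  have ci: "continuous_on UNIV (\<lambda>x. infdist x (- \<Omega>))" by (intro continuous_intros)
  show o: "open U" unfolding U_def using open_Collect_less[OF continuous_on_const ci] .
  have "closed {x. r \<le> infdist x (- \<Omega>)}" using closed_Collect_le[OF continuous_on_const ci] .
  then have "closure U \<subseteq> {x. r \<le> infdist x (- \<Omega>)}" by (intro closure_minimal) (auto simp: U_def)
  then show c: "\<And>x. x \<in> closure U \<Longrightarrow> r \<le> infdist x (- \<Omega>)" by auto
  show "closure U \<subseteq> \<Omega>"
  proof
    fix x assume "x \<in> closure U"
    then have "infdist x (- \<Omega>) > 0" using c[of x] r by simp
    then show "x \<in> \<Omega>" using infdist_zero[of x "- \<Omega>"] by (metis ComplI less_irrefl)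
  qed
  show f: "\<And>x. x \<in> frontier U \<Longrightarrow> infdist x (- \<Omega>) = r"
  proof -
    fix x assume "x \<in> frontier U"
    then have "x \<in> closure U" "x \<notin> U" using o by (auto simp: frontier_def interior_open)
    then show "infdist x (- \<Omega>) = r" using c[of x] by (auto simp: U_def)
  qed
  show "extball U r" unfolding extball_def
  proof (intro conjI ballI)
    fix x0 assume "x0 \<in> frontier U"
    then have e: "infdist x0 (- \<Omega>) = r" by (rule f)
    obtain y where y: "y \<in> - \<Omega>" "infdist x0 (- \<Omega>) = dist x0 y" using infdist_attains_inf[OF cl ne] by blast
    have "r \<le> dist x y" if "x \<in> U" for x using infdist_le[OF y(1), of x] that by (simp add: U_def)
    then show "\<exists>y. dist x0 y = r \<and> (\<forall>x\<in>U. r \<le> dist x y)" using e y(2) by auto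
  qed (rule r)
qed

text \<open>The points up to time \<open>t2\<close> where the inequality fails have compact closure,
  and none of their limits lies on the parabolic boundary; \<open>m0\<close>, which vanishes there,
  therefore has a positive minimum on the closure.\<close>

lemma boundary_gap:
  fixes \<Omega> :: "(real^'n::finite) set" and f g :: "'n pt \<Rightarrow> real"
  assumes \<Omega>: "open \<Omega>" "bounded \<Omega>" and t2: "t2 < T"
    and bnd: "\<And>z0. z0 \<in> pbdry \<Omega> 0 T \<Longrightarrow> \<exists>d>0. \<forall>y\<in>cyl \<Omega> 0 T. dist y z0 < d \<longrightarrow> f y < g y + \<epsilon>"
  obtains c where "c > 0" "\<And>z. z \<in> cyl \<Omega> 0 T \<Longrightarrow> snd z \<le> t2 \<Longrightarrow> snd z < c \<or> infdist (fst z) (- \<Omega>) < c \<Longrightarrow> f z < g z + \<epsilon>"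
proof -
  define A where "A = {z\<in>cyl \<Omega> 0 T. snd z \<le> t2 \<and> g z + \<epsilon> \<le> f z}"
  define m0 where "m0 = (\<lambda>z::'n pt. min (snd z) (infdist (fst z) (- \<Omega>)))"
  have sub: "closure A \<subseteq> closure \<Omega> \<times> {0..t2}"
    using closure_subset[of \<Omega>] by (intro closure_minimal closed_Times) (auto simp: A_def cyl_def)
  have "bounded (closure \<Omega> \<times> {0..t2})" using \<Omega> by (intro bounded_Times) auto
  then have cA: "compact (closure A)" using sub by (simp add: compact_eq_bounded_closed bounded_subset)
  have pos: "m0 z > 0" if z: "z \<in> closure A" for z
  proof (rule ccontr)
    assume "\<not> m0 z > 0"
    have zc: "fst z \<in> closure \<Omega>" "0 \<le> snd z" "snd z \<le> t2" using z sub by auto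
    have "snd z = 0 \<or> infdist (fst z) (- \<Omega>) = 0" using \<open>\<not> m0 z > 0\<close> zc infdist_nonneg[of "fst z" "- \<Omega>"] by (auto simp: m0_def min_def split: if_splits)
    moreover have "fst z \<in> frontier \<Omega>" if "infdist (fst z) (- \<Omega>) = 0"
    proof -
      have "- \<Omega> \<noteq> {}" using \<Omega>(2) not_bounded_UNIV by (metis Compl_empty_eq double_complement)
      then have "fst z \<in> - \<Omega>" using in_closed_iff_infdist_zero[of "- \<Omega>" "fst z"] that \<Omega>(1) by auto
      then show ?thesis using zc \<Omega>(1) by (simp add: frontier_def interior_open)
    qed
    ultimately have "z \<in> pbdry \<Omega> 0 T" using zc t2 by (cases z) (auto simp: pbdry_def)
    then obtain d where d: "d > 0" "\<forall>y\<in>cyl \<Omega> 0 T. dist y z < d \<longrightarrow> f y < g y + \<epsilon>" using bnd by blast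
    obtain y where "y \<in> A" "dist y z < d" using z d(1) by (metis closure_approachable)
    then show False using d(2) by (force simp: A_def)
  qed
  show thesis
  proof (cases "closure A = {}")
    case True
    then have "A = {}" using closure_subset[of A] by blast
    then have "f z < g z + \<epsilon>" if "z \<in> cyl \<Omega> 0 T" "snd z \<le> t2" for z using that unfolding A_def by (metis (mono_tags, lifting) empty_Collect_eq not_le)
    then show thesis using that[of 1] by auto
  next
    case False
    have "continuous_on (closure A) m0" unfolding m0_def by (intro continuous_intros)
    from continuous_attains_inf[OF cA False this]
    obtain p where p: "p \<in> closure A" "\<forall>q\<in>closure A. m0 p \<le> m0 q" by blast
    show thesis
    proof (rule that[OF pos[OF p(1)]])
      fix z assume z: "z \<in> cyl \<Omega> 0 T" "snd z \<le> t2" "snd z < m0 p \<or> infdist (fst z) (- \<Omega>) < m0 p"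
      then have "\<not> m0 p \<le> m0 z" by (auto simp: m0_def)
      then have "z \<notin> A" using p(2) closure_subset[of A] by blast
      then show "f z < g z + \<epsilon>" using z by (auto simp: A_def)
    qed
  qed
qed

section \<open>Stability of the scheme and comparison\<close>

context pme
begin

text \<open>The interior estimate supplies the one-sided bound of \<open>reg\<close>, so
  \<open>K\<close> is fixed by \<open>\<rho>\<close> before the data and the domain. The factor 2 in
  space and time leaves room for the whole cylinder of size \<open>\<rho>\<close> about the
  point.\<close>

lemma dsol_reg:
  assumes \<rho>: "\<rho> > 0"
  obtains K where "K > 0" "\<And>h U t0 \<Psi> y s. \<lbrakk>0 < h; \<forall>z. 0 \<le> \<Psi> z \<and> \<Psi> z \<le> M; y \<in> lat h; \<forall>x. (\<forall>i. \<bar>(x - y) $ i\<bar> < 2 * \<rho>) \<longrightarrow> x \<in> U;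
     2 * \<rho> \<le> real s * (l * h\<^sup>2)\<rbrakk> \<Longrightarrow> reg K h \<rho> (dsol h U t0 \<Psi>) y s"
proof -
  have "2 * \<rho> > 0" using \<rho> by simp
  from interior_one_sided[OF this \<rho>] obtain K where K: "K > 0"
    "\<And>h w (c::real^'n) k1 k x. \<lbrakk>0 < h; \<forall>k x. k \<le> Suc k1 \<longrightarrow> x \<in> lat h \<longrightarrow> (\<forall>i. \<bar>(x - c) $ i\<bar> < 2 * \<rho>) \<longrightarrow> 0 \<le> w k x \<and> w k x \<le> M;
      \<forall>k x. k \<le> k1 \<longrightarrow> x \<in> lat h \<longrightarrow> (\<forall>i. \<bar>(x - c) $ i\<bar> < 2 * \<rho>) \<longrightarrow> scheme h w k x;
      k \<le> k1; \<rho> \<le> real k * (l * h\<^sup>2); x \<in> lat h; \<forall>i. \<bar>(x - c) $ i\<bar> \<le> 2 * \<rho> / 2\<rbrakk>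
      \<Longrightarrow> w k x - w (Suc k) x \<le> K * (l * h\<^sup>2)" by blast
  show thesis
  proof (rule that[OF K(1)])
    fix h t0 :: real and U :: "(real^'n) set" and \<Psi> :: "'n pt \<Rightarrow> real" and y :: "real^'n" and s :: nat
    assume h: "0 < h" and pb: "\<forall>z. 0 \<le> \<Psi> z \<and> \<Psi> z \<le> M" and y: "y \<in> lat h" and U: "\<forall>x. (\<forall>i. \<bar>(x - y) $ i\<bar> < 2 * \<rho>) \<longrightarrow> x \<in> U"
      and s: "2 * \<rho> \<le> real s * (l * h\<^sup>2)"
    let ?w = "dsol h U t0 \<Psi>"
    have sch: "scheme h ?w k x" if "x \<in> lat h" "\<forall>i. \<bar>(x - y) $ i\<bar> < 2 * \<rho>" for k x
    proof (rule dsol_scheme[OF pb])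
      show "rnd h x \<in> U" using rnd_id[OF h that(1)] U that(2) by simp
    qed
    show "reg K h \<rho> ?w y s" unfolding reg_def
    proof (intro conjI ballI allI impI)
      show "\<rho> \<le> real s * (l * h\<^sup>2)" using s \<rho> by simp
      show "y \<in> lat h" by fact
      fix x k assume x: "x \<in> lat h" and d: "dist x y < \<rho>" and k: "\<bar>real k - real s\<bar> * (l * h\<^sup>2) < \<rho>"
      show "0 \<le> ?w k x" "?w k x \<le> M" using dsol_bounds[OF pb] by auto
      have c: "\<bar>(x - y) $ i\<bar> \<le> \<rho>" for i using component_le_norm_cart[of "x - y" i] d by (simp add: dist_norm)
      have c2: "\<bar>(x - y) $ i\<bar> < 2 * \<rho>" for i using c[of i] \<rho> by linarith
      show "scheme h ?w k x" using sch[OF x] c2 by blast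
      have "(real s - real k) * (l * h\<^sup>2) \<le> \<bar>real k - real s\<bar> * (l * h\<^sup>2)" using l0 by (intro mult_right_mono) auto
      then have kt: "\<rho> \<le> real k * (l * h\<^sup>2)" using k s by (simp add: left_diff_distrib)
      have "\<forall>i. \<bar>(x - y) $ i\<bar> \<le> 2 * \<rho> / 2" using c by simp
      then show "?w k x - ?w (Suc k) x \<le> K * (l * h\<^sup>2)"
        using K(2)[where w = ?w and c = y and ?k1.0 = k and k = k and x = x and h = h] h dsol_bounds[OF pb, of h U t0] sch kt x by simp
    qed
  qed
qed

text \<open>The time sum \<open>Z\<close> of the differences satisfies
  \<open>l * lap h Z \<ge> - rt \<epsilon>\<close>, because the final difference of roots is
  nonnegative and the initial one is at most \<open>rt \<epsilon>\<close>. A paraboloid turns it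
  into a strict subsolution that is nonpositive outside \<open>U\<close>.\<close>

lemma dsol_sum_diff:
  assumes h: "0 < h" "h \<le> 1" and pb: "\<forall>z. 0 \<le> \<Psi> z \<and> \<Psi> z \<le> M" "\<forall>z. 0 \<le> \<Phi> z \<and> \<Phi> z \<le> M"
    and le: "\<And>z. \<Phi> z \<le> \<Psi> z" "\<And>z. \<Psi> z \<le> \<Phi> z + \<epsilon>" and \<epsilon>: "\<epsilon> > 0" and UD: "\<forall>x\<in>U. norm x \<le> D" and y: "y \<in> lat h" "y \<in> U"
  shows "l * h\<^sup>2 * (\<Sum>j<k. dsol h U t0 \<Psi> j y - dsol h U t0 \<Phi> j y) \<le> real k * (l * h\<^sup>2) * \<epsilon> + (rt \<epsilon> + \<epsilon>) * (D + 1)\<^sup>2 / (2 * N)"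
proof -
  let ?w1 = "dsol h U t0 \<Psi>" and ?w2 = "dsol h U t0 \<Phi>"
  define Z where "Z = (\<lambda>x. \<Sum>j<k. ?w1 j x - ?w2 j x)"
  \<comment> \<open>The paraboloid contributes \<open>rt \<epsilon> + \<epsilon>\<close> to
    \<open>l * lap h G\<close>: the first term compensates \<open>Z\<close>, the second gives
    strictness.\<close>
  define A where "A = (rt \<epsilon> + \<epsilon>) / (2 * N * l * h\<^sup>2)"
  have N0: "N > 0" using N1 by simp
  have A: "A \<ge> 0" "2 * N * l * h\<^sup>2 * A = rt \<epsilon> + \<epsilon>" using N0 l0 h \<epsilon> by (auto simp: A_def intro!: divide_nonneg_nonneg)
  define G where "G = (\<lambda>x. (Z x - real k * \<epsilon>) + A * ((norm (x - 0))\<^sup>2 - (D + 1)\<^sup>2))"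
  have D0: "0 \<le> D" using UD y(2) norm_ge_zero[of y] order_trans by blast
  have mono: "?w2 j x \<le> ?w1 j x" for j x by (rule dsol_mono[OF h(1) pb(2,1) le(1)])
  have sumI: "(\<Sum>j<k. ?w1 j x - ?w2 j x) \<le> real k * c" if "\<And>j. ?w1 j x - ?w2 j x \<le> c" for x c
    using sum_bounded_above[of "{..<k}" "\<lambda>j. ?w1 j x - ?w2 j x" c] that by simp
  have ZM: "Z x \<le> real k * M" for x unfolding Z_def
    by (rule sumI) (use dsol_bounds[OF pb(1), of h U t0 _ x] dsol_bounds[OF pb(2), of h U t0 _ x] in \<open>smt (verit)\<close>)
  have Zout: "Z x \<le> real k * \<epsilon>" if "rnd h x \<notin> U" for x unfolding Z_def
    by (rule sumI) (use le in \<open>simp add: dsol_outside[OF that] diff_le_eq add.commute\<close>)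
  have norm1: "A * ((norm (x - 0))\<^sup>2 - (D + 1)\<^sup>2) \<le> 0" if "norm x \<le> D + 1" for x :: "real^'n"
    using power_mono[OF that, of 2] A by (intro mult_nonneg_nonpos) auto
  have "G y \<le> 0"
  proof (rule discrete_max_principle[where D = "lat h \<inter> U" and h = h and \<kappa> = "\<epsilon> / l" and g = G])
    have "G x \<le> real k * M" if "x \<in> lat h \<inter> U" for x
    proof -
      have "norm x \<le> D + 1" using UD that by force
      moreover have "0 \<le> real k * \<epsilon>" using \<epsilon> by simp
      ultimately show ?thesis using norm1[of x] ZM[of x] unfolding G_def by linarith
    qed
    then show "bdd_above (G ` (lat h \<inter> U))" by (intro bdd_aboveI2) auto
    show "0 < \<epsilon> / l" using \<epsilon> l0 by simp
    show "\<epsilon> / l \<le> lap h G x" if "x \<in> lat h \<inter> U" for x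
    proof -
      have rx: "rnd h x \<in> U" using rnd_id[OF h(1), of x] that by simp
      have "rt (?w1 k x) - rt (?w1 0 x) = l * lap h (\<lambda>x. \<Sum>j\<in>{0..<k}. ?w1 j x) x"
        "rt (?w2 k x) - rt (?w2 0 x) = l * lap h (\<lambda>x. \<Sum>j\<in>{0..<k}. ?w2 j x) x"
        by (intro scheme_sum dsol_scheme pb rx; simp)+
      moreover have "Z = (\<lambda>x. (\<Sum>j\<in>{0..<k}. ?w1 j x) - (\<Sum>j\<in>{0..<k}. ?w2 j x))"
        by (simp add: Z_def sum_subtractf atLeast0LessThan)
      ultimately have lZ: "l * lap h Z x = (rt (?w1 k x) - rt (?w2 k x)) - (rt (?w1 0 x) - rt (?w2 0 x))"
        by (simp add: lap_diff right_diff_distrib)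
      have "rt (?w2 k x) \<le> rt (?w1 k x)" using root_mono[OF m1] mono dsol_bounds[OF pb(2)] by blast
      moreover have "rt (?w1 0 x) - rt (?w2 0 x) \<le> rt \<epsilon>"
        unfolding dsol.simps using pb(2) le by (intro root_diff_le[OF m1]) auto
      ultimately have "- rt \<epsilon> \<le> l * lap h Z x" using lZ by linarith
      moreover have "lap h G x = lap h Z x + A * (2 * N * h\<^sup>2)"
        unfolding G_def by (simp only: lap_add lap_diff lap_cmult lap_const lap_norm_sq N_def) simp
      then have "l * lap h G x = l * lap h Z x + 2 * N * l * h\<^sup>2 * A" by (simp add: algebra_simps)
      ultimately have "\<epsilon> \<le> l * lap h G x" using A(2) by linarith
      then show ?thesis using l0 by (simp add: pos_divide_le_eq mult.commute)
    qed
    show "x' \<in> lat h \<inter> U \<or> G x' \<le> 0" if x: "x \<in> lat h \<inter> U" and x': "x' \<in> nbrs h x" for x x'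
    proof (cases "x' \<in> U")
      case True then show ?thesis using lat_nbrs x x' by blast
    next
      case False
      have "x' \<in> lat h" using lat_nbrs x x' by blast
      then have "rnd h x' \<notin> U" using rnd_id[OF h(1), of x'] False by simp
      then have "Z x' \<le> real k * \<epsilon>" by (rule Zout)
      moreover have "norm x' \<le> D + 1"
      proof -
        have "norm x' \<le> norm x + dist x' x" using norm_triangle_sub[of x' x] by (simp add: dist_norm)
        moreover have "norm x \<le> D" using UD x by auto
        ultimately show ?thesis using dist_nbrs[OF x'] h by simp
      qed
      ultimately show ?thesis using norm1[of x'] unfolding G_def by linarith
    qed
  qed (use y in auto)
  then have "Z y \<le> real k * \<epsilon> + A * (D + 1)\<^sup>2" using mult_nonneg_nonneg[OF A(1), of "(norm (y - 0))\<^sup>2"] unfolding G_def right_diff_distrib by simp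
  then have "l * h\<^sup>2 * Z y \<le> l * h\<^sup>2 * (real k * \<epsilon> + A * (D + 1)\<^sup>2)" using l0 by (intro mult_left_mono) auto
  also have "\<dots> = real k * (l * h\<^sup>2) * \<epsilon> + (rt \<epsilon> + \<epsilon>) * (D + 1)\<^sup>2 / (2 * N)"
    using N0 l0 h by (simp add: A_def field_simps)
  finally show ?thesis by (simp add: Z_def)
qed

text \<open>A gap above \<open>3 * \<mu>\<close> at step \<open>s\<close> stays at least
  \<open>\<mu>\<close> for a time about \<open>\<delta>\<close>: the upper solution falls slowly by
  the one-sided bound, and the lower one cannot rise much by equicontinuity. The time sum would then
  exceed the bound of \<open>dsol_sum_diff\<close>. The order of quantifiers matters:
  \<open>\<epsilon>\<close> and \<open>h0\<close> precede \<open>U\<close>, \<open>\<Psi>\<close>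
  and \<open>\<Phi>\<close>.\<close>

lemma discrete_stability:
  assumes \<mu>: "\<mu> > 0" and \<rho>: "\<rho> > 0" and T: "T > 0"
  obtains \<epsilon> h0 where "\<epsilon> > 0" "h0 > 0"
    "\<And>h U t0 \<Psi> \<Phi> y s. \<lbrakk>0 < h; h < h0; \<forall>z. 0 \<le> \<Psi> z \<and> \<Psi> z \<le> M; \<forall>z. 0 \<le> \<Phi> z \<and> \<Phi> z \<le> M; \<And>z. \<Phi> z \<le> \<Psi> z; \<And>z. \<Psi> z \<le> \<Phi> z + \<epsilon>;
       \<forall>x\<in>U. norm x \<le> D; y \<in> lat h; \<forall>x. (\<forall>i. \<bar>(x - y) $ i\<bar> < 2 * \<rho>) \<longrightarrow> x \<in> U; 2 * \<rho> \<le> real s * (l * h\<^sup>2); real s * (l * h\<^sup>2) \<le> T\<rbrakk>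
       \<Longrightarrow> dsol h U t0 \<Psi> s y \<le> dsol h U t0 \<Phi> s y + 3 * \<mu>"
proof -
  obtain K where K: "K > 0" and reg: "\<And>h U t0 \<Psi> y s. \<lbrakk>0 < h; \<forall>z. 0 \<le> \<Psi> z \<and> \<Psi> z \<le> M; y \<in> lat h; \<forall>x. (\<forall>i. \<bar>(x - y) $ i\<bar> < 2 * \<rho>) \<longrightarrow> x \<in> U;
     2 * \<rho> \<le> real s * (l * h\<^sup>2)\<rbrakk> \<Longrightarrow> reg K h \<rho> (dsol h U t0 \<Psi>) y s" using dsol_reg[OF \<rho>] by blast
  have "K \<ge> 0" using K by simp
  from equicont[OF this \<rho> \<mu>] obtain \<delta>1 where \<delta>1: "\<delta>1 > 0" and eq: "\<And>h w y s x k. \<lbrakk>0 < h; h < \<delta>1; reg K h \<rho> w y s; x \<in> lat h; dist x y < \<delta>1;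
     \<bar>real k - real s\<bar> * (l * h\<^sup>2) < \<delta>1\<rbrakk> \<Longrightarrow> w k x < w s y + \<mu>" by blast
  define \<delta> where "\<delta> = min (min \<delta>1 \<rho>) (min 1 (\<mu> / K))"
  have \<delta>: "\<delta> > 0" "\<delta> \<le> \<delta>1" "\<delta> \<le> \<rho>" "\<delta> \<le> 1" "\<delta> * K \<le> \<mu>"
  proof -
    show "\<delta> > 0" using \<delta>1 \<rho> \<mu> K by (simp add: \<delta>_def)
    have "\<delta> \<le> \<mu> / K" by (simp add: \<delta>_def)
    then show "\<delta> * K \<le> \<mu>" using K by (simp add: pos_le_divide_eq)
  qed (auto simp: \<delta>_def)
  \<comment> \<open>The bound of \<open>dsol_sum_diff\<close> over time \<open>T + 1\<close> tends
    to 0 with \<open>\<epsilon>\<close>, so it can be pushed below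
    \<open>\<mu> * \<delta> / 2\<close>, the least contribution of a persisting gap.\<close>
  have "((\<lambda>\<epsilon>. (T + 1) * \<epsilon> + (rt \<epsilon> + \<epsilon>) * (D + 1)\<^sup>2 / (2 * N)) \<longlongrightarrow> (T + 1) * 0 + (rt 0 + 0) * (D + 1)\<^sup>2 / (2 * N)) (at_right 0)"
    using m1 N1 by (intro tendsto_intros tendsto_powr') (auto simp: eventually_at_filter)
  then have "\<forall>\<^sub>F \<epsilon> in at_right 0. (T + 1) * \<epsilon> + (rt \<epsilon> + \<epsilon>) * (D + 1)\<^sup>2 / (2 * N) < \<mu> * \<delta> / 2"
    by (rule order_tendstoD(2)) (use \<mu> \<delta> in simp)
  then obtain b where b: "b > 0" "\<And>\<epsilon>. 0 < \<epsilon> \<Longrightarrow> \<epsilon> < b \<Longrightarrow> (T + 1) * \<epsilon> + (rt \<epsilon> + \<epsilon>) * (D + 1)\<^sup>2 / (2 * N) < \<mu> * \<delta> / 2"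
    unfolding eventually_at_right_field by blast
  define \<epsilon> where "\<epsilon> = b / 2"
  have \<epsilon>: "\<epsilon> > 0" "\<epsilon> < b" using b by (auto simp: \<epsilon>_def)
  define h0 where "h0 = min (min \<delta>1 1) (\<delta> / (2 * l))"
  have h0: "h0 > 0" using \<delta>1 \<delta> l0 by (simp add: h0_def)
  show thesis
  proof (rule that[OF \<epsilon>(1) h0], rule ccontr)
    fix h t0 :: real and U :: "(real^'n) set" and \<Psi> \<Phi> :: "'n pt \<Rightarrow> real" and y :: "real^'n" and s :: nat
    assume h: "0 < h" "h < h0" and pb: "\<forall>z. 0 \<le> \<Psi> z \<and> \<Psi> z \<le> M" "\<forall>z. 0 \<le> \<Phi> z \<and> \<Phi> z \<le> M"
      and le: "\<And>z. \<Phi> z \<le> \<Psi> z" "\<And>z. \<Psi> z \<le> \<Phi> z + \<epsilon>" and UD: "\<forall>x\<in>U. norm x \<le> D" and y: "y \<in> lat h"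
      and U: "\<forall>x. (\<forall>i. \<bar>(x - y) $ i\<bar> < 2 * \<rho>) \<longrightarrow> x \<in> U" and s: "2 * \<rho> \<le> real s * (l * h\<^sup>2)" "real s * (l * h\<^sup>2) \<le> T"
    let ?w1 = "dsol h U t0 \<Psi>" and ?w2 = "dsol h U t0 \<Phi>"
    assume "\<not> ?w1 s y \<le> ?w2 s y + 3 * \<mu>"
    then have big: "?w1 s y > ?w2 s y + 3 * \<mu>" by simp
    define \<tau> where "\<tau> = l * h\<^sup>2"
    have h1: "h < \<delta>1" "h \<le> 1" "h < \<delta> / (2 * l)" using h by (auto simp: h0_def)
    have \<tau>: "\<tau> > 0" using l0 h by (simp add: \<tau>_def)
    have \<tau>\<delta>: "\<tau> \<le> \<delta> / 2"
    proof -
      have "h\<^sup>2 \<le> h" using h h1 by (simp add: power2_eq_square)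
      then have "\<tau> \<le> l * h" using l0 by (simp add: \<tau>_def)
      also have "l * h \<le> \<delta> / 2" using h1(3) l0 by (simp add: field_simps)
      finally show ?thesis .
    qed
    have yU: "y \<in> U" using U \<rho> by auto
    have r1: "reg K h \<rho> ?w1 y s" and r2: "reg K h \<rho> ?w2 y s" using reg h(1) pb y U s(1) by blast+
    define n where "n = nat \<lfloor>\<delta> / \<tau>\<rfloor>"
    have "0 \<le> \<delta> / \<tau>" using \<delta> \<tau> by simp
    then have "real n \<le> \<delta> / \<tau>" "\<delta> / \<tau> < real n + 1" unfolding n_def by linarith+
    then have n: "real n * \<tau> \<le> \<delta>" "\<delta> < real n * \<tau> + \<tau>" using \<tau> by (simp_all add: field_simps)
    have gap: "\<mu> \<le> ?w1 j y - ?w2 j y" if j: "s \<le> j" "j < s + n" for j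
    proof -
      have "real (j - s) * \<tau> < real n * \<tau>" using j \<tau> by (intro mult_strict_right_mono) auto
      then have js: "real (j - s) * \<tau> < \<delta>" using n(1) by (rule order_less_le_trans)
      have jd: "\<bar>real j - real s\<bar> = real (j - s)" using j by simp
      have "?w2 j y < ?w2 s y + \<mu>" by (rule eq[OF h(1) h1(1) r2 y]) (use \<delta>1 jd js \<delta> in \<open>auto simp: \<tau>_def\<close>)
      moreover have "?w1 s y \<le> ?w1 j y + real (j - s) * (K * \<tau>)"
      proof (rule one_sided_sum[OF j(1)])
        fix i assume i: "s \<le> i" "i < j"
        have "real (i - s) * \<tau> \<le> real (j - s) * \<tau>" using i \<tau> by (intro mult_right_mono) auto
        then have "\<bar>real i - real s\<bar> * (l * h\<^sup>2) < \<rho>" using i js \<delta> by (simp add: \<tau>_def)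
        then show "?w1 i y - ?w1 (Suc i) y \<le> K * \<tau>" using r1 y \<rho> unfolding reg_def \<tau>_def by simp
      qed
      moreover have "real (j - s) * (K * \<tau>) \<le> \<delta> * K" using js K mult_right_mono[of "real (j - s) * \<tau>" \<delta> K] by (simp add: mult_ac)
      ultimately show ?thesis using big \<delta>(5) by linarith
    qed
    have mono: "?w2 j x \<le> ?w1 j x" for j x by (rule dsol_mono[OF h(1) pb(2,1) le(1)])
    have "real n * \<mu> \<le> (\<Sum>j\<in>{s..<s+n}. ?w1 j y - ?w2 j y)"
      using sum_bounded_below[of "{s..<s+n}" \<mu> "\<lambda>j. ?w1 j y - ?w2 j y"] gap by simp
    also have "\<dots> \<le> (\<Sum>j<s+n. ?w1 j y - ?w2 j y)" using mono by (intro sum_mono2) auto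
    finally have "\<tau> * (real n * \<mu>) \<le> \<tau> * (\<Sum>j<s+n. ?w1 j y - ?w2 j y)" using \<tau> by (intro mult_left_mono) auto
    also have "\<dots> \<le> real (s + n) * \<tau> * \<epsilon> + (rt \<epsilon> + \<epsilon>) * (D + 1)\<^sup>2 / (2 * N)"
      unfolding \<tau>_def by (rule dsol_sum_diff[OF h(1) h1(2) pb le \<epsilon>(1) UD y yU])
    also have "real (s + n) * \<tau> * \<epsilon> \<le> (T + 1) * \<epsilon>"
    proof (rule mult_right_mono)
      have "real (s + n) * \<tau> = real s * \<tau> + real n * \<tau>" by (simp add: distrib_right)
      then show "real (s + n) * \<tau> \<le> T + 1" using s(2) n(1) \<delta>(4) by (simp add: \<tau>_def)
    qed (use \<epsilon> in simp)
    finally have up: "\<tau> * (real n * \<mu>) < \<mu> * \<delta> / 2" using b(2)[OF \<epsilon>(1,2)] by linarith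
    have "\<delta> / 2 \<le> real n * \<tau>" using n(2) \<tau>\<delta> by simp
    then have "\<mu> * (\<delta> / 2) \<le> \<mu> * (real n * \<tau>)" using \<mu> by (intro mult_left_mono) auto
    then show False using up by (simp add: mult_ac)
  qed
qed

text \<open>Formulated for the powers \<open>f\<close> and \<open>g\<close> of \<open>u\<close> and
  \<open>v\<close>. On one inner cylinder the definitions compare \<open>u\<close> and
  \<open>v\<close> with two weak solutions, and these are compared with each other at one small mesh
  size.\<close>

theorem viscosity_comparison:
  fixes \<Omega> :: "(real^'n) set"
  assumes \<Omega>: "open \<Omega>" "bounded \<Omega>" and sub: "visc_sub m (cyl \<Omega> 0 T) u" and sup: "visc_super m (cyl \<Omega> 0 T) v"
    and uf: "\<forall>z\<in>cyl \<Omega> 0 T. u z = ereal (rt (f z)) \<and> 0 \<le> f z \<and> f z \<le> M"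
    and vg: "\<forall>z\<in>cyl \<Omega> 0 T. v z = ereal (rt (g z)) \<and> 0 \<le> g z \<and> g z \<le> M"
    and usc: "\<And>z c. z \<in> cyl \<Omega> 0 T \<Longrightarrow> f z < c \<Longrightarrow> \<exists>d>0. \<forall>y\<in>cyl \<Omega> 0 T. dist y z < d \<longrightarrow> f y < c"
    and lsc: "\<And>z c. z \<in> cyl \<Omega> 0 T \<Longrightarrow> c < g z \<Longrightarrow> \<exists>d>0. \<forall>y\<in>cyl \<Omega> 0 T. dist y z < d \<longrightarrow> c < g y"
    and bnd: "\<And>z0 \<epsilon>. z0 \<in> pbdry \<Omega> 0 T \<Longrightarrow> \<epsilon> > 0 \<Longrightarrow> \<exists>d>0. \<forall>y\<in>cyl \<Omega> 0 T. dist y z0 < d \<longrightarrow> f y < g y + \<epsilon>"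
    and z: "z \<in> cyl \<Omega> 0 T"
  shows "f z \<le> g z"
proof (rule field_le_epsilon)
  fix e :: real assume e: "e > 0"
  \<comment> \<open>Three parts for the stability estimate and one for each of the two
    limits.\<close>
  define \<mu> where "\<mu> = e / 5"
  have \<mu>: "\<mu> > 0" using e by (simp add: \<mu>_def)
  define S where "S = cyl \<Omega> 0 T"
  define x t where "x = fst z" and "t = snd z"
  have zxt: "z = (x, t)" and x: "x \<in> \<Omega>" and t: "0 < t" "t < T" using z by (auto simp: x_def t_def cyl_def)
  have N0: "N > 0" using N1 by simp
  obtain D where D: "\<forall>x\<in>\<Omega>. norm x \<le> D" using \<Omega>(2) by (auto simp: bounded_iff)
  define \<delta> where "\<delta> = infdist x (- \<Omega>)"
  have "- \<Omega> \<noteq> {}" using \<Omega>(2) not_bounded_UNIV by (metis Compl_empty_eq double_complement)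
  then have \<delta>: "\<delta> > 0" using in_closed_iff_infdist_zero[of "- \<Omega>" x] x \<Omega>(1) infdist_nonneg[of x "- \<Omega>"]
    unfolding \<delta>_def by (auto simp: closed_def less_le)
  \<comment> \<open>Depends on the point alone, since it must precede \<open>\<epsilon>\<close> and
    hence \<open>r\<close> and \<open>U\<close>. The factor 16 makes the cube about the rounded
    point fit into \<open>U\<close> for every later \<open>r \<le> \<delta>/4\<close>.\<close>
  define \<rho> where "\<rho> = min (\<delta> / (16 * N)) (t / 16)"
  have \<rho>: "\<rho> > 0" "\<rho> \<le> \<delta> / (16 * N)" "\<rho> \<le> t / 16" using \<delta> t N0 by (auto simp: \<rho>_def)
  have N\<rho>: "N * (2 * \<rho>) \<le> \<delta> / 8" using \<rho>(2) N0 by (simp add: field_simps)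
  have T0: "T > 0" using t by simp
  obtain \<epsilon> h0 where \<epsilon>: "\<epsilon> > 0" and h0: "h0 > 0" and stab:
    "\<And>h U t0 \<Psi> \<Phi> y s. \<lbrakk>0 < h; h < h0; \<forall>z. 0 \<le> \<Psi> z \<and> \<Psi> z \<le> M; \<forall>z. 0 \<le> \<Phi> z \<and> \<Phi> z \<le> M; \<And>z. \<Phi> z \<le> \<Psi> z; \<And>z. \<Psi> z \<le> \<Phi> z + \<epsilon>;
       \<forall>x\<in>U. norm x \<le> D; y \<in> lat h; \<forall>x. (\<forall>i. \<bar>(x - y) $ i\<bar> < 2 * \<rho>) \<longrightarrow> x \<in> U; 2 * \<rho> \<le> real s * (l * h\<^sup>2); real s * (l * h\<^sup>2) \<le> T\<rbrakk>
       \<Longrightarrow> dsol h U t0 \<Psi> s y \<le> dsol h U t0 \<Phi> s y + 3 * \<mu>"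
    by (fact discrete_stability[OF \<mu> \<rho>(1) T0, where D = D])
  define t2 where "t2 = (t + T) / 2"
  have t2: "t < t2" "t2 < T" using t by (auto simp: t2_def)
  obtain c where c: "c > 0" "\<And>z. z \<in> S \<Longrightarrow> snd z \<le> t2 \<Longrightarrow> snd z < c \<or> infdist (fst z) (- \<Omega>) < c \<Longrightarrow> f z < g z + \<epsilon>"
    unfolding S_def using boundary_gap[OF \<Omega> t2(2), of f g \<epsilon>] bnd[OF _ \<epsilon>] by blast
  \<comment> \<open>\<open>r < c\<close> puts the bottom and the sides of the cylinder into the
    layer where \<open>f < g + \<epsilon>\<close>.\<close>
  define r where "r = min (c / 2) (min (\<delta> / 4) (t / 4))"
  have r: "r > 0" "r < c" "r \<le> \<delta> / 4" "r \<le> t / 4" using c(1) \<delta> t by (auto simp: r_def)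
  define U where "U = {x. r < infdist x (- \<Omega>)}"
  note U = inner_domain[OF \<Omega> r(1), folded U_def]
  have UD: "\<forall>x\<in>U. norm x \<le> D" using D U(2) closure_subset[of U] by blast
  have xU: "x \<in> U" using r \<delta> by (simp add: U_def \<delta>_def)
  have rt2: "r < t2" "t2 - r > 0" "r + (t2 - r) = t2" "r < t" using r t t2 by auto
  define K where "K = pbdry U r t2"
  have KS: "K \<subseteq> S"
    using U(2) r rt2 t2 by (auto simp: K_def S_def pbdry_def cyl_def frontier_def)
  have bU: "bounded U" using \<Omega>(2) U(2) closure_subset[of U] by (meson bounded_subset)
  have Kc: "compact K" unfolding K_def pbdry_def using bU by (intro compact_Un compact_Times) (auto intro: compact_frontier_bounded)
  have Kne: "K \<noteq> {}" using xU closure_subset[of U] by (auto simp: K_def pbdry_def)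
  have Kt: "snd w \<le> t2 \<and> (snd w < c \<or> infdist (fst w) (- \<Omega>) < c)" if "w \<in> K" for w
    using that rt2 r U(4) by (auto simp: K_def pbdry_def)
  obtain k where k: "k > 0" "\<And>w. w \<in> K \<Longrightarrow> f w \<le> supconv K f k w" "\<And>w. w \<in> K \<Longrightarrow> supconv K f k w \<le> g w + \<epsilon>"
  proof (rule supconv_approx[OF Kne Kc, of f M g \<epsilon>])
    show "\<forall>y\<in>K. 0 \<le> f y \<and> f y \<le> M" using uf KS by (auto simp: S_def)
    show "0 \<le> g y" if "y \<in> K" for y using vg KS that by (auto simp: S_def)
    show "\<exists>d>0. \<forall>y\<in>K. dist y w < d \<longrightarrow> f y < c" if "w \<in> K" "f w < c" for w c
      using usc[of w c] that KS unfolding S_def by blast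
    show "\<exists>d>0. \<forall>y\<in>K. dist y w < d \<longrightarrow> c < g y" if "w \<in> K" "c < g w" for w c
      using lsc[of w c] that KS unfolding S_def by blast
    show "f w < g w + \<epsilon>" if "w \<in> K" for w using c(2) Kt[OF that] KS that by blast
  qed (use \<epsilon> in auto)
  define \<Psi> where "\<Psi> = supconv K f k"
  define \<Phi> where "\<Phi> = (\<lambda>w. max 0 (\<Psi> w - \<epsilon>))"
  have g1: "good M (3 * M + (2 * real CARD('n) + 3) * k) \<Psi>" unfolding \<Psi>_def
    by (rule supconv_good[OF Kne _ k(1)]) (use uf KS in \<open>auto simp: S_def\<close>)
  have g2: "good M (3 * M + (2 * real CARD('n) + 3) * k) \<Phi>" unfolding \<Phi>_def by (rule good_truncate[OF g1 \<epsilon>])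
  define hs where "hs = (\<lambda>n. 1 / real (Suc n))"
  have hs: "\<And>n. hs n > 0" "hs \<longlonglongrightarrow> 0" unfolding hs_def using LIMSEQ_inverse_real_of_nat by (auto simp: inverse_eq_divide)
  obtain s1 \<omega>1 where s1: "strict_mono (s1::nat\<Rightarrow>nat)" and lim1: "\<And>z. z \<in> closure U \<times> {r..t2} \<Longrightarrow> (\<lambda>n. wfun U r \<Psi> (hs (s1 n)) z) \<longlonglongrightarrow> \<omega>1 z"
    and \<omega>1: "continuous_on (closure U \<times> {r..t2}) \<omega>1" "\<And>z. z \<in> K \<Longrightarrow> \<omega>1 z = \<Psi> z" "\<And>z. 0 \<le> \<omega>1 z \<and> \<omega>1 z \<le> M"
      "weak_sol m (cyl U r t2) (\<lambda>z. rt (\<omega>1 z))"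
    by (fact dirichlet_solution[OF g1 U(3,1) UD rt2(2) hs, of r, unfolded rt2(3), folded K_def])
  \<comment> \<open>The second solution is extracted along the mesh sizes of the first, so both are
    limits along the common sequence \<open>h\<close>.\<close>
  define hs' where "hs' = (\<lambda>n. hs (s1 n))"
  have hs': "\<And>n. hs' n > 0" "hs' \<longlonglongrightarrow> 0" unfolding hs'_def using hs(1) LIMSEQ_subseq_LIMSEQ[OF hs(2) s1] by (auto simp: o_def)
  obtain s2 \<omega>2 where s2: "strict_mono (s2::nat\<Rightarrow>nat)" and lim2: "\<And>z. z \<in> closure U \<times> {r..t2} \<Longrightarrow> (\<lambda>n. wfun U r \<Phi> (hs' (s2 n)) z) \<longlonglongrightarrow> \<omega>2 z"
    and \<omega>2: "continuous_on (closure U \<times> {r..t2}) \<omega>2" "\<And>z. z \<in> K \<Longrightarrow> \<omega>2 z = \<Phi> z" "\<And>z. 0 \<le> \<omega>2 z \<and> \<omega>2 z \<le> M"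
      "weak_sol m (cyl U r t2) (\<lambda>z. rt (\<omega>2 z))"
    by (fact dirichlet_solution[OF g2 U(3,1) UD rt2(2) hs', of r, unfolded rt2(3), folded K_def])
  define h where "h = (\<lambda>n. hs' (s2 n))"
  have hp: "h n > 0" for n using hs' by (simp add: h_def)
  have hl: "h \<longlonglongrightarrow> 0" using LIMSEQ_subseq_LIMSEQ[OF hs'(2) s2] by (simp add: o_def h_def)
  have clc: "closure (cyl U r t2) = closure U \<times> {r..t2}" unfolding cyl_def closure_Times using rt2 by simp
  have ccU: "cc (cyl U r t2) S" unfolding cc_def clc
    using bU U(2) r t2 by (auto intro!: compact_Times simp: S_def cyl_def)
  have zc: "z \<in> cyl U r t2" using xU rt2 t2 by (simp add: zxt cyl_def)
  have zcl: "z \<in> closure U \<times> {r..t2}" using zc closure_subset[of "cyl U r t2"] clc by auto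
  have zS: "z \<in> S" using z by (simp add: S_def)
  have cont: "continuous_on (closure (cyl U r t2)) (\<lambda>z. rt (\<omega> z))" if "continuous_on (closure U \<times> {r..t2}) \<omega>" "\<And>z. 0 \<le> \<omega> z \<and> \<omega> z \<le> M" for \<omega> :: "'n pt \<Rightarrow> real"
    unfolding clc using that m1 by (intro continuous_on_powr') (auto intro: continuous_intros)
  have "u z \<le> ereal (rt (\<omega>1 z))"
  proof -
    have b: "\<forall>w\<in>pbdry U r t2. u w \<le> ereal (rt (\<omega>1 w))"
    proof
      fix w assume w: "w \<in> pbdry U r t2"
      then have wK: "w \<in> K" by (simp add: K_def)
      then have fw: "u w = ereal (rt (f w))" "0 \<le> f w" using uf KS by (auto simp: S_def)
      have "f w \<le> \<omega>1 w" using k(2)[OF wK] \<omega>1(2)[OF wK] by (simp add: \<Psi>_def)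
      then show "u w \<le> ereal (rt (\<omega>1 w))" using fw root_mono[OF m1 fw(2)] by simp
    qed
    have "open U \<and> r < t2 \<and> cc (cyl U r t2) (cyl \<Omega> 0 T) \<and> weak_sol m (cyl U r t2) (\<lambda>z. rt (\<omega>1 z)) \<and>
      continuous_on (closure (cyl U r t2)) (\<lambda>z. rt (\<omega>1 z)) \<and> (\<forall>w\<in>pbdry U r t2. u w \<le> ereal (rt (\<omega>1 w)))"
      using U(1) rt2(1) ccU \<omega>1(4) cont[OF \<omega>1(1,3)] b unfolding S_def by blast
    then show ?thesis using sub zc unfolding visc_sub_def by blast
  qed
  then have f\<omega>: "f z \<le> \<omega>1 z" using uf z root_le_imp[OF m1, of "f z" "\<omega>1 z"] \<omega>1(3)[of z] by simp
  have "ereal (rt (\<omega>2 z)) \<le> v z"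
  proof -
    have b: "\<forall>w\<in>pbdry U r t2. ereal (rt (\<omega>2 w)) \<le> v w"
    proof
      fix w assume w: "w \<in> pbdry U r t2"
      then have wK: "w \<in> K" by (simp add: K_def)
      then have fw: "v w = ereal (rt (g w))" "0 \<le> g w" using vg KS by (auto simp: S_def)
      have "\<omega>2 w \<le> g w" using k(3)[OF wK] \<omega>2(2)[OF wK] fw(2) by (simp add: \<Psi>_def \<Phi>_def)
      then show "ereal (rt (\<omega>2 w)) \<le> v w" using fw root_mono[OF m1, of "\<omega>2 w" "g w"] \<omega>2(3)[of w] by simp
    qed
    have "open U \<and> r < t2 \<and> cc (cyl U r t2) (cyl \<Omega> 0 T) \<and> weak_sol m (cyl U r t2) (\<lambda>z. rt (\<omega>2 z)) \<and>
      continuous_on (closure (cyl U r t2)) (\<lambda>z. rt (\<omega>2 z)) \<and> (\<forall>w\<in>pbdry U r t2. ereal (rt (\<omega>2 w)) \<le> v w)"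
      using U(1) rt2(1) ccU \<omega>2(4) cont[OF \<omega>2(1,3)] b unfolding S_def by blast
    then show ?thesis using sup zc unfolding visc_super_def by blast
  qed
  then have g\<omega>: "\<omega>2 z \<le> g z" using vg z root_le_imp[OF m1, of "\<omega>2 z" "g z"] \<omega>2(3)[of z] by simp
  have L1: "(\<lambda>n. wfun U r \<Psi> (h n) z) \<longlonglongrightarrow> \<omega>1 z"
    using LIMSEQ_subseq_LIMSEQ[OF lim1[OF zcl] s2] by (simp add: o_def h_def hs'_def)
  have L2: "(\<lambda>n. wfun U r \<Phi> (h n) z) \<longlonglongrightarrow> \<omega>2 z" using lim2[OF zcl] by (simp add: h_def)
  have "(\<lambda>n. l * (h n)\<^sup>2) \<longlonglongrightarrow> l * 0\<^sup>2" by (intro tendsto_intros hl)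
  then have L3: "(\<lambda>n. l * (h n)\<^sup>2) \<longlonglongrightarrow> 0" by simp
  have "\<forall>\<^sub>F n in sequentially. wfun U r \<Psi> (h n) z > \<omega>1 z - \<mu> \<and> wfun U r \<Phi> (h n) z < \<omega>2 z + \<mu> \<and> h n < h0 \<and> h n < \<delta> / (16 * N) \<and> l * (h n)\<^sup>2 < t / 4"
    using \<mu> h0 \<delta> N0 t by (intro eventually_conj order_tendstoD[OF L1] order_tendstoD[OF L2] order_tendstoD[OF hl] order_tendstoD[OF L3]) auto
  then obtain n where n: "wfun U r \<Psi> (h n) z > \<omega>1 z - \<mu>" "wfun U r \<Phi> (h n) z < \<omega>2 z + \<mu>" "h n < h0" "h n < \<delta> / (16 * N)" "l * (h n)\<^sup>2 < t / 4"
    by (auto simp: eventually_sequentially)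
  define y where "y = rnd (h n) x"
  define s where "s = nat \<lfloor>(t - r) / (l * (h n)\<^sup>2)\<rfloor>"
  have w: "wfun U r \<Psi> (h n) z = dsol (h n) U r \<Psi> s y" "wfun U r \<Phi> (h n) z = dsol (h n) U r \<Phi> s y"
    unfolding wfun_def zxt s_def y_def by (simp_all add: dsol_rnd[OF hp])
  have "r \<le> t" using rt2 by simp
  note st = step_time[OF hp this, of n, folded s_def]
  have "dsol (h n) U r \<Psi> s y \<le> dsol (h n) U r \<Phi> s y + 3 * \<mu>"
  proof (rule stab[OF hp n(3)])
    show "\<forall>z. 0 \<le> \<Psi> z \<and> \<Psi> z \<le> M" "\<forall>z. 0 \<le> \<Phi> z \<and> \<Phi> z \<le> M" using g1 g2 unfolding good_def by blast+
    then have "0 \<le> \<Psi> w" for w by blast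
    then show "\<Phi> w \<le> \<Psi> w" for w using \<epsilon> by (simp add: \<Phi>_def)
    show "\<Psi> w \<le> \<Phi> w + \<epsilon>" for w by (simp add: \<Phi>_def)
    show "\<forall>x\<in>U. norm x \<le> D" by fact
    show "y \<in> lat (h n)" by (simp add: y_def)
    show "\<forall>x'. (\<forall>i. \<bar>(x' - y) $ i\<bar> < 2 * \<rho>) \<longrightarrow> x' \<in> U"
    proof (intro allI impI)
      fix x' assume i: "\<forall>i. \<bar>(x' - y) $ i\<bar> < 2 * \<rho>"
      have "norm (x' - y) \<le> (\<Sum>i\<in>UNIV. \<bar>(x' - y) $ i\<bar>)" by (rule norm_le_l1_cart)
      also have "\<dots> \<le> (\<Sum>i\<in>(UNIV::'n set). 2 * \<rho>)" using i by (intro sum_mono less_imp_le) auto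
      finally have 1: "dist x' y \<le> \<delta> / 8" using N\<rho> by (simp add: dist_norm N_def)
      have "N * h n \<le> \<delta> / 16" using n(4) N0 by (simp add: field_simps)
      then have 2: "dist x y \<le> \<delta> / 16" using dist_rnd[OF hp[of n], of x] by (simp add: y_def N_def)
      have "dist x x' \<le> \<delta> / 8 + \<delta> / 16" using dist_triangle2[of x x' y] 1 2 by simp
      moreover have "\<delta> \<le> infdist x' (- \<Omega>) + dist x x'" unfolding \<delta>_def by (rule infdist_triangle)
      ultimately show "x' \<in> U" using r(3) \<delta> by (simp add: U_def)
    qed
    show "2 * \<rho> \<le> real s * (l * (h n)\<^sup>2)" using st(2) n(5) r(4) \<rho>(3) t by linarith
    show "real s * (l * (h n)\<^sup>2) \<le> T" using st(1) r(1) t by linarith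
  qed
  then have "\<omega>1 z \<le> \<omega>2 z + 5 * \<mu>" using n(1,2) w by linarith
  then show "f z \<le> g z + e" using f\<omega> g\<omega> by (simp add: \<mu>_def)
qed

end

section \<open>Back to \<open>u\<close> and \<open>v\<close> and their boundary limits\<close>

lemma powr_gap:
  fixes m \<alpha> \<epsilon> :: real
  assumes m: "m > 1" and \<alpha>: "\<alpha> \<ge> 0" and \<epsilon>: "\<epsilon> > 0"
  obtains \<eta> where "\<eta> > 0" "\<And>\<beta>. 0 \<le> \<beta> \<Longrightarrow> \<beta> < \<alpha> + \<eta> \<Longrightarrow> \<beta> powr m < \<alpha> powr m + \<epsilon>"
    "\<And>\<beta>. 0 \<le> \<beta> \<Longrightarrow> \<alpha> - \<eta> < \<beta> \<Longrightarrow> \<alpha> powr m - \<epsilon> < \<beta> powr m"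
proof -
  have "continuous_on {0..} (\<lambda>x::real. x powr m)" using m by (intro continuous_on_powr') (auto intro: continuous_intros)
  then obtain \<eta> where \<eta>: "\<eta> > 0" "\<And>\<beta>. 0 \<le> \<beta> \<Longrightarrow> dist \<beta> \<alpha> < \<eta> \<Longrightarrow> dist (\<beta> powr m) (\<alpha> powr m) < \<epsilon>"
    using \<alpha> \<epsilon> unfolding continuous_on_iff by (metis atLeast_iff)
  show thesis
  proof (rule that[OF \<eta>(1)])
    fix \<beta> :: real assume b: "0 \<le> \<beta>"
    have near: "\<bar>\<beta> powr m - \<alpha> powr m\<bar> < \<epsilon>" if "\<bar>\<beta> - \<alpha>\<bar> < \<eta>" using \<eta>(2)[OF b] that by (simp add: dist_real_def)
    have lo: "\<beta> powr m \<le> \<alpha> powr m" if "\<beta> \<le> \<alpha>" using that b m by (intro powr_mono2) auto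
    have hi: "\<alpha> powr m \<le> \<beta> powr m" if "\<alpha> \<le> \<beta>" using that \<alpha> m by (intro powr_mono2) auto
    show "\<beta> powr m < \<alpha> powr m + \<epsilon>" if "\<beta> < \<alpha> + \<eta>" using near lo hi that \<epsilon> by (cases "\<beta> \<le> \<alpha>") auto
    show "\<alpha> powr m - \<epsilon> < \<beta> powr m" if "\<alpha> - \<eta> < \<beta>" using near lo hi that \<epsilon> by (cases "\<alpha> \<le> \<beta>") auto
  qed
qed

text \<open>The filter \<open>at z0 within S\<close> leaves out \<open>z0\<close> itself, hence the
  condition \<open>y \<noteq> z0\<close>.\<close>

lemma Limsup_less_near:
  fixes u :: "'a::metric_space \<Rightarrow> ereal"
  assumes "Limsup (at z0 within S) u \<le> ereal \<alpha>" "\<eta> > 0"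
  obtains d where "d > 0" "\<And>y. y \<in> S \<Longrightarrow> y \<noteq> z0 \<Longrightarrow> dist y z0 < d \<Longrightarrow> u y < ereal (\<alpha> + \<eta>)"
proof -
  have "Limsup (at z0 within S) u < ereal (\<alpha> + \<eta>)" using assms by (simp add: le_less_trans)
  from Limsup_lessD[OF this] show thesis using that by (auto simp: eventually_at)
qed

lemma less_Liminf_near:
  fixes u :: "'a::metric_space \<Rightarrow> ereal"
  assumes "ereal \<alpha> \<le> Liminf (at z0 within S) u" "\<eta> > 0"
  obtains d where "d > 0" "\<And>y. y \<in> S \<Longrightarrow> y \<noteq> z0 \<Longrightarrow> dist y z0 < d \<Longrightarrow> ereal (\<alpha> - \<eta>) < u y"
proof -
  have "ereal (\<alpha> - \<eta>) < ereal \<alpha>" using assms by simp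
  then have "ereal (\<alpha> - \<eta>) < Liminf (at z0 within S) u" using assms(1) by (rule less_le_trans)
  from less_LiminfD[OF this] show thesis using that by (auto simp: eventually_at)
qed

theorem theorem3p3:
  fixes m T :: real and \<Omega> :: "(real ^ 'n::finite) set"
    and u v :: "'n pt \<Rightarrow> ereal"
  assumes "m > 1" and "bounded \<Omega>" and "open \<Omega>" and "T > 0"
    and "visc_sub m (cyl \<Omega> 0 T) u" and "\<exists>M. \<forall>z\<in>cyl \<Omega> 0 T. u z \<le> ereal M"
    and "visc_super m (cyl \<Omega> 0 T) v" and "\<exists>M. \<forall>z\<in>cyl \<Omega> 0 T. v z \<le> ereal M"
    and "\<forall>z0\<in>pbdry \<Omega> 0 T.
           Limsup (at z0 within cyl \<Omega> 0 T) u \<le> Liminf (at z0 within cyl \<Omega> 0 T) v"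
  shows "\<forall>z\<in>cyl \<Omega> 0 T. u z \<le> v z"
proof -
  define S where "S = cyl \<Omega> 0 T"
  obtain Mu Mv where Mu: "\<forall>z\<in>S. u z \<le> ereal Mu" and Mv: "\<forall>z\<in>S. v z \<le> ereal Mv" using assms(6,8) unfolding S_def by blast
  \<comment> \<open>The 1 makes \<open>M\<close> positive, as the locale demands.\<close>
  define B where "B = max 1 (max Mu Mv)"
  have u0: "\<forall>z\<in>S. 0 \<le> u z" and v0: "\<forall>z\<in>S. 0 \<le> v z" and uusc: "usc_on S u" and vlsc: "lsc_on S v"
    using assms(5,7) by (auto simp: S_def visc_sub_def visc_super_def)
  define a b where "a = (\<lambda>z. real_of_ereal (u z))" and "b = (\<lambda>z. real_of_ereal (v z))"
  have fin: "w = ereal (real_of_ereal w) \<and> 0 \<le> real_of_ereal w \<and> real_of_ereal w \<le> B" if "0 \<le> w" "w \<le> ereal C" "C \<le> B" for w C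
    using that by (cases w) auto
  have ua: "u z = ereal (a z)" "0 \<le> a z" "a z \<le> B" if "z \<in> S" for z
    using fin[of "u z" Mu] u0 Mu that by (auto simp: a_def B_def)
  have vb: "v z = ereal (b z)" "0 \<le> b z" "b z \<le> B" if "z \<in> S" for z
    using fin[of "v z" Mv] v0 Mv that by (auto simp: b_def B_def)
  define M where "M = B powr m"
  define N where "N = real CARD('n)"
  \<comment> \<open>The largest ratio that \<open>cfl\<close> admits.\<close>
  define l where "l = (1/m) * (M + 1) powr (1/m - 1) / (4 * N)"
  have M0: "M > 0" and N0: "N > 0" by (auto simp: M_def N_def B_def)
  interpret pme m M l N "TYPE('n)"
  proof
    show "m > 1" "M > 0" "N = real CARD('n)" by (fact assms(1) M0 N_def)+
    show "l > 0" using assms(1) M0 N0 by (simp add: l_def)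
    show "4 * N * l \<le> (1/m) * (M + 1) powr (1/m - 1)" using N0 by (simp add: l_def)
  qed
  define f g where "f = (\<lambda>z. a z powr m)" and "g = (\<lambda>z. b z powr m)"
  have usc: "\<exists>d>0. \<forall>y\<in>S. dist y z < d \<longrightarrow> f y < c" if z: "z \<in> S" and c: "f z < c" for z c
  proof -
    have "c - f z > 0" using c by simp
    from powr_gap[OF m1 ua(2)[OF z] this] obtain \<eta>
      where \<eta>: "\<eta> > 0" "\<And>\<beta>. 0 \<le> \<beta> \<Longrightarrow> \<beta> < a z + \<eta> \<Longrightarrow> \<beta> powr m < a z powr m + (c - f z)" by blast
    have "Limsup (at z within S) u \<le> ereal (a z)" using uusc z ua(1)[OF z] unfolding usc_on_def by metis
    from Limsup_less_near[OF this \<eta>(1)] obtain d where d: "d > 0" "\<And>y. y \<in> S \<Longrightarrow> y \<noteq> z \<Longrightarrow> dist y z < d \<Longrightarrow> u y < ereal (a z + \<eta>)" by blast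
    have "f y < c" if "y \<in> S" "dist y z < d" for y
    proof (cases "y = z")
      case False
      then have "a y < a z + \<eta>" using d(2)[of y] that ua(1)[of y] by simp
      then show ?thesis using \<eta>(2)[of "a y"] ua(2)[of y] that by (simp add: f_def)
    qed (use c in simp)
    then show ?thesis using d(1) by blast
  qed
  have lsc: "\<exists>d>0. \<forall>y\<in>S. dist y z < d \<longrightarrow> c < g y" if z: "z \<in> S" and c: "c < g z" for z c
  proof -
    have "g z - c > 0" using c by simp
    from powr_gap[OF m1 vb(2)[OF z] this] obtain \<eta>
      where \<eta>: "\<eta> > 0" "\<And>\<beta>. 0 \<le> \<beta> \<Longrightarrow> b z - \<eta> < \<beta> \<Longrightarrow> b z powr m - (g z - c) < \<beta> powr m" by blast
    have "ereal (b z) \<le> Liminf (at z within S) v" using vlsc z vb(1)[OF z] unfolding lsc_on_def by metis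
    from less_Liminf_near[OF this \<eta>(1)] obtain d where d: "d > 0" "\<And>y. y \<in> S \<Longrightarrow> y \<noteq> z \<Longrightarrow> dist y z < d \<Longrightarrow> ereal (b z - \<eta>) < v y" by blast
    have "c < g y" if "y \<in> S" "dist y z < d" for y
    proof (cases "y = z")
      case False
      then have "b z - \<eta> < b y" using d(2)[of y] that vb(1)[of y] by simp
      then show ?thesis using \<eta>(2)[of "b y"] vb(2)[of y] that by (simp add: g_def)
    qed (use c in simp)
    then show ?thesis using d(1) by blast
  qed
  have bnd: "\<exists>d>0. \<forall>y\<in>S. dist y z0 < d \<longrightarrow> f y < g y + \<epsilon>" if z0: "z0 \<in> pbdry \<Omega> 0 T" and \<epsilon>: "\<epsilon> > 0" for z0 \<epsilon>
  proof -
    have nS: "z0 \<notin> S" using z0 assms(3) by (auto simp: S_def cyl_def pbdry_def frontier_def interior_open)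
    \<comment> \<open>The maximum with 0 makes \<open>L\<close> nonnegative without asking whether
      \<open>z0\<close> is a limit point of \<open>S\<close>, and \<open>L\<close> still lies below
      the lower limit of \<open>v\<close>.\<close>
    define L where "L = max 0 (Limsup (at z0 within S) u)"
    have "0 \<le> Liminf (at z0 within S) v" using v0 by (intro Liminf_bounded) (auto simp: eventually_at_filter)
    then have L2: "L \<le> Liminf (at z0 within S) v" using assms(9) z0 by (simp add: L_def S_def)
    have "Limsup (at z0 within S) u \<le> ereal B" using ua by (intro Limsup_bounded) (auto simp: eventually_at_filter)
    moreover have "0 \<le> B" by (simp add: B_def)
    ultimately have "L \<le> ereal B" "0 \<le> L" by (auto simp: L_def)
    then obtain \<alpha> where \<alpha>: "L = ereal \<alpha>" "0 \<le> \<alpha>" using fin[of L B] by auto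
    have "\<epsilon> / 2 > 0" using \<epsilon> by simp
    from powr_gap[OF m1 \<alpha>(2) this] obtain \<eta> where \<eta>: "\<eta> > 0" "\<And>\<beta>. 0 \<le> \<beta> \<Longrightarrow> \<beta> < \<alpha> + \<eta> \<Longrightarrow> \<beta> powr m < \<alpha> powr m + \<epsilon> / 2"
      "\<And>\<beta>. 0 \<le> \<beta> \<Longrightarrow> \<alpha> - \<eta> < \<beta> \<Longrightarrow> \<alpha> powr m - \<epsilon> / 2 < \<beta> powr m" by blast
    have "Limsup (at z0 within S) u \<le> ereal \<alpha>" unfolding \<alpha>(1)[symmetric] by (simp add: L_def)
    from Limsup_less_near[OF this \<eta>(1)] obtain d1 where d1: "d1 > 0" "\<And>y. y \<in> S \<Longrightarrow> y \<noteq> z0 \<Longrightarrow> dist y z0 < d1 \<Longrightarrow> u y < ereal (\<alpha> + \<eta>)" by blast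
    from less_Liminf_near[OF L2[unfolded \<alpha>(1)] \<eta>(1)] obtain d2 where d2: "d2 > 0" "\<And>y. y \<in> S \<Longrightarrow> y \<noteq> z0 \<Longrightarrow> dist y z0 < d2 \<Longrightarrow> ereal (\<alpha> - \<eta>) < v y" by blast
    have "f y < g y + \<epsilon>" if y: "y \<in> S" "dist y z0 < min d1 d2" for y
    proof -
      have "y \<noteq> z0" using y nS by auto
      then have "a y < \<alpha> + \<eta>" "\<alpha> - \<eta> < b y" using d1(2)[of y] d2(2)[of y] y ua(1)[of y] vb(1)[of y] by auto
      then have "f y < \<alpha> powr m + \<epsilon> / 2" "\<alpha> powr m - \<epsilon> / 2 < g y" using \<eta>(2)[of "a y"] \<eta>(3)[of "b y"] ua(2) vb(2) y by (auto simp: f_def g_def)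
      then show ?thesis by linarith
    qed
    then show ?thesis using d1(1) d2(1) by (intro exI[of _ "min d1 d2"]) auto
  qed
  have rtp: "rt (\<beta> powr m) = \<beta>" if "0 \<le> \<beta>" for \<beta> :: real using that m1 by (simp add: powr_powr)
  have uf: "\<forall>z\<in>S. u z = ereal (rt (f z)) \<and> 0 \<le> f z \<and> f z \<le> M" using ua m1 rtp by (auto simp: f_def M_def intro: powr_mono2)
  have vg: "\<forall>z\<in>S. v z = ereal (rt (g z)) \<and> 0 \<le> g z \<and> g z \<le> M" using vb m1 rtp by (auto simp: g_def M_def intro: powr_mono2)
  show ?thesis
  proof
    fix z assume z: "z \<in> cyl \<Omega> 0 T"
    have "f z \<le> g z"
      by (rule viscosity_comparison[OF assms(3,2,5,7) uf[unfolded S_def] vg[unfolded S_def] usc[unfolded S_def] lsc[unfolded S_def] bnd[unfolded S_def] z])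
    then have "rt (f z) \<le> rt (g z)" using uf z root_mono[OF m1] by (auto simp: S_def)
    then show "u z \<le> v z" using uf vg z by (simp add: S_def)
  qed
qed

end
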